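(* Let $\Omega$ be a complex manifold of complex dimension $n$. Suppose that its Bergman space $A^2(\Omega)$ is base point free and separates holomorphic directions. Then the Bergman metric of $\Omega$ cannot have zero constant holomorphic sectional curvature.
   Context: Here $n\ge1$ and all complex manifolds are assumed connected. For a complex manifold $\Omega$ of dimension $n$, the Bergman space $A^2(\Omega)$ is the Hilbert space of holomorphic $(n,0)$-forms $f$ on $\Omega$ with $(-1)^{n^2/2}\int_\Omega f\wedge\overline f<\infty$, with inner product $(f,g)=(-1)^{n^2/2}\int_\Omega f\wedge\overline g$ (here $(-1)^{n^2/2}=(\sqrt{-1})^{n^2}$). If $\{f_j\}_{j=1}^N$ ($N\le\infty$) is an orthonormal basis of $A^2(\Omega)$, the Bergman kernel form is $K_\Omega=\sum_{j=1}^N f_j\wedge\overline{f_j}$; in a local holomorphic chart $z$ write $K_\Omega=K_\Omega(z,\overline z)\,dz_1\wedge\cdots\wedge dz_n\wedge d\overline z_1\wedge\cdots\wedge d\overline z_n$. $A^2(\Omega)$ is base point free if for every $p\in\Omega$ there is $\phi\in A^2(\Omega)$ with $\phi(p)\neq0$. $A^2(\Omega)$ separates holomorphic directions if for every $p\in\Omega$ and every nonzero $X_p\in T_p^{(1,0)}\Omega$ there is $\phi\in A^2(\Omega)$ with $\phi(p)=0$ and $X_p(\phi)(p)\ne0$, where, in a local chart near $p$, $\phi=\phi^o\,dz_1\wedge\cdots\wedge dz_n$ is identified with the holomorphic function $\phi^o$. Under these two conditions the form $\omega_\Omega=\sqrt{-1}\,\partial\overline\partial\log K_\Omega(z,\overline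 z)$ is well defined and positive definite, and is called the Bergman metric of $\Omega$. Its metric tensor is $g_{\alpha\overline\beta}=\partial^2\log K_\Omega/\partial z_\alpha\partial\overline z_\beta$, with curvature $R_{i\overline jk\overline l}=-\partial_k\partial_{\overline l}g_{i\overline j}+\sum g^{\alpha\overline\beta}\,\partial_kg_{i\overline\beta}\,\partial_{\overline l}g_{\alpha\overline j}$; the holomorphic sectional curvature in the direction of a nonzero $(1,0)$-vector $X$ is $R(X,\overline X,X,\overline X)/g(X,\overline X)^2$. The metric is not assumed complete. *)

theory Defs
  imports "HOL-Analysis.Analysis" "HOL-Library.Extended_Nat"
begin

text \<open>Points of \<open>\<complex>\<^sup>n\<close> have type \<open>complex ^ 'n\<close>, so \<open>n = CARD('n) \<ge> 1\<close>.\<close>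

definition holomorphic_Cn_on :: "(complex ^ 'n \<Rightarrow> complex) \<Rightarrow> (complex ^ 'n) set \<Rightarrow> bool" where
  "holomorphic_Cn_on f S \<longleftrightarrow>
     (\<forall>z\<in>S. \<exists>L. (f has_derivative L) (at z within S) \<and> (\<forall>a v. L (a *s v) = a * L v))"

text \<open>
  The Wirtinger derivatives \<open>\<partial>/\<partial>z\<^sub>i = (\<partial>/\<partial>x\<^sub>i - \<i> \<partial>/\<partial>y\<^sub>i)/2\<close> and
  \<open>\<partial>/\<partial>(cnj z\<^sub>i) = (\<partial>/\<partial>x\<^sub>i + \<i> \<partial>/\<partial>y\<^sub>i)/2\<close>, where \<open>z\<^sub>i = x\<^sub>i + \<i> y\<^sub>i\<close>.
\<close>

definition wirtinger :: "'n \<Rightarrow> (complex ^ 'n \<Rightarrow> complex) \<Rightarrow> complex ^ 'n \<Rightarrow> complex" where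
  "wirtinger i u z =
     (frechet_derivative u (at z) (axis i 1) - \<i> * frechet_derivative u (at z) (axis i \<i>)) / 2"

definition wirtinger_bar :: "'n \<Rightarrow> (complex ^ 'n \<Rightarrow> complex) \<Rightarrow> complex ^ 'n \<Rightarrow> complex" where
  "wirtinger_bar i u z =
     (frechet_derivative u (at z) (axis i 1) + \<i> * frechet_derivative u (at z) (axis i \<i>)) / 2"

text \<open>
  A chart is a pair \<open>(U, \<phi>)\<close>. The values of \<open>\<phi>\<close> outside \<open>U\<close> are irrelevant.
\<close>

type_synonym ('a, 'n) chart = "'a set \<times> ('a \<Rightarrow> complex ^ 'n)"

definition chart_image :: "('a, 'n) chart \<Rightarrow> (complex ^ 'n) set" where
  "chart_image c = snd c ` fst c"

definition chart_inv :: "('a, 'n) chart \<Rightarrow> complex ^ 'n \<Rightarrow> 'a" where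
  "chart_inv c = inv_into (fst c) (snd c)"

definition transition :: "('a, 'n) chart \<Rightarrow> ('a, 'n) chart \<Rightarrow> complex ^ 'n \<Rightarrow> complex ^ 'n" where
  "transition c d z = snd d (chart_inv c z)"

definition complex_jacobian :: "(complex ^ 'n \<Rightarrow> complex ^ 'n) \<Rightarrow> complex ^ 'n \<Rightarrow> complex ^ 'n ^ 'n" where
  "complex_jacobian \<tau> z = (\<chi> i j. wirtinger j (\<lambda>w. \<tau> w $ i) z)"

text \<open>
  \<open>A\<close> is a holomorphic atlas on the space \<open>M\<close>; it need not be maximal.
  Manifolds are nonempty, Hausdorff, second countable and connected.
\<close>

definition complex_manifold :: "'a topology \<Rightarrow> ('a, 'n::finite) chart set \<Rightarrow> bool" where
  "complex_manifold M A \<longleftrightarrow>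
     topspace M \<noteq> {} \<and> Hausdorff_space M \<and> second_countable M \<and> connected_space M \<and>
     (\<forall>(U, \<phi>)\<in>A. openin M U \<and> open (\<phi> ` U) \<and>
        homeomorphic_map (subtopology M U) (top_of_set (\<phi> ` U)) \<phi>) \<and>
     (\<Union>c\<in>A. fst c) = topspace M \<and>
     (\<forall>c\<in>A. \<forall>d\<in>A. \<forall>i.
        holomorphic_Cn_on (\<lambda>z. transition c d z $ i) (snd c ` (fst c \<inter> fst d)))"

text \<open>
  An \<open>(n,0)\<close>-form is given by its coefficients \<open>f c z\<close>, meaning
  \<open>f c (z) dz\<^sub>1 \<and> \<dots> \<and> dz\<^sub>n\<close> in the chart \<open>c\<close>; as \<open>dw\<^sub>1 \<and> \<dots> \<and> dw\<^sub>n = det (\<partial>w/\<partial>z) dz\<^sub>1 \<and> \<dots> \<and> dz\<^sub>n\<close>,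
  coefficients in two charts differ by the Jacobian determinant of the transition map.
  Coefficients are set to zero where they carry no meaning, so that
  equal forms are equal as functions.
\<close>

type_synonym ('a, 'n) form = "('a, 'n) chart \<Rightarrow> complex ^ 'n \<Rightarrow> complex"

definition holomorphic_forms :: "('a, 'n::finite) chart set \<Rightarrow> ('a, 'n) form set" where
  "holomorphic_forms A = {f.
     (\<forall>c\<in>A. holomorphic_Cn_on (f c) (chart_image c)) \<and>
     (\<forall>c\<in>A. \<forall>d\<in>A. \<forall>z\<in>snd c ` (fst c \<inter> fst d).
        f c z = det (complex_jacobian (transition c d) z) * f d (transition c d z)) \<and>
     (\<forall>c z. c \<notin> A \<or> z \<notin> chart_image c \<longrightarrow> f c z = 0)}"

text \<open>
  An \<open>(n,n)\<close>-form is likewise given by coefficients \<open>h c z\<close> with respect to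
  \<open>dz\<^sub>1 \<and> \<dots> \<and> dz\<^sub>n \<and> d(cnj z\<^sub>1) \<and> \<dots> \<and> d(cnj z\<^sub>n)\<close>. To integrate it, cover the manifold by charts
  \<open>(U\<^sub>0, \<phi>\<^sub>0), (U\<^sub>1, \<phi>\<^sub>1), \<dots>\<close> of the atlas and add up the integrals over the disjoint Borel
  sets \<open>U\<^sub>k - (U\<^sub>0 \<union> \<dots> \<union> U\<^bsub>k-1\<^esub>)\<close>, computed in the chart \<open>\<phi>\<^sub>k\<close>. The sum of integrals is one
  integral over a subset of \<open>\<nat> \<times> \<complex>\<^sup>n\<close>. By the change of variables formula the result
  does not depend on the cover.
\<close>

definition chart_cover :: "'a topology \<Rightarrow> ('a, 'n) chart set \<Rightarrow> nat \<Rightarrow> ('a, 'n) chart" where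
  "chart_cover M A = (SOME e. range e \<subseteq> A \<and> (\<Union>k. fst (e k)) = topspace M)"

definition chart_pieces :: "(nat \<Rightarrow> ('a, 'n) chart) \<Rightarrow> (nat \<times> (complex ^ 'n)) set" where
  "chart_pieces e = (SIGMA k:UNIV. snd (e k) ` (fst (e k) - (\<Union>j<k. fst (e j))))"

text \<open>
  The complex orientation satisfies
  \<open>\<i>\<^bsup>n\<^sup>2\<^esup> dz\<^sub>1 \<and> \<dots> \<and> dz\<^sub>n \<and> d(cnj z\<^sub>1) \<and> \<dots> \<and> d(cnj z\<^sub>n) = \<Prod>\<^sub>j \<i> dz\<^sub>j \<and> d(cnj z\<^sub>j) = 2\<^sup>n dx\<^sub>1 dy\<^sub>1 \<dots> dx\<^sub>n dy\<^sub>n\<close>,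
  which explains the constant below.
\<close>

definition form_density ::
  "'a topology \<Rightarrow> ('a, 'n::finite) chart set \<Rightarrow> ('a, 'n) form \<Rightarrow> nat \<times> (complex ^ 'n) \<Rightarrow> complex" where
  "form_density M A h =
     (\<lambda>(k, z). h (chart_cover M A k) z * (2 ^ CARD('n) / \<i> ^ (CARD('n)\<^sup>2)))"

definition form_integrable :: "'a topology \<Rightarrow> ('a, 'n::finite) chart set \<Rightarrow> ('a, 'n) form \<Rightarrow> bool" where
  "form_integrable M A h \<longleftrightarrow>
     set_integrable (count_space UNIV \<Otimes>\<^sub>M lborel) (chart_pieces (chart_cover M A))
       (form_density M A h)"

definition form_integral :: "'a topology \<Rightarrow> ('a, 'n::finite) chart set \<Rightarrow> ('a, 'n) form \<Rightarrow> complex" where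
  "form_integral M A h =
     set_lebesgue_integral (count_space UNIV \<Otimes>\<^sub>M lborel) (chart_pieces (chart_cover M A))
       (form_density M A h)"

definition wedge_cnj :: "('a, 'n) form \<Rightarrow> ('a, 'n) form \<Rightarrow> ('a, 'n) form" where
  "wedge_cnj f g = (\<lambda>c z. f c z * cnj (g c z))"

definition bergman_space :: "'a topology \<Rightarrow> ('a, 'n::finite) chart set \<Rightarrow> ('a, 'n) form set" where
  "bergman_space M A = {f \<in> holomorphic_forms A. form_integrable M A (wedge_cnj f f)}"

definition bergman_inner ::
  "'a topology \<Rightarrow> ('a, 'n::finite) chart set \<Rightarrow> ('a, 'n) form \<Rightarrow> ('a, 'n) form \<Rightarrow> complex" where
  "bergman_inner M A f g = \<i> ^ (CARD('n)\<^sup>2) * form_integral M A (wedge_cnj f g)"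

text \<open>
  An orthonormal basis of the Hilbert space is a maximal orthonormal system, here
  \<open>f j\<close> for \<open>j < N \<le> \<infinity>\<close>.
\<close>

definition bergman_orthonormal_basis ::
  "'a topology \<Rightarrow> ('a, 'n::finite) chart set \<Rightarrow> enat \<Rightarrow> (nat \<Rightarrow> ('a, 'n) form) \<Rightarrow> bool" where
  "bergman_orthonormal_basis M A N f \<longleftrightarrow>
     (\<forall>j. enat j < N \<longrightarrow> f j \<in> bergman_space M A) \<and>
     (\<forall>i j. enat i < N \<and> enat j < N \<longrightarrow> bergman_inner M A (f i) (f j) = (if i = j then 1 else 0)) \<and>
     (\<forall>g\<in>bergman_space M A. (\<forall>j. enat j < N \<longrightarrow> bergman_inner M A g (f j) = 0) \<longrightarrow> g = (\<lambda>c z. 0))"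

text \<open>
  The coefficient \<open>K(z, cnj z)\<close> of the Bergman kernel form in the chart \<open>c\<close>; it does not
  depend on the choice of the orthonormal basis.
\<close>

definition bergman_kernel ::
  "'a topology \<Rightarrow> ('a, 'n::finite) chart set \<Rightarrow> ('a, 'n) form" where
  "bergman_kernel M A c z =
     (let (N, f) = (SOME (N, f). bergman_orthonormal_basis M A N f)
      in \<Sum>\<^sub>\<infinity>j\<in>{j. enat j < N}. wedge_cnj (f j) (f j) c z)"

definition base_point_free :: "'a topology \<Rightarrow> ('a, 'n::finite) chart set \<Rightarrow> bool" where
  "base_point_free M A \<longleftrightarrow>
     (\<forall>c\<in>A. \<forall>z\<in>chart_image c. \<exists>f\<in>bergman_space M A. f c z \<noteq> 0)"

text \<open>
  A \<open>(1,0)\<close>-vector \<open>\<Sum>\<^sub>i X\<^sub>i \<partial>/\<partial>z\<^sub>i\<close> is given by its components \<open>X\<close> in a chart.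
\<close>

definition separates_holomorphic_directions ::
  "'a topology \<Rightarrow> ('a, 'n::finite) chart set \<Rightarrow> bool" where
  "separates_holomorphic_directions M A \<longleftrightarrow>
     (\<forall>c\<in>A. \<forall>z\<in>chart_image c. \<forall>X::complex ^ 'n. X \<noteq> 0 \<longrightarrow>
        (\<exists>f\<in>bergman_space M A. f c z = 0 \<and> (\<Sum>i\<in>UNIV. X $ i * wirtinger i (f c) z) \<noteq> 0))"

definition log_bergman_kernel ::
  "'a topology \<Rightarrow> ('a, 'n::finite) chart set \<Rightarrow> ('a, 'n) form" where
  "log_bergman_kernel M A c z = complex_of_real (ln (Re (bergman_kernel M A c z)))"

definition bergman_metric ::
  "'a topology \<Rightarrow> ('a, 'n::finite) chart set \<Rightarrow> ('a, 'n) chart \<Rightarrow> complex ^ 'n \<Rightarrow> complex ^ 'n ^ 'n" where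
  "bergman_metric M A c z =
     (\<chi> \<alpha> \<beta>. wirtinger \<alpha> (wirtinger_bar \<beta> (log_bergman_kernel M A c)) z)"

text \<open>
  The entry \<open>g z $ i $ j\<close> is the component of a Hermitian metric with indices \<open>i\<close> and \<open>j\<close>-bar.
  The inverse metric with upper indices \<open>\<alpha>\<close> and \<open>\<beta>\<close>-bar is the \<open>(\<beta>, \<alpha>)\<close> entry of the inverse
  matrix: its contraction over \<open>\<beta>\<close> with \<open>g z $ \<gamma> $ \<beta>\<close> is the Kronecker delta of \<open>\<gamma>\<close> and \<open>\<alpha>\<close>.
\<close>

definition curvature_component ::
  "(complex ^ 'n \<Rightarrow> complex ^ 'n ^ 'n) \<Rightarrow> complex ^ 'n \<Rightarrow> 'n \<Rightarrow> 'n \<Rightarrow> 'n \<Rightarrow> 'n::finite \<Rightarrow> complex" where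
  "curvature_component g z i j k l =
     - wirtinger k (wirtinger_bar l (\<lambda>w. g w $ i $ j)) z +
     (\<Sum>\<alpha>\<in>UNIV. \<Sum>\<beta>\<in>UNIV. matrix_inv (g z) $ \<beta> $ \<alpha> *
        wirtinger k (\<lambda>w. g w $ i $ \<beta>) z * wirtinger_bar l (\<lambda>w. g w $ \<alpha> $ j) z)"

definition holomorphic_sectional_curvature ::
  "(complex ^ 'n \<Rightarrow> complex ^ 'n ^ 'n) \<Rightarrow> complex ^ 'n \<Rightarrow> complex ^ 'n::finite \<Rightarrow> complex" where
  "holomorphic_sectional_curvature g z X =
     (\<Sum>i\<in>UNIV. \<Sum>j\<in>UNIV. \<Sum>k\<in>UNIV. \<Sum>l\<in>UNIV.
        curvature_component g z i j k l * X $ i * cnj (X $ j) * X $ k * cnj (X $ l)) /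
     (\<Sum>i\<in>UNIV. \<Sum>j\<in>UNIV. g z $ i $ j * X $ i * cnj (X $ j))\<^sup>2"

definition bergman_metric_has_constant_hsc ::
  "'a topology \<Rightarrow> ('a, 'n::finite) chart set \<Rightarrow> real \<Rightarrow> bool" where
  "bergman_metric_has_constant_hsc M A \<kappa> \<longleftrightarrow>
     (\<forall>c\<in>A. \<forall>z\<in>chart_image c. \<forall>X. X \<noteq> 0 \<longrightarrow>
        holomorphic_sectional_curvature (bergman_metric M A c) z X = complex_of_real \<kappa>)"

end

theory Submission
  imports Defs "HOL-Complex_Analysis.Complex_Analysis"
begin

text \<open>
  Suppose the Bergman metric is flat. In local coordinates the polarized logarithm of the kernel is
  a function of \<open>z\<close> and \<open>cnj w\<close> whose mixed derivatives form the metric. Vanishing of all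
  holomorphic sectional curvatures kills the whole curvature tensor, on the diagonal and hence
  near it, and this forces \<open>K z w = s z * cnj (s w) * exp (F z \<cdot> cnj (F w))\<close> with local coordinates
  \<open>F\<close> (\<open>local_flat_structure\<close>). So near a point the Bergman space looks like the Fock space.

  The Bergman space then contains the analogues of the monomials and of the exponentials of Fock
  space: the Taylor coefficients of \<open>f / s\<close> in the coordinates \<open>F\<close> are bounded functionals, and
  their representers \<open>coh v k\<close> sum up to coherent states \<open>coherent y\<close>, equal to
  \<open>s * exp (F \<cdot> cnj y)\<close> near the point, for every \<open>y\<close> in \<open>\<complex>\<^sup>n\<close>. The algebraic relations between
  them are global. They show that the form \<open>vac\<close> extending \<open>s\<close> has no zeros
  (\<open>vac_nonzero\<close>, from base point freeness) and that \<open>F\<close> extends to a globally defined map \<open>dev\<close>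
  that is everywhere locally biholomorphic (\<open>jac_nonzero\<close>, from the separation of directions).

  All trigonometric moments of the image under \<open>dev\<close> of the measure \<open>|vac|\<^sup>2\<close> are now known: they are
  those of a Gaussian. Hence a cube has mass at most a constant times its volume
  (\<open>push_cube\<close>), and by the change of variables formula the holomorphic function
  \<open>coherent y / jac\<close> is bounded (\<open>quot_bounded_piece\<close>). A bounded holomorphic function acts on the
  Bergman space by multiplication, and the coherent states are eigenvectors of the adjoint. The
  eigenvalue is an entire function of the parameter bounded by the norm of the operator, so it is
  constant by Liouville, and so is the multiplier (\<open>quot_constant\<close>). But the
  quotient of these functions for two values of \<open>y\<close> is \<open>exp (dev \<cdot> cnj y)\<close>, which is not constant.
\<close>

no_notation fps_nth (infixl \<open>$\<close> 75)

section \<open>Holomorphic functions of several variables\<close>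

lemma norm_vector_scale_complex: "norm (a *s v) = norm a * norm (v :: complex ^ 'm)"
  by (simp add: norm_vec_def L2_set_def norm_mult power_mult_distrib sum_distrib_left[symmetric]
      real_sqrt_mult)

lemma scale_eq_scaleR: "of_real r *s v = r *\<^sub>R (v :: complex ^ 'm)"
  by (simp add: vec_eq_iff) (simp add: scaleR_conv_of_real)

lemma bounded_linear_scale_left: "bounded_linear (\<lambda>\<zeta>. \<zeta> *s (v :: complex ^ 'm))"
  by (rule bounded_linear_intro[of _ "norm v"])
     (auto simp: norm_vector_scale_complex vec_eq_iff algebra_simps)

lemma bounded_linear_scale_right: "bounded_linear (\<lambda>v :: complex ^ 'm. a *s v)"
  by (rule bounded_linear_intro[of _ "norm a"])
     (auto simp: norm_vector_scale_complex vec_eq_iff algebra_simps)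

lemma axis_expansion: "(v :: complex ^ 'm) = (\<Sum>i\<in>UNIV. v $ i *s axis i 1)"
  by (simp add: vec_eq_iff axis_def if_distrib cong: if_cong)

lemma clinear_expansion:
  fixes L :: "complex ^ 'm \<Rightarrow> complex"
  assumes "linear L" "\<And>a v. L (a *s v) = a * L v"
  shows "L v = (\<Sum>i\<in>UNIV. v $ i * L (axis i 1))"
  by (subst axis_expansion[of v]) (simp add: linear_sum[OF assms(1)] assms(2))

lemma wirtinger_eqI:
  assumes "(f has_derivative L) (at z)" "\<And>a v. L (a *s v) = a * L v"
  shows "wirtinger i f z = L (axis i 1)"
proof -
  have "frechet_derivative f (at z) = L"
    using assms(1) frechet_derivative_at by metis
  moreover have "L (axis i \<i>) = \<i> * L (axis i 1)"
    using assms(2)[of \<i> "axis i 1"] by (simp add: axis_def vector_scalar_mult_def if_distrib cong: if_cong)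
  ultimately show ?thesis
    by (simp add: wirtinger_def algebra_simps)
qed

lemma wirtinger_cong:
  assumes "open S" "z \<in> S" "\<And>w. w \<in> S ==> f w = g w"
  shows "wirtinger i f z = wirtinger i g z" "wirtinger_bar i f z = wirtinger_bar i g z"
proof -
  have "(f has_derivative L) (at z) = (g has_derivative L) (at z)" for L
    using has_derivative_transform_within_open[of f L z UNIV S g]
      has_derivative_transform_within_open[of g L z UNIV S f] assms by auto
  then have "frechet_derivative f (at z) = frechet_derivative g (at z)"
    by (simp add: frechet_derivative_def)
  then show "wirtinger i f z = wirtinger i g z" "wirtinger_bar i f z = wirtinger_bar i g z"
    by (simp_all add: wirtinger_def wirtinger_bar_def)
qed

definition Cn_derivative :: "(complex ^ 'm \<Rightarrow> complex) \<Rightarrow> complex ^ 'm \<Rightarrow> complex ^ 'm \<Rightarrow> complex" where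
  "Cn_derivative f z v = (\<Sum>i\<in>UNIV. v $ i * wirtinger i f z)"

lemma Cn_derivative_eqI:
  assumes "(f has_derivative L) (at z)" "\<And>a v. L (a *s v) = a * L v"
  shows "Cn_derivative f z = L"
proof
  show "Cn_derivative f z v = L v" for v
    unfolding Cn_derivative_def wirtinger_eqI[OF assms]
    using clinear_expansion[OF has_derivative_linear[OF assms(1)] assms(2), of v] by simp
qed

lemma Cn_derivative_scale: "Cn_derivative f z (a *s v) = a * Cn_derivative f z v"
  by (simp add: Cn_derivative_def sum_distrib_left algebra_simps)

lemma Cn_derivative_add: "Cn_derivative f z (u + v) = Cn_derivative f z u + Cn_derivative f z v"
  by (simp add: Cn_derivative_def sum.distrib algebra_simps)

lemma Cn_derivative_axis: "Cn_derivative f z (axis i 1) = wirtinger i f z"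
  by (simp add: Cn_derivative_def axis_def if_distrib[of "\<lambda>x. x * _"] cong: if_cong)

lemma holomorphic_CnI:
  assumes "\<And>z. z \<in> S ==> (f has_derivative L z) (at z)" "\<And>z a v. z \<in> S ==> L z (a *s v) = a * L z v"
  shows "holomorphic_Cn_on f S"
  unfolding holomorphic_Cn_on_def using assms has_derivative_at_withinI by blast

lemma holomorphic_Cn_derivative:
  assumes "holomorphic_Cn_on f S" "open S" "z \<in> S"
  shows "(f has_derivative Cn_derivative f z) (at z)"
proof -
  obtain L where L: "(f has_derivative L) (at z)" "\<And>a v. L (a *s v) = a * L v"
    using assms unfolding holomorphic_Cn_on_def by (metis at_within_open)
  then show ?thesis using Cn_derivative_eqI[OF L] by simp
qed

lemma holomorphic_Cn_subset: "holomorphic_Cn_on f S ==> T \<subseteq> S ==> holomorphic_Cn_on f T"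
  unfolding holomorphic_Cn_on_def by (meson has_derivative_subset subsetD)

lemma holomorphic_Cn_cong:
  assumes "holomorphic_Cn_on f S" "\<And>z. z \<in> S ==> f z = g z"
  shows "holomorphic_Cn_on g S"
  using assms unfolding holomorphic_Cn_on_def by (metis has_derivative_transform)

lemma holomorphic_Cn_continuous:
  "holomorphic_Cn_on f S ==> continuous_on S f"
  unfolding holomorphic_Cn_on_def continuous_on_eq_continuous_within
  using has_derivative_continuous by blast

lemma has_derivative_field_compose:
  assumes "(f has_derivative L) (at z)" "(g has_field_derivative d) (at (f z))"
  shows "((\<lambda>z. g (f z)) has_derivative (\<lambda>v. d * L v)) (at z)"
  using diff_chain_at[OF assms(1) assms(2)[unfolded has_field_derivative_def]]
  by (simp add: o_def)

lemma holomorphic_Cn_compose_field: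
  assumes f: "holomorphic_Cn_on f S" "open S" and g: "g holomorphic_on T" "open T" and "f ` S \<subseteq> T"
  shows "holomorphic_Cn_on (\<lambda>z. g (f z)) S"
    and "\<And>z i. z \<in> S ==> wirtinger i (\<lambda>z. g (f z)) z = deriv g (f z) * wirtinger i f z"
proof -
  have *: "((\<lambda>z. g (f z)) has_derivative (\<lambda>v. deriv g (f z) * Cn_derivative f z v)) (at z)" if "z \<in> S" for z
    using assms that
    by (intro has_derivative_field_compose holomorphic_Cn_derivative[OF f]) (auto intro: holomorphic_derivI)
  show "holomorphic_Cn_on (\<lambda>z. g (f z)) S"
    by (rule holomorphic_CnI[OF *]) (auto simp: Cn_derivative_scale)
  show "wirtinger i (\<lambda>z. g (f z)) z = deriv g (f z) * wirtinger i f z" if "z \<in> S" for z i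
    using wirtinger_eqI[OF *[OF that]] by (simp add: Cn_derivative_scale Cn_derivative_axis)
qed

lemma holomorphic_Cn_const [intro!, simp]: "holomorphic_Cn_on (\<lambda>z. c) S"
  by (rule holomorphic_CnI[where L = "\<lambda>_ _. 0"]) auto

lemma holomorphic_Cn_component [intro!, simp]: "holomorphic_Cn_on (\<lambda>z. z $ i) S"
  by (rule holomorphic_CnI[where L = "\<lambda>_ v. v $ i"]) (auto intro: bounded_linear_imp_has_derivative bounded_linear_vec_nth)

lemma wirtinger_const [simp]: "wirtinger i (\<lambda>z. c) z = 0"
  by (subst wirtinger_eqI[where L = "\<lambda>_. 0"]) auto

lemma wirtinger_component: "wirtinger i (\<lambda>z. z $ j) z = (if i = j then 1 else 0)"
  by (subst wirtinger_eqI[where L = "\<lambda>v. v $ j"])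
     (auto intro: bounded_linear_imp_has_derivative bounded_linear_vec_nth simp: axis_def)

lemma holomorphic_Cn_add:
  assumes "holomorphic_Cn_on f S" "holomorphic_Cn_on g S" "open S"
  shows "holomorphic_Cn_on (\<lambda>z. f z + g z) S"
    and "\<And>z i. z \<in> S ==> wirtinger i (\<lambda>z. f z + g z) z = wirtinger i f z + wirtinger i g z"
proof -
  have *: "((\<lambda>z. f z + g z) has_derivative (\<lambda>v. Cn_derivative f z v + Cn_derivative g z v)) (at z)" if "z \<in> S" for z
    using assms that by (intro has_derivative_add holomorphic_Cn_derivative) auto
  show "holomorphic_Cn_on (\<lambda>z. f z + g z) S"
    by (rule holomorphic_CnI[OF *]) (auto simp: Cn_derivative_scale algebra_simps)
  show "wirtinger i (\<lambda>z. f z + g z) z = wirtinger i f z + wirtinger i g z" if "z \<in> S" for z i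
    using wirtinger_eqI[OF *[OF that]] by (simp add: Cn_derivative_scale Cn_derivative_axis algebra_simps)
qed

lemma holomorphic_Cn_mult:
  assumes "holomorphic_Cn_on f S" "holomorphic_Cn_on g S" "open S"
  shows "holomorphic_Cn_on (\<lambda>z. f z * g z) S"
    and "\<And>z i. z \<in> S ==> wirtinger i (\<lambda>z. f z * g z) z = f z * wirtinger i g z + wirtinger i f z * g z"
proof -
  have *: "((\<lambda>z. f z * g z) has_derivative (\<lambda>v. f z * Cn_derivative g z v + Cn_derivative f z v * g z)) (at z)" if "z \<in> S" for z
    using assms that by (intro has_derivative_mult holomorphic_Cn_derivative) auto
  show "holomorphic_Cn_on (\<lambda>z. f z * g z) S"
    by (rule holomorphic_CnI[OF *]) (auto simp: Cn_derivative_scale algebra_simps)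
  show "wirtinger i (\<lambda>z. f z * g z) z = f z * wirtinger i g z + wirtinger i f z * g z" if "z \<in> S" for z i
    using wirtinger_eqI[OF *[OF that]] by (simp add: Cn_derivative_scale Cn_derivative_axis algebra_simps)
qed

lemma holomorphic_Cn_cmult:
  assumes "holomorphic_Cn_on f S" "open S"
  shows "holomorphic_Cn_on (\<lambda>z. c * f z) S"
    and "\<And>z i. z \<in> S ==> wirtinger i (\<lambda>z. c * f z) z = c * wirtinger i f z"
  using holomorphic_Cn_mult(1)[OF holomorphic_Cn_const assms, of c]
    holomorphic_Cn_mult(2)[OF holomorphic_Cn_const[of c] assms] by auto

lemma holomorphic_Cn_uminus:
  assumes "holomorphic_Cn_on f S" "open S"
  shows "holomorphic_Cn_on (\<lambda>z. - f z) S"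
    and "\<And>z i. z \<in> S ==> wirtinger i (\<lambda>z. - f z) z = - wirtinger i f z"
  using holomorphic_Cn_cmult(1)[OF assms, of "-1"] holomorphic_Cn_cmult(2)[OF assms, where c = "-1"] by auto

lemma holomorphic_Cn_diff:
  assumes "holomorphic_Cn_on f S" "holomorphic_Cn_on g S" "open S"
  shows "holomorphic_Cn_on (\<lambda>z. f z - g z) S"
    and "\<And>z i. z \<in> S ==> wirtinger i (\<lambda>z. f z - g z) z = wirtinger i f z - wirtinger i g z"
  using holomorphic_Cn_add[OF assms(1) holomorphic_Cn_uminus(1)[OF assms(2,3)] assms(3)]
    holomorphic_Cn_uminus(2)[OF assms(2,3)] by auto

lemma holomorphic_Cn_sum:
  assumes "finite I" "\<And>j. j \<in> I ==> holomorphic_Cn_on (f j) S" "open S"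
  shows "holomorphic_Cn_on (\<lambda>z. \<Sum>j\<in>I. f j z) S \<and>
     (\<forall>z\<in>S. \<forall>i. wirtinger i (\<lambda>z. \<Sum>j\<in>I. f j z) z = (\<Sum>j\<in>I. wirtinger i (f j) z))"
  using assms(1,2)
proof (induction I rule: finite_induct)
  case (insert j I)
  then show ?case
    using holomorphic_Cn_add[OF _ _ assms(3), of "f j" "\<lambda>z. \<Sum>j\<in>I. f j z"] by auto
qed auto

lemma holomorphic_Cn_prod:
  assumes "\<And>j. j \<in> I ==> holomorphic_Cn_on (f j) S" "open S"
  shows "holomorphic_Cn_on (\<lambda>z. \<Prod>j\<in>I. f j z) S"
  using assms(1)
proof (induction I rule: infinite_finite_induct)
  case (insert j I)
  then show ?case
    using holomorphic_Cn_mult(1)[OF _ _ assms(2), of "f j" "\<lambda>z. \<Prod>j\<in>I. f j z"] by auto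
qed auto

lemma holomorphic_Cn_power:
  assumes "holomorphic_Cn_on f S" "open S"
  shows "holomorphic_Cn_on (\<lambda>z. f z ^ k) S"
  using holomorphic_Cn_prod[of "{..<k}" "\<lambda>_. f"] assms by simp

lemma holomorphic_Cn_divide:
  assumes "holomorphic_Cn_on f S" "holomorphic_Cn_on g S" "open S" "\<And>z. z \<in> S ==> g z \<noteq> 0"
  shows "holomorphic_Cn_on (\<lambda>z. f z / g z) S"
proof -
  have "holomorphic_Cn_on (\<lambda>z. inverse (g z)) S"
    using assms by (intro holomorphic_Cn_compose_field(1)[where T = "- {0}" and g = inverse])
      (auto intro: holomorphic_intros)
  from holomorphic_Cn_mult(1)[OF assms(1) this assms(3)] show ?thesis by (simp add: field_simps)
qed

lemma holomorphic_Cn_exp: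
  assumes "holomorphic_Cn_on f S" "open S"
  shows "holomorphic_Cn_on (\<lambda>z. exp (f z)) S"
    and "\<And>z i. z \<in> S ==> wirtinger i (\<lambda>z. exp (f z)) z = exp (f z) * wirtinger i f z"
  using holomorphic_Cn_compose_field[OF assms, of exp UNIV]
  by (auto simp: holomorphic_on_exp DERIV_imp_deriv[OF DERIV_exp])

lemma has_derivative_vec_iff:
  fixes \<tau> :: "'b::real_normed_vector \<Rightarrow> complex ^ 'k"
  shows "(\<tau> has_derivative L) (at z) \<longleftrightarrow> (\<forall>k. ((\<lambda>z. \<tau> z $ k) has_derivative (\<lambda>v. L v $ k)) (at z))"
proof
  assume "(\<tau> has_derivative L) (at z)"
  then show "\<forall>k. ((\<lambda>z. \<tau> z $ k) has_derivative (\<lambda>v. L v $ k)) (at z)"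
    using bounded_linear.has_derivative[OF bounded_linear_vec_nth] by blast
next
  assume *: "\<forall>k. ((\<lambda>z. \<tau> z $ k) has_derivative (\<lambda>v. L v $ k)) (at z)"
  have "((\<lambda>z. \<Sum>k\<in>UNIV. \<tau> z $ k *s axis k 1) has_derivative (\<lambda>v. \<Sum>k\<in>UNIV. L v $ k *s axis k 1)) (at z)"
    by (intro has_derivative_sum bounded_linear.has_derivative[OF bounded_linear_scale_left] *[rule_format])
  then show "(\<tau> has_derivative L) (at z)"
    using axis_expansion by (metis (no_types, lifting) ext)
qed

definition Cn_map_derivative :: "(complex ^ 'm \<Rightarrow> complex ^ 'k) \<Rightarrow> complex ^ 'm \<Rightarrow> complex ^ 'm \<Rightarrow> complex ^ 'k" where
  "Cn_map_derivative \<tau> z v = (\<chi> k. Cn_derivative (\<lambda>z. \<tau> z $ k) z v)"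

lemma holomorphic_Cn_map_derivative:
  fixes \<tau> :: "complex ^ 'm \<Rightarrow> complex ^ 'k"
  assumes "\<And>k. holomorphic_Cn_on (\<lambda>z. \<tau> z $ k) S" "open S" "z \<in> S"
  shows "(\<tau> has_derivative Cn_map_derivative \<tau> z) (at z)"
  using assms holomorphic_Cn_derivative by (auto simp: has_derivative_vec_iff Cn_map_derivative_def)

lemma Cn_map_derivative_jacobian:
  "Cn_map_derivative \<tau> z v = complex_jacobian \<tau> z *v v"
  by (simp add: Cn_map_derivative_def complex_jacobian_def vec_eq_iff matrix_vector_mult_def Cn_derivative_def mult.commute)

lemma holomorphic_Cn_compose:
  fixes \<tau> :: "complex ^ 'm \<Rightarrow> complex ^ 'k"
  assumes \<tau>: "\<And>k. holomorphic_Cn_on (\<lambda>z. \<tau> z $ k) S" "open S"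
    and f: "holomorphic_Cn_on f T" "open T" and "\<tau> ` S \<subseteq> T"
  shows "holomorphic_Cn_on (\<lambda>z. f (\<tau> z)) S"
    and "\<And>z i. z \<in> S ==> wirtinger i (\<lambda>z. f (\<tau> z)) z = (\<Sum>k\<in>UNIV. wirtinger k f (\<tau> z) * wirtinger i (\<lambda>z. \<tau> z $ k) z)"
proof -
  have *: "((\<lambda>z. f (\<tau> z)) has_derivative (\<lambda>v. Cn_derivative f (\<tau> z) (Cn_map_derivative \<tau> z v))) (at z)" if "z \<in> S" for z
    using assms that diff_chain_at[OF holomorphic_Cn_map_derivative[OF \<tau> that] holomorphic_Cn_derivative[OF f]]
    by (auto simp: o_def)
  have sc: "Cn_map_derivative \<tau> z (a *s v) = a *s Cn_map_derivative \<tau> z v" for z a v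
    by (simp add: Cn_map_derivative_def vec_eq_iff Cn_derivative_scale)
  show "holomorphic_Cn_on (\<lambda>z. f (\<tau> z)) S"
    by (rule holomorphic_CnI[OF *]) (auto simp: Cn_derivative_scale sc)
  show "wirtinger i (\<lambda>z. f (\<tau> z)) z = (\<Sum>k\<in>UNIV. wirtinger k f (\<tau> z) * wirtinger i (\<lambda>z. \<tau> z $ k) z)" if "z \<in> S" for z i
    using wirtinger_eqI[OF *[OF that], of i] 
    by (simp add: Cn_derivative_scale sc) (simp add: Cn_derivative_def[of f] Cn_map_derivative_def Cn_derivative_axis mult.commute)
qed

lemma holomorphic_along_line:
  fixes f :: "complex ^ 'm \<Rightarrow> complex"
  assumes f: "holomorphic_Cn_on f S" "open S" and "z + \<zeta> *s v \<in> S"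
  shows "((\<lambda>\<zeta>. f (z + \<zeta> *s v)) has_field_derivative Cn_derivative f (z + \<zeta> *s v) v) (at \<zeta>)"
proof -
  have "((\<lambda>\<zeta>. z + \<zeta> *s v) has_derivative (\<lambda>h. h *s v)) (at \<zeta>)"
    using bounded_linear_imp_has_derivative[OF bounded_linear_scale_left] by (auto intro!: derivative_eq_intros)
  from diff_chain_at[OF this holomorphic_Cn_derivative[OF assms]] show ?thesis
    by (simp add: o_def has_field_derivative_def Cn_derivative_scale mult_commute_abs)
qed

lemma open_line_vimage: "open S ==> open {\<zeta>. z + \<zeta> *s v \<in> (S :: (complex ^ 'm) set)}"
proof -
  assume "open S"
  moreover have "continuous_on UNIV (\<lambda>\<zeta>. z + \<zeta> *s v)"
    by (intro continuous_intros linear_continuous_on bounded_linear_scale_left)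
  ultimately show ?thesis using open_vimage[of S "\<lambda>\<zeta>. z + \<zeta> *s v"] by (simp add: vimage_def)
qed

lemma convex_line_vimage:
  assumes "convex S" shows "convex {\<zeta>. z + \<zeta> *s v \<in> (S :: (complex ^ 'm) set)}"
proof (rule convexI, unfold mem_Collect_eq)
  fix x y and u w :: real
  assume *: "z + x *s v \<in> S" "z + y *s v \<in> S" "0 \<le> u" "0 \<le> w" "u + w = 1"
  have "z + (u *\<^sub>R x + w *\<^sub>R y) *s v = u *\<^sub>R (z + x *s v) + w *\<^sub>R (z + y *s v)"
  proof -
    have "z = u *\<^sub>R z + w *\<^sub>R z"
      using *(5) by (metis scaleR_add_left scaleR_one)
    then show ?thesis
      by (simp add: scale_eq_scaleR[symmetric] vec_eq_iff scaleR_conv_of_real algebra_simps)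
  qed
  then show "z + (u *\<^sub>R x + w *\<^sub>R y) *s v \<in> S"
    using convexD[OF assms *] by simp
qed

lemma holomorphic_on_line:
  fixes f :: "complex ^ 'm \<Rightarrow> complex"
  assumes "holomorphic_Cn_on f S" "open S"
  shows "(\<lambda>\<zeta>. f (z + \<zeta> *s v)) holomorphic_on {\<zeta>. z + \<zeta> *s v \<in> S}"
  using holomorphic_along_line[OF assms] open_line_vimage[OF assms(2)]
  by (auto simp: holomorphic_on_open)

section \<open>Estimates for holomorphic functions of several variables\<close>

lemma power_series_remainder_bound:
  fixes g :: "complex \<Rightarrow> complex"
  assumes g: "g holomorphic_on ball 0 r" and r: "r > 0"
    and M: "\<And>\<zeta>. \<zeta> \<in> ball 0 r ==> norm (g \<zeta>) \<le> M" and \<zeta>: "norm \<zeta> \<le> r / 4"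
  shows "norm (g \<zeta> - g 0 - deriv g 0 * \<zeta>) \<le> 8 * M * (norm \<zeta> / r)\<^sup>2"
proof -
  define a where "a = (\<lambda>k. (deriv ^^ k) g 0 / fact k)"
  define q where "q = 2 * norm \<zeta> / r"
  have q: "0 \<le> q" "q \<le> 1 / 2" using r \<zeta> by (auto simp: q_def field_simps)
  have M0: "0 \<le> M" using M[of 0] r by (smt (verit) centre_in_ball norm_ge_zero)
  have a: "norm (a k * \<zeta> ^ k) \<le> M * q ^ k" for k
  proof -
    have "norm ((deriv ^^ k) g 0) \<le> fact k * M / (r / 2) ^ k"
      using r by (intro Cauchy_inequality holomorphic_on_subset[OF g] holomorphic_on_imp_continuous_on M) (auto simp: dist_norm)
    then have "norm (a k) \<le> M / (r / 2) ^ k"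
      by (simp add: a_def norm_divide field_simps)
    then have "norm (a k) * norm \<zeta> ^ k \<le> M / (r / 2) ^ k * norm \<zeta> ^ k"
      by (rule mult_right_mono) auto
    then show ?thesis by (simp add: q_def norm_mult norm_power power_divide power_mult_distrib field_simps)
  qed
  have sums: "(\<lambda>k. a k * \<zeta> ^ k) sums g \<zeta>"
    using holomorphic_power_series[OF g, of \<zeta>] r \<zeta> by (simp add: a_def)
  have "(\<lambda>k. a (k + 2) * \<zeta> ^ (k + 2)) sums (g \<zeta> - (\<Sum>k<2. a k * \<zeta> ^ k))"
    using sums by (subst sums_iff_shift) simp
  moreover have "(\<Sum>k<2. a k * \<zeta> ^ k) = g 0 + deriv g 0 * \<zeta>"
    by (simp add: a_def numeral_2_eq_2)
  ultimately have s2: "(\<lambda>k. a (k + 2) * \<zeta> ^ (k + 2)) sums (g \<zeta> - g 0 - deriv g 0 * \<zeta>)"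
    by (simp add: algebra_simps)
  have geo: "(\<lambda>k. M * q\<^sup>2 * q ^ k) sums (M * q\<^sup>2 * (1 / (1 - q)))"
    using q by (intro sums_mult geometric_sums) auto
  have "norm (g \<zeta> - g 0 - deriv g 0 * \<zeta>) = norm (\<Sum>k. a (k + 2) * \<zeta> ^ (k + 2))"
    using s2 by (simp add: sums_iff)
  also have "\<dots> \<le> (\<Sum>k. M * q\<^sup>2 * q ^ k)"
    using geo a[of "_ + 2"] by (intro norm_suminf_le) (auto simp: sums_iff power_add mult_ac power2_eq_square)
  also have "\<dots> = M * q\<^sup>2 * (1 / (1 - q))"
    using geo by (simp add: sums_iff)
  also have "\<dots> \<le> M * q\<^sup>2 * 2"
    using q M0 by (intro mult_left_mono) (auto simp: field_simps)
  also have "\<dots> = 8 * M * (norm \<zeta> / r)\<^sup>2"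
    by (simp add: q_def power2_eq_square)
  finally show ?thesis .
qed

text \<open>
  A bound for a holomorphic function controls the first derivative and the remainder of the
  first-order expansion, by Cauchy's inequalities on the complex line through the two points.
\<close>

lemma holomorphic_Cn_first_order:
  fixes f :: "complex ^ 'm \<Rightarrow> complex"
  assumes f: "holomorphic_Cn_on f (ball x r)" and r: "r > 0"
    and M: "\<And>y. y \<in> ball x r ==> norm (f y) \<le> M"
  shows "norm u \<le> r / 4 ==> norm (f (x + u) - f x - Cn_derivative f x u) \<le> 8 * M * (norm u / r)\<^sup>2"
    and "norm (Cn_derivative f x v) \<le> 2 * M / r * norm v"
proof -
  have line: "(\<lambda>\<zeta>. f (x + \<zeta> *s v)) holomorphic_on ball 0 r"
      "deriv (\<lambda>\<zeta>. f (x + \<zeta> *s v)) 0 = Cn_derivative f x v"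
      "\<And>\<zeta>. \<zeta> \<in> ball 0 r ==> x + \<zeta> *s v \<in> ball x r"
    if "norm v = 1" for v
  proof -
    show *: "x + \<zeta> *s v \<in> ball x r" if "\<zeta> \<in> ball 0 r" for \<zeta>
      using that \<open>norm v = 1\<close> by (simp add: dist_norm norm_vector_scale_complex)
    show "(\<lambda>\<zeta>. f (x + \<zeta> *s v)) holomorphic_on ball 0 r"
      by (rule holomorphic_on_subset[OF holomorphic_on_line[OF f]]) (use * in auto)
    show "deriv (\<lambda>\<zeta>. f (x + \<zeta> *s v)) 0 = Cn_derivative f x v"
      using DERIV_imp_deriv[OF holomorphic_along_line[OF f, of x 0 v]] r by auto
  qed
  have M0: "0 \<le> M" using M[of x] r by (smt (verit) centre_in_ball norm_ge_zero)
  show "norm (f (x + u) - f x - Cn_derivative f x u) \<le> 8 * M * (norm u / r)\<^sup>2" if u: "norm u \<le> r / 4"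
  proof (cases "u = 0")
    case True
    then show ?thesis using M0 by (simp add: Cn_derivative_def)
  next
    case False
    define v where "v = of_real (1 / norm u) *s u"
    have v: "norm v = 1" "of_real (norm u) *s v = u"
      using False by (auto simp: v_def norm_vector_scale_complex norm_divide)
    have "norm (f (x + of_real (norm u) *s v) - f (x + 0 *s v) - deriv (\<lambda>\<zeta>. f (x + \<zeta> *s v)) 0 * of_real (norm u))
        \<le> 8 * M * (norm (complex_of_real (norm u)) / r)\<^sup>2"
      by (rule power_series_remainder_bound[OF line(1)[OF v(1)] r]) (use M line(3)[OF v(1)] u in auto)
    moreover have "Cn_derivative f x v * of_real (norm u) = Cn_derivative f x u"
      using Cn_derivative_scale[of f x "of_real (norm u)" v] v(2) by (simp add: mult.commute)
    ultimately show ?thesis by (simp add: v line(2)[OF v(1)])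
  qed
  show "norm (Cn_derivative f x v) \<le> 2 * M / r * norm v"
  proof (cases "v = 0")
    case True
    then show ?thesis by (simp add: Cn_derivative_def)
  next
    case False
    define w where "w = of_real (1 / norm v) *s v"
    have w: "norm w = 1" "of_real (norm v) *s w = v"
      using False by (auto simp: w_def norm_vector_scale_complex norm_divide)
    have "norm ((deriv ^^ 1) (\<lambda>\<zeta>. f (x + \<zeta> *s w)) 0) \<le> fact 1 * M / (r / 2) ^ 1"
      using r by (intro Cauchy_inequality holomorphic_on_subset[OF line(1)[OF w(1)]] holomorphic_on_imp_continuous_on M line(3)[OF w(1)])
         (auto simp: dist_norm)
    then have "norm (Cn_derivative f x w) \<le> 2 * M / r"
      by (simp add: line(2)[OF w(1)] mult.commute)
    then have "norm v * norm (Cn_derivative f x w) \<le> norm v * (2 * M / r)"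
      by (rule mult_left_mono) auto
    moreover have "Cn_derivative f x v = of_real (norm v) * Cn_derivative f x w"
      using Cn_derivative_scale[of f x "of_real (norm v)" w] w(2) by simp
    ultimately show ?thesis by (simp add: norm_mult mult_ac)
  qed
qed

text \<open>
  Pointwise convergence of a locally bounded sequence suffices for the convergence of the
  derivatives: the quadratic remainder is uniform in the sequence, so difference quotients with a
  small fixed step are uniformly good approximations.
\<close>

lemma bounded_pointwise_limit:
  fixes F :: "nat \<Rightarrow> complex ^ 'm \<Rightarrow> complex"
  assumes F: "\<And>k. holomorphic_Cn_on (F k) S" and S: "open S"
    and bd: "\<And>x. x \<in> S ==> \<exists>r>0. \<exists>M. ball x r \<subseteq> S \<and> (\<forall>k. \<forall>y\<in>ball x r. norm (F k y) \<le> M)"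
    and lim: "\<And>x. x \<in> S ==> (\<lambda>k. F k x) \<longlonglongrightarrow> f x"
  shows "holomorphic_Cn_on f S"
    and "\<And>x i. x \<in> S ==> (\<lambda>k. wirtinger i (F k) x) \<longlonglongrightarrow> wirtinger i f x"
proof -
  have main: "\<exists>L. (f has_derivative L) (at x) \<and> (\<forall>a v. L (a *s v) = a * L v) \<and>
      (\<forall>v. (\<lambda>k. Cn_derivative (F k) x v) \<longlonglongrightarrow> L v)" if x: "x \<in> S" for x
  proof -
    obtain r M where r: "r > 0" "ball x r \<subseteq> S" and M: "\<And>k y. y \<in> ball x r ==> norm (F k y) \<le> M"
      using bd[OF x] by blast
    have M0: "0 \<le> M" using M[of x 0] r by (smt (verit) centre_in_ball norm_ge_zero)
    define C where "C = 8 * M / r\<^sup>2"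
    have C0: "C \<ge> 0" using M0 by (simp add: C_def)
    have Fb: "holomorphic_Cn_on (F k) (ball x r)" for k
      using holomorphic_Cn_subset[OF F r(2)] .
    have rem: "norm (F k (x + u) - F k x - Cn_derivative (F k) x u) \<le> C * (norm u)\<^sup>2" if "norm u \<le> r / 4" for k u
      using holomorphic_Cn_first_order(1)[OF Fb r(1) M that] by (simp add: C_def power_divide)
    have "Cauchy (\<lambda>k. Cn_derivative (F k) x v)" for v
    proof (rule metric_CauchyI)
      fix e :: real assume e: "e > 0"
      define t where "t = min (r / (4 * (norm v + 1))) (e / (8 * (C * (norm v)\<^sup>2 + 1)))"
      have "0 \<le> C * (norm v)\<^sup>2" using C0 by simp
      then have t: "t > 0" "t * norm v \<le> r / 4" "t * (C * (norm v)\<^sup>2) \<le> e / 8"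
      proof -
        show "t > 0" using r e \<open>0 \<le> C * (norm v)\<^sup>2\<close> by (simp add: t_def add_nonneg_pos)
        have "t * norm v \<le> r / (4 * (norm v + 1)) * norm v" by (rule mult_right_mono) (auto simp: t_def)
        also have "\<dots> = r / 4 * (norm v / (norm v + 1))" by simp
        also have "\<dots> \<le> r / 4 * 1" using r by (intro mult_left_mono) (auto simp: divide_simps add_nonneg_pos)
        finally show "t * norm v \<le> r / 4" by simp
        have "t * (C * (norm v)\<^sup>2) \<le> e / (8 * (C * (norm v)\<^sup>2 + 1)) * (C * (norm v)\<^sup>2)"
          by (rule mult_right_mono) (use C0 in \<open>auto simp: t_def\<close>)
        also have "\<dots> \<le> e / 8" using e \<open>0 \<le> C * (norm v)\<^sup>2\<close>
          by (simp add: divide_simps)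
        finally show "t * (C * (norm v)\<^sup>2) \<le> e / 8" .
      qed
      let ?u = "of_real t *s v"
      have nu: "norm ?u = t * norm v" using t by (simp add: norm_vector_scale_complex)
      have "?u + x \<in> ball x r"
        using t r by (simp add: dist_norm nu)
      then have "x + ?u \<in> S" using r by (auto simp: add.commute)
      then have "Cauchy (\<lambda>k. F k (x + ?u))" "Cauchy (\<lambda>k. F k x)"
        using lim x by (auto intro!: LIMSEQ_imp_Cauchy)
      moreover have "t * e / 8 > 0" using t e by simp
      ultimately obtain N1 N2 where N: "\<And>k l. k \<ge> N1 ==> l \<ge> N1 ==> dist (F k (x + ?u)) (F l (x + ?u)) < t * e / 8"
          "\<And>k l. k \<ge> N2 ==> l \<ge> N2 ==> dist (F k x) (F l x) < t * e / 8"
        by (meson metric_CauchyD)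
      show "\<exists>N. \<forall>k\<ge>N. \<forall>l\<ge>N. dist (Cn_derivative (F k) x v) (Cn_derivative (F l) x v) < e"
      proof (intro exI[of _ "max N1 N2"] allI impI)
        fix k l assume kl: "max N1 N2 \<le> k" "max N1 N2 \<le> l"
        have R: "norm (F m (x + ?u) - F m x - Cn_derivative (F m) x ?u) \<le> t * e / 8" for m
        proof -
          have "norm (F m (x + ?u) - F m x - Cn_derivative (F m) x ?u) \<le> C * (t * norm v)\<^sup>2"
            using rem[of ?u m] t by (simp add: nu)
          also have "\<dots> = t * (t * (C * (norm v)\<^sup>2))" by (simp add: power2_eq_square)
          also have "\<dots> \<le> t * (e / 8)" using t by (intro mult_left_mono) auto
          finally show ?thesis by simp
        qed
        let ?R = "\<lambda>m. F m (x + ?u) - F m x - Cn_derivative (F m) x ?u"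
        have eq: "Cn_derivative (F k) x ?u - Cn_derivative (F l) x ?u =
            ((F k (x + ?u) - F l (x + ?u)) - (F k x - F l x)) - (?R k - ?R l)" by simp
        have "norm (Cn_derivative (F k) x ?u - Cn_derivative (F l) x ?u)
            \<le> norm ((F k (x + ?u) - F l (x + ?u)) - (F k x - F l x)) + norm (?R k - ?R l)"
          unfolding eq by (rule norm_triangle_ineq4)
        also have "\<dots> \<le> (norm (F k (x + ?u) - F l (x + ?u)) + norm (F k x - F l x)) + (norm (?R k) + norm (?R l))"
          by (intro add_mono norm_triangle_ineq4)
        also have "\<dots> \<le> (t * e / 8 + t * e / 8) + (t * e / 8 + t * e / 8)"
          using R[of k] R[of l] N(1)[of k l] N(2)[of k l] kl
          by (intro add_mono) (auto simp: dist_norm)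
        also have "\<dots> < t * e" using \<open>t * e / 8 > 0\<close> by linarith
        finally have "norm (Cn_derivative (F k) x ?u - Cn_derivative (F l) x ?u) < t * e" .
        then have "t * norm (Cn_derivative (F k) x v - Cn_derivative (F l) x v) < t * e"
          using t by (simp add: Cn_derivative_scale norm_mult right_diff_distrib[symmetric])
        then show "dist (Cn_derivative (F k) x v) (Cn_derivative (F l) x v) < e"
          using t by (simp add: dist_norm)
      qed
    qed
    then have "\<forall>v. \<exists>l. (\<lambda>k. Cn_derivative (F k) x v) \<longlonglongrightarrow> l"
      by (simp add: Cauchy_convergent_iff convergent_def)
    then obtain L where L: "\<And>v. (\<lambda>k. Cn_derivative (F k) x v) \<longlonglongrightarrow> L v"
      by metis
    have Lsc: "L (a *s v) = a * L v" for a v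
    proof (rule LIMSEQ_unique[OF L])
      show "(\<lambda>k. Cn_derivative (F k) x (a *s v)) \<longlonglongrightarrow> a * L v"
        unfolding Cn_derivative_scale by (intro tendsto_mult_left L)
    qed
    have Ladd: "L (u + v) = L u + L v" for u v
    proof (rule LIMSEQ_unique[OF L])
      show "(\<lambda>k. Cn_derivative (F k) x (u + v)) \<longlonglongrightarrow> L u + L v"
        unfolding Cn_derivative_add by (intro tendsto_add L)
    qed
    have "linear L"
      by (rule linearI) (auto simp: Ladd scale_eq_scaleR[symmetric] Lsc scaleR_conv_of_real)
    then have bL: "bounded_linear L" by (rule linear_conv_bounded_linear[THEN iffD1])
    have remf: "norm (f (x + u) - f x - L u) \<le> C * (norm u)\<^sup>2" if u: "norm u \<le> r / 4" for u
    proof (rule LIMSEQ_le_const2)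
      have "x + u \<in> S" using u r by (auto simp: dist_norm intro!: subsetD[OF r(2)])
      then show "(\<lambda>k. norm (F k (x + u) - F k x - Cn_derivative (F k) x u)) \<longlonglongrightarrow> norm (f (x + u) - f x - L u)"
        by (intro tendsto_intros lim L x)
    qed (use rem[OF u] in auto)
    have "(f has_derivative L) (at x)"
      unfolding has_derivative_at
    proof (intro conjI bL)
      show "(\<lambda>h. norm (f (x + h) - f x - L h) / norm h) \<midarrow>0\<rightarrow> 0"
      proof (rule Lim_null_comparison)
        show "\<forall>\<^sub>F h in at 0. norm (norm (f (x + h) - f x - L h) / norm h) \<le> C * norm h"
          unfolding eventually_at
        proof (intro exI[of _ "r / 4"] conjI ballI impI)
          fix h :: "complex ^ 'm" assume h: "h \<noteq> 0 \<and> dist h 0 < r / 4"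
          then have "norm (f (x + h) - f x - L h) \<le> C * (norm h)\<^sup>2" by (intro remf) auto
          then show "norm (norm (f (x + h) - f x - L h) / norm h) \<le> C * norm h"
            using h by (simp add: divide_simps power2_eq_square mult_ac)
        qed (use r in auto)
        show "(\<lambda>h. C * norm h) \<midarrow>0\<rightarrow> 0"
          by (rule tendsto_eq_intros refl | simp)+
      qed
    qed
    then show ?thesis using Lsc L by blast
  qed
  then obtain L where L: "\<And>x. x \<in> S ==> (f has_derivative L x) (at x)"
     "\<And>x a v. x \<in> S ==> L x (a *s v) = a * L x v"
     "\<And>x v. x \<in> S ==> (\<lambda>k. Cn_derivative (F k) x v) \<longlonglongrightarrow> L x v"
    by metis
  show "holomorphic_Cn_on f S" using holomorphic_CnI[OF L(1,2)] .
  show "(\<lambda>k. wirtinger i (F k) x) \<longlonglongrightarrow> wirtinger i f x" if "x \<in> S" for x i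
    using L(3)[OF that, of "axis i 1"] wirtinger_eqI[OF L(1)[OF that] L(2)[OF that]] 
    by (simp add: Cn_derivative_axis)
qed

lemma holomorphic_Cn_locally_bounded:
  fixes f :: "complex ^ 'm \<Rightarrow> complex"
  assumes "holomorphic_Cn_on f S" "open S" "x \<in> S"
  obtains r M where "r > 0" "ball x r \<subseteq> S" "\<And>y. y \<in> ball x r ==> norm (f y) \<le> M"
proof -
  obtain r where r: "r > 0" "cball x r \<subseteq> S"
    using assms open_contains_cball by blast
  have "compact (f ` cball x r)"
    using r by (intro compact_continuous_image continuous_on_subset[OF holomorphic_Cn_continuous[OF assms(1)]]) auto
  then obtain M where "\<And>y. y \<in> cball x r ==> norm (f y) \<le> M"
    by (metis compact_imp_bounded bounded_iff imageI)
  then show thesis using r by (intro that[of r M]) (auto simp: subset_iff)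
qed

text \<open>
  Partial derivatives are limits of difference quotients. The mean value inequality bounds the
  quotients, so the lemma above applies to them.
\<close>

lemma difference_quotient_limit:
  fixes f :: "complex ^ 'm \<Rightarrow> complex"
  assumes f: "holomorphic_Cn_on f S" and S: "open S" and x: "x \<in> S"
  shows "\<exists>r>0. \<exists>F :: nat \<Rightarrow> complex ^ 'm \<Rightarrow> complex. ball x r \<subseteq> S \<and> (\<forall>k. holomorphic_Cn_on (F k) (ball x r)) \<and>
    (\<forall>y\<in>ball x r. \<exists>s>0. \<exists>M. ball y s \<subseteq> ball x r \<and> (\<forall>k. \<forall>w\<in>ball y s. norm (F k w) \<le> M)) \<and>
    (\<forall>y\<in>ball x r. (\<lambda>k. F k y) \<longlonglongrightarrow> wirtinger j f y) \<and>
    (\<forall>y\<in>ball x r. \<forall>i. \<forall>\<^sub>F k in sequentially. wirtinger i (F k) y =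
        of_nat k * (wirtinger i f (y + of_real (1 / of_nat k) *s axis j 1) - wirtinger i f y))"
proof -
  obtain R M where R: "R > 0" "ball x R \<subseteq> S" "\<And>y. y \<in> ball x R ==> norm (f y) \<le> M"
    using holomorphic_Cn_locally_bounded[OF f S x] by blast
  have M0: "0 \<le> M" using R(3)[of x] R(1) by (smt (verit) centre_in_ball norm_ge_zero)
  define r where "r = R / 4"
  have r: "r > 0" "ball x r \<subseteq> S" using R by (auto simp: r_def)
  obtain K :: nat where K: "1 / r < of_nat K" "K > 0"
    by (metis reals_Archimedean2 gr0I r(1) of_nat_0 divide_pos_pos less_asym zero_less_one)
  define h :: "nat \<Rightarrow> real" where "h k = 1 / of_nat (k + K)" for k
  have h: "0 < h k" "h k < r" for k
  proof -
    show "0 < h k" using K by (simp add: h_def)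
    have "1 / r < of_nat (k + K)" using K by linarith
    then show "h k < r" using r K by (simp add: h_def field_simps)
  qed
  define a where "a k = (of_real (1 / of_nat k) :: complex) *s axis j 1" for k :: nat
  have na: "norm (a k) = 1 / of_nat k" for k
    by (simp add: a_def norm_vector_scale_complex norm_divide)
  have a: "y + a k \<in> ball x (R / 2)" if "y \<in> ball x r" "k \<ge> K" for k y
  proof -
    have "1 / of_nat k < r" using h(2)[of "k - K"] that by (simp add: h_def)
    moreover have "dist x (y + a k) \<le> dist x y + norm (a k)"
      unfolding dist_norm by norm
    ultimately show ?thesis using that by (simp add: na r_def)
  qed
  define F where "F k y = (if k < K then 0 else of_nat k * (f (y + a k) - f y))" for k y
  have Fk: "F k = (\<lambda>y. of_nat k * (f (y + a k) - f y))" if "k \<ge> K" for k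
    using that by (auto simp: F_def fun_eq_iff)
  have fb: "holomorphic_Cn_on f (ball x R)" using holomorphic_Cn_subset[OF f R(2)] .
  have shift: "holomorphic_Cn_on (\<lambda>y. f (y + a k)) (ball x r)"
      "\<And>y i. y \<in> ball x r ==> wirtinger i (\<lambda>y. f (y + a k)) y = wirtinger i f (y + a k)" if "k \<ge> K" for k
  proof -
    have *: "((\<lambda>y. f (y + a k)) has_derivative Cn_derivative f (y + a k)) (at y)" if "y \<in> ball x r" for y
    proof -
      have "((\<lambda>y. y + a k) has_derivative (\<lambda>v. v)) (at y)" by (auto intro!: derivative_eq_intros)
      moreover have "y + a k \<in> ball x R" using a[OF that \<open>k \<ge> K\<close>] R by auto
      ultimately show ?thesis
        using diff_chain_at[of "\<lambda>y. y + a k" _ y, OF _ holomorphic_Cn_derivative[OF fb]] by (auto simp: o_def)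
    qed
    show "holomorphic_Cn_on (\<lambda>y. f (y + a k)) (ball x r)"
      by (rule holomorphic_CnI[OF *]) (auto simp: Cn_derivative_scale)
    show "wirtinger i (\<lambda>y. f (y + a k)) y = wirtinger i f (y + a k)" if "y \<in> ball x r" for y i
      using wirtinger_eqI[OF *[OF that]] by (simp add: Cn_derivative_scale Cn_derivative_axis)
  qed
  have fbr: "holomorphic_Cn_on f (ball x r)" using holomorphic_Cn_subset[OF f r(2)] .
  have Fhol: "holomorphic_Cn_on (F k) (ball x r)" for k
  proof (cases "k < K")
    case True
    then have "F k = (\<lambda>_. 0)" by (auto simp: F_def)
    then show ?thesis by simp
  next
    case False
    then show ?thesis
      using Fk[of k] holomorphic_Cn_cmult(1)[OF holomorphic_Cn_diff(1)[OF shift(1) fbr open_ball] open_ball] by simp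
  qed
  have Fder: "wirtinger i (F k) y = of_nat k * (wirtinger i f (y + a k) - wirtinger i f y)"
    if "y \<in> ball x r" "k \<ge> K" for i k y
    unfolding Fk[OF that(2)] using holomorphic_Cn_cmult(2)[OF holomorphic_Cn_diff(1)[OF shift(1) fbr open_ball] open_ball, OF that(2,1)]
       holomorphic_Cn_diff(2)[OF shift(1) fbr open_ball, OF that(2,1)] shift(2)[OF that(2,1)] by simp
  have Fbd: "norm (F k y) \<le> 4 * M / R" if y: "y \<in> ball x r" for k y
  proof (cases "k < K")
    case True
    then show ?thesis using M0 R by (simp add: F_def)
  next
    case False
    have "norm (f (y + a k) - f y) \<le> 4 * M / R * norm (y + a k - y)"
    proof (rule differentiable_bound[of "ball x (R / 2)" f "Cn_derivative f"])
      fix w assume w: "w \<in> ball x (R / 2)"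
      have sub: "ball w (R / 2) \<subseteq> ball x R"
      proof
        fix v assume "v \<in> ball w (R / 2)"
        then show "v \<in> ball x R" using w dist_triangle[of x v w] by simp
      qed
      have "w \<in> ball x R" using w R by simp
      then show "(f has_derivative Cn_derivative f w) (at w within ball x (R / 2))"
        by (rule has_derivative_at_withinI[OF holomorphic_Cn_derivative[OF fb open_ball]])
      have "norm (Cn_derivative f w v) \<le> 2 * M / (R / 2) * norm v" for v
      proof (rule holomorphic_Cn_first_order(2)[OF holomorphic_Cn_subset[OF fb sub]])
        show "norm (f y) \<le> M" if "y \<in> ball w (R / 2)" for y
          using R(3) sub that by blast
      qed (use R(1) in simp)
      then have "onorm (Cn_derivative f w) \<le> 2 * M / (R / 2)"
        by (rule onorm_le)
      then show "onorm (Cn_derivative f w) \<le> 4 * M / R"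
        by simp
    qed (use a[OF y] False y R in \<open>auto simp: r_def\<close>)
    then have "of_nat k * norm (f (y + a k) - f y) \<le> of_nat k * (4 * M / R * (1 / of_nat k))"
      by (intro mult_left_mono) (auto simp: na)
    then show ?thesis using False K by (simp add: F_def norm_mult)
  qed
  have "ball x r \<subseteq> S \<and> (\<forall>k. holomorphic_Cn_on (F k) (ball x r)) \<and>
    (\<forall>y\<in>ball x r. \<exists>s>0. \<exists>M. ball y s \<subseteq> ball x r \<and> (\<forall>k. \<forall>w\<in>ball y s. norm (F k w) \<le> M)) \<and>
    (\<forall>y\<in>ball x r. (\<lambda>k. F k y) \<longlonglongrightarrow> wirtinger j f y) \<and>
    (\<forall>y\<in>ball x r. \<forall>i. \<forall>\<^sub>F k in sequentially. wirtinger i (F k) y =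
        of_nat k * (wirtinger i f (y + of_real (1 / of_nat k) *s axis j 1) - wirtinger i f y))"
  proof (intro conjI ballI allI)
    show "\<exists>s>0. \<exists>M. ball y s \<subseteq> ball x r \<and> (\<forall>k. \<forall>w\<in>ball y s. norm (F k w) \<le> M)" if "y \<in> ball x r" for y
      using open_contains_ball_eq[OF open_ball, of y x r] that Fbd by blast
    show "(\<lambda>k. F k y) \<longlonglongrightarrow> wirtinger j f y" if y: "y \<in> ball x r" for y
    proof -
      have "((\<lambda>\<zeta>. f (y + \<zeta> *s axis j 1)) has_field_derivative wirtinger j f y) (at 0)"
        using holomorphic_along_line[OF f S, of y 0 "axis j 1"] y r by (auto simp: Cn_derivative_axis)
      then have "(\<lambda>h. (f (y + h *s axis j 1) - f y) / h) \<midarrow>0\<rightarrow> wirtinger j f y"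
        by (simp add: DERIV_def)
      moreover have "filterlim (\<lambda>k. complex_of_real (1 / real k)) (at 0) sequentially"
        unfolding filterlim_at
      proof
        show "(\<lambda>k. complex_of_real (1 / real k)) \<longlonglongrightarrow> 0"
          using lim_1_over_n[where 'a = complex] by simp
        show "\<forall>\<^sub>F k in sequentially. complex_of_real (1 / real k) \<in> UNIV \<and> complex_of_real (1 / real k) \<noteq> 0"
          using eventually_gt_at_top[of 0] by eventually_elim auto
      qed
      ultimately have "(\<lambda>k. (f (y + complex_of_real (1 / real k) *s axis j 1) - f y) / complex_of_real (1 / real k)) \<longlonglongrightarrow> wirtinger j f y"
        by (rule filterlim_compose)
      then show ?thesis
        by (rule Lim_transform_eventually)
           (use eventually_ge_at_top[of K] in \<open>eventually_elim, auto simp: F_def a_def\<close>)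
    qed
    show "\<forall>\<^sub>F k in sequentially. wirtinger i (F k) y =
        of_nat k * (wirtinger i f (y + of_real (1 / of_nat k) *s axis j 1) - wirtinger i f y)" if y: "y \<in> ball x r" for y i
      using eventually_ge_at_top[of K] by eventually_elim (use Fder[OF y] in \<open>simp add: a_def\<close>)
  qed (use r Fhol in auto)
  then show ?thesis using r(1) by blast
qed

lemma holomorphic_Cn_local:
  assumes "\<And>x. x \<in> S ==> \<exists>r>0. holomorphic_Cn_on f (ball x r)"
  shows "holomorphic_Cn_on f S"
proof (rule holomorphic_CnI)
  fix z assume "z \<in> S"
  then obtain r where "r > 0" "holomorphic_Cn_on f (ball z r)" using assms by blast
  then show "(f has_derivative Cn_derivative f z) (at z)"
    using holomorphic_Cn_derivative by (metis centre_in_ball open_ball)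
qed (auto simp: Cn_derivative_scale)

lemma holomorphic_Cn_wirtinger:
  fixes f :: "complex ^ 'm \<Rightarrow> complex"
  assumes f: "holomorphic_Cn_on f S" and S: "open S"
  shows "holomorphic_Cn_on (wirtinger j f) S"
proof (rule holomorphic_Cn_local)
  fix x assume "x \<in> S"
  then have x: "x \<in> S" .
  obtain r and F :: "nat \<Rightarrow> complex ^ 'm \<Rightarrow> complex" where r: "r > 0"
    and rF: "(\<forall>k. holomorphic_Cn_on (F k) (ball x r)) \<and>
    (\<forall>y\<in>ball x r. \<exists>s>0. \<exists>M. ball y s \<subseteq> ball x r \<and> (\<forall>k. \<forall>w\<in>ball y s. norm (F k w) \<le> M)) \<and>
    (\<forall>y\<in>ball x r. (\<lambda>k. F k y) \<longlonglongrightarrow> wirtinger j f y)"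
    using difference_quotient_limit[OF f S x, of j] by (elim exE conjE) (rule that, auto)
  have "holomorphic_Cn_on (wirtinger j f) (ball x r)"
    by (rule bounded_pointwise_limit(1)[where F = F]) (use rF in auto)
  then show "\<exists>r>0. holomorphic_Cn_on (wirtinger j f) (ball x r)"
    using r by blast
qed

lemma wirtinger_commute:
  fixes f :: "complex ^ 'm \<Rightarrow> complex"
  assumes f: "holomorphic_Cn_on f S" and S: "open S" and x: "x \<in> S"
  shows "wirtinger i (wirtinger j f) x = wirtinger j (wirtinger i f) x"
proof -
  obtain r and F :: "nat \<Rightarrow> complex ^ 'm \<Rightarrow> complex" where r: "r > 0"
    and rF: "(\<forall>k. holomorphic_Cn_on (F k) (ball x r)) \<and>
    (\<forall>y\<in>ball x r. \<exists>s>0. \<exists>M. ball y s \<subseteq> ball x r \<and> (\<forall>k. \<forall>w\<in>ball y s. norm (F k w) \<le> M)) \<and>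
    (\<forall>y\<in>ball x r. (\<lambda>k. F k y) \<longlonglongrightarrow> wirtinger j f y)"
    and ev: "\<forall>y\<in>ball x r. \<forall>i. \<forall>\<^sub>F k in sequentially. wirtinger i (F k) y =
        of_nat k * (wirtinger i f (y + of_real (1 / of_nat k) *s axis j 1) - wirtinger i f y)"
    using difference_quotient_limit[OF f S x, of j] by (elim exE conjE) (rule that, auto)
  have xb: "x \<in> ball x r" using r by simp
  have 1: "(\<lambda>k. wirtinger i (F k) x) \<longlonglongrightarrow> wirtinger i (wirtinger j f) x"
    by (rule bounded_pointwise_limit(2)[where F = F and S = "ball x r"]) (use rF xb in auto)
  have "((\<lambda>\<zeta>. wirtinger i f (x + \<zeta> *s axis j 1)) has_field_derivative wirtinger j (wirtinger i f) x) (at 0)"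
    using holomorphic_along_line[OF holomorphic_Cn_wirtinger[OF f S] S, of x 0 "axis j 1"] x by (auto simp: Cn_derivative_axis)
  then have "(\<lambda>h. (wirtinger i f (x + h *s axis j 1) - wirtinger i f x) / h) \<midarrow>0\<rightarrow> wirtinger j (wirtinger i f) x"
    by (simp add: DERIV_def)
  moreover have "filterlim (\<lambda>k. complex_of_real (1 / real k)) (at 0) sequentially"
    unfolding filterlim_at
  proof
    show "(\<lambda>k. complex_of_real (1 / real k)) \<longlonglongrightarrow> 0"
      using lim_1_over_n[where 'a = complex] by simp
    show "\<forall>\<^sub>F k in sequentially. complex_of_real (1 / real k) \<in> UNIV \<and> complex_of_real (1 / real k) \<noteq> 0"
      using eventually_gt_at_top[of 0] by eventually_elim auto
  qed
  ultimately have "(\<lambda>k. (wirtinger i f (x + complex_of_real (1 / real k) *s axis j 1) - wirtinger i f x) / complex_of_real (1 / real k))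
      \<longlonglongrightarrow> wirtinger j (wirtinger i f) x"
    by (rule filterlim_compose)
  then have "(\<lambda>k. wirtinger i (F k) x) \<longlonglongrightarrow> wirtinger j (wirtinger i f) x"
    by (rule Lim_transform_eventually) (use ev[rule_format, OF xb, of i] in \<open>eventually_elim, simp\<close>)
  then show ?thesis using LIMSEQ_unique[OF 1] by simp
qed

text \<open>
  The line joining a point of \<open>T\<close> to \<open>x\<close> meets \<open>T\<close> in an open set, and the identity theorem in one
  variable applies along it.
\<close>

lemma holomorphic_Cn_identity:
  fixes f :: "complex ^ 'm \<Rightarrow> complex"
  assumes f: "holomorphic_Cn_on f S" and S: "open S" "convex S"
    and T: "open T" "T \<noteq> {}" "T \<subseteq> S" "\<And>z. z \<in> T ==> f z = 0" and x: "x \<in> S"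
  shows "f x = 0"
proof -
  obtain q where q: "q \<in> T" using T by blast
  let ?D = "{\<zeta>. q + \<zeta> *s (x - q) \<in> S}" and ?E = "{\<zeta>. q + \<zeta> *s (x - q) \<in> T}"
  have "f (q + 1 *s (x - q)) = 0"
  proof (rule analytic_continuation_open[where f = "\<lambda>\<zeta>. f (q + \<zeta> *s (x - q))" and s = ?E and s' = ?D and g = "\<lambda>_. 0"])
    show "?E \<noteq> {}" using q by (auto intro!: exI[of _ 0])
    show "connected ?D" by (intro convex_connected convex_line_vimage S)
    show "open ?D" "open ?E" using T S by (auto intro!: open_line_vimage simp del: vector_ssub_ldistrib)
    show "(\<lambda>\<zeta>. f (q + \<zeta> *s (x - q))) holomorphic_on ?D" by (rule holomorphic_on_line[OF f S(1)])
  qed (use T x in auto)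
  then show ?thesis by simp
qed

section \<open>Functions of a point and its conjugate\<close>

definition vec_cnj :: "complex ^ 'n \<Rightarrow> complex ^ 'n" where
  "vec_cnj z = (\<chi> i. cnj (z $ i))"

definition vec_join :: "complex ^ 'n \<Rightarrow> complex ^ 'n \<Rightarrow> complex ^ ('n + 'n)" where
  "vec_join z w = (\<chi> s. case s of Inl i \<Rightarrow> z $ i | Inr i \<Rightarrow> w $ i)"

lemma vec_cnj_nth [simp]: "vec_cnj z $ i = cnj (z $ i)"
  by (simp add: vec_cnj_def)

lemma vec_join_nth [simp]: "vec_join z w $ Inl i = z $ i" "vec_join z w $ Inr i = w $ i"
  by (simp_all add: vec_join_def)

lemma vec_join_eq_iff: "vec_join z w = x \<longleftrightarrow> (\<forall>i. x $ Inl i = z $ i) \<and> (\<forall>i. x $ Inr i = w $ i)"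
  by (auto simp: vec_eq_iff vec_join_def split: sum.splits)

lemma vec_cnj_cnj [simp]: "vec_cnj (vec_cnj z) = z"
  by (simp add: vec_eq_iff)

lemma norm_vec_cnj [simp]: "norm (vec_cnj z) = norm z"
  by (simp add: norm_vec_def L2_set_def)

lemma vec_cnj_diff: "vec_cnj z - vec_cnj w = vec_cnj (z - w)"
  by (simp add: vec_eq_iff)

lemma vec_cnj_in_ball [simp]: "vec_cnj z \<in> ball (vec_cnj p) r \<longleftrightarrow> z \<in> ball p r"
  by (simp add: dist_norm vec_cnj_diff)

lemma bounded_linear_vec_join1: "bounded_linear (\<lambda>v :: complex ^ 'n. vec_join v 0)"
  unfolding linear_conv_bounded_linear[symmetric]
  by (rule linearI; subst vec_join_eq_iff; simp)

lemma bounded_linear_vec_join2: "bounded_linear (\<lambda>v :: complex ^ 'n. vec_join 0 v)"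
  unfolding linear_conv_bounded_linear[symmetric]
  by (rule linearI; subst vec_join_eq_iff; simp)

lemma bounded_linear_vec_join_cnj: "bounded_linear (\<lambda>v :: complex ^ 'n. vec_join v (vec_cnj v))"
  unfolding linear_conv_bounded_linear[symmetric]
  by (rule linearI; subst vec_join_eq_iff; simp)

lemma vec_join_add: "vec_join (a + b) (c + d) = vec_join a c + vec_join b d"
  by (subst vec_join_eq_iff) simp

lemma vec_join_scale: "vec_join (k *s a) (k *s c) = k *s vec_join a c"
  by (subst vec_join_eq_iff) simp

lemma Cn_derivative_vec_join:
  "Cn_derivative f x (vec_join a b) = (\<Sum>i\<in>UNIV. a $ i * wirtinger (Inl i) f x) + (\<Sum>i\<in>UNIV. b $ i * wirtinger (Inr i) f x)"
  unfolding Cn_derivative_def UNIV_Plus_UNIV[symmetric] by (subst sum.Plus) (auto simp: comp_def)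

definition bidisc :: "complex ^ 'n \<Rightarrow> real \<Rightarrow> (complex ^ ('n + 'n)) set" where
  "bidisc p r = {x. (\<chi> i. x $ Inl i) \<in> ball p r \<and> (\<chi> i. x $ Inr i) \<in> ball (vec_cnj p) r}"

lemma vec_join_in_bidisc [simp]:
  "vec_join z w \<in> bidisc p r \<longleftrightarrow> z \<in> ball p r \<and> w \<in> ball (vec_cnj p) r"
  by (simp add: bidisc_def)

lemma bidisc_cases:
  assumes "x \<in> bidisc p r"
  obtains z w where "x = vec_join z w" "z \<in> ball p r" "w \<in> ball (vec_cnj p) r"
  using assms unfolding bidisc_def by (intro that[of "\<chi> i. x $ Inl i" "\<chi> i. x $ Inr i"]) (auto simp: vec_eq_iff vec_join_def split: sum.splits)

lemma bidisc_mono: "r \<le> s ==> bidisc p r \<subseteq> bidisc p s"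
  by (auto simp: bidisc_def)

lemma open_bidisc: "open (bidisc p r)"
proof -
  have 1: "continuous_on UNIV (\<lambda>x :: complex ^ ('n + 'n). (\<chi> i. x $ Inl i) :: complex ^ 'n)"
    and 2: "continuous_on UNIV (\<lambda>x :: complex ^ ('n + 'n). (\<chi> i. x $ Inr i) :: complex ^ 'n)"
    by (auto intro!: continuous_intros)
  have "bidisc p r = (\<lambda>x. \<chi> i. x $ Inl i) -` ball p r \<inter> (\<lambda>x. \<chi> i. x $ Inr i) -` ball (vec_cnj p) r"
    by (auto simp: bidisc_def)
  then show ?thesis
    using open_Int[OF open_vimage[OF open_ball 1] open_vimage[OF open_ball 2]] by (simp only:)
qed

lemma wirtinger_join_left:
  assumes "holomorphic_Cn_on f S" "open S" "vec_join z w \<in> S"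
  shows "((\<lambda>z. f (vec_join z w)) has_derivative (\<lambda>v. Cn_derivative f (vec_join z w) (vec_join v 0))) (at z)"
    and "wirtinger i (\<lambda>z. f (vec_join z w)) z = wirtinger (Inl i) f (vec_join z w)"
proof -
  have *: "vec_join z w = vec_join 0 w + vec_join z 0" for z by (simp add: vec_join_add[symmetric])
  have "((\<lambda>z. vec_join 0 w + vec_join z 0) has_derivative (\<lambda>v. vec_join v 0)) (at z)"
    using bounded_linear_imp_has_derivative[OF bounded_linear_vec_join1] by (auto intro!: derivative_eq_intros)
  then have "((\<lambda>z. vec_join z w) has_derivative (\<lambda>v. vec_join v 0)) (at z)" by (simp add: *[symmetric])
  from diff_chain_at[OF this holomorphic_Cn_derivative[OF assms]]
  show 1: "((\<lambda>z. f (vec_join z w)) has_derivative (\<lambda>v. Cn_derivative f (vec_join z w) (vec_join v 0))) (at z)"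
    by (simp add: o_def)
  have sc: "vec_join (a *s v) (0 :: complex ^ 'a) = a *s vec_join v 0" for a v
    using vec_join_scale[of a v 0] by simp
  show "wirtinger i (\<lambda>z. f (vec_join z w)) z = wirtinger (Inl i) f (vec_join z w)"
    using wirtinger_eqI[OF 1, of i]
    by (simp add: sc Cn_derivative_scale) (simp add: Cn_derivative_vec_join axis_def if_distrib[of "\<lambda>x. x * _"] cong: if_cong)
qed

lemma wirtinger_join_right:
  assumes "holomorphic_Cn_on f S" "open S" "vec_join z w \<in> S"
  shows "((\<lambda>w. f (vec_join z w)) has_derivative (\<lambda>v. Cn_derivative f (vec_join z w) (vec_join 0 v))) (at w)"
    and "wirtinger i (\<lambda>w. f (vec_join z w)) w = wirtinger (Inr i) f (vec_join z w)"
proof -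
  have *: "vec_join z w = vec_join z 0 + vec_join 0 w" for w by (simp add: vec_join_add[symmetric])
  have "((\<lambda>w. vec_join z 0 + vec_join 0 w) has_derivative (\<lambda>v. vec_join 0 v)) (at w)"
    using bounded_linear_imp_has_derivative[OF bounded_linear_vec_join2] by (auto intro!: derivative_eq_intros)
  then have "((\<lambda>w. vec_join z w) has_derivative (\<lambda>v. vec_join 0 v)) (at w)" by (simp add: *[symmetric])
  from diff_chain_at[OF this holomorphic_Cn_derivative[OF assms]]
  show 1: "((\<lambda>w. f (vec_join z w)) has_derivative (\<lambda>v. Cn_derivative f (vec_join z w) (vec_join 0 v))) (at w)"
    by (simp add: o_def)
  have sc: "vec_join (0 :: complex ^ 'a) (a *s v) = a *s vec_join 0 v" for a v
    using vec_join_scale[of a 0 v] by simp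
  show "wirtinger i (\<lambda>w. f (vec_join z w)) w = wirtinger (Inr i) f (vec_join z w)"
    using wirtinger_eqI[OF 1, of i]
    by (simp add: sc Cn_derivative_scale) (simp add: Cn_derivative_vec_join axis_def if_distrib[of "\<lambda>x. x * _"] cong: if_cong)
qed

text \<open>
  On the totally real set of pairs of conjugate points, the two Wirtinger derivatives are the
  partial derivatives with respect to the two groups of variables.
\<close>

lemma wirtinger_join_cnj:
  assumes "holomorphic_Cn_on f S" "open S" "vec_join z (vec_cnj z) \<in> S"
  shows "wirtinger i (\<lambda>z. f (vec_join z (vec_cnj z))) z = wirtinger (Inl i) f (vec_join z (vec_cnj z))"
    and "wirtinger_bar i (\<lambda>z. f (vec_join z (vec_cnj z))) z = wirtinger (Inr i) f (vec_join z (vec_cnj z))"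
proof -
  have "((\<lambda>z. vec_join z (vec_cnj z)) has_derivative (\<lambda>v. vec_join v (vec_cnj v))) (at z)"
    using bounded_linear_imp_has_derivative[OF bounded_linear_vec_join_cnj] by auto
  from diff_chain_at[OF this holomorphic_Cn_derivative[OF assms]]
  have "((\<lambda>z. f (vec_join z (vec_cnj z))) has_derivative
      (\<lambda>v. Cn_derivative f (vec_join z (vec_cnj z)) (vec_join v (vec_cnj v)))) (at z)"
    by (simp add: o_def)
  note fd = frechet_derivative_at[OF this]
  have *: "frechet_derivative (\<lambda>z. f (vec_join z (vec_cnj z))) (at z) (axis i a) =
      a * wirtinger (Inl i) f (vec_join z (vec_cnj z)) + cnj a * wirtinger (Inr i) f (vec_join z (vec_cnj z))" for a
    unfolding fd[symmetric] by (simp add: Cn_derivative_vec_join axis_def if_distrib[of "\<lambda>x. x * _"] if_distrib[of cnj] cong: if_cong)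
  show "wirtinger i (\<lambda>z. f (vec_join z (vec_cnj z))) z = wirtinger (Inl i) f (vec_join z (vec_cnj z))"
    and "wirtinger_bar i (\<lambda>z. f (vec_join z (vec_cnj z))) z = wirtinger (Inr i) f (vec_join z (vec_cnj z))"
    by (simp_all add: wirtinger_def[of _ "\<lambda>z. f (vec_join z (vec_cnj z))"]
      wirtinger_bar_def[of _ "\<lambda>z. f (vec_join z (vec_cnj z))"] * algebra_simps)
qed

text \<open>
  Polarization: the complex line through \<open>(a, cnj a)\<close> in direction \<open>(b, cnj b)\<close> meets the
  conjugate pairs in its real points, while its point with parameter \<open>\<i>\<close> is an arbitrary pair for
  suitable \<open>a\<close> and \<open>b\<close>.
\<close>

lemma polarization:
  fixes f :: "complex ^ ('n::finite + 'n) \<Rightarrow> complex"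
  assumes f: "holomorphic_Cn_on f (bidisc p r)"
    and zero: "\<And>z. z \<in> ball p r ==> f (vec_join z (vec_cnj z)) = 0"
    and zw: "z \<in> ball p (r / 4)" "w \<in> ball (vec_cnj p) (r / 4)"
  shows "f (vec_join z w) = 0"
proof -
  define v where "v = vec_cnj w"
  have v2: "w = vec_cnj v" by (simp add: v_def)
  have v: "v \<in> ball p (r / 4)" "w = vec_cnj v"
    using zw(2) unfolding v2 vec_cnj_in_ball by simp_all
  define a where "a = (1 / 2) *s (z + v)"
  define b where "b = (1 / (2 * \<i>)) *s (z - v)"
  let ?L = "\<lambda>\<zeta>. vec_join a (vec_cnj a) + \<zeta> *s vec_join b (vec_cnj b)"
  have r: "r > 0" using zw(1) zero_le_dist[of p z] unfolding mem_ball by linarith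
  have na: "norm (p - a) < r / 4"
  proof -
    have "p - a = (1 / 2) *s ((p - z) + (p - v))" by (simp add: a_def vec_eq_iff field_simps)
    then have "norm (p - a) = norm ((1 / 2 :: complex) *s ((p - z) + (p - v)))" by (simp only:)
    then have "norm (p - a) = 1 / 2 * norm ((p - z) + (p - v))" by (simp only: norm_vector_scale_complex) simp
    also have "norm ((p - z) + (p - v)) \<le> norm (p - z) + norm (p - v)" by (rule norm_triangle_ineq)
    finally show ?thesis using zw(1) v(1) by (simp add: dist_norm)
  qed
  have nb: "norm b < r / 4"
  proof -
    have "norm b = norm (1 / (2 * \<i>)) * norm (z - v)" by (simp only: b_def norm_vector_scale_complex)
    then have "norm b = 1 / 2 * norm (z - v)" by (simp add: norm_divide)
    also have "norm (z - v) \<le> norm (p - v) + norm (p - z)" by norm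
    finally show ?thesis using zw(1) v(1) by (simp add: dist_norm)
  qed
  have L: "?L \<zeta> \<in> bidisc p r" if "\<zeta> \<in> ball 0 2" for \<zeta>
  proof -
    have eq: "?L \<zeta> = vec_join (a + \<zeta> *s b) (vec_cnj (a + cnj \<zeta> *s b))"
      by (simp add: vec_eq_iff vec_join_def split: sum.split)
    have "a + \<zeta>' *s b \<in> ball p r" if "norm \<zeta>' < 2" for \<zeta>'
    proof -
      have "norm (\<zeta>' *s b) \<le> 2 * norm b"
        using that by (simp add: norm_vector_scale_complex mult_right_mono)
      then have "norm (p - (a + \<zeta>' *s b)) \<le> norm (p - a) + 2 * norm b" by norm
      then show ?thesis using na nb r by (simp add: dist_norm)
    qed
    then show ?thesis using that by (simp add: eq del: mem_ball)
  qed
  have "f (?L \<i>) = 0"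
  proof (rule analytic_continuation[where f = "\<lambda>\<zeta>. f (?L \<zeta>)" and S = "ball 0 2" and U = "of_real ` {-1<..<1}" and \<xi> = 0])
    show "(\<lambda>\<zeta>. f (?L \<zeta>)) holomorphic_on ball 0 2"
      by (rule holomorphic_on_subset[OF holomorphic_on_line[OF f open_bidisc]]) (use L in auto)
    show "f (?L \<zeta>) = 0" if \<zeta>: "\<zeta> \<in> complex_of_real ` {-1<..<1}" for \<zeta>
    proof -
      obtain t where "\<zeta> = of_real t" "- 1 < t" "t < 1" using \<zeta> by auto
      then have t: "\<zeta> = of_real t" "\<bar>t\<bar> < 1" by auto
      have eq: "?L \<zeta> = vec_join (a + of_real t *s b) (vec_cnj (a + of_real t *s b))"
        by (simp add: t vec_eq_iff vec_join_def split: sum.split)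
      have "?L \<zeta> \<in> bidisc p r" using t by (intro L) auto
      then have "a + of_real t *s b \<in> ball p r" unfolding eq by simp
      then show ?thesis unfolding eq by (rule zero)
    qed
    show "(0 :: complex) islimpt complex_of_real ` {-1<..<1}"
      unfolding islimpt_approachable
    proof (intro allI impI)
      fix e :: real assume "e > 0"
      then show "\<exists>x'\<in>complex_of_real ` {- 1<..<1}. x' \<noteq> 0 \<and> dist x' 0 < e"
        by (intro bexI[of _ "of_real (min (1 / 2) (e / 2))"]) (auto simp: min_def)
    qed
  qed auto
  moreover have "?L \<i> = vec_join z w"
    by (auto simp: vec_eq_iff vec_join_def v(2) a_def b_def field_simps split: sum.split)
  ultimately show ?thesis by simp
qed

section \<open>Volumes of holomorphic images\<close>

text \<open>
  The linear isomorphism of \<open>\<complex>\<^sup>n\<close> with \<open>\<real>\<^sup>2\<^sup>n\<close> transports the behaviour of volumes under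
  differentiable maps. The index type \<open>'n bit0\<close> has \<open>2 n\<close> elements and is well-ordered, as the
  change of variables formula requires.
\<close>

lemma euclidean_measure_isomorphism:
  assumes "DIM('a::euclidean_space) = DIM('b::euclidean_space)"
  obtains T :: "'a::euclidean_space \<Rightarrow> 'b::euclidean_space" and S :: "'b::euclidean_space \<Rightarrow> 'a::euclidean_space" where
    "linear T" "linear S" "\<And>x. S (T x) = x" "\<And>y. T (S y) = y" "distr lborel borel T = lborel"
proof -
  obtain \<beta> where \<beta>: "bij_betw \<beta> (Basis :: 'a set) (Basis :: 'b set)"
    using assms finite_same_card_bij[OF finite_Basis finite_Basis] by blast
  define \<gamma> where "\<gamma> = the_inv_into Basis \<beta>"
  have \<gamma>: "bij_betw \<gamma> (Basis :: 'b set) (Basis :: 'a set)" "\<And>b. b \<in> Basis ==> \<gamma> (\<beta> b) = b" "\<And>c. c \<in> Basis ==> \<beta> (\<gamma> c) = c"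
    using \<beta> bij_betw_the_inv_into[OF \<beta>]
    by (auto simp: \<gamma>_def the_inv_into_f_f f_the_inv_into_f bij_betw_def)
  have \<beta>B: "\<And>b. b \<in> Basis ==> \<beta> b \<in> Basis" "\<And>c. c \<in> Basis ==> \<gamma> c \<in> Basis"
    using \<beta> \<gamma>(1) by (auto simp: bij_betw_def)
  define T where "T x = (\<Sum>b\<in>Basis. (x \<bullet> b) *\<^sub>R \<beta> b)" for x :: 'a
  define S where "S y = (\<Sum>c\<in>Basis. (y \<bullet> c) *\<^sub>R \<gamma> c)" for y :: 'b
  have Tb: "T x \<bullet> c = x \<bullet> \<gamma> c" if "c \<in> Basis" for x c
  proof -
    have "T x \<bullet> c = (\<Sum>b\<in>Basis. (x \<bullet> b) * (\<beta> b \<bullet> c))" by (simp add: T_def inner_sum_left)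
    also have "\<dots> = (\<Sum>b\<in>Basis. if b = \<gamma> c then x \<bullet> b else 0)"
      using \<gamma> \<beta>B that by (intro sum.cong refl) (auto simp: inner_Basis)
    finally show ?thesis using \<beta>B that by simp
  qed
  have Sb: "S y \<bullet> b = y \<bullet> \<beta> b" if "b \<in> Basis" for y b
  proof -
    have "S y \<bullet> b = (\<Sum>c\<in>Basis. (y \<bullet> c) * (\<gamma> c \<bullet> b))" by (simp add: S_def inner_sum_left)
    also have "\<dots> = (\<Sum>c\<in>Basis. if c = \<beta> b then y \<bullet> c else 0)"
      using \<gamma> \<beta>B that by (intro sum.cong refl) (auto simp: inner_Basis)
    finally show ?thesis using \<beta>B that by simp
  qed
  have lin: "linear T" "linear S"
    by (auto intro!: linearI simp: T_def S_def inner_add_left scaleR_add_left sum.distrib scaleR_sum_right)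
  have ST: "S (T x) = x" for x
    by (rule euclidean_eqI) (simp add: Sb Tb \<beta>B \<gamma>)
  have TS: "T (S y) = y" for y
    by (rule euclidean_eqI) (simp add: Sb Tb \<beta>B \<gamma>)
  have Tm: "T \<in> borel_measurable borel"
    by (intro borel_measurable_continuous_onI linear_continuous_on linear_conv_bounded_linear[THEN iffD1] lin)
  have "lborel = distr lborel borel T"
  proof (rule lborel_eqI)
    fix l u :: 'b assume le: "\<And>b. b \<in> Basis ==> l \<bullet> b \<le> u \<bullet> b"
    have "T -` box l u = box (S l) (S u)"
      using \<gamma> \<beta>B by (auto simp: mem_box Tb Sb) (metis Tb Sb \<gamma> \<beta>B)+
    moreover have "(\<Prod>b\<in>Basis. (S u - S l) \<bullet> b) = (\<Prod>c\<in>Basis. (u - l) \<bullet> c)"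
      using prod.reindex_bij_betw[OF \<beta>, of "\<lambda>c. (u - l) \<bullet> c"] by (simp add: inner_diff_left Sb)
    moreover have "emeasure lborel (box (S l) (S u)) = (\<Prod>b\<in>Basis. (S u - S l) \<bullet> b)"
      using le \<beta>B by (intro emeasure_lborel_box) (simp add: Sb)
    ultimately show "emeasure (distr lborel borel T) (box l u) = (\<Prod>b\<in>Basis. (u - l) \<bullet> b)"
      using Tm by (subst emeasure_distr) auto
  qed simp
  then show thesis using that[OF lin ST TS] by simp
qed

definition column_replaced :: "'n \<Rightarrow> complex ^ 'n \<Rightarrow> complex ^ 'n ^ 'n" where
  "column_replaced k v = (\<chi> i j. if j = k then v $ i else if i = j then 1 else 0)"

lemma column_replaced_vector: "column_replaced k v *v w = w + w $ k *s (v - axis k 1)"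
proof -
  have "(column_replaced k v *v w) $ i = (w + w $ k *s (v - axis k 1)) $ i" for i
  proof -
    have "(column_replaced k v *v w) $ i = v $ i * w $ k + (\<Sum>j\<in>UNIV - {k}. (if i = j then 1 else 0) * w $ j)"
      by (simp add: matrix_vector_mult_def column_replaced_def sum.remove[of UNIV k])
    also have "(\<Sum>j\<in>UNIV - {k}. (if i = j then 1 else 0) * w $ j) = (if i = k then 0 else w $ i)"
      by (simp add: if_distrib[of "\<lambda>x. x * _"] sum.delta' cong: if_cong)
    finally show ?thesis by (auto simp: axis_def algebra_simps)
  qed
  then show ?thesis by (simp add: vec_eq_iff)
qed

lemma det_column_replaced:
  fixes v :: "complex ^ 'n::finite"
  shows "det (column_replaced k v) = v $ k"
proof -
  have "v $ k = det (\<chi> i j. if j = k then ((mat 1 :: complex ^ 'n ^ 'n) *v v) $ i else (mat 1 :: complex ^ 'n ^ 'n) $ i $ j)"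
    by (subst cramer_lemma) simp
  also have "(\<chi> i j. if j = k then ((mat 1 :: complex ^ 'n ^ 'n) *v v) $ i else (mat 1 :: complex ^ 'n ^ 'n) $ i $ j) = column_replaced k v"
    by (simp only: matrix_vector_mul_lid) (simp add: column_replaced_def vec_eq_iff mat_def)
  finally show ?thesis by simp
qed

text \<open>
  Complex matrices with a nonzero determinant are products of matrices that differ from the
  identity in one column: such factors turn the columns into unit vectors one after the other.
\<close>

lemma column_replaced_induct:
  fixes A :: "complex ^ 'n ^ 'n"
  assumes one: "P (mat 1)"
    and step: "\<And>A k v. v $ k \<noteq> 0 ==> P (column_replaced k v ** A) ==> P A"
    and A: "det A \<noteq> 0"
  shows "P A"
proof -
  have col: "column k (B :: complex ^ 'n ^ 'n) = B *v axis k 1" for B k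
    by (simp add: vec_eq_iff column_def matrix_vector_mult_def axis_def if_distrib cong: if_cong)
  have "P A" if "finite K" "\<And>j. j \<notin> K ==> column j A = axis j 1" "det A \<noteq> 0" for K A
    using that
  proof (induction K arbitrary: A rule: finite_induct)
    case empty
    then have "A = mat 1"
      by (simp add: vec_eq_iff column_def axis_def mat_def)
    then show ?case using one by simp
  next
    case (insert k K)
    have keep: "column j (column_replaced l v ** B) = axis j 1" if "j \<noteq> l" "column j B = axis j 1" for j l :: 'n and v and B :: "complex ^ 'n ^ 'n"
    proof -
      have "column j (column_replaced l v ** B) = column_replaced l v *v column j B"
        by (simp add: col matrix_vector_mul_assoc)
      also have "\<dots> = axis j 1"
        unfolding that(2) column_replaced_vector using that(1) by (simp add: axis_def vec_eq_iff)
      finally show ?thesis .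
    qed
    have main: "P B" if Bk: "B $ k $ k \<noteq> 0" and B: "\<And>j. j \<notin> insert k K ==> column j B = axis j 1" "det B \<noteq> 0" for B
    proof -
      define v where "v = axis k 1 - (1 / B $ k $ k) *s (column k B - axis k 1)"
      have vk: "v $ k = 1 / B $ k $ k"
        using Bk by (simp add: v_def column_def field_simps)
      have Bkk: "(B *v axis k 1) $ k = B $ k $ k" by (simp add: col[symmetric] column_def)
      have "column k (column_replaced k v ** B) = axis k 1"
        using Bk by (simp add: col matrix_vector_mul_assoc[symmetric] column_replaced_vector v_def vec_eq_iff Bkk field_simps)
      then have "column j (column_replaced k v ** B) = axis j 1" if "j \<notin> K" for j
        using keep[of j k B v] B(1) that by (cases "j = k") auto
      then have "P (column_replaced k v ** B)"
        by (rule insert.IH) (use Bk B vk in \<open>auto simp: det_mul det_column_replaced\<close>)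
      then show ?thesis by (rule step[rotated]) (use vk Bk in auto)
    qed
    show ?case
    proof (cases "A $ k $ k = 0")
      case False
      then show ?thesis using main insert.prems by blast
    next
      case True
      obtain l where l: "A $ l $ k \<noteq> 0" "l \<in> insert k K"
      proof (rule ccontr)
        assume "\<not> thesis"
        then have z: "\<And>l. l \<in> insert k K ==> A $ l $ k = 0" using that by blast
        define w where "w = axis k 1 - (\<Sum>j\<in>- insert k K. A $ j $ k *s axis j 1)"
        have "A *v w = 0"
        proof -
          have "A *v (\<Sum>j\<in>- insert k K. A $ j $ k *s axis j 1) = (\<Sum>j\<in>- insert k K. A $ j $ k *s axis j 1)"
            using insert.prems(1) by (simp add: linear_sum[OF matrix_vector_mul_linear] matrix_vector_mult_scaleR vector_scalar_commute col[symmetric])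
          also have "\<dots> = (\<Sum>j\<in>UNIV. column k A $ j *s axis j 1)"
            using z by (intro sum.mono_neutral_cong_left) (auto simp: column_def)
          also have "\<dots> = column k A" using axis_expansion by metis
          finally show ?thesis by (simp add: w_def matrix_vector_mult_diff_distrib col)
        qed
        moreover have "w \<noteq> 0"
        proof -
          have "w $ k = 1" by (simp add: w_def axis_def) (auto intro!: sum.neutral split: if_splits)
          then show ?thesis by auto
        qed
        ultimately show False
          using insert.prems(2) by (metis invertible_det_nz inj_matrix_vector_mult injD matrix_vector_mult_0_right)
      qed
      have lk: "l \<noteq> k" using l True by auto
      define B where "B = column_replaced l (axis l 1 + axis k 1) ** A"
      have rows: "B $ k $ j = A $ k $ j + A $ l $ j" for j
      proof -
        have "column j B $ k = A $ k $ j + A $ l $ j"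
          using lk by (simp add: B_def col matrix_vector_mul_assoc[symmetric] column_replaced_vector)
             (simp add: col[symmetric] column_def)
        then show ?thesis by (simp add: column_def)
      qed
      have "P B"
      proof (rule main)
        show "B $ k $ k \<noteq> 0" using l True by (simp add: rows)
        show "column j B = axis j 1" if "j \<notin> insert k K" for j
          unfolding B_def using l(2) that insert.prems(1) by (intro keep) auto
        show "det B \<noteq> 0" using insert.prems(2) lk by (simp add: B_def det_mul det_column_replaced axis_def)
      qed
      then show ?thesis unfolding B_def by (rule step[rotated]) (use lk in \<open>simp add: axis_def\<close>)
    qed
  qed
  from this[of UNIV A] A show ?thesis by simp
qed

text \<open>
  A positive function on linear maps that is multiplicative and scales real homotheties correctly
  equals the squared modulus of the determinant: a shear is conjugate to its square by a diagonal
  matrix, and a complex dilation of one coordinate is conjugate to its complex conjugate.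
\<close>

lemma multiplicative_eq_det_square:
  fixes \<rho> :: "(complex ^ 'n \<Rightarrow> complex ^ 'n) \<Rightarrow> real"
  assumes mult: "\<And>f g. linear f ==> linear g ==> \<rho> (f \<circ> g) = \<rho> f * \<rho> g"
    and nonneg: "\<And>f. \<rho> f \<ge> 0"
    and real: "\<And>r. r > 0 ==> \<rho> (\<lambda>x. r *\<^sub>R x) = r ^ (2 * CARD('n))"
    and sing: "\<And>f. linear f ==> \<not> inj f ==> \<rho> f = 0"
  shows "\<rho> ((*v) A) = (cmod (det A))\<^sup>2"
proof -
  define r where "r A = \<rho> ((*v) A)" for A :: "complex ^ 'n ^ 'n"
  have lin: "linear ((*v) A)" for A :: "complex ^ 'n ^ 'n"
    by (rule linearI) (auto simp: matrix_vector_right_distrib scale_eq_scaleR[symmetric] vector_scalar_commute)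
  have rm: "r (A ** B) = r A * r B" for A B
    using mult[OF lin lin, of A B] by (simp add: r_def comp_def matrix_vector_mul_assoc)
  have r1: "r (mat 1) = 1"
  proof -
    have "(*v) (mat 1 :: complex ^ 'n ^ 'n) = (\<lambda>x. 1 *\<^sub>R x)" by (auto simp: fun_eq_iff)
    then show ?thesis using real[of 1] by (simp add: r_def)
  qed
  let ?C = "column_replaced"
  have CC: "?C k v ** ?C k w = ?C k (w + w $ k *s (v - axis k 1))" for k :: 'n and v w
    by (subst matrix_eq)
       (simp add: matrix_vector_mul_assoc[symmetric] column_replaced_vector vec_eq_iff algebra_simps axis_def)
  have C1: "?C k (axis k 1) = mat 1" for k :: 'n
    by (simp add: column_replaced_def vec_eq_iff mat_def axis_def)
  have r_shear: "r (?C k (axis k 1 + u)) = 1" if u: "u $ k = 0" for k u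
  proof -
    have e1: "?C k (axis k 1 + u) ** ?C k (axis k 1 + u) = ?C k (axis k 1 + 2 *s u)"
      unfolding CC by (rule arg_cong[of _ _ "?C k"]) (use u in \<open>simp add: vec_eq_iff\<close>)
    have e2: "?C k ((1 / 2) *s axis k 1) ** (?C k (axis k 1 + u) ** ?C k (2 *s axis k 1)) = ?C k (axis k 1 + 2 *s u)"
      unfolding CC by (rule arg_cong[of _ _ "?C k"]) (use u in \<open>simp add: vec_eq_iff axis_def algebra_simps\<close>)
    have e3: "?C k ((1 / 2) *s axis k 1) ** ?C k (2 *s axis k 1) = mat 1"
      unfolding CC C1[of k, symmetric] by (rule arg_cong[of _ _ "?C k"]) (simp add: vec_eq_iff axis_def)
    have e4: "?C k (axis k 1 + u) ** ?C k (axis k 1 - u) = mat 1"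
      unfolding CC C1[of k, symmetric] by (rule arg_cong[of _ _ "?C k"]) (use u in \<open>simp add: vec_eq_iff\<close>)
    have "r (?C k ((1 / 2) *s axis k 1)) * r (?C k (2 *s axis k 1)) = 1"
      using arg_cong[OF e3, of r] by (simp add: rm r1)
    then have "r (?C k (axis k 1 + u)) = r (?C k ((1 / 2) *s axis k 1)) * r (?C k (2 *s axis k 1)) * r (?C k (axis k 1 + u))"
      by (simp only: mult_1)
    also have "\<dots> = r (?C k ((1 / 2) *s axis k 1)) * (r (?C k (axis k 1 + u)) * r (?C k (2 *s axis k 1)))"
      by (simp only: mult_ac)
    also have "r (?C k ((1 / 2) *s axis k 1)) * (r (?C k (axis k 1 + u)) * r (?C k (2 *s axis k 1))) = r (?C k (axis k 1 + u)) * r (?C k (axis k 1 + u))"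
      using arg_cong[OF trans[OF e2 e1[symmetric]], of r] by (simp only: rm)
    finally have "r (?C k (axis k 1 + u)) = r (?C k (axis k 1 + u)) * r (?C k (axis k 1 + u))" .
    moreover have "r (?C k (axis k 1 + u)) \<noteq> 0"
      using arg_cong[OF e4, of r] by (auto simp: rm r1)
    ultimately show ?thesis by simp
  qed
  define d where "d k c = r (?C k (c *s axis k 1))" for k c
  have d_mult: "d k (a * b) = d k a * d k b" for k a b
  proof -
    have "?C k (a *s axis k 1) ** ?C k (b *s axis k 1) = ?C k ((a * b) *s axis k 1)"
      unfolding CC by (rule arg_cong[of _ _ "?C k"]) (simp add: vec_eq_iff axis_def algebra_simps)
    then show ?thesis unfolding d_def by (metis rm)
  qed
  have d_nonneg: "d k c \<ge> 0" for k c by (simp add: d_def r_def nonneg)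
  have d_swap: "d k c = d l c" for k l c
  proof -
    let ?P = "\<lambda>x :: complex ^ 'n. \<chi> i. x $ Transposition.transpose k l i"
    have P: "linear ?P" by (rule linearI) (auto simp: vec_eq_iff)
    have PP: "?P \<circ> ?P = (\<lambda>x. 1 *\<^sub>R x)" by (auto simp: fun_eq_iff vec_eq_iff)
    have one: "\<rho> ?P * \<rho> ?P = 1" using mult[OF P P] unfolding PP using real[of 1] by simp
    have "?P \<circ> ((*v) (?C k (c *s axis k 1)) \<circ> ?P) = (*v) (?C l (c *s axis l 1))"
    proof
      fix x
      have t: "Transposition.transpose k l i = k \<longleftrightarrow> i = l" for i
        by (auto simp: Transposition.transpose_def)
      show "(?P \<circ> ((*v) (?C k (c *s axis k 1)) \<circ> ?P)) x = ?C l (c *s axis l 1) *v x"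
        by (simp add: vec_eq_iff column_replaced_vector axis_def t)
    qed
    then have "d l c = \<rho> (?P \<circ> ((*v) (?C k (c *s axis k 1)) \<circ> ?P))" unfolding d_def r_def by (simp only:)
    then have "\<rho> ?P * (d k c * \<rho> ?P) = d l c"
      by (simp only: d_def r_def mult[OF P linear_compose[OF P lin]] mult[OF lin P])
    then have "(\<rho> ?P * \<rho> ?P) * d k c = d l c" by (simp only: mult_ac)
    then show ?thesis by (simp only: one mult_1)
  qed
  have d_cnj: "d k (cnj c) = d k c" for k c
  proof -
    have K: "linear (vec_cnj :: complex ^ 'n \<Rightarrow> complex ^ 'n)" by (rule linearI) (auto simp: vec_eq_iff)
    have KK: "vec_cnj \<circ> vec_cnj = (\<lambda>x. 1 *\<^sub>R x)" by (auto simp: fun_eq_iff)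
    have one: "\<rho> vec_cnj * \<rho> vec_cnj = 1" using mult[OF K K] unfolding KK using real[of 1] by simp
    have "vec_cnj \<circ> ((*v) (?C k (c *s axis k 1)) \<circ> vec_cnj) = (*v) (?C k (cnj c *s axis k 1))"
      by (rule ext) (simp add: vec_eq_iff column_replaced_vector axis_def)
    then have "d k (cnj c) = \<rho> (vec_cnj \<circ> ((*v) (?C k (c *s axis k 1)) \<circ> vec_cnj))" unfolding d_def r_def by (simp only:)
    then have "\<rho> vec_cnj * (d k c * \<rho> vec_cnj) = d k (cnj c)"
      by (simp only: d_def r_def mult[OF K linear_compose[OF K lin]] mult[OF lin K])
    then have "(\<rho> vec_cnj * \<rho> vec_cnj) * d k c = d k (cnj c)" by (simp only: mult_ac)
    then show ?thesis by (simp only: one mult_1)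
  qed
  have d_real: "d k (of_real t) = t\<^sup>2" if t: "t > 0" for k t
  proof -
    have "r (\<chi> i j. if i = j then if i \<in> I then of_real t else 1 else 0) = d k (of_real t) ^ card I" if "finite I" for I
      using that
    proof (induction I rule: finite_induct)
      case empty
      then show ?case using r1 by (simp add: mat_def cong: if_cong)
    next
      case (insert l I)
      let ?D = "\<lambda>I. (\<chi> i j. if i = j then if i \<in> I then of_real t else 1 else 0) :: complex ^ 'n ^ 'n"
      have D: "?D I *v x = (\<chi> i. (if i \<in> I then of_real t else 1) * x $ i)" for I x
        by (simp add: matrix_vector_mult_def vec_eq_iff if_distrib[of "\<lambda>a. a * _"] cong: if_cong)
      have "?C l (of_real t *s axis l 1) ** ?D I = ?D (insert l I)"
        by (subst matrix_eq, unfold matrix_vector_mul_assoc[symmetric] D column_replaced_vector)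
           (use insert.hyps in \<open>auto simp: vec_eq_iff axis_def algebra_simps\<close>)
      then have "r (?D (insert l I)) = d l (of_real t) * r (?D I)"
        unfolding d_def by (metis rm)
      then show ?case using insert d_swap[of l "of_real t" k] by simp
    qed
    from this[of UNIV] have "r (\<chi> i j. if i = j then of_real t else 0) = d k (of_real t) ^ CARD('n)"
      by (simp cong: if_cong)
    moreover have "(*v) (\<chi> i j. if i = j then of_real t else 0) = (\<lambda>x :: complex ^ 'n. t *\<^sub>R x)"
      by (auto simp: fun_eq_iff matrix_vector_mult_def vec_eq_iff if_distrib[of "\<lambda>a. a * _"] scaleR_conv_of_real[of _ "_ :: complex"] cong: if_cong)
    ultimately have "d k (of_real t) ^ CARD('n) = (t\<^sup>2) ^ CARD('n)"
      using real[OF t] by (simp add: r_def power_mult)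
    then show ?thesis
      using power_eq_imp_eq_base[of "d k (of_real t)" "CARD('n)" "t\<^sup>2"] d_nonneg by simp
  qed
  have d: "d k c = (cmod c)\<^sup>2" if "c \<noteq> 0" for k c
  proof -
    have "(d k c)\<^sup>2 = d k (of_real ((cmod c)\<^sup>2))"
      using d_mult[of k c "cnj c"] by (simp add: d_cnj power2_eq_square complex_norm_square[symmetric])
    also have "\<dots> = ((cmod c)\<^sup>2)\<^sup>2" using that by (intro d_real) simp
    finally show ?thesis by (rule power2_eq_imp_eq) (auto simp: d_nonneg)
  qed
  have rC: "r (?C k v) = (cmod (v $ k))\<^sup>2" if "v $ k \<noteq> 0" for k v
  proof -
    define u where "u = (1 / v $ k) *s v - axis k 1"
    have u: "u $ k = 0" using that by (simp add: u_def axis_def)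
    have "?C k (axis k 1 + u) ** ?C k (v $ k *s axis k 1) = ?C k v"
      unfolding CC by (rule arg_cong[of _ _ "?C k"]) (use that in \<open>simp add: u_def vec_eq_iff axis_def\<close>)
    then have "r (?C k v) = r (?C k (axis k 1 + u)) * d k (v $ k)" unfolding d_def by (metis rm)
    then show ?thesis using r_shear[OF u] d[OF that] by simp
  qed
  show ?thesis
  proof (cases "det A = 0")
    case True
    then have "\<not> inj ((*v) A)"
      using invertible_det_nz[of A] invertible_left_inverse[of A] matrix_left_invertible_injective[of A] by blast
    then show ?thesis using sing[OF lin] True by simp
  next
    case False
    have "r A = (cmod (det A))\<^sup>2"
    proof (rule column_replaced_induct[OF _ _ False])
      fix A k v assume v: "(v :: complex ^ 'n) $ k \<noteq> 0"
        and "r (?C k v ** A) = (cmod (det (?C k v ** A)))\<^sup>2"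
      then show "r A = (cmod (det A))\<^sup>2"
        using rC[OF v] by (simp add: rm det_mul det_column_replaced norm_mult power_mult_distrib)
    qed (simp add: r1)
    then show ?thesis by (simp add: r_def)
  qed
qed

lemma lborel_isomorphism_image:
  assumes "linear T" "linear S" "\<And>x. S (T x) = x" "\<And>y. T (S y) = y"
  shows "T ` X = S -` X"
  using assms(3,4) by (auto simp: image_iff) metis

lemma holomorphic_image_cover:
  fixes F :: "complex ^ 'n \<Rightarrow> complex ^ 'n"
  assumes F: "\<And>k. holomorphic_Cn_on (\<lambda>z. F z $ k) U" "open U" and S: "S \<subseteq> U" "S \<in> sets borel"
    and e: "e > 0" and fin: "emeasure lborel S < \<infinity>"
    and I: "(\<integral>\<^sup>+z\<in>S. ennreal ((cmod (det (complex_jacobian F z)))\<^sup>2) \<partial>lborel) \<le> ennreal I" "0 \<le> I"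
  shows "\<exists>V. open V \<and> F ` S \<subseteq> V \<and> emeasure lborel V \<le> ennreal (I + e)"
proof -
  have "DIM(complex ^ 'n) = DIM(real ^ ('n bit0))" by simp
  then obtain T :: "complex ^ 'n \<Rightarrow> real ^ ('n bit0)" and R :: "real ^ ('n bit0) \<Rightarrow> complex ^ 'n" where
    T: "linear T" "linear R" "\<And>x. R (T x) = x" "\<And>y. T (R y) = y" "distr lborel borel T = lborel"
    using euclidean_measure_isomorphism[where 'a = "complex ^ 'n" and 'b = "real ^ ('n bit0)"] by blast
  have bT: "bounded_linear T" "bounded_linear R"
    using T(1,2) by (auto simp: linear_conv_bounded_linear)
  have Tm: "T \<in> borel_measurable borel" and Rm: "R \<in> borel_measurable borel"
    by (intro borel_measurable_continuous_onI linear_continuous_on bT)+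
  have Rinv: "distr lborel borel R = lborel"
  proof -
    have "distr lborel borel R = distr (distr lborel borel T) borel R" by (simp only: T(5))
    also have "\<dots> = distr lborel borel (\<lambda>x. x)"
      using Tm Rm by (subst distr_distr) (auto simp: comp_def T(3))
    finally show ?thesis by (simp add: distr_id2)
  qed
  define \<rho> where "\<rho> f = \<bar>det (matrix (T \<circ> f \<circ> R))\<bar>" for f
  have \<rho>: "\<rho> ((*v) A) = (cmod (det A))\<^sup>2" for A
  proof (rule multiplicative_eq_det_square)
    fix f g :: "complex ^ 'n \<Rightarrow> complex ^ 'n" assume "linear f" "linear g"
    then have "linear (T \<circ> g \<circ> R)" "linear (T \<circ> f \<circ> R)" using T by (auto intro!: linear_compose)
    moreover have "T \<circ> (f \<circ> g) \<circ> R = (T \<circ> f \<circ> R) \<circ> (T \<circ> g \<circ> R)" by (auto simp: fun_eq_iff T)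
    ultimately show "\<rho> (f \<circ> g) = \<rho> f * \<rho> g"
      unfolding \<rho>_def by (simp only: matrix_compose det_mul abs_mult)
  next
    fix r :: real assume "r > 0"
    have "T \<circ> (\<lambda>x. r *\<^sub>R x) \<circ> R = (\<lambda>x. r *\<^sub>R x)" using T by (auto simp: fun_eq_iff linear_cmul)
    moreover have "det (matrix (\<lambda>x :: real ^ ('n bit0). r *\<^sub>R x)) = r ^ (2 * CARD('n))"
      by (subst det_diagonal) (auto simp: matrix_def axis_def)
    ultimately show "\<rho> (\<lambda>x. r *\<^sub>R x) = r ^ (2 * CARD('n))"
      using \<open>r > 0\<close> by (simp add: \<rho>_def)
  next
    fix f :: "complex ^ 'n \<Rightarrow> complex ^ 'n" assume f: "linear f" "\<not> inj f"
    then have l: "linear (T \<circ> f \<circ> R)" using T by (auto intro!: linear_compose)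
    have "\<not> inj (T \<circ> f \<circ> R)"
    proof
      assume "inj (T \<circ> f \<circ> R)"
      have "inj f"
      proof (rule injI)
        fix x y assume "f x = f y"
        then have "(T \<circ> f \<circ> R) (T x) = (T \<circ> f \<circ> R) (T y)" by (simp add: T)
        then have "T x = T y" using injD[OF \<open>inj (T \<circ> f \<circ> R)\<close>] by blast
        then show "x = y" using T(3) by metis
      qed
      then show False using f by simp
    qed
    then show "\<rho> f = 0" unfolding \<rho>_def using det_nz_iff_inj[OF l] by simp
  qed (simp add: \<rho>_def)
  define G where "G = T \<circ> F \<circ> R"
  define G' where "G' y = T \<circ> (*v) (complex_jacobian F (R y)) \<circ> R" for y
  have G': "(G has_derivative G' y) (at y within T ` S)" if "y \<in> T ` S" for y
  proof -
    have "R y \<in> U" using that S T by auto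
    then have "(F has_derivative (*v) (complex_jacobian F (R y))) (at (R y))"
      using holomorphic_Cn_map_derivative[OF F] by (simp add: Cn_map_derivative_jacobian[abs_def] ext)
    moreover have "(R has_derivative R) (at y)" "(T has_derivative T) (at (F (R y)))"
      using bT by (auto intro: bounded_linear_imp_has_derivative)
    ultimately have "(G has_derivative G' y) (at y)"
      unfolding G_def G'_def by (intro diff_chain_at[of _ "_ \<circ> R", simplified comp_assoc[symmetric]] diff_chain_at) auto
    then show ?thesis by (rule has_derivative_at_withinI)
  qed
  have detG: "\<bar>det (matrix (G' y))\<bar> = (cmod (det (complex_jacobian F (R y))))\<^sup>2" for y
    using \<rho>[of "complex_jacobian F (R y)"] by (simp add: \<rho>_def G'_def)
  have TS: "T ` S = R -` S" by (rule lborel_isomorphism_image) (use T in auto)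
  have TSb: "T ` S \<in> sets borel"
    unfolding TS using measurable_sets[OF Rm S(2)] by simp
  have em: "emeasure lborel (T ` S) = emeasure lborel S"
  proof -
    have "emeasure lborel S = emeasure (distr lborel borel R) S" by (simp only: Rinv)
    also have "\<dots> = emeasure lborel (R -` S)" using Rm S(2) by (subst emeasure_distr) auto
    finally show ?thesis by (simp add: TS)
  qed
  have lm: "T ` S \<in> lmeasurable"
    using em fin TSb by (intro fmeasurableI) auto
  have meas: "(\<lambda>z. indicator S z * (cmod (det (complex_jacobian F z)))\<^sup>2) \<in> borel_measurable borel"
  proof -
    have "continuous_on U (\<lambda>z. (cmod (det (complex_jacobian F z)))\<^sup>2)"
      unfolding det_def complex_jacobian_def
      by (intro continuous_intros) (auto intro!: holomorphic_Cn_continuous holomorphic_Cn_wirtinger F)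
    then have "(\<lambda>z. indicator U z * (cmod (det (complex_jacobian F z)))\<^sup>2) \<in> borel_measurable borel"
      using borel_measurable_continuous_on_indicator[of U "\<lambda>z. (cmod (det (complex_jacobian F z)))\<^sup>2"] F(2) by simp
    from borel_measurable_times[OF borel_measurable_indicator[OF S(2)] this]
    have "(\<lambda>z. indicator S z * (indicator U z * (cmod (det (complex_jacobian F z)))\<^sup>2)) \<in> borel_measurable borel" .
    moreover have "(\<lambda>z. indicator S z * (indicator U z * (cmod (det (complex_jacobian F z)))\<^sup>2)) =
        (\<lambda>z. indicator S z * (cmod (det (complex_jacobian F z)))\<^sup>2)"
      using S(1) by (auto simp: indicator_def fun_eq_iff)
    ultimately show ?thesis by (simp only:)
  qed
  define h where "h y = (cmod (det (complex_jacobian F (R y))))\<^sup>2" for y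
  have nnh: "(\<integral>\<^sup>+y. ennreal (indicator (T ` S) y * h y) \<partial>lborel) \<le> ennreal I"
  proof -
    have "(\<integral>\<^sup>+z\<in>S. ennreal ((cmod (det (complex_jacobian F z)))\<^sup>2) \<partial>lborel)
        = (\<integral>\<^sup>+z. ennreal (indicator S z * (cmod (det (complex_jacobian F z)))\<^sup>2) \<partial>lborel)"
      by (intro nn_integral_cong) (auto simp: indicator_def)
    also have "\<dots> = (\<integral>\<^sup>+z. ennreal (indicator S z * (cmod (det (complex_jacobian F z)))\<^sup>2) \<partial>distr lborel borel R)"
      by (simp only: Rinv)
    also have "\<dots> = (\<integral>\<^sup>+y. ennreal (indicator S (R y) * h y) \<partial>lborel)"
      using Rm meas by (subst nn_integral_distr) (auto simp: h_def)
    also have "\<dots> = (\<integral>\<^sup>+y. ennreal (indicator (T ` S) y * h y) \<partial>lborel)"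
      by (intro nn_integral_cong) (auto simp: indicator_def TS)
    finally show ?thesis using I(1) by simp
  qed
  have hm: "(\<lambda>y. indicator (T ` S) y * h y) \<in> borel_measurable borel"
  proof -
    have "(\<lambda>y. indicator (T ` S) y * h y) = (\<lambda>z. indicator S z * (cmod (det (complex_jacobian F z)))\<^sup>2) \<circ> R"
      by (auto simp: fun_eq_iff h_def TS indicator_def)
    then show ?thesis using measurable_comp[OF Rm meas] by simp
  qed
  have hi: "integrable lborel (\<lambda>y. indicator (T ` S) y * h y)"
  proof (rule integrableI_nonneg)
    show "(\<integral>\<^sup>+y. ennreal (indicator (T ` S) y * h y) \<partial>lborel) < \<infinity>"
      using nnh by (rule le_less_trans) simp
  qed (use hm in \<open>auto simp: h_def\<close>)
  have hI: "(\<integral>y. indicator (T ` S) y * h y \<partial>lborel) \<le> I"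
    using nnh hi I(2) by (subst (asm) nn_integral_eq_integral) (auto simp: h_def)
  have "set_integrable lborel (T ` S) h" using hi by (simp add: set_integrable_def)
  then have abs_h: "set_integrable lebesgue (T ` S) h"
    unfolding set_integrable_def using integrable_completion[of "\<lambda>y. indicator (T ` S) y *\<^sub>R h y" lborel] hm by simp
  then have "(h has_integral (LINT y:T ` S|lebesgue. h y)) (T ` S)"
    by (rule has_integral_set_lebesgue)
  moreover have "(LINT y:T ` S|lebesgue. h y) = (LINT y:T ` S|lborel. h y)"
    unfolding set_lebesgue_integral_def using integral_completion[of "\<lambda>y. indicator (T ` S) y *\<^sub>R h y" lborel] hm by simp
  ultimately have hint: "h integrable_on T ` S" "integral (T ` S) h \<le> I"
    using hI by (auto simp: set_lebesgue_integral_def dest: has_integral_integrable integral_unique)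
  have "G ` (T ` S) \<in> lmeasurable \<and> measure lebesgue (G ` (T ` S)) \<le> integral (T ` S) (\<lambda>y. \<bar>det (matrix (G' y))\<bar>)"
    by (rule m_diff_image_weak[OF lm G']) (use hint in \<open>auto simp: detG h_def[symmetric]\<close>)
  then have Gm: "G ` (T ` S) \<in> lmeasurable" "measure lebesgue (G ` (T ` S)) \<le> I"
    using hint by (auto simp: detG h_def[symmetric])
  have "G ` (T ` S) \<in> sets lebesgue" using Gm(1) by auto
  then obtain W where W: "open W" "G ` (T ` S) \<subseteq> W" "W - G ` (T ` S) \<in> lmeasurable"
      "emeasure lebesgue (W - G ` (T ` S)) < ennreal e"
    using sets_lebesgue_outer_open[OF _ e] by metis
  show ?thesis
  proof (intro exI[of _ "T -` W"] conjI)
    show "open (T -` W)" using W(1) by (intro open_vimage linear_continuous_on bT)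
    show "F ` S \<subseteq> T -` W" using W(2) by (auto simp: image_subset_iff G_def T)
    have "emeasure lborel (T -` W) = emeasure (distr lborel borel T) W"
      using Tm W(1) by (subst emeasure_distr) auto
    also have "\<dots> = emeasure lborel W" by (simp only: T(5))
    also have "\<dots> = emeasure lebesgue W" using W(1) by simp
    also have "\<dots> \<le> emeasure lebesgue (G ` (T ` S)) + emeasure lebesgue (W - G ` (T ` S))"
    proof -
      have "G ` (T ` S) \<union> (W - G ` (T ` S)) = W" using W(2) by blast
      then show ?thesis
        using emeasure_subadditive[of "G ` (T ` S)" lebesgue "W - G ` (T ` S)"] Gm(1) W(3) by auto
    qed
    also have "\<dots> \<le> ennreal I + ennreal e"
      using Gm W(4) by (intro add_mono) (auto simp: emeasure_eq_measure2 intro: ennreal_leI less_imp_le)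
    also have "\<dots> = ennreal (I + e)" using e I(2) by simp
    finally show "emeasure lborel (T -` W) \<le> ennreal (I + e)" .
  qed
qed

lemma emeasure_holomorphic_image_le:
  fixes F :: "complex ^ 'n \<Rightarrow> complex ^ 'n"
  assumes F: "\<And>k. holomorphic_Cn_on (\<lambda>z. F z $ k) U" "open U" and S: "S \<subseteq> U" "S \<in> sets borel"
    and img: "\<And>X. X \<in> sets borel ==> X \<subseteq> S ==> F ` X \<in> sets borel"
  shows "emeasure lborel (F ` S) \<le> (\<integral>\<^sup>+z\<in>S. ennreal ((cmod (det (complex_jacobian F z)))\<^sup>2) \<partial>lborel)" (is "_ \<le> ?J S")
proof (cases "?J S = \<infinity>")
  case True
  then show ?thesis by simp
next
  case False
  define I where "I = enn2real (?J S)"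
  have I: "?J S = ennreal I" "0 \<le> I"
    unfolding I_def by (subst ennreal_enn2real) (use False in \<open>auto simp: less_top\<close>)
  define X where "X k = S \<inter> ball 0 (real k)" for k
  have X: "X k \<in> sets borel" "X k \<subseteq> S" for k using S(2) by (auto simp: X_def)
  have bd: "emeasure lborel (F ` X k) \<le> ennreal I" for k
  proof (rule ennreal_le_epsilon)
    fix e :: real assume e: "e > 0"
    have fin: "emeasure lborel (X k) < \<infinity>"
      by (rule emeasure_bounded_finite) (auto simp: X_def intro: bounded_subset[OF bounded_ball])
    have "?J (X k) \<le> ?J S"
      by (intro nn_integral_mono) (use X in \<open>auto simp: indicator_def\<close>)
    then obtain V where V: "open V" "F ` X k \<subseteq> V" "emeasure lborel V \<le> ennreal (I + e)"
      using holomorphic_image_cover[OF F _ X(1) e fin _ I(2)] X(2) S(1) I(1) by (metis order_trans)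
    have "emeasure lborel (F ` X k) \<le> emeasure lborel V"
      using V by (intro emeasure_mono) auto
    also have "\<dots> \<le> ennreal I + ennreal e" using V(3) e I(2) by simp
    finally show "emeasure lborel (F ` X k) \<le> ennreal I + ennreal e" .
  qed
  have "S = (\<Union>k. X k)"
  proof
    show "S \<subseteq> (\<Union>k. X k)"
    proof
      fix x assume "x \<in> S"
      moreover obtain k :: nat where "norm x < real k" using reals_Archimedean2 by blast
      ultimately have "x \<in> X k" by (simp add: X_def)
      then show "x \<in> (\<Union>k. X k)" by blast
    qed
  qed (use X(2) in blast)
  then have FS: "F ` S = (\<Union>k. F ` X k)" by auto
  have sup: "(SUP k. emeasure lborel (F ` X k)) = emeasure lborel (\<Union>k. F ` X k)"
  proof (rule SUP_emeasure_incseq)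
    show "range (\<lambda>k. F ` X k) \<subseteq> sets lborel" using img X by auto
    show "incseq (\<lambda>k. F ` X k)" by (auto simp: incseq_def X_def)
  qed
  show ?thesis unfolding FS sup[symmetric] I(1) by (rule SUP_least) (rule bd)
qed

text \<open>The same inequality for integrals, by comparing two measures on Borel sets.\<close>

lemma nn_integral_holomorphic_image_le:
  fixes F :: "complex ^ 'n \<Rightarrow> complex ^ 'n"
  assumes F: "\<And>k. holomorphic_Cn_on (\<lambda>z. F z $ k) U" "open U" and E: "E \<subseteq> U" "E \<in> sets borel"
    and img: "\<And>X. X \<in> sets borel ==> X \<subseteq> E ==> F ` X \<in> sets borel"
    and g: "g \<in> borel_measurable borel"
  shows "(\<integral>\<^sup>+w\<in>F ` E. g w \<partial>lborel) \<le> (\<integral>\<^sup>+z\<in>E. g (F z) * ennreal ((cmod (det (complex_jacobian F z)))\<^sup>2) \<partial>lborel)"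
proof -
  define F' where "F' z = (if z \<in> U then F z else 0)" for z
  have "continuous_on U F"
  proof (intro continuous_at_imp_continuous_on ballI)
    fix z assume "z \<in> U"
    then show "isCont F z"
      using has_derivative_continuous[OF holomorphic_Cn_map_derivative[OF F]] by blast
  qed
  then have F'm: "F' \<in> borel_measurable borel"
    unfolding F'_def using F(2) by (intro borel_measurable_continuous_on_if) auto
  define j where "j z = ennreal ((cmod (det (complex_jacobian F z)))\<^sup>2) * indicator U z" for z
  have jm: "j \<in> borel_measurable borel"
  proof -
    have "continuous_on U (\<lambda>z. (cmod (det (complex_jacobian F z)))\<^sup>2)"
      unfolding det_def complex_jacobian_def
      by (intro continuous_intros) (auto intro!: holomorphic_Cn_continuous holomorphic_Cn_wirtinger F)
    then have "(\<lambda>z. indicator U z * (cmod (det (complex_jacobian F z)))\<^sup>2) \<in> borel_measurable borel"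
      using borel_measurable_continuous_on_indicator[of U "\<lambda>z. (cmod (det (complex_jacobian F z)))\<^sup>2"] F(2) by simp
    moreover have "j z = ennreal (indicator U z * (cmod (det (complex_jacobian F z)))\<^sup>2)" for z
      by (auto simp: j_def indicator_def)
    ultimately show ?thesis by (simp add: j_def[abs_def])
  qed
  define m where "m = density lborel (indicator (F ` E) :: _ \<Rightarrow> ennreal)"
  define n where "n = distr (density lborel (\<lambda>z. indicator E z * j z)) borel F'"
  have FE: "F ` E \<in> sets borel" using img[OF E(2)] by simp
  have ind: "(\<lambda>z. indicator E z * j z) \<in> borel_measurable borel"
    using jm E(2) by (intro borel_measurable_times_ennreal borel_measurable_indicator) auto
  have le: "emeasure m B \<le> emeasure n B" if B: "B \<in> sets borel" for B
  proof -
    have S: "E \<inter> F' -` B \<in> sets borel" using E(2) measurable_sets[OF F'm B] by auto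
    have "emeasure m B = (\<integral>\<^sup>+w. indicator (F ` E) w * indicator B w \<partial>lborel)"
      unfolding m_def using B FE by (subst emeasure_density) auto
    also have "\<dots> = emeasure lborel (F ` E \<inter> B)"
      using B FE by (simp add: indicator_inter_arith[symmetric])
    also have "F ` E \<inter> B = F ` (E \<inter> F' -` B)" using E(1) by (auto simp: F'_def)
    also have "emeasure lborel \<dots> \<le> (\<integral>\<^sup>+z\<in>E \<inter> F' -` B. ennreal ((cmod (det (complex_jacobian F z)))\<^sup>2) \<partial>lborel)"
      by (rule emeasure_holomorphic_image_le[OF F]) (use E S img in auto)
    also have "\<dots> = (\<integral>\<^sup>+z. (indicator E z * j z) * indicator (F' -` B) z \<partial>lborel)"
      by (intro nn_integral_cong) (use E(1) in \<open>auto simp: indicator_def j_def\<close>)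
    also have "\<dots> = emeasure (density lborel (\<lambda>z. indicator E z * j z)) (F' -` B)"
      using ind measurable_sets[OF F'm B] by (subst emeasure_density) auto
    also have "\<dots> = emeasure n B"
      unfolding n_def using F'm B by (subst emeasure_distr) auto
    finally show ?thesis .
  qed
  have "(\<integral>\<^sup>+w\<in>F ` E. g w \<partial>lborel) = integral\<^sup>N m g"
    unfolding m_def using FE g by (subst nn_integral_density) (auto simp: mult.commute)
  also have "\<dots> \<le> integral\<^sup>N n g"
  proof (rule nn_integral_mono_measure)
    show "m \<le> n" by (subst le_measure) (auto simp: m_def n_def le[unfolded m_def n_def])
  qed (auto simp: m_def n_def)
  also have "\<dots> = (\<integral>\<^sup>+z. (indicator E z * j z) * g (F' z) \<partial>lborel)"
    unfolding n_def using F'm g ind by (subst nn_integral_distr, simp, simp, subst nn_integral_density) auto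
  also have "\<dots> = (\<integral>\<^sup>+z\<in>E. g (F z) * ennreal ((cmod (det (complex_jacobian F z)))\<^sup>2) \<partial>lborel)"
    by (intro nn_integral_cong) (use E(1) in \<open>auto simp: indicator_def j_def F'_def mult.commute\<close>)
  finally show ?thesis .
qed

section \<open>Mean values\<close>

lemma nn_integral_rotation_le:
  fixes g :: "complex ^ 'n \<Rightarrow> ennreal"
  assumes "cmod \<omega> = 1" "g \<in> borel_measurable borel"
  shows "(\<integral>\<^sup>+u\<in>ball 0 r. g (\<omega> *s u) \<partial>lborel) \<le> (\<integral>\<^sup>+u\<in>ball 0 r. g u \<partial>lborel)"
proof -
  define \<eta> where "\<eta> = inverse \<omega>"
  have \<omega>: "\<omega> \<noteq> 0" using assms(1) by auto
  have \<eta>: "cmod \<eta> = 1" "\<eta> * \<omega> = 1" using assms(1) \<omega> by (auto simp: \<eta>_def norm_inverse)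
  have cont: "continuous_on UNIV (\<lambda>u. a *s u)" for a :: complex and X :: "'n itself"
    by (intro linear_continuous_on bounded_linear_scale_right)
  have img: "(*s) \<eta> ` X = (*s) \<omega> -` X" for X :: "(complex ^ 'n) set"
    using \<eta>(2) by (auto simp: image_iff) (metis mult.commute vector_ssub_ldistrib vector_smult_assoc vector_smult_lid)+
  have ball: "(*s) \<eta> ` ball 0 r = ball (0 :: complex ^ 'n) r"
    unfolding img using assms(1) by (auto simp: norm_vector_scale_complex)
  have jac: "complex_jacobian ((*s) \<eta>) z = mat \<eta>" for z :: "complex ^ 'n"
  proof -
    have "wirtinger j (\<lambda>w. \<eta> * w $ i) z = \<eta> * (if j = i then 1 else 0)" for i j
      using holomorphic_Cn_cmult(2)[OF holomorphic_Cn_component open_UNIV, of z j \<eta> i] by (simp add: wirtinger_component)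
    then show ?thesis by (simp add: complex_jacobian_def vec_eq_iff mat_def)
  qed
  have "(\<integral>\<^sup>+u\<in>ball 0 r. g (\<omega> *s u) \<partial>lborel) = (\<integral>\<^sup>+u\<in>(*s) \<eta> ` ball 0 r. g (\<omega> *s u) \<partial>lborel)"
    by (simp only: ball)
  also have "\<dots> \<le> (\<integral>\<^sup>+u\<in>ball 0 r. g (\<omega> *s (\<eta> *s u)) * ennreal ((cmod (det (complex_jacobian ((*s) \<eta>) u)))\<^sup>2) \<partial>lborel)"
  proof (rule nn_integral_holomorphic_image_le[where U = UNIV])
    show "holomorphic_Cn_on (\<lambda>z :: complex ^ 'n. (\<eta> *s z) $ k) UNIV" for k
      using holomorphic_Cn_cmult(1)[OF holomorphic_Cn_component open_UNIV] by simp
    show "(*s) \<eta> ` X \<in> sets borel" if "X \<in> sets borel" for X :: "(complex ^ 'n) set"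
      unfolding img using measurable_sets[OF borel_measurable_continuous_onI[OF cont] that] by simp
    show "(\<lambda>u. g (\<omega> *s u)) \<in> borel_measurable borel"
      using measurable_comp[OF borel_measurable_continuous_onI[OF cont] assms(2)] by (simp add: comp_def)
  qed auto
  also have "\<dots> = (\<integral>\<^sup>+u\<in>ball 0 r. g u \<partial>lborel)"
  proof -
    have "det (mat \<eta> :: complex ^ 'n ^ 'n) = \<eta> ^ CARD('n)"
      by (subst det_diagonal) (auto simp: mat_def)
    then show ?thesis using \<eta> by (simp add: jac norm_power vector_smult_assoc mult.commute[of \<omega>])
  qed
  finally show ?thesis .
qed

lemma circle_mean_bound:
  assumes g: "g holomorphic_on ball 0 R" and R: "R > 1"
  shows "ennreal (cmod (g 0)) \<le> (\<integral>\<^sup>+t. indicator {0..1} t * ennreal (cmod (g (exp (2 * of_real pi * \<i> * of_real t)))) \<partial>lborel)"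
proof -
  let ?e = "\<lambda>t. exp (2 * of_real pi * \<i> * of_real t)"
  have ne: "cmod (?e t) = 1" for t :: real
    by (metis norm_exp_i_times mult.commute mult.left_commute mult.assoc of_real_mult of_real_numeral)
  have "((\<lambda>u. g u / (u - 0)) has_contour_integral (2 * of_real pi * \<i> * g 0)) (circlepath 0 1)"
    using R by (intro Cauchy_integral_circlepath_simple holomorphic_on_subset[OF g]) auto
  then have "((\<lambda>t. g (?e t) / ?e t * (2 * of_real pi * \<i> * ?e t)) has_integral (2 * of_real pi * \<i> * g 0)) {0..1}"
    unfolding has_contour_integral
    by (rule has_integral_eq[rotated]) (simp only: vector_derivative_circlepath, simp add: circlepath mult_ac)
  then have "((\<lambda>t. (1 / (2 * of_real pi * \<i>)) * (g (?e t) / ?e t * (2 * of_real pi * \<i> * ?e t))) has_integral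
      (1 / (2 * of_real pi * \<i>)) * (2 * of_real pi * \<i> * g 0)) {0..1}"
    by (rule has_integral_mult_right)
  then have mean: "((\<lambda>t. g (?e t)) has_integral g 0) {0..1}"
    by (simp add: field_simps)
  have cont: "continuous_on {0..1} (\<lambda>t. g (?e t))"
    by (rule continuous_on_compose2[OF holomorphic_on_imp_continuous_on[OF g]])
       (use R in \<open>auto intro!: continuous_intros simp: ne\<close>)
  have int: "(\<lambda>t. cmod (g (?e t))) integrable_on {0..1}"
    by (intro integrable_continuous_interval continuous_intros cont)
  have "cmod (g 0) \<le> integral {0..1} (\<lambda>t. cmod (g (?e t)))"
    using integral_norm_bound_integral[OF has_integral_integrable[OF mean] int] integral_unique[OF mean] by simp
  then have "ennreal (cmod (g 0)) \<le> ennreal (integral {0..1} (\<lambda>t. cmod (g (?e t))))"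
    by (rule ennreal_leI)
  also have "\<dots> = (\<integral>\<^sup>+t. ennreal (indicator {0..1} t * cmod (g (?e t))) \<partial>lborel)"
    by (subst nn_integral_has_integral_lebesgue[OF _ integrable_integral[OF int]]) auto
  also have "\<dots> = (\<integral>\<^sup>+t. indicator {0..1} t * ennreal (cmod (g (?e t))) \<partial>lborel)"
    by (intro nn_integral_cong) (auto simp: indicator_def)
  finally show ?thesis .
qed

text \<open>
  The square of a holomorphic function is holomorphic, so the mean value property on circles
  gives the inequality for \<open>L\<^sup>2\<close> means over balls after averaging over all circles.
\<close>

lemma holomorphic_ball_mean:
  fixes f :: "complex ^ 'n \<Rightarrow> complex"
  assumes f: "holomorphic_Cn_on f (ball z r)"
  shows "ennreal ((cmod (f z))\<^sup>2) * emeasure lborel (ball z r) \<le> (\<integral>\<^sup>+w\<in>ball z r. ennreal ((cmod (f w))\<^sup>2) \<partial>lborel)"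
proof -
  define h where "h w = ennreal ((cmod (f w))\<^sup>2) * indicator (ball z r) w" for w
  have hm: "h \<in> borel_measurable borel"
  proof -
    have "(\<lambda>w. indicator (ball z r) w * (cmod (f w))\<^sup>2) \<in> borel_measurable borel"
      using borel_measurable_continuous_on_indicator[of "ball z r" "\<lambda>w. (cmod (f w))\<^sup>2"] holomorphic_Cn_continuous[OF f]
      by (simp add: continuous_intros)
    moreover have "h w = ennreal (indicator (ball z r) w * (cmod (f w))\<^sup>2)" for w by (auto simp: h_def indicator_def)
    ultimately show ?thesis by (simp add: h_def[abs_def])
  qed
  let ?e = "\<lambda>t :: real. exp (2 * of_real pi * \<i> * of_real t) :: complex"
  have ne: "cmod (?e t) = 1" for t :: real
    by (metis norm_exp_i_times mult.commute mult.left_commute mult.assoc of_real_mult of_real_numeral)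
  have mean: "ennreal ((cmod (f z))\<^sup>2) \<le> (\<integral>\<^sup>+t. indicator {0..1} t * h (z + ?e t *s u) \<partial>lborel)" if u: "u \<in> ball 0 r" for u
  proof -
    define R where "R = (if u = 0 then 2 else r / norm u)"
    have R: "R > 1" using u by (auto simp: R_def)
    have inb: "z + \<zeta> *s u \<in> ball z r" if "\<zeta> \<in> ball 0 R" for \<zeta>
      using that u by (cases "u = 0") (auto simp: R_def dist_norm norm_vector_scale_complex field_simps)
    have "(\<lambda>\<zeta>. (f (z + \<zeta> *s u))\<^sup>2) holomorphic_on ball 0 R"
      by (intro holomorphic_intros holomorphic_on_subset[OF holomorphic_on_line[OF f open_ball]]) (use inb in auto)
    from circle_mean_bound[OF this R]
    have "ennreal ((cmod (f z))\<^sup>2) \<le> (\<integral>\<^sup>+t. indicator {0..1} t * ennreal (cmod ((f (z + ?e t *s u))\<^sup>2)) \<partial>lborel)"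
      by (simp add: norm_power)
    also have "\<dots> = (\<integral>\<^sup>+t. indicator {0..1} t * h (z + ?e t *s u) \<partial>lborel)"
      using inb R by (intro nn_integral_cong) (auto simp: h_def norm_power ne indicator_def simp del: mem_ball)
    finally show ?thesis .
  qed
  have pm: "(\<lambda>(u, t). indicator (ball 0 r) u * (indicator {0..1} t * h (z + ?e t *s u))) \<in> borel_measurable (lborel \<Otimes>\<^sub>M lborel)"
  proof -
    have cont: "continuous_on UNIV (\<lambda>(u, t). z + ?e t *s u)"
    proof -
      have "continuous_on UNIV (\<lambda>p. (\<chi> i. z $ i + ?e (snd p) * fst p $ i) :: complex ^ 'n)"
        by (intro continuous_intros)
      moreover have "(\<lambda>(u, t). z + ?e t *s u) = (\<lambda>p. (\<chi> i. z $ i + ?e (snd p) * fst p $ i) :: complex ^ 'n)"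
        by (auto simp: fun_eq_iff vec_eq_iff)
      ultimately show ?thesis by simp
    qed
    have "(\<lambda>(u, t). z + ?e t *s u) \<in> borel_measurable (borel \<Otimes>\<^sub>M borel)"
      using borel_measurable_continuous_onI[OF cont] by (simp only: borel_prod)
    from measurable_comp[OF this hm]
    have "(\<lambda>p. h (z + ?e (snd p) *s fst p)) \<in> borel_measurable (lborel \<Otimes>\<^sub>M lborel)"
      by (simp add: comp_def case_prod_beta' cong: measurable_cong_sets)
    moreover have "(\<lambda>p :: (complex ^ 'n) \<times> real. indicator (ball 0 r) (fst p) :: ennreal) \<in> borel_measurable (lborel \<Otimes>\<^sub>M lborel)"
      by (rule measurable_compose[OF measurable_fst borel_measurable_indicator]) simp
    moreover have "(\<lambda>p :: (complex ^ 'n) \<times> real. indicator {0..1} (snd p) :: ennreal) \<in> borel_measurable (lborel \<Otimes>\<^sub>M lborel)"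
      by (rule measurable_compose[OF measurable_snd borel_measurable_indicator]) simp
    ultimately show ?thesis unfolding case_prod_beta' by (intro borel_measurable_times_ennreal)
  qed
  have "emeasure lborel (ball z r) = emeasure lborel (ball (0 :: complex ^ 'n) r)"
  proof (cases "r \<ge> 0")
    case True
    show ?thesis unfolding emeasure_ball[OF True] by (rule refl)
  next
    case False
    then have "ball z r = {}" "ball (0 :: complex ^ 'n) r = {}" by (auto simp: ball_empty)
    then show ?thesis by (simp only: emeasure_empty)
  qed
  then have "ennreal ((cmod (f z))\<^sup>2) * emeasure lborel (ball z r) = ennreal ((cmod (f z))\<^sup>2) * emeasure lborel (ball (0 :: complex ^ 'n) r)"
    by (simp only:)
  also have "\<dots> = (\<integral>\<^sup>+u. ennreal ((cmod (f z))\<^sup>2) * indicator (ball (0 :: complex ^ 'n) r) u \<partial>lborel)"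
    by (subst nn_integral_cmult_indicator) auto
  also have "\<dots> \<le> (\<integral>\<^sup>+u. \<integral>\<^sup>+t. indicator (ball 0 r) u * (indicator {0..1} t * h (z + ?e t *s u)) \<partial>lborel \<partial>lborel)"
    by (intro nn_integral_mono) (use mean in \<open>auto simp: indicator_def[of "ball 0 r"] simp del: mem_ball\<close>)
  also have "\<dots> = (\<integral>\<^sup>+t. \<integral>\<^sup>+u. indicator (ball 0 r) u * (indicator {0..1} t * h (z + ?e t *s u)) \<partial>lborel \<partial>lborel)"
    by (rule lborel_pair.Fubini'[OF pm, symmetric])
  also have "\<dots> \<le> (\<integral>\<^sup>+t. indicator {0 .. 1 :: real} t * (\<integral>\<^sup>+w\<in>ball z r. ennreal ((cmod (f w))\<^sup>2) \<partial>lborel) \<partial>lborel)"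
  proof (rule nn_integral_mono)
    fix t :: real
    have shift: "(\<lambda>u. h (z + u)) \<in> borel_measurable borel"
      using hm by measurable
    have "(\<integral>\<^sup>+u. indicator (ball 0 r) u * (indicator {0..1} t * h (z + ?e t *s u)) \<partial>lborel)
        \<le> (\<integral>\<^sup>+u\<in>ball 0 r. indicator {0..1} t * h (z + ?e t *s u) \<partial>lborel)"
      by (simp add: mult.commute)
    also have "\<dots> \<le> (\<integral>\<^sup>+u\<in>ball 0 r. indicator {0..1} t * h (z + u) \<partial>lborel)"
      by (rule nn_integral_rotation_le[OF ne]) (use shift in measurable)
    also have "\<dots> = indicator {0..1} t * (\<integral>\<^sup>+u\<in>ball 0 r. h (z + u) \<partial>lborel)"
    proof -
      have "(\<lambda>u. h (z + u) * indicator (ball 0 r) u) \<in> borel_measurable borel"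
        using shift by (intro borel_measurable_times_ennreal borel_measurable_indicator) auto
      then show ?thesis by (subst nn_integral_cmult[symmetric]) (auto simp: mult.assoc)
    qed
    also have "(\<integral>\<^sup>+u\<in>ball 0 r. h (z + u) \<partial>lborel) = (\<integral>\<^sup>+u. h (z + u) \<partial>lborel)"
      by (intro nn_integral_cong) (auto simp: h_def indicator_def dist_norm)
    also have "\<dots> = (\<integral>\<^sup>+w. h w \<partial>distr lborel borel ((+) z))"
      using hm by (subst nn_integral_distr) auto
    also have "\<dots> = (\<integral>\<^sup>+w\<in>ball z r. ennreal ((cmod (f w))\<^sup>2) \<partial>lborel)"
      by (simp only: lborel_distr_plus h_def)
    finally show "(\<integral>\<^sup>+u. indicator (ball 0 r) u * (indicator {0..1} t * h (z + ?e t *s u)) \<partial>lborel)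
      \<le> indicator {0..1} t * (\<integral>\<^sup>+w\<in>ball z r. ennreal ((cmod (f w))\<^sup>2) \<partial>lborel)" .
  qed
  also have "\<dots> = (\<integral>\<^sup>+w\<in>ball z r. ennreal ((cmod (f w))\<^sup>2) \<partial>lborel)"
    by (subst nn_integral_multc) auto
  finally show ?thesis .
qed

section \<open>Hilbert spaces of functions with bounded point evaluations\<close>

abbreviation (input) zero_form :: "'c \<Rightarrow> 'z \<Rightarrow> complex" where
  "zero_form \<equiv> (\<lambda>c z. 0)"

abbreviation (input) form_add :: "('c \<Rightarrow> 'z \<Rightarrow> complex) \<Rightarrow> ('c \<Rightarrow> 'z \<Rightarrow> complex) \<Rightarrow> 'c \<Rightarrow> 'z \<Rightarrow> complex" where
  "form_add f g \<equiv> (\<lambda>c z. f c z + g c z)"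

abbreviation (input) form_diff :: "('c \<Rightarrow> 'z \<Rightarrow> complex) \<Rightarrow> ('c \<Rightarrow> 'z \<Rightarrow> complex) \<Rightarrow> 'c \<Rightarrow> 'z \<Rightarrow> complex" where
  "form_diff f g \<equiv> (\<lambda>c z. f c z - g c z)"

abbreviation (input) form_scale :: "complex \<Rightarrow> ('c \<Rightarrow> 'z \<Rightarrow> complex) \<Rightarrow> 'c \<Rightarrow> 'z \<Rightarrow> complex" where
  "form_scale a f \<equiv> (\<lambda>c z. a * f c z)"

abbreviation (input) form_comb :: "'j set \<Rightarrow> ('j \<Rightarrow> complex) \<Rightarrow> ('j \<Rightarrow> 'c \<Rightarrow> 'z \<Rightarrow> complex) \<Rightarrow> 'c \<Rightarrow> 'z \<Rightarrow> complex" where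
  "form_comb F a \<phi> \<equiv> (\<lambda>c z. \<Sum>j\<in>F. a j * \<phi> j c z)"

lemma of_real_cmod_square: "(complex_of_real (cmod z))\<^sup>2 = z * cnj z"
  by (simp add: complex_norm_square flip: of_real_power)

locale function_inner_space =
  fixes H :: "('c \<Rightarrow> 'z \<Rightarrow> complex) set"
    and ip :: "('c \<Rightarrow> 'z \<Rightarrow> complex) \<Rightarrow> ('c \<Rightarrow> 'z \<Rightarrow> complex) \<Rightarrow> complex"
  assumes zero_mem: "zero_form \<in> H"
    and add_mem: "f \<in> H ==> g \<in> H ==> form_add f g \<in> H"
    and scale_mem: "f \<in> H ==> form_scale a f \<in> H"
    and ip_add: "f \<in> H ==> g \<in> H ==> h \<in> H ==> ip (form_add f g) h = ip f h + ip g h"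
    and ip_scale: "f \<in> H ==> h \<in> H ==> ip (form_scale a f) h = a * ip f h"
    and ip_cnj: "f \<in> H ==> g \<in> H ==> ip g f = cnj (ip f g)"
    and ip_nonneg: "f \<in> H ==> 0 \<le> Re (ip f f)"
    and eval_bound: "\<exists>C. \<forall>f\<in>H. (cmod (f c z))\<^sup>2 \<le> C * Re (ip f f)"
    and norm_complete: "(\<And>m :: nat. s m \<in> H) ==>
      (\<And>e. e > 0 ==> \<exists>K. \<forall>m\<ge>K. \<forall>k\<ge>K. Re (ip (form_diff (s m) (s k)) (form_diff (s m) (s k))) < e) ==>
      \<exists>f\<in>H. \<forall>e>0. \<exists>K. \<forall>m\<ge>K. Re (ip (form_diff (s m) f) (form_diff (s m) f)) < e"
    and separable: "\<exists>D. countable D \<and> (\<forall>f\<in>H. (\<forall>(c, z)\<in>D. f c z = 0) \<longrightarrow> f = zero_form)"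
begin

definition sqn :: "('c \<Rightarrow> 'z \<Rightarrow> complex) \<Rightarrow> real" where
  "sqn f = Re (ip f f)"

lemma ip_self: "f \<in> H ==> ip f f = of_real (sqn f)"
  using ip_cnj[of f f] by (simp add: sqn_def complex_eq_iff)

lemma sqn_nonneg: "f \<in> H ==> 0 \<le> sqn f"
  using ip_nonneg by (simp add: sqn_def)

lemma diff_mem: "f \<in> H ==> g \<in> H ==> form_diff f g \<in> H"
  using add_mem[OF _ scale_mem[of g "-1"], of f] by simp

lemma ip_diff: "f \<in> H ==> g \<in> H ==> h \<in> H ==> ip (form_diff f g) h = ip f h - ip g h"
  using ip_add[OF _ scale_mem[of g "-1"], of f h] ip_scale[of g h "-1"] by simp

lemma ip_scale_right: "f \<in> H ==> h \<in> H ==> ip h (form_scale a f) = cnj a * ip h f"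
  using ip_cnj[of "form_scale a f" h] ip_cnj[of f h] ip_scale[of f h a] scale_mem[of f a] by simp

lemma ip_diff_right: "f \<in> H ==> g \<in> H ==> h \<in> H ==> ip h (form_diff f g) = ip h f - ip h g"
  using ip_cnj[of "form_diff f g" h] ip_cnj[of f h] ip_cnj[of g h] ip_diff[of f g h] diff_mem[of f g] by simp

lemma comb_mem: "(\<And>j. j \<in> F ==> \<phi> j \<in> H) ==> form_comb F a \<phi> \<in> H"
proof (induction F rule: infinite_finite_induct)
  case (insert j F)
  then show ?case using add_mem[OF scale_mem[of "\<phi> j" "a j"], of "form_comb F a \<phi>"] by simp
qed (use zero_mem in auto)

lemma ip_zero: "g \<in> H ==> ip zero_form g = 0"
  using ip_scale[OF zero_mem, of g 0] by simp

lemma ip_comb: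
  "finite F ==> (\<And>j. j \<in> F ==> \<phi> j \<in> H) ==> g \<in> H ==> ip (form_comb F a \<phi>) g = (\<Sum>j\<in>F. a j * ip (\<phi> j) g)"
proof (induction F rule: finite_induct)
  case (insert j F)
  then show ?case
    using ip_add[OF scale_mem[of "\<phi> j" "a j"] comb_mem[of F \<phi> a], of g] by (simp add: ip_scale)
qed (simp add: ip_zero)

lemma ip_comb_right:
  "finite F ==> (\<And>j. j \<in> F ==> \<phi> j \<in> H) ==> g \<in> H ==> ip g (form_comb F a \<phi>) = (\<Sum>j\<in>F. cnj (a j) * ip g (\<phi> j))"
  using ip_cnj[OF comb_mem[of F \<phi> a], of g] ip_comb[of F \<phi> g a]
  by (simp add: ip_cnj[of _ g, symmetric])

lemma sqn_diff: "f \<in> H ==> g \<in> H ==> sqn (form_diff f g) = sqn f - 2 * Re (ip f g) + sqn g"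
  by (simp add: sqn_def ip_diff ip_diff_right diff_mem ip_cnj[of f g])

lemma cauchy_schwarz:
  assumes f: "f \<in> H" and g: "g \<in> H"
  shows "(cmod (ip f g))\<^sup>2 \<le> sqn f * sqn g"
proof -
  have key: "2 * cmod (ip f g) ^ 2 * t \<le> sqn f + t\<^sup>2 * cmod (ip f g) ^ 2 * sqn g" for t :: real
  proof -
    define a where "a = of_real t * ip f g"
    have e1: "ip f (form_scale a g) = of_real (t * cmod (ip f g) ^ 2)"
    proof -
      have "ip f (form_scale a g) = cnj a * ip f g" by (rule ip_scale_right[OF g f])
      then show ?thesis by (simp add: a_def of_real_cmod_square mult_ac)
    qed
    have e2: "sqn (form_scale a g) = t\<^sup>2 * cmod (ip f g) ^ 2 * sqn g"
    proof -
      have "ip (form_scale a g) (form_scale a g) = a * (cnj a * ip g g)"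
        using ip_scale[OF g scale_mem[OF g], of a a] ip_scale_right[OF g g, of a] by simp
      also have "\<dots> = of_real (t\<^sup>2 * cmod (ip f g) ^ 2 * sqn g)"
        by (simp add: ip_self[OF g] a_def of_real_cmod_square power2_eq_square[of "complex_of_real t"] mult_ac)
      finally show ?thesis by (simp add: sqn_def)
    qed
    have "0 \<le> sqn (form_diff f (form_scale a g))" by (intro sqn_nonneg diff_mem f scale_mem g)
    also have "\<dots> = sqn f - 2 * Re (ip f (form_scale a g)) + sqn (form_scale a g)"
      by (intro sqn_diff f scale_mem g)
    also have "\<dots> = sqn f - 2 * (t * cmod (ip f g) ^ 2) + t\<^sup>2 * cmod (ip f g) ^ 2 * sqn g"
      by (simp only: e1 e2 Re_complex_of_real)
    finally show ?thesis by (simp add: mult_ac)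
  qed
  show ?thesis
  proof (cases "sqn g = 0")
    case True
    have "cmod (ip f g) ^ 2 = 0"
    proof (rule ccontr)
      assume nz: "cmod (ip f g) ^ 2 \<noteq> 0"
      then have "sqn f + 1 \<le> sqn f * 1 / 1 * 1"
        using key[of "(sqn f + 1) / (2 * cmod (ip f g) ^ 2)"] True sqn_nonneg[OF f] by simp
      then show False by simp
    qed
    then show ?thesis using True by simp
  next
    case False
    then have pos: "sqn g > 0" using sqn_nonneg[OF g] by simp
    have "2 * cmod (ip f g) ^ 2 * (1 / sqn g) \<le> sqn f + (1 / sqn g)\<^sup>2 * cmod (ip f g) ^ 2 * sqn g"
      by (rule key)
    then have "2 * cmod (ip f g) ^ 2 / sqn g \<le> sqn f + cmod (ip f g) ^ 2 / sqn g"
      using pos by (simp add: power2_eq_square)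
    then have "cmod (ip f g) ^ 2 / sqn g \<le> sqn f" by simp
    then show ?thesis using pos by (simp add: divide_simps)
  qed
qed

lemma eq_zero_if_sqn_zero:
  assumes "f \<in> H" "sqn f = 0" shows "f = zero_form"
proof (intro ext)
  fix c z
  obtain C where "(cmod (f c z))\<^sup>2 \<le> C * sqn f" using eval_bound assms(1) unfolding sqn_def by blast
  then show "f c z = 0" using assms(2) by simp
qed

definition orthonormal_family :: "nat set \<Rightarrow> (nat \<Rightarrow> 'c \<Rightarrow> 'z \<Rightarrow> complex) \<Rightarrow> bool" where
  "orthonormal_family J \<phi> \<longleftrightarrow> (\<forall>j. \<phi> j \<in> H) \<and> (\<forall>j. j \<notin> J \<longrightarrow> \<phi> j = zero_form) \<and>
     (\<forall>i j. ip (\<phi> i) (\<phi> j) = (if i = j \<and> i \<in> J then 1 else 0))"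

lemma sqn_comb:
  assumes "orthonormal_family J \<phi>" "finite F"
  shows "sqn (form_comb F a \<phi>) = (\<Sum>j\<in>F \<inter> J. (cmod (a j))\<^sup>2)"
proof -
  have m: "\<phi> j \<in> H" for j using assms(1) by (simp add: orthonormal_family_def)
  have o: "ip (\<phi> i) (\<phi> j) = (if i = j \<and> i \<in> J then 1 else 0)" for i j
    using assms(1) by (simp add: orthonormal_family_def)
  have "ip (form_comb F a \<phi>) (form_comb F a \<phi>) = (\<Sum>i\<in>F. a i * (\<Sum>j\<in>F. cnj (a j) * ip (\<phi> i) (\<phi> j)))"
    by (simp only: ip_comb[OF assms(2) m comb_mem[OF m]] ip_comb_right[OF assms(2) m m])
  also have "\<dots> = (\<Sum>i\<in>F. if i \<in> J then of_real ((cmod (a i))\<^sup>2) else 0)"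
  proof (rule sum.cong[OF refl])
    fix i assume i: "i \<in> F"
    have "(\<Sum>j\<in>F. cnj (a j) * ip (\<phi> i) (\<phi> j)) = (\<Sum>j\<in>F. if j = i then (if i \<in> J then cnj (a i) else 0) else 0)"
      by (intro sum.cong refl) (auto simp: o)
    also have "\<dots> = (if i \<in> J then cnj (a i) else 0)" using i assms(2) by simp
    finally show "a i * (\<Sum>j\<in>F. cnj (a j) * ip (\<phi> i) (\<phi> j)) = (if i \<in> J then of_real ((cmod (a i))\<^sup>2) else 0)"
      by (simp add: of_real_cmod_square)
  qed
  also have "\<dots> = (\<Sum>i\<in>F \<inter> J. of_real ((cmod (a i))\<^sup>2))"
    using assms(2) by (simp add: sum.inter_restrict del: of_real_power)
  finally show ?thesis by (simp add: sqn_def)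
qed

lemma bessel:
  assumes "orthonormal_family J \<phi>" "finite F" "f \<in> H"
  shows "(\<Sum>j\<in>F. (cmod (ip f (\<phi> j)))\<^sup>2) \<le> sqn f"
proof -
  have m: "\<phi> j \<in> H" for j using assms(1) by (simp add: orthonormal_family_def)
  have z: "ip f (\<phi> j) = 0" if "j \<notin> J" for j
    using assms(1,3) that ip_zero[of f] ip_cnj[OF zero_mem, of f] by (simp add: orthonormal_family_def)
  let ?a = "\<lambda>j. ip f (\<phi> j)"
  have "0 \<le> sqn (form_diff f (form_comb F ?a \<phi>))" by (intro sqn_nonneg diff_mem assms comb_mem m)
  also have "\<dots> = sqn f - 2 * Re (ip f (form_comb F ?a \<phi>)) + sqn (form_comb F ?a \<phi>)"
    by (intro sqn_diff assms comb_mem m)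
  also have "ip f (form_comb F ?a \<phi>) = of_real (\<Sum>j\<in>F. (cmod (?a j))\<^sup>2)"
    by (simp only: ip_comb_right[OF assms(2) m assms(3)]) (simp add: of_real_cmod_square mult.commute)
  also have "sqn (form_comb F ?a \<phi>) = (\<Sum>j\<in>F. (cmod (?a j))\<^sup>2)"
    unfolding sqn_comb[OF assms(1,2)] using assms(2) z by (intro sum.mono_neutral_left) auto
  finally show ?thesis by simp
qed

lemma norm_limit_eval:
  assumes s: "\<And>m. s m \<in> H" and f: "f \<in> H"
    and lim: "\<And>e. e > 0 ==> \<exists>K. \<forall>m\<ge>K. sqn (form_diff (s m) f) < e"
  shows "(\<lambda>m. s m c z) \<longlonglongrightarrow> f c z" and "\<And>g. g \<in> H ==> (\<lambda>m. ip (s m) g) \<longlonglongrightarrow> ip f g"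
    and "\<And>l C. (\<And>g. g \<in> H ==> (cmod (l g))\<^sup>2 \<le> C * sqn g) ==>
        (\<And>g h. g \<in> H ==> h \<in> H ==> l (form_diff g h) = l g - l h) ==> (\<lambda>m. l (s m)) \<longlonglongrightarrow> l f"
proof -
  show gen: "(\<lambda>m. l (s m)) \<longlonglongrightarrow> l f" if l: "\<And>g. g \<in> H ==> (cmod (l g))\<^sup>2 \<le> C * sqn g"
    and d: "\<And>g h. g \<in> H ==> h \<in> H ==> l (form_diff g h) = l g - l h" for l :: "('c \<Rightarrow> 'z \<Rightarrow> complex) \<Rightarrow> complex" and C
  proof (rule LIMSEQ_I)
    fix e :: real assume e: "e > 0"
    then have "e\<^sup>2 / (\<bar>C\<bar> + 1) > 0" by (simp add: add_nonneg_pos)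
    from lim[OF this] obtain K where K: "\<And>m. m \<ge> K ==> sqn (form_diff (s m) f) < e\<^sup>2 / (\<bar>C\<bar> + 1)" by blast
    show "\<exists>K. \<forall>m\<ge>K. norm (l (s m) - l f) < e"
    proof (intro exI[of _ K] allI impI)
      fix m assume "K \<le> m"
      have n0: "0 \<le> sqn (form_diff (s m) f)" by (intro sqn_nonneg diff_mem s f)
      have "(cmod (l (s m) - l f))\<^sup>2 \<le> C * sqn (form_diff (s m) f)"
        using l[OF diff_mem[OF s[of m] f]] d[OF s[of m] f] by simp
      also have "\<dots> \<le> (\<bar>C\<bar> + 1) * sqn (form_diff (s m) f)" using n0 by (intro mult_right_mono) auto
      also have "\<dots> < (\<bar>C\<bar> + 1) * (e\<^sup>2 / (\<bar>C\<bar> + 1))" using K[OF \<open>K \<le> m\<close>] by (intro mult_strict_left_mono) auto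
      also have "\<dots> = e\<^sup>2" by (simp add: add_nonneg_eq_0_iff)
      finally show "norm (l (s m) - l f) < e" using e by (simp add: power2_less_imp_less)
    qed
  qed
  obtain C where "\<And>g. g \<in> H ==> (cmod (g c z))\<^sup>2 \<le> C * sqn g" using eval_bound[of c z] unfolding sqn_def by blast
  then show "(\<lambda>m. s m c z) \<longlonglongrightarrow> f c z" by (rule gen[of "\<lambda>g. g c z" C]) simp_all
  show "(\<lambda>m. ip (s m) g) \<longlonglongrightarrow> ip f g" if "g \<in> H" for g
  proof (rule gen[of "\<lambda>f. ip f g" "sqn g"])
    show "(cmod (ip h g))\<^sup>2 \<le> sqn g * sqn h" if "h \<in> H" for h
      using cauchy_schwarz[OF that \<open>g \<in> H\<close>] by (simp only: mult.commute)
    show "ip (form_diff h k) g = ip h g - ip k g" if "h \<in> H" "k \<in> H" for h k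
      by (rule ip_diff[OF that \<open>g \<in> H\<close>])
  qed
qed

lemma riesz_fischer:
  assumes on: "orthonormal_family J \<phi>" and sm: "summable (\<lambda>j. (cmod (a j))\<^sup>2)"
  obtains f where "f \<in> H" "\<And>j. j \<in> J ==> ip f (\<phi> j) = a j" "\<And>c z. (\<lambda>j. a j * \<phi> j c z) sums f c z"
    "\<And>e. e > 0 ==> \<exists>K. \<forall>m\<ge>K. sqn (form_diff (form_comb {..<m} a \<phi>) f) < e"
proof -
  have m: "\<phi> j \<in> H" for j using on by (simp add: orthonormal_family_def)
  have o: "ip (\<phi> i) (\<phi> j) = (if i = j \<and> i \<in> J then 1 else 0)" for i j
    using on by (simp add: orthonormal_family_def)
  define s where "s = (\<lambda>m. form_comb {..<m} a \<phi>)"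
  have sH: "s m \<in> H" for m unfolding s_def by (intro comb_mem m)
  have wlog: "sqn (form_diff (s p) (s q)) \<le> (\<Sum>j\<in>{q..<p}. (cmod (a j))\<^sup>2)" if "q \<le> p" for p q
  proof -
    have "form_diff (s p) (s q) = form_comb {q..<p} a \<phi>"
      using that by (auto simp: s_def fun_eq_iff lessThan_atLeast0 sum_diff_nat_ivl)
    then have "sqn (form_diff (s p) (s q)) = (\<Sum>j\<in>{q..<p} \<inter> J. (cmod (a j))\<^sup>2)"
      using sqn_comb[OF on, of "{q..<p}" a] by simp
    also have "\<dots> \<le> (\<Sum>j\<in>{q..<p}. (cmod (a j))\<^sup>2)" by (intro sum_mono2) auto
    finally show ?thesis .
  qed
  have sym: "sqn (form_diff (s p) (s q)) = sqn (form_diff (s q) (s p))" for p q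
    using sqn_diff[OF sH[of p] sH[of q]] sqn_diff[OF sH[of q] sH[of p]] ip_cnj[OF sH[of p] sH[of q]] by simp
  have "\<exists>f\<in>H. \<forall>e>0. \<exists>K. \<forall>m\<ge>K. Re (ip (form_diff (s m) f) (form_diff (s m) f)) < e"
  proof (rule norm_complete[OF sH])
    fix e :: real assume e: "e > 0"
    from sm[unfolded summable_Cauchy] e obtain K where
      K: "\<And>m n. m \<ge> K ==> norm (\<Sum>j\<in>{m..<n}. (cmod (a j))\<^sup>2) < e" by blast
    show "\<exists>K. \<forall>m\<ge>K. \<forall>k\<ge>K. Re (ip (form_diff (s m) (s k)) (form_diff (s m) (s k))) < e"
    proof (intro exI[of _ K] allI impI)
      fix p q assume "K \<le> p" "K \<le> q"
      then have "sqn (form_diff (s p) (s q)) < e"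
        using wlog[of p q] wlog[of q p] K[of p q] K[of q p] sym[of p q]
        by (cases "p \<le> q") (auto intro: le_less_trans)
      then show "Re (ip (form_diff (s p) (s q)) (form_diff (s p) (s q))) < e" by (simp add: sqn_def)
    qed
  qed
  then obtain f where f: "f \<in> H" and lim: "\<And>e. e > 0 ==> \<exists>K. \<forall>m\<ge>K. sqn (form_diff (s m) f) < e"
    unfolding sqn_def by blast
  show thesis
  proof (rule that[OF f])
    fix j assume j: "j \<in> J"
    have "(\<lambda>m. ip (s m) (\<phi> j)) \<longlonglongrightarrow> ip f (\<phi> j)" by (rule norm_limit_eval(2)[OF sH f lim m])
    moreover have "(\<lambda>m. ip (s m) (\<phi> j)) \<longlonglongrightarrow> a j"
    proof (rule tendsto_eventually)
      show "\<forall>\<^sub>F m in sequentially. ip (s m) (\<phi> j) = a j"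
        using eventually_gt_at_top[of j]
      proof eventually_elim
        case (elim k)
        have "ip (s k) (\<phi> j) = (\<Sum>i<k. a i * ip (\<phi> i) (\<phi> j))" unfolding s_def by (rule ip_comb) (auto simp: m)
        also have "\<dots> = (\<Sum>i<k. if i = j then a j else 0)" by (intro sum.cong refl) (use j in \<open>auto simp: o\<close>)
        finally show ?case using elim by simp
      qed
    qed
    ultimately show "ip f (\<phi> j) = a j" by (rule LIMSEQ_unique)
  next
    show "(\<lambda>j. a j * \<phi> j c z) sums f c z" for c z
      using norm_limit_eval(1)[OF sH f lim, of c z] by (simp add: sums_def s_def)
  next
    show "\<exists>K. \<forall>m\<ge>K. sqn (form_diff (form_comb {..<m} a \<phi>) f) < e" if "e > 0" for e
      using lim[OF that] by (simp add: s_def)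
  qed
qed

definition orthonormal_basis :: "nat set \<Rightarrow> (nat \<Rightarrow> 'c \<Rightarrow> 'z \<Rightarrow> complex) \<Rightarrow> bool" where
  "orthonormal_basis J \<phi> \<longleftrightarrow> orthonormal_family J \<phi> \<and> (\<forall>g\<in>H. (\<forall>j. ip g (\<phi> j) = 0) \<longrightarrow> g = zero_form)"

lemma summable_bessel:
  assumes "orthonormal_family J \<phi>" "f \<in> H"
  shows "summable (\<lambda>j. (cmod (ip f (\<phi> j)))\<^sup>2)" "(\<Sum>j. (cmod (ip f (\<phi> j)))\<^sup>2) \<le> sqn f"
proof -
  show "summable (\<lambda>j. (cmod (ip f (\<phi> j)))\<^sup>2)"
    by (rule summableI_nonneg_bounded[of _ "sqn f"]) (use bessel[OF assms(1) _ assms(2)] in auto)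
  then show "(\<Sum>j. (cmod (ip f (\<phi> j)))\<^sup>2) \<le> sqn f"
    by (rule suminf_le_const) (use bessel[OF assms(1) _ assms(2)] in auto)
qed

lemma basis_expansion:
  assumes b: "orthonormal_basis J \<phi>" and f: "f \<in> H"
  shows "(\<lambda>j. ip f (\<phi> j) * \<phi> j c z) sums f c z"
    "e > 0 ==> \<exists>K. \<forall>m\<ge>K. sqn (form_diff (form_comb {..<m} (\<lambda>j. ip f (\<phi> j)) \<phi>) f) < e"
proof -
  have on: "orthonormal_family J \<phi>" using b by (simp add: orthonormal_basis_def)
  have m: "\<phi> j \<in> H" for j using on by (simp add: orthonormal_family_def)
  obtain g where g: "g \<in> H" "\<And>j. j \<in> J ==> ip g (\<phi> j) = ip f (\<phi> j)"
    "\<And>c z. (\<lambda>j. ip f (\<phi> j) * \<phi> j c z) sums g c z"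
    "\<And>e. e > 0 ==> \<exists>K. \<forall>m\<ge>K. sqn (form_diff (form_comb {..<m} (\<lambda>j. ip f (\<phi> j)) \<phi>) g) < e"
    using riesz_fischer[OF on summable_bessel(1)[OF on f]] by blast
  have "ip (form_diff g f) (\<phi> j) = 0" for j
  proof (cases "j \<in> J")
    case True
    then show ?thesis using g f m by (simp add: ip_diff)
  next
    case False
    then have "\<phi> j = zero_form" using on by (simp add: orthonormal_family_def)
    then show ?thesis using ip_cnj[OF zero_mem diff_mem[OF g(1) f]] ip_zero[OF diff_mem[OF g(1) f]] by simp
  qed
  then have "form_diff g f = zero_form"
    using b diff_mem[OF g(1) f] by (simp add: orthonormal_basis_def)
  then have "g = f" by (auto simp: fun_eq_iff)
  then show "(\<lambda>j. ip f (\<phi> j) * \<phi> j c z) sums f c z"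
    "e > 0 ==> \<exists>K. \<forall>m\<ge>K. sqn (form_diff (form_comb {..<m} (\<lambda>j. ip f (\<phi> j)) \<phi>) f) < e"
    using g(3,4) by auto
qed

text \<open>
  The element is the sum of the basis vectors, weighted by the conjugate values of the functional.
\<close>

lemma riesz:
  assumes b: "orthonormal_basis J \<phi>"
    and l_add: "\<And>f g. f \<in> H ==> g \<in> H ==> l (form_add f g) = l f + l g"
    and l_scale: "\<And>f a. f \<in> H ==> l (form_scale a f) = a * l f"
    and l_bound: "\<And>f. f \<in> H ==> (cmod (l f))\<^sup>2 \<le> C * sqn f"
  obtains e where "e \<in> H" "\<And>f. f \<in> H ==> ip f e = l f"
proof -
  have on: "orthonormal_family J \<phi>" using b by (simp add: orthonormal_basis_def)
  have m: "\<phi> j \<in> H" for j using on by (simp add: orthonormal_family_def)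
  have l0: "l zero_form = 0" using l_scale[OF zero_mem, of 0] by simp
  have l_diff: "l (form_diff f g) = l f - l g" if "f \<in> H" "g \<in> H" for f g
    using l_add[OF that(1) scale_mem[OF that(2), of "-1"]] l_scale[OF that(2), of "-1"] by simp
  have l_comb: "l (form_comb F a \<phi>) = (\<Sum>j\<in>F. a j * l (\<phi> j))" if "finite F" for F a
    using that
  proof (induction F rule: finite_induct)
    case (insert j F)
    then show ?case using l_add[OF scale_mem[OF m, of "a j" j] comb_mem[of F \<phi> a]] m by (simp add: l_scale)
  qed (simp add: l0)
  let ?a = "\<lambda>j. cnj (l (\<phi> j))"
  have bd: "(\<Sum>j\<in>F. (cmod (?a j))\<^sup>2) \<le> \<bar>C\<bar>" if F: "finite F" for F
  proof -
    define S where "S = (\<Sum>j\<in>F. (cmod (?a j))\<^sup>2)"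
    have S0: "S \<ge> 0" by (simp add: S_def sum_nonneg)
    have "l (form_comb F ?a \<phi>) = of_real S"
      using F by (simp add: l_comb S_def of_real_cmod_square mult.commute)
    then have "S\<^sup>2 \<le> C * sqn (form_comb F ?a \<phi>)"
      using l_bound[OF comb_mem[of F \<phi> ?a]] m S0 by simp
    also have "sqn (form_comb F ?a \<phi>) = S"
      unfolding S_def sqn_comb[OF on F] 
    proof (rule sum.mono_neutral_left)
      show "\<forall>i\<in>F - F \<inter> J. (cmod (cnj (l (\<phi> i))))\<^sup>2 = 0"
      proof
        fix i assume "i \<in> F - F \<inter> J"
        then have "\<phi> i = zero_form" using on by (simp add: orthonormal_family_def)
        then show "(cmod (cnj (l (\<phi> i))))\<^sup>2 = 0" using l0 by simp
      qed
    qed (use F in auto)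
    finally have "S * S \<le> C * S" by (simp add: power2_eq_square)
    then show ?thesis using S0 unfolding S_def[symmetric]
      by (cases "S = 0") auto
  qed
  have sm: "summable (\<lambda>j. (cmod (?a j))\<^sup>2)"
    by (rule summableI_nonneg_bounded[of _ "\<bar>C\<bar>"]) (use bd in auto)
  obtain e where e: "e \<in> H" "\<And>j. j \<in> J ==> ip e (\<phi> j) = ?a j"
    using riesz_fischer[OF on sm] by metis
  have ej: "ip (\<phi> j) e = l (\<phi> j)" for j
  proof (cases "j \<in> J")
    case True
    then show ?thesis using e(2)[OF True] ip_cnj[OF e(1) m, of j] by simp
  next
    case False
    then have "\<phi> j = zero_form" using on by (simp add: orthonormal_family_def)
    then show ?thesis using l0 ip_zero[OF e(1)] by simp
  qed
  have "ip f e = l f" if f: "f \<in> H" for f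
  proof (rule LIMSEQ_unique)
    let ?s = "\<lambda>k. form_comb {..<k} (\<lambda>j. ip f (\<phi> j)) \<phi>"
    have sH: "?s k \<in> H" for k by (intro comb_mem m)
    show "(\<lambda>k. ip (?s k) e) \<longlonglongrightarrow> ip f e"
      by (rule norm_limit_eval(2)[OF sH f basis_expansion(2)[OF b f] e(1)])
    have "(\<lambda>k. l (?s k)) \<longlonglongrightarrow> l f"
      by (rule norm_limit_eval(3)[OF sH f basis_expansion(2)[OF b f] l_bound l_diff])
    moreover have "l (?s k) = ip (?s k) e" for k
      using e(1) m by (simp add: l_comb ip_comb ej)
    ultimately show "(\<lambda>k. ip (?s k) e) \<longlonglongrightarrow> l f" by simp
  qed
  then show thesis using that e(1) by blast
qed

text \<open>
  A maximal orthonormal set exists by Zorn's lemma. It is countable: by Bessel's inequality for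
  the functional representing a point evaluation, only countably many of its elements are nonzero
  at a given point, and countably many points detect all elements.
\<close>

lemma evaluation_bessel:
  assumes O: "finite F" "F \<subseteq> H" "\<And>f g. f \<in> F ==> g \<in> F ==> ip f g = (if f = g then 1 else 0)"
    and C: "\<And>f. f \<in> H ==> (cmod (f c z))\<^sup>2 \<le> C * sqn f"
  shows "(\<Sum>f\<in>F. (cmod (f c z))\<^sup>2) \<le> \<bar>C\<bar>"
proof -
  define S where "S = (\<Sum>f\<in>F. (cmod (f c z))\<^sup>2)"
  have S0: "S \<ge> 0" by (simp add: S_def sum_nonneg)
  let ?g = "form_comb F (\<lambda>f. cnj (f c z)) (\<lambda>f. f)"
  have gH: "?g \<in> H" by (rule comb_mem) (use O in auto)
  have "?g c z = of_real S" by (simp add: S_def of_real_cmod_square mult.commute)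
  have "ip ?g ?g = (\<Sum>f\<in>F. cnj (f c z) * (\<Sum>g\<in>F. g c z * ip f g))"
    using O gH by (simp add: ip_comb ip_comb_right subset_iff)
  also have "\<dots> = (\<Sum>f\<in>F. cnj (f c z) * f c z)"
  proof (rule sum.cong[OF refl])
    fix f assume f: "f \<in> F"
    have "(\<Sum>g\<in>F. g c z * ip f g) = (\<Sum>g\<in>F. if g = f then f c z else 0)"
      by (intro sum.cong refl) (auto simp: O(3)[OF f])
    then show "cnj (f c z) * (\<Sum>g\<in>F. g c z * ip f g) = cnj (f c z) * f c z" using f O(1) by simp
  qed
  also have "\<dots> = of_real S" by (simp add: S_def of_real_cmod_square mult.commute)
  finally have "sqn ?g = S" by (simp add: sqn_def)
  then have "S * S \<le> C * S"
    using C[OF gH] \<open>?g c z = of_real S\<close> S0 by (simp add: power2_eq_square)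
  then show ?thesis using S0 unfolding S_def[symmetric] by (cases "S = 0") auto
qed

definition orthonormal_set :: "('c \<Rightarrow> 'z \<Rightarrow> complex) set \<Rightarrow> bool" where
  "orthonormal_set S \<longleftrightarrow> S \<subseteq> H \<and> (\<forall>f\<in>S. \<forall>g\<in>S. ip f g = (if f = g then 1 else 0))"

lemma maximal_orthonormal_set:
  obtains S where "orthonormal_set S" "\<And>g. g \<in> H ==> (\<And>f. f \<in> S ==> ip g f = 0) ==> g = zero_form"
proof -
  have "\<exists>S\<in>{S. orthonormal_set S}. \<forall>X\<in>{S. orthonormal_set S}. S \<subseteq> X \<longrightarrow> X = S"
  proof (rule subset_Zorn')
    fix C assume C: "subset.chain {S. orthonormal_set S} C"
    have "ip f g = (if f = g then 1 else 0)" if fg: "f \<in> \<Union>C" "g \<in> \<Union>C" for f g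
    proof -
      obtain X Y where "X \<in> C" "f \<in> X" "Y \<in> C" "g \<in> Y" using fg by blast
      then obtain Z where "Z \<in> C" "f \<in> Z" "g \<in> Z"
        using C unfolding subset_chain_def by blast
      moreover have "orthonormal_set Z" using \<open>Z \<in> C\<close> C unfolding subset_chain_def by blast
      ultimately show ?thesis by (simp add: orthonormal_set_def)
    qed
    moreover have "\<Union>C \<subseteq> H" using C unfolding subset_chain_def orthonormal_set_def by blast
    ultimately show "\<Union>C \<in> {S. orthonormal_set S}" by (simp add: orthonormal_set_def)
  qed
  then obtain S where S: "orthonormal_set S" "\<And>X. orthonormal_set X ==> S \<subseteq> X ==> X = S" by blast
  show thesis
  proof (rule that[OF S(1)])
    fix g assume g: "g \<in> H" "\<And>f. f \<in> S ==> ip g f = 0"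
    show "g = zero_form"
    proof (rule ccontr)
      assume "g \<noteq> zero_form"
      then have pos: "sqn g > 0" using eq_zero_if_sqn_zero[OF g(1)] sqn_nonneg[OF g(1)] by fastforce
      define h where "h = form_scale (of_real (1 / sqrt (sqn g))) g"
      have h: "h \<in> H" unfolding h_def by (rule scale_mem[OF g(1)])
      have hh: "ip h h = 1"
      proof -
        define a where "a = complex_of_real (1 / sqrt (sqn g))"
        have "ip h h = a * (cnj a * ip g g)"
          unfolding h_def a_def[symmetric]
          using ip_scale[OF g(1) scale_mem[OF g(1)], of a a] ip_scale_right[OF g(1) g(1), of a] by simp
        also have "\<dots> = of_real (1 / sqrt (sqn g) * (1 / sqrt (sqn g)) * sqn g)"
          by (simp only: a_def ip_self[OF g(1)] complex_cnj_complex_of_real of_real_mult mult.assoc)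
        also have "1 / sqrt (sqn g) * (1 / sqrt (sqn g)) * sqn g = 1" using pos by (simp add: field_simps)
        finally show ?thesis by simp
      qed
      have hf: "ip h f = 0 \<and> ip f h = 0" if "f \<in> S" for f
      proof -
        have "f \<in> H" using that S(1) by (auto simp: orthonormal_set_def)
        then have "ip h f = 0" unfolding h_def using ip_scale[OF g(1)] g(2)[OF that] by (simp only: mult_zero_right)
        then show ?thesis using ip_cnj[OF h \<open>f \<in> H\<close>] by simp
      qed
      have "h \<notin> S" using hf[of h] hh by auto
      moreover have "orthonormal_set (insert h S)"
        using S(1) h hh hf \<open>h \<notin> S\<close> unfolding orthonormal_set_def by auto
      ultimately show False using S(2)[of "insert h S"] by blast
    qed
  qed
qed

lemma orthonormal_set_countable:
  assumes S: "orthonormal_set S" shows "countable S"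
proof -
  obtain D where D: "countable D" "\<And>f. f \<in> H ==> (\<forall>(c, z)\<in>D. f c z = 0) ==> f = zero_form"
    using separable by blast
  have cnt: "countable {f \<in> S. f c z \<noteq> 0}" for c z
  proof -
    obtain C where C: "\<And>f. f \<in> H ==> (cmod (f c z))\<^sup>2 \<le> C * sqn f"
      using eval_bound[of c z] unfolding sqn_def by blast
    have fin: "finite {f \<in> S. (cmod (f c z))\<^sup>2 > 1 / real (Suc k)}" for k
    proof (rule ccontr)
      assume "infinite {f \<in> S. (cmod (f c z))\<^sup>2 > 1 / real (Suc k)}"
      moreover obtain m :: nat where m: "real m > \<bar>C\<bar> * real (Suc k)" using reals_Archimedean2 by blast
      ultimately obtain F where F: "finite F" "card F = m" "F \<subseteq> {f \<in> S. (cmod (f c z))\<^sup>2 > 1 / real (Suc k)}"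
        using infinite_arbitrarily_large by blast
      have "real m * (1 / real (Suc k)) = (\<Sum>f\<in>F. 1 / real (Suc k))" using F by simp
      also have "\<dots> \<le> (\<Sum>f\<in>F. (cmod (f c z))\<^sup>2)" using F(3) by (intro sum_mono) auto
      also have "\<dots> \<le> \<bar>C\<bar>"
        by (rule evaluation_bessel[OF F(1) _ _ C]) (use F(3) S in \<open>unfold orthonormal_set_def, blast+\<close>)
      finally have "real m \<le> \<bar>C\<bar> * real (Suc k)" by (simp add: divide_simps)
      then show False using m by simp
    qed
    have "{f \<in> S. f c z \<noteq> 0} = (\<Union>k. {f \<in> S. (cmod (f c z))\<^sup>2 > 1 / real (Suc k)})"
    proof (intro equalityI subsetI)
      fix f assume f: "f \<in> {f \<in> S. f c z \<noteq> 0}"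
      then have "(cmod (f c z))\<^sup>2 > 0" by simp
      then obtain k where "inverse (real (Suc k)) < (cmod (f c z))\<^sup>2" using reals_Archimedean by blast
      then show "f \<in> (\<Union>k. {f \<in> S. (cmod (f c z))\<^sup>2 > 1 / real (Suc k)})" using f by (auto simp: inverse_eq_divide)
    next
      fix f assume "f \<in> (\<Union>k. {f \<in> S. (cmod (f c z))\<^sup>2 > 1 / real (Suc k)})"
      then obtain k where "f \<in> S" "(cmod (f c z))\<^sup>2 > 1 / real (Suc k)" by blast
      moreover have "1 / real (Suc k) > 0" by simp
      ultimately have "(cmod (f c z))\<^sup>2 > 0" by linarith
      then show "f \<in> {f \<in> S. f c z \<noteq> 0}" using \<open>f \<in> S\<close> by auto
    qed
    then show ?thesis using fin by (simp add: countable_finite)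
  qed
  have "S \<subseteq> (\<Union>(c, z)\<in>D. {f \<in> S. f c z \<noteq> 0})"
  proof
    fix f assume f: "f \<in> S"
    have "f \<noteq> zero_form"
    proof
      assume "f = zero_form"
      then have "ip f f = 0" using ip_zero[OF zero_mem] by simp
      moreover have "ip f f = 1" using f S by (simp add: orthonormal_set_def)
      ultimately show False by simp
    qed
    moreover have "f \<in> H" using f S by (auto simp: orthonormal_set_def)
    ultimately obtain c z where "(c, z) \<in> D" "f c z \<noteq> 0" using D(2)[of f] by blast
    then show "f \<in> (\<Union>(c, z)\<in>D. {f \<in> S. f c z \<noteq> 0})" using f by blast
  qed
  moreover have "countable (\<Union>(c, z)\<in>D. {f \<in> S. f c z \<noteq> 0})"
    using D(1) cnt by (intro countable_UN) auto
  ultimately show ?thesis by (rule countable_subset)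
qed

lemma orthonormal_sequence_exists:
  obtains N :: enat and f :: "nat \<Rightarrow> 'c \<Rightarrow> 'z \<Rightarrow> complex" where
    "\<And>j. enat j < N ==> f j \<in> H"
    "\<And>i j. enat i < N ==> enat j < N ==> ip (f i) (f j) = (if i = j then 1 else 0)"
    "\<And>g. g \<in> H ==> (\<And>j. enat j < N ==> ip g (f j) = 0) ==> g = zero_form"
proof -
  obtain S where S: "orthonormal_set S" "\<And>g. g \<in> H ==> (\<And>f. f \<in> S ==> ip g f = 0) ==> g = zero_form"
    using maximal_orthonormal_set by blast
  have "\<exists>N f. bij_betw f {j. enat j < N} S"
  proof (cases "finite S")
    case True
    then obtain f where "bij_betw f {0..<card S} S" using ex_bij_betw_nat_finite by blast
    moreover have "{j. enat j < enat (card S)} = {0..<card S}" by auto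
    ultimately show ?thesis by metis
  next
    case False
    then have "bij_betw (from_nat_into S) UNIV S"
      using orthonormal_set_countable[OF S(1)] by (rule bij_betw_from_nat_into[rotated])
    moreover have "{j. enat j < \<infinity>} = UNIV" by auto
    ultimately show ?thesis by metis
  qed
  then obtain N f where f: "bij_betw f {j. enat j < N} S" by blast
  then have inS: "f j \<in> S" if "enat j < N" for j using that by (auto simp: bij_betw_def)
  show thesis
  proof (rule that[of N f])
    show "f j \<in> H" if "enat j < N" for j using inS[OF that] S(1) by (auto simp: orthonormal_set_def)
    show "ip (f i) (f j) = (if i = j then 1 else 0)" if "enat i < N" "enat j < N" for i j
    proof -
      have "f i = f j \<longleftrightarrow> i = j" using f that by (auto simp: bij_betw_def inj_on_def)
      then show ?thesis using inS[OF that(1)] inS[OF that(2)] S(1) by (simp add: orthonormal_set_def)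
    qed
    show "g = zero_form" if "g \<in> H" "\<And>j. enat j < N ==> ip g (f j) = 0" for g
    proof (rule S(2)[OF that(1)])
      fix h assume "h \<in> S"
      then obtain j where "enat j < N" "h = f j" using f by (auto simp: bij_betw_def)
      then show "ip g h = 0" using that(2) by simp
    qed
  qed
qed

end

section \<open>Charts and forms\<close>

lemma complex_jacobian_compose:
  fixes \<sigma> \<tau> :: "complex ^ 'n \<Rightarrow> complex ^ 'n"
  assumes \<sigma>: "\<And>k. holomorphic_Cn_on (\<lambda>z. \<sigma> z $ k) S" "open S"
    and \<tau>: "\<And>k. holomorphic_Cn_on (\<lambda>z. \<tau> z $ k) T" "open T" and "\<sigma> ` S \<subseteq> T" "z \<in> S"
  shows "complex_jacobian (\<lambda>z. \<tau> (\<sigma> z)) z = complex_jacobian \<tau> (\<sigma> z) ** complex_jacobian \<sigma> z"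
  using holomorphic_Cn_compose(2)[OF \<sigma> \<tau> assms(5,6)]
  by (simp add: complex_jacobian_def matrix_matrix_mult_def vec_eq_iff)

lemma complex_jacobian_cong:
  assumes "open S" "z \<in> S" "\<And>w. w \<in> S ==> \<sigma> w = \<tau> w"
  shows "complex_jacobian \<sigma> z = complex_jacobian \<tau> z"
proof -
  have "wirtinger j (\<lambda>w. \<sigma> w $ i) z = wirtinger j (\<lambda>w. \<tau> w $ i) z" for i j
    by (rule wirtinger_cong(1)[OF assms(1,2)]) (simp add: assms(3))
  then show ?thesis by (simp add: complex_jacobian_def)
qed

lemma complex_jacobian_id: "complex_jacobian (\<lambda>z. z) z = mat 1"
  by (simp add: complex_jacobian_def wirtinger_component mat_def vec_eq_iff)

locale holomorphic_atlas =
  fixes M :: "'a topology" and A :: "('a, 'n::finite) chart set"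
  assumes manifold: "complex_manifold M A"
begin

lemma chart_domain: "c \<in> A ==> openin M (fst c)" "c \<in> A ==> open (chart_image c)"
  and chart_homeo: "c \<in> A ==> homeomorphic_map (subtopology M (fst c)) (top_of_set (chart_image c)) (snd c)"
  using manifold unfolding complex_manifold_def chart_image_def by (auto simp: case_prod_beta)

lemma chart_subset: "c \<in> A ==> fst c \<subseteq> topspace M"
  using chart_domain(1) openin_subset by blast

lemma chart_inj: "c \<in> A ==> inj_on (snd c) (fst c)"
  using homeomorphic_imp_injective_map[OF chart_homeo[of c]] chart_subset[of c] by (simp add: Int_absorb1)

lemma charts_cover: "x \<in> topspace M ==> \<exists>c\<in>A. x \<in> fst c"
  using manifold unfolding complex_manifold_def by blast

lemma chart_image_mem [simp]: "x \<in> fst c ==> snd c x \<in> chart_image c"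
  by (simp add: chart_image_def)

lemma chart_inv_snd [simp]: "c \<in> A ==> x \<in> fst c ==> chart_inv c (snd c x) = x"
  by (simp add: chart_inv_def chart_inj)

lemma open_snd_image:
  assumes "c \<in> A" "openin M W" "W \<subseteq> fst c" shows "open (snd c ` W)"
proof -
  have "openin (subtopology M (fst c)) W" using assms by (simp add: openin_subtopology_self openin_subset_topspace_eq openin_open_subtopology chart_domain)
  then have "openin (top_of_set (chart_image c)) (snd c ` W)"
    using homeomorphic_imp_open_map[OF chart_homeo[OF assms(1)]] by (simp add: open_map_def)
  then show ?thesis using chart_domain(2)[OF assms(1)] by (simp add: openin_open_eq)
qed

lemma openin_snd_vimage:
  assumes "c \<in> A" "open S" shows "openin M {x \<in> fst c. snd c x \<in> S}"
proof -
  have "continuous_map (subtopology M (fst c)) (top_of_set (chart_image c)) (snd c)"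
    using homeomorphic_imp_continuous_map[OF chart_homeo[OF assms(1)]] .
  then have "continuous_map (subtopology M (fst c)) euclidean (snd c)"
    by (simp add: continuous_map_in_subtopology)
  then have "openin (subtopology M (fst c)) {x \<in> topspace (subtopology M (fst c)). snd c x \<in> S}"
    using assms(2) by (intro openin_continuous_map_preimage) auto
  moreover have "{x \<in> topspace (subtopology M (fst c)). snd c x \<in> S} = {x \<in> fst c. snd c x \<in> S}"
    using chart_subset[OF assms(1)] by auto
  ultimately show ?thesis
    by (simp only: openin_open_subtopology[OF chart_domain(1)[OF assms(1)]])
qed

definition overlap :: "('a, 'n) chart \<Rightarrow> ('a, 'n) chart \<Rightarrow> (complex ^ 'n) set" where
  "overlap c d = snd c ` (fst c \<inter> fst d)"

lemma overlap_open: "c \<in> A ==> d \<in> A ==> open (overlap c d)"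
  unfolding overlap_def by (rule open_snd_image) (auto intro: openin_Int chart_domain(1) simp del: split_paired_All)

lemma overlap_subset: "overlap c d \<subseteq> chart_image c"
  by (auto simp: overlap_def chart_image_def)

lemma transition_snd [simp]: "c \<in> A ==> x \<in> fst c ==> transition c d (snd c x) = snd d x"
  by (simp add: transition_def)

lemma transition_holomorphic:
  "c \<in> A ==> d \<in> A ==> holomorphic_Cn_on (\<lambda>z. transition c d z $ i) (overlap c d)"
  using manifold unfolding complex_manifold_def overlap_def by blast

lemma transition_image: "c \<in> A ==> transition c d ` overlap c d = overlap d c"
  by (force simp: overlap_def)

lemma transition_inverse: "c \<in> A ==> d \<in> A ==> z \<in> overlap c d ==> transition d c (transition c d z) = z"
  by (auto simp: overlap_def)

lemma transition_jacobian_inverse: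
  assumes "c \<in> A" "d \<in> A" "z \<in> overlap c d"
  shows "complex_jacobian (transition d c) (transition c d z) ** complex_jacobian (transition c d) z = mat 1"
proof -
  have "complex_jacobian (\<lambda>z. transition d c (transition c d z)) z =
      complex_jacobian (transition d c) (transition c d z) ** complex_jacobian (transition c d) z"
    using assms by (intro complex_jacobian_compose[where T = "overlap d c" and S = "overlap c d"])
      (auto simp: transition_holomorphic overlap_open transition_image)
  moreover have "complex_jacobian (\<lambda>z. transition d c (transition c d z)) z = complex_jacobian (\<lambda>z. z) z"
    using assms by (intro complex_jacobian_cong[OF overlap_open[of c d]]) (auto simp: transition_inverse)
  ultimately show ?thesis by (simp add: complex_jacobian_id)
qed

lemma transition_det_nonzero:
  assumes "c \<in> A" "d \<in> A" "z \<in> overlap c d"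
  shows "det (complex_jacobian (transition c d) z) \<noteq> 0"
proof
  assume "det (complex_jacobian (transition c d) z) = 0"
  then have "det (mat 1 :: complex ^ 'n ^ 'n) = 0"
    using transition_jacobian_inverse[OF assms, symmetric] by (simp add: det_mul)
  then show False by simp
qed

text \<open>A set that propagates through every coordinate ball it meets is the whole manifold.\<close>

lemma chart_continuation:
  assumes Q: "openin M Q" "Q \<noteq> {}"
    and step: "\<And>c z r x. c \<in> A ==> ball z r \<subseteq> chart_image c ==> x \<in> Q ==> x \<in> fst c ==> snd c x \<in> ball z r ==>
       {y \<in> fst c. snd c y \<in> ball z r} \<subseteq> Q"
  shows "Q = topspace M"
proof -
  have "openin M (topspace M - Q)"
  proof (subst openin_subopen, intro ballI)
    fix x assume x: "x \<in> topspace M - Q"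
    obtain c where c: "c \<in> A" "x \<in> fst c" using charts_cover x by blast
    obtain r where r: "r > 0" "ball (snd c x) r \<subseteq> chart_image c"
      by (rule openE[OF chart_domain(2)[OF c(1)] chart_image_mem[OF c(2)]])
    let ?T = "{y \<in> fst c. snd c y \<in> ball (snd c x) r}"
    have "?T \<inter> Q = {}"
    proof (rule ccontr)
      assume "?T \<inter> Q \<noteq> {}"
      then obtain y where "y \<in> Q" "y \<in> fst c" "snd c y \<in> ball (snd c x) r" by blast
      from step[OF c(1) r(2) this] have "x \<in> Q" using c r by auto
      then show False using x by simp
    qed
    moreover have "?T \<subseteq> topspace M" using chart_subset[OF c(1)] by blast
    ultimately show "\<exists>T. openin M T \<and> x \<in> T \<and> T \<subseteq> topspace M - Q"
      using openin_snd_vimage[OF c(1) open_ball, of "snd c x" r] c r by (intro exI[of _ ?T]) auto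
  qed
  then have "closedin M Q" using Q openin_subset by (auto simp: closedin_def)
  moreover have "connected_space M" using manifold by (simp add: complex_manifold_def)
  ultimately show ?thesis using Q connected_space_clopen_in by blast
qed

lemma formD:
  assumes "f \<in> holomorphic_forms A"
  shows "c \<in> A ==> holomorphic_Cn_on (f c) (chart_image c)"
    and "c \<in> A ==> d \<in> A ==> x \<in> fst c ==> x \<in> fst d ==>
      f c (snd c x) = det (complex_jacobian (transition c d) (snd c x)) * f d (snd d x)"
    and "c \<notin> A \<or> z \<notin> chart_image c ==> f c z = 0"
proof -
  show "c \<in> A ==> holomorphic_Cn_on (f c) (chart_image c)"
    using assms unfolding holomorphic_forms_def by blast
  show "f c (snd c x) = det (complex_jacobian (transition c d) (snd c x)) * f d (snd d x)"
    if "c \<in> A" "d \<in> A" "x \<in> fst c" "x \<in> fst d"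
  proof -
    have "snd c x \<in> snd c ` (fst c \<inter> fst d)" using that by blast
    then have "f c (snd c x) = det (complex_jacobian (transition c d) (snd c x)) * f d (transition c d (snd c x))"
      using assms that(1,2) unfolding holomorphic_forms_def by blast
    then show ?thesis using that by simp
  qed
  show "c \<notin> A \<or> z \<notin> chart_image c ==> f c z = 0"
    using assms unfolding holomorphic_forms_def by blast
qed

lemma formI:
  assumes "\<And>c. c \<in> A ==> holomorphic_Cn_on (f c) (chart_image c)"
    and "\<And>c d x. c \<in> A ==> d \<in> A ==> x \<in> fst c ==> x \<in> fst d ==>
      f c (snd c x) = det (complex_jacobian (transition c d) (snd c x)) * f d (snd d x)"
    and "\<And>c z. c \<notin> A \<or> z \<notin> chart_image c ==> f c z = 0"
  shows "f \<in> holomorphic_forms A"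
  unfolding holomorphic_forms_def
proof (intro CollectI conjI ballI allI impI)
  fix c d z assume c: "c \<in> A" "d \<in> A" "z \<in> snd c ` (fst c \<inter> fst d)"
  then obtain x where x: "x \<in> fst c" "x \<in> fst d" "z = snd c x" by blast
  show "f c z = det (complex_jacobian (transition c d) z) * f d (transition c d z)"
    using assms(2)[OF c(1,2) x(1,2)] x c by simp
qed (use assms(1,3) in blast)+

lemma form_zero: "zero_form \<in> holomorphic_forms A"
  by (rule formI) simp_all

lemma form_add_mem:
  assumes f: "f \<in> holomorphic_forms A" and g: "g \<in> holomorphic_forms A"
  shows "form_add f g \<in> holomorphic_forms A"
proof (rule formI)
  show "holomorphic_Cn_on (\<lambda>z. f c z + g c z) (chart_image c)" if "c \<in> A" for c
    by (rule holomorphic_Cn_add(1)[OF formD(1)[OF f that] formD(1)[OF g that] chart_domain(2)[OF that]])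
  show "f c (snd c x) + g c (snd c x) = det (complex_jacobian (transition c d) (snd c x)) * (f d (snd d x) + g d (snd d x))"
    if "c \<in> A" "d \<in> A" "x \<in> fst c" "x \<in> fst d" for c d x
    unfolding formD(2)[OF f that] formD(2)[OF g that] by (rule distrib_left[symmetric])
  show "f c z + g c z = 0" if "c \<notin> A \<or> z \<notin> chart_image c" for c z
    using formD(3)[OF f that] formD(3)[OF g that] by simp
qed

lemma form_scale_mem:
  assumes f: "f \<in> holomorphic_forms A"
  shows "form_scale a f \<in> holomorphic_forms A"
proof (rule formI)
  show "holomorphic_Cn_on (\<lambda>z. a * f c z) (chart_image c)" if "c \<in> A" for c
    by (rule holomorphic_Cn_cmult(1)[OF formD(1)[OF f that] chart_domain(2)[OF that]])
  show "a * f c (snd c x) = det (complex_jacobian (transition c d) (snd c x)) * (a * f d (snd d x))"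
    if "c \<in> A" "d \<in> A" "x \<in> fst c" "x \<in> fst d" for c d x
    unfolding formD(2)[OF f that] by (rule mult.left_commute)
  show "a * f c z = 0" if "c \<notin> A \<or> z \<notin> chart_image c" for c z
    using formD(3)[OF f that] by simp
qed

text \<open>Forms form a module over the holomorphic functions on the manifold.\<close>

lemma form_mult_mem:
  assumes f: "f \<in> holomorphic_forms A"
    and u: "\<And>c. c \<in> A ==> holomorphic_Cn_on (u c) (chart_image c)"
      "\<And>c d x. c \<in> A ==> d \<in> A ==> x \<in> fst c ==> x \<in> fst d ==> u c (snd c x) = u d (snd d x)"
  shows "(\<lambda>c z. u c z * f c z) \<in> holomorphic_forms A"
proof (rule formI)
  show "holomorphic_Cn_on (\<lambda>z. u c z * f c z) (chart_image c)" if "c \<in> A" for c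
    by (rule holomorphic_Cn_mult(1)[OF u(1)[OF that] formD(1)[OF f that] chart_domain(2)[OF that]])
  show "u c (snd c x) * f c (snd c x) = det (complex_jacobian (transition c d) (snd c x)) * (u d (snd d x) * f d (snd d x))"
    if "c \<in> A" "d \<in> A" "x \<in> fst c" "x \<in> fst d" for c d x
    unfolding u(2)[OF that] formD(2)[OF f that] by (rule mult.left_commute)
  show "u c z * f c z = 0" if "c \<notin> A \<or> z \<notin> chart_image c" for c z
    using formD(3)[OF f that] by simp
qed

text \<open>
  Zeros of a section of a line bundle propagate: vanishing at a point does not depend on the chart,
  so the identity theorem carries it from one coordinate ball to the next.
\<close>

lemma section_identity:
  assumes f: "\<And>d. d \<in> A ==> holomorphic_Cn_on (f d) (chart_image d)"
    and nb: "\<And>d e x. d \<in> A ==> x \<in> fst d ==> e \<in> A ==> x \<in> fst e ==> f e (snd e x) = 0 ==> f d (snd d x) = 0"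
    and c: "c \<in> A" and T: "open T" "T \<noteq> {}" "T \<subseteq> chart_image c" "\<And>z. z \<in> T ==> f c z = 0"
    and d: "d \<in> A" and w: "w \<in> chart_image d"
  shows "f d w = 0"
proof -
  define Q where "Q = \<Union>{W. openin M W \<and> (\<forall>d\<in>A. \<forall>x\<in>W \<inter> fst d. f d (snd d x) = 0)}"
  have "Q = topspace M"
  proof (rule chart_continuation)
    show "openin M Q" unfolding Q_def by (rule openin_Union) auto
    have "{x \<in> fst c. snd c x \<in> T} \<subseteq> Q"
      unfolding Q_def using openin_snd_vimage[OF c T(1)] nb[OF _ _ c] T(4) by blast
    moreover obtain x where "x \<in> fst c" "snd c x \<in> T" using T by (auto simp: chart_image_def)
    ultimately show "Q \<noteq> {}" by blast
    fix d z r x assume d: "d \<in> A" "ball z r \<subseteq> chart_image d" "x \<in> Q" "x \<in> fst d" "snd d x \<in> ball z r"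
    from d(3) obtain W where W: "openin M W" "x \<in> W" "\<And>e y. e \<in> A ==> y \<in> W ==> y \<in> fst e ==> f e (snd e y) = 0"
      unfolding Q_def by blast
    have o: "open (snd d ` (W \<inter> fst d) \<inter> ball z r)"
      by (rule open_Int[OF open_snd_image[OF d(1) openin_Int[OF W(1) chart_domain(1)[OF d(1)]]] open_ball]) blast
    have "f d w = 0" if "w \<in> ball z r" for w
    proof (rule holomorphic_Cn_identity[OF holomorphic_Cn_subset[OF f[OF d(1)] d(2)] open_ball convex_ball o])
      show "snd d ` (W \<inter> fst d) \<inter> ball z r \<noteq> {}" using W(2) d by blast
      show "f d w = 0" if "w \<in> snd d ` (W \<inter> fst d) \<inter> ball z r" for w using that W(3)[OF d(1)] by blast
    qed (use that in auto)
    then show "{y \<in> fst d. snd d y \<in> ball z r} \<subseteq> Q"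
      unfolding Q_def using openin_snd_vimage[OF d(1) open_ball, of z r] nb[OF _ _ d(1)] by blast
  qed
  moreover obtain x where x: "x \<in> fst d" "w = snd d x" using w by (auto simp: chart_image_def)
  ultimately have "x \<in> Q" using chart_subset[OF d] by blast
  then show ?thesis using x d unfolding Q_def by blast
qed

lemma form_identity:
  assumes f: "f \<in> holomorphic_forms A" and c: "c \<in> A" and T: "open T" "T \<noteq> {}" "T \<subseteq> chart_image c"
    and z: "\<And>z. z \<in> T ==> f c z = 0"
  shows "f = zero_form"
proof -
  have "f d w = 0" for d w
  proof (cases "d \<in> A \<and> w \<in> chart_image d")
    case True
    show ?thesis
    proof (rule section_identity[OF formD(1)[OF f] _ c T z])
      show "f d (snd d x) = 0" if "d \<in> A" "x \<in> fst d" "e \<in> A" "x \<in> fst e" "f e (snd e x) = 0" for d e x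
        using formD(2)[OF f that(1,3,2,4)] that(5) by simp
    qed (use True in auto)
  next
    case False
    then show ?thesis using formD(3)[OF f, of d w] by blast
  qed
  then show ?thesis by (intro ext)
qed

section \<open>The Bergman space\<close>

abbreviation "cov \<equiv> chart_cover M A"

lemma cover_charts: "cov k \<in> A" and cover_covers: "(\<Union>k. fst (cov k)) = topspace M"
proof -
  have "Lindelof_space M" using manifold second_countable_imp_Lindelof_space by (auto simp: complex_manifold_def)
  moreover have "\<forall>U\<in>fst ` A. openin M U" using chart_domain by auto
  moreover have "\<Union>(fst ` A) = topspace M" using charts_cover chart_subset by blast
  ultimately obtain V where V: "countable V" "V \<subseteq> fst ` A" "\<Union>V = topspace M"
    unfolding Lindelof_space_def by meson
  moreover have "topspace M \<noteq> {}" using manifold unfolding complex_manifold_def by blast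
  ultimately have ne: "V \<noteq> {}" by (metis Union_empty)
  define e where "e k = (SOME c. c \<in> A \<and> fst c = from_nat_into V k)" for k
  have e: "e k \<in> A \<and> fst (e k) = from_nat_into V k" for k
  proof -
    have "from_nat_into V k \<in> fst ` A" by (rule subsetD[OF V(2) from_nat_into[OF ne]])
    then obtain c where "c \<in> A \<and> fst c = from_nat_into V k" by (elim imageE) simp
    then show ?thesis unfolding e_def by (rule someI)
  qed
  have "range e \<subseteq> A \<and> (\<Union>k. fst (e k)) = topspace M"
  proof
    have "fst (e k) = from_nat_into V k" for k using e[of k] by blast
    then have "(\<Union>k. fst (e k)) = \<Union>(range (from_nat_into V))" by simp
    also have "range (from_nat_into V) = V" using range_from_nat_into[OF ne V(1)] .
    finally show "(\<Union>k. fst (e k)) = topspace M" using V(3) by simp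
    show "range e \<subseteq> A" using e by blast
  qed
  then have "range cov \<subseteq> A \<and> (\<Union>k. fst (cov k)) = topspace M"
    unfolding chart_cover_def by (rule someI[of "\<lambda>e. range e \<subseteq> A \<and> (\<Union>k. fst (e k)) = topspace M" e])
  then show "cov k \<in> A" "(\<Union>k. fst (cov k)) = topspace M" by auto
qed

definition pcell :: "nat \<Rightarrow> 'a set" where
  "pcell k = fst (cov k) - (\<Union>j<k. fst (cov j))"

definition piece :: "nat \<Rightarrow> (complex ^ 'n) set" where
  "piece k = snd (cov k) ` pcell k"

lemma pcell_cover: "x \<in> topspace M ==> \<exists>k. x \<in> pcell k"
proof -
  assume "x \<in> topspace M"
  then have ex: "\<exists>k. x \<in> fst (cov k)" using cover_covers by blast
  then have "x \<in> pcell (LEAST k. x \<in> fst (cov k))"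
    unfolding pcell_def using LeastI_ex[OF ex] not_less_Least by auto
  then show ?thesis by blast
qed

lemma pcell_disjoint: "j \<noteq> k ==> pcell j \<inter> pcell k = {}"
  unfolding pcell_def by (cases "j < k") auto

lemma pcell_subset: "pcell k \<subseteq> fst (cov k)"
  by (auto simp: pcell_def)

lemma snd_pcell_borel:
  assumes "c \<in> A" shows "snd c ` (fst c \<inter> pcell k) \<in> sets borel"
proof -
  have "snd c ` (fst c \<inter> pcell k) = snd c ` (fst c \<inter> fst (cov k)) - snd c ` (fst c \<inter> (\<Union>j<k. fst (cov j)))"
    unfolding pcell_def using chart_inj[OF assms] by (auto simp: inj_on_def)
  moreover have "open (snd c ` (fst c \<inter> fst (cov k)))" "open (snd c ` (fst c \<inter> (\<Union>j<k. fst (cov j))))"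
    using openin_Int[OF chart_domain(1)[OF assms] chart_domain(1)[OF cover_charts]]
      openin_Int[OF chart_domain(1)[OF assms] openin_Union[of "(\<lambda>j. fst (cov j)) ` {..<k}" M]] chart_domain(1)[OF cover_charts]
    by (auto intro!: open_snd_image[OF assms] simp del: Int_iff)
  ultimately show ?thesis by auto
qed

lemma piece_borel: "piece k \<in> sets borel"
  using snd_pcell_borel[OF cover_charts, of k k] pcell_subset[of k] by (simp add: piece_def Int_absorb1)

lemma piece_subset: "piece k \<subseteq> chart_image (cov k)"
  using pcell_subset by (auto simp: piece_def chart_image_def)

lemma chart_pieces_eq: "chart_pieces cov = (SIGMA k:UNIV. piece k)"
  by (simp add: chart_pieces_def piece_def pcell_def)

abbreviation "base \<equiv> count_space (UNIV :: nat set) \<Otimes>\<^sub>M (lborel :: (complex ^ 'n) measure)"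

text \<open>The function on \<open>\<nat> \<times> \<complex>\<^sup>n\<close> that a form is integrated as.\<close>

definition rep :: "('a, 'n) form \<Rightarrow> nat \<times> (complex ^ 'n) \<Rightarrow> complex" where
  "rep f p = indicator (piece (fst p)) (snd p) * f (cov (fst p)) (snd p)"

lemma form_borel:
  assumes "f \<in> holomorphic_forms A" shows "f c \<in> borel_measurable borel"
proof (cases "c \<in> A")
  case True
  have "(\<lambda>z. indicator (chart_image c) z *\<^sub>R f c z) \<in> borel_measurable borel"
    using holomorphic_Cn_continuous[OF formD(1)[OF assms True]] chart_domain(2)[OF True]
    by (intro borel_measurable_continuous_on_indicator) auto
  moreover have "(\<lambda>z. indicator (chart_image c) z *\<^sub>R f c z) = f c"
    using formD(3)[OF assms, of c] by (intro ext) (auto simp: indicator_def)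
  ultimately show ?thesis by simp
next
  case False
  then have "f c = (\<lambda>z. 0)" using formD(3)[OF assms, of c] by (intro ext) simp
  then show ?thesis by simp
qed

lemma base_measurable:
  assumes "\<And>k. (\<lambda>z. h (k, z)) \<in> borel_measurable borel"
  shows "h \<in> borel_measurable base"
  by (rule measurable_pair_measure_countable1) (use assms in auto)

lemma rep_measurable:
  assumes "f \<in> holomorphic_forms A" shows "rep f \<in> borel_measurable base"
proof (rule base_measurable)
  fix k
  have "(\<lambda>z. indicator (piece k) z *\<^sub>R f (cov k) z) \<in> borel_measurable borel"
    using form_borel[OF assms] piece_borel by (intro borel_measurable_scaleR borel_measurable_indicator) auto
  moreover have "(\<lambda>z. indicator (piece k) z *\<^sub>R f (cov k) z) = (\<lambda>z. rep f (k, z))"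
    by (auto simp: rep_def indicator_def)
  ultimately show "(\<lambda>z. rep f (k, z)) \<in> borel_measurable borel" by simp
qed

lemma nn_integral_base:
  assumes "h \<in> borel_measurable base"
  shows "(\<integral>\<^sup>+p. h p \<partial>base) = (\<Sum>k. \<integral>\<^sup>+z. h (k, z) \<partial>lborel)"
  using lborel.nn_integral_fst[OF assms] by (simp add: nn_integral_count_space_nat)

lemma rep_add: "rep (form_add f g) p = rep f p + rep g p"
  and rep_diff: "rep (form_diff f g) p = rep f p - rep g p"
  and rep_scale: "rep (form_scale a f) p = a * rep f p"
  by (auto simp: rep_def algebra_simps)

lemma form_density_indicator:
  "indicator (chart_pieces cov) p *\<^sub>R form_density M A (wedge_cnj f g) p
     = (2 ^ CARD('n) / \<i> ^ (CARD('n)\<^sup>2)) * (rep f p * cnj (rep g p))"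
  by (cases p) (auto simp: chart_pieces_eq form_density_def wedge_cnj_def rep_def indicator_def)

definition L2_form :: "('a, 'n) form \<Rightarrow> bool" where
  "L2_form f \<longleftrightarrow> f \<in> holomorphic_forms A \<and> integrable base (\<lambda>p. (cmod (rep f p))\<^sup>2)"

lemma ennreal_two_power: "ennreal (2 ^ k) = 2 ^ k"
  by (induction k) (simp_all add: ennreal_mult)

lemma bergman_space_iff: "f \<in> bergman_space M A \<longleftrightarrow> L2_form f"
proof -
  have "form_integrable M A (wedge_cnj f f) \<longleftrightarrow> integrable base (\<lambda>p. rep f p * cnj (rep f p))"
    unfolding form_integrable_def set_integrable_def form_density_indicator
  proof
    let ?c = "2 ^ CARD('n) / \<i> ^ (CARD('n)\<^sup>2) :: complex"
    have c: "?c \<noteq> 0" by simp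
    assume "integrable base (\<lambda>p. ?c * (rep f p * cnj (rep f p)))"
    from integrable_mult_right[OF this, of "inverse ?c"]
    show "integrable base (\<lambda>p. rep f p * cnj (rep f p))"
      by (simp only: mult.assoc[symmetric] left_inverse[OF c] mult_1)
  qed (rule integrable_mult_right)
  also have "(\<lambda>p. rep f p * cnj (rep f p)) = (\<lambda>p. complex_of_real ((cmod (rep f p))\<^sup>2))"
    by (simp add: of_real_cmod_square)
  also have "integrable base (\<lambda>p. complex_of_real ((cmod (rep f p))\<^sup>2)) \<longleftrightarrow> integrable base (\<lambda>p. (cmod (rep f p))\<^sup>2)"
    by (rule complex_of_real_integrable_eq)
  finally show ?thesis by (auto simp: bergman_space_def L2_form_def)
qed

lemma bergman_inner_eq:
  "bergman_inner M A f g = 2 ^ CARD('n) * (\<integral>p. rep f p * cnj (rep g p) \<partial>base)"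
proof -
  have "form_integral M A (wedge_cnj f g) = (2 ^ CARD('n) / \<i> ^ (CARD('n)\<^sup>2)) * (\<integral>p. rep f p * cnj (rep g p) \<partial>base)"
    unfolding form_integral_def set_lebesgue_integral_def form_density_indicator by simp
  then show ?thesis by (simp add: bergman_inner_def)
qed

lemma rep_mult_integrable:
  assumes f: "L2_form f" and g: "L2_form g"
  shows "integrable base (\<lambda>p. rep f p * cnj (rep g p))"
proof (rule Bochner_Integration.integrable_bound[where f = "\<lambda>p. (cmod (rep f p))\<^sup>2 + (cmod (rep g p))\<^sup>2"])
  show "integrable base (\<lambda>p. (cmod (rep f p))\<^sup>2 + (cmod (rep g p))\<^sup>2)"
    using f g by (auto simp: L2_form_def)
  have "rep f \<in> borel_measurable base" "rep g \<in> borel_measurable base"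
    using f g rep_measurable by (auto simp: L2_form_def)
  then show "(\<lambda>p. rep f p * cnj (rep g p)) \<in> borel_measurable base"
    by (intro borel_measurable_times measurable_compose[OF _ borel_measurable_continuous_onI[OF continuous_on_cnj[OF continuous_on_id]]])
  have "a * b \<le> a\<^sup>2 + b\<^sup>2" if "a \<ge> 0" "b \<ge> 0" for a b :: real
  proof -
    have "0 \<le> (a - b)\<^sup>2 + a * b" using that by simp
    then show ?thesis by (simp add: power2_diff)
  qed
  then show "AE p in base. norm (rep f p * cnj (rep g p)) \<le> norm ((cmod (rep f p))\<^sup>2 + (cmod (rep g p))\<^sup>2)"
    by (intro AE_I2) (simp add: norm_mult)
qed

lemma L2_zero: "L2_form zero_form"
  by (simp add: L2_form_def form_zero rep_def)

lemma L2_scale: "L2_form f ==> L2_form (form_scale a f)"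
  by (simp add: L2_form_def form_scale_mem rep_scale norm_mult power_mult_distrib)

lemma L2_add:
  assumes "L2_form f" "L2_form g" shows "L2_form (form_add f g)"
proof -
  have m: "rep f \<in> borel_measurable base" "rep g \<in> borel_measurable base" and h: "f \<in> holomorphic_forms A" "g \<in> holomorphic_forms A"
    using assms rep_measurable by (auto simp: L2_form_def)
  have "integrable base (\<lambda>p. (cmod (rep (form_add f g) p))\<^sup>2)"
  proof (rule Bochner_Integration.integrable_bound[where f = "\<lambda>p. 2 * (cmod (rep f p))\<^sup>2 + 2 * (cmod (rep g p))\<^sup>2"])
    show "integrable base (\<lambda>p. 2 * (cmod (rep f p))\<^sup>2 + 2 * (cmod (rep g p))\<^sup>2)"
      using assms by (auto simp: L2_form_def)
    show "(\<lambda>p. (cmod (rep (form_add f g) p))\<^sup>2) \<in> borel_measurable base"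
      using m unfolding rep_add by measurable
    have "(cmod (x + y))\<^sup>2 \<le> 2 * (cmod x)\<^sup>2 + 2 * (cmod y)\<^sup>2" for x y
    proof -
      have "(cmod (x + y))\<^sup>2 \<le> (cmod x + cmod y)\<^sup>2" by (intro power_mono norm_triangle_ineq) auto
      also have "\<dots> \<le> \<dots> + (cmod x - cmod y)\<^sup>2" by simp
      finally show ?thesis by (simp add: power2_sum power2_diff)
    qed
    then show "AE p in base. norm ((cmod (rep (form_add f g) p))\<^sup>2) \<le> norm (2 * (cmod (rep f p))\<^sup>2 + 2 * (cmod (rep g p))\<^sup>2)"
      unfolding rep_add by (intro AE_I2) simp
  qed
  then show ?thesis using h form_add_mem by (auto simp: L2_form_def)
qed

definition sqnorm :: "('a, 'n) form \<Rightarrow> real" where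
  "sqnorm f = 2 ^ CARD('n) * (\<integral>p. (cmod (rep f p))\<^sup>2 \<partial>base)"

lemma inner_self: "bergman_inner M A f f = of_real (sqnorm f)"
proof -
  have "(\<lambda>p. rep f p * cnj (rep f p)) = (\<lambda>p. complex_of_real ((cmod (rep f p))\<^sup>2))"
    by (simp add: of_real_cmod_square)
  then have "(\<integral>p. rep f p * cnj (rep f p) \<partial>base) = complex_of_real (\<integral>p. (cmod (rep f p))\<^sup>2 \<partial>base)"
    by (simp only: integral_complex_of_real)
  then show ?thesis by (simp add: bergman_inner_eq sqnorm_def)
qed

lemma sqnorm_nn_integral:
  assumes "L2_form f"
  shows "ennreal (sqnorm f) = 2 ^ CARD('n) * (\<Sum>k. \<integral>\<^sup>+z\<in>piece k. ennreal ((cmod (f (cov k) z))\<^sup>2) \<partial>lborel)"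
proof -
  have m: "rep f \<in> borel_measurable base" using assms rep_measurable by (auto simp: L2_form_def)
  have "ennreal (sqnorm f) = 2 ^ CARD('n) * ennreal (\<integral>p. (cmod (rep f p))\<^sup>2 \<partial>base)"
    unfolding sqnorm_def by (subst ennreal_mult) (auto simp: ennreal_two_power)
  also have "ennreal (\<integral>p. (cmod (rep f p))\<^sup>2 \<partial>base) = (\<integral>\<^sup>+p. ennreal ((cmod (rep f p))\<^sup>2) \<partial>base)"
    using assms by (subst nn_integral_eq_integral) (auto simp: L2_form_def)
  also have "\<dots> = (\<Sum>k. \<integral>\<^sup>+z. ennreal ((cmod (rep f (k, z)))\<^sup>2) \<partial>lborel)"
    by (rule nn_integral_base[OF measurable_compose[OF borel_measurable_power[OF measurable_compose[OF m borel_measurable_norm]] measurable_ennreal]])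
  also have "\<dots> = (\<Sum>k. \<integral>\<^sup>+z\<in>piece k. ennreal ((cmod (f (cov k) z))\<^sup>2) \<partial>lborel)"
    by (intro suminf_cong nn_integral_cong) (auto simp: rep_def indicator_def)
  finally show ?thesis .
qed

text \<open>
  The mass of a form on a coordinate ball does not exceed its norm, since the ball is the disjoint
  union of its parts in the cells, each of which is the image of part of a piece.
\<close>

lemma ball_mass_le:
  assumes f: "f \<in> holomorphic_forms A" and c: "c \<in> A" and B: "B \<in> sets borel" "B \<subseteq> chart_image c"
  shows "(\<integral>\<^sup>+z\<in>B. ennreal ((cmod (f c z))\<^sup>2) \<partial>lborel)
      \<le> (\<Sum>k. \<integral>\<^sup>+z\<in>piece k. ennreal ((cmod (f (cov k) z))\<^sup>2) \<partial>lborel)"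
proof -
  define Bk where "Bk k = B \<inter> snd c ` (fst c \<inter> pcell k)" for k
  have Bkb: "Bk k \<in> sets borel" for k unfolding Bk_def using B snd_pcell_borel[OF c] by blast
  have fm: "(\<lambda>z. ennreal ((cmod (f d z))\<^sup>2)) \<in> borel_measurable borel" for d
    using form_borel[OF f, of d] by measurable
  have Bu: "B = (\<Union>k. Bk k)"
  proof
    show "B \<subseteq> (\<Union>k. Bk k)"
    proof
      fix z assume z: "z \<in> B"
      then obtain x where x: "x \<in> fst c" "z = snd c x" using B(2) by (auto simp: chart_image_def)
      then obtain k where "x \<in> pcell k" using pcell_cover chart_subset[OF c] by blast
      then show "z \<in> (\<Union>k. Bk k)" using x z by (auto simp: Bk_def)
    qed
  qed (auto simp: Bk_def)
  have disj: "disjoint_family Bk"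
    unfolding disjoint_family_on_def
  proof (intro ballI impI)
    fix j k :: nat assume "j \<noteq> k"
    then show "Bk j \<inter> Bk k = {}"
      using pcell_disjoint[of j k] chart_inj[OF c] unfolding Bk_def inj_on_def by blast
  qed
  have piecewise: "(\<integral>\<^sup>+z\<in>Bk k. ennreal ((cmod (f c z))\<^sup>2) \<partial>lborel)
      \<le> (\<integral>\<^sup>+z\<in>piece k. ennreal ((cmod (f (cov k) z))\<^sup>2) \<partial>lborel)" for k
  proof -
    let ?d = "cov k" and ?\<sigma> = "transition (cov k) c" and ?\<tau> = "transition c (cov k)"
    have d: "?d \<in> A" by (rule cover_charts)
    define E where "E = ?\<tau> ` Bk k"
    have Bo: "Bk k \<subseteq> overlap c ?d" using pcell_subset[of k] by (auto simp: Bk_def overlap_def)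
    have img: "transition e e' ` X \<in> sets borel" if X: "X \<in> sets borel" "X \<subseteq> overlap e e'" and e: "e \<in> A" "e' \<in> A" for X e e'
    proof -
      have cont: "continuous_on (overlap e' e) (transition e' e)"
      proof (intro continuous_at_imp_continuous_on ballI)
        fix z assume "z \<in> overlap e' e"
        then show "isCont (transition e' e) z"
          using has_derivative_continuous[OF holomorphic_Cn_map_derivative[OF transition_holomorphic overlap_open]] e by blast
      qed
      have mm: "(\<lambda>z. if z \<in> overlap e' e then transition e' e z else 0) \<in> borel_measurable borel"
        using cont overlap_open[OF e(2,1)] by (intro borel_measurable_continuous_on_if) auto
      have "transition e e' ` X = overlap e' e \<inter> (\<lambda>z. if z \<in> overlap e' e then transition e' e z else 0) -` X"
      proof (intro equalityI subsetI)
        fix y assume "y \<in> transition e e' ` X"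
        then obtain x where x: "x \<in> X" "y = transition e e' x" by blast
        then have "y \<in> overlap e' e" using transition_image[OF e(1), of e'] X(2) by blast
        moreover have "transition e' e y = x" using x X(2) e transition_inverse by blast
        ultimately show "y \<in> overlap e' e \<inter> (\<lambda>z. if z \<in> overlap e' e then transition e' e z else 0) -` X" using x by simp
      next
        fix y assume y: "y \<in> overlap e' e \<inter> (\<lambda>z. if z \<in> overlap e' e then transition e' e z else 0) -` X"
        then have "transition e' e y \<in> X" "transition e e' (transition e' e y) = y"
          using e transition_inverse by auto
        then show "y \<in> transition e e' ` X" by force
      qed
      then show ?thesis using measurable_sets[OF mm X(1)] overlap_open[OF e(2,1)] by auto
    qed
    have E: "E \<in> sets borel" "E \<subseteq> overlap ?d c"
      unfolding E_def using img[OF Bkb Bo c d] transition_image[OF c, of ?d] Bo by auto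
    have \<sigma>E: "?\<sigma> ` E = Bk k"
      unfolding E_def image_image using Bo transition_inverse[OF c d] by (auto simp: subset_iff image_iff)
    have "(\<integral>\<^sup>+z\<in>?\<sigma> ` E. ennreal ((cmod (f c z))\<^sup>2) \<partial>lborel) \<le>
        (\<integral>\<^sup>+z\<in>E. ennreal ((cmod (f c (?\<sigma> z)))\<^sup>2) * ennreal ((cmod (det (complex_jacobian ?\<sigma> z)))\<^sup>2) \<partial>lborel)"
      by (rule nn_integral_holomorphic_image_le[OF transition_holomorphic[OF d c] overlap_open[OF d c] E(2,1) _ fm])
         (use img d c E in blast)
    also have "\<dots> = (\<integral>\<^sup>+z\<in>E. ennreal ((cmod (f ?d z))\<^sup>2) \<partial>lborel)"
    proof (intro nn_integral_cong)
      fix z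
      show "ennreal ((cmod (f c (?\<sigma> z)))\<^sup>2) * ennreal ((cmod (det (complex_jacobian ?\<sigma> z)))\<^sup>2) * indicator E z
          = ennreal ((cmod (f ?d z))\<^sup>2) * indicator E z"
      proof (cases "z \<in> E")
        case True
        then obtain x where x: "x \<in> fst ?d" "x \<in> fst c" "z = snd ?d x" using E(2) by (auto simp: overlap_def)
        then have "f ?d z = det (complex_jacobian ?\<sigma> z) * f c (?\<sigma> z)" using formD(2)[OF f d c] d by simp
        then have "(cmod (f ?d z))\<^sup>2 = (cmod (f c (?\<sigma> z)))\<^sup>2 * (cmod (det (complex_jacobian ?\<sigma> z)))\<^sup>2"
          by (simp add: norm_mult power_mult_distrib)
        then show ?thesis by (simp add: ennreal_mult)
      qed simp
    qed
    also have "\<dots> \<le> (\<integral>\<^sup>+z\<in>piece k. ennreal ((cmod (f ?d z))\<^sup>2) \<partial>lborel)"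
    proof -
      have "E \<subseteq> piece k" unfolding E_def Bk_def piece_def using c by (auto simp: image_iff)
      then show ?thesis by (intro nn_integral_mono) (auto simp: indicator_def)
    qed
    finally show ?thesis by (simp only: \<sigma>E)
  qed
  have "(\<integral>\<^sup>+z\<in>B. ennreal ((cmod (f c z))\<^sup>2) \<partial>lborel) = (\<Sum>k. \<integral>\<^sup>+z\<in>Bk k. ennreal ((cmod (f c z))\<^sup>2) \<partial>lborel)"
    unfolding Bu by (rule nn_integral_disjoint_family) (use disj Bkb fm in auto)
  also have "\<dots> \<le> (\<Sum>k. \<integral>\<^sup>+z\<in>piece k. ennreal ((cmod (f (cov k) z))\<^sup>2) \<partial>lborel)"
    by (intro suminf_le piecewise summableI)
  finally show ?thesis .
qed

lemma local_evaluation_bound: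
  assumes c: "c \<in> A" and z: "z \<in> chart_image c"
  obtains r C where "r > 0" "ball z r \<subseteq> chart_image c"
    "\<And>f w. L2_form f ==> w \<in> ball z r ==> (cmod (f c w))\<^sup>2 \<le> C * sqnorm f"
proof -
  obtain r where r: "r > 0" "ball z (2 * r) \<subseteq> chart_image c"
  proof -
    obtain r where "r > 0" "ball z r \<subseteq> chart_image c"
      by (rule openE[OF chart_domain(2)[OF c] z])
    then show ?thesis by (intro that[of "r / 2"]) auto
  qed
  define V where "V = unit_ball_vol (real DIM(complex ^ 'n)) * r ^ DIM(complex ^ 'n)"
  have V: "V > 0" using r unfolding V_def by (intro mult_pos_pos unit_ball_vol_pos zero_less_power) auto
  have Veq: "emeasure lborel (ball w r) = ennreal V" for w :: "complex ^ 'n"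
    unfolding V_def by (rule emeasure_ball) (use r in simp)
  show thesis
  proof (rule that[of r "1 / (2 ^ CARD('n) * V)"])
    show "r > 0" by fact
    show "ball z r \<subseteq> chart_image c" using r subset_ball[of r "2 * r" z] by auto
    fix f w assume f: "L2_form f" and w: "w \<in> ball z r"
    have fh: "f \<in> holomorphic_forms A" using f by (simp add: L2_form_def)
    have sub: "ball w r \<subseteq> chart_image c"
    proof
      fix v assume "v \<in> ball w r"
      then have "v \<in> ball z (2 * r)" using w dist_triangle[of z v w] by simp
      then show "v \<in> chart_image c" using r(2) by blast
    qed
    have "ennreal ((cmod (f c w))\<^sup>2) * ennreal V \<le> (\<integral>\<^sup>+z\<in>ball w r. ennreal ((cmod (f c z))\<^sup>2) \<partial>lborel)"
      using holomorphic_ball_mean[OF holomorphic_Cn_subset[OF formD(1)[OF fh c] sub]] by (simp add: Veq)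
    also have "\<dots> \<le> (\<Sum>k. \<integral>\<^sup>+z\<in>piece k. ennreal ((cmod (f (cov k) z))\<^sup>2) \<partial>lborel)"
      by (rule ball_mass_le[OF fh c _ sub]) simp
    finally have "2 ^ CARD('n) * (ennreal ((cmod (f c w))\<^sup>2) * ennreal V) \<le> ennreal (sqnorm f)"
      unfolding sqnorm_nn_integral[OF f] by (rule mult_left_mono) simp
    moreover have "2 ^ CARD('n) * (ennreal ((cmod (f c w))\<^sup>2) * ennreal V) = ennreal (2 ^ CARD('n) * ((cmod (f c w))\<^sup>2 * V))"
      using V by (simp add: ennreal_mult ennreal_two_power)
    moreover have "sqnorm f \<ge> 0" by (simp add: sqnorm_def)
    ultimately have "2 ^ CARD('n) * ((cmod (f c w))\<^sup>2 * V) \<le> sqnorm f"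
      by (simp add: ennreal_le_iff)
    then show "(cmod (f c w))\<^sup>2 \<le> 1 / (2 ^ CARD('n) * V) * sqnorm f"
      using V by (simp add: field_simps)
  qed
qed

end

context holomorphic_atlas
begin

lemma sqnorm_nonneg: "0 \<le> sqnorm f"
  by (simp add: sqnorm_def)

definition mass :: "('a, 'n) form \<Rightarrow> ennreal" where
  "mass f = (\<integral>\<^sup>+p. ennreal ((cmod (rep f p))\<^sup>2) \<partial>base)"

lemma rep_square_measurable:
  "f \<in> holomorphic_forms A ==> (\<lambda>p. (cmod (rep f p))\<^sup>2) \<in> borel_measurable base"
  by (intro borel_measurable_power measurable_compose[OF rep_measurable borel_measurable_norm])

lemma L2_form_iff_mass: "L2_form f \<longleftrightarrow> f \<in> holomorphic_forms A \<and> mass f < \<infinity>"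
  unfolding L2_form_def mass_def using rep_square_measurable
  by (auto simp: integrable_iff_bounded)

lemma sqnorm_mass: "L2_form f ==> ennreal (sqnorm f) = 2 ^ CARD('n) * mass f"
  unfolding sqnorm_def mass_def L2_form_def
  by (subst ennreal_mult) (auto simp: ennreal_two_power nn_integral_eq_integral)

lemma sqnorm_add_le:
  assumes f: "L2_form f" and g: "L2_form g"
  shows "sqnorm (form_add f g) \<le> 2 * sqnorm f + 2 * sqnorm g"
proof -
  have ineq: "(cmod (x + y))\<^sup>2 \<le> 2 * (cmod x)\<^sup>2 + 2 * (cmod y)\<^sup>2" for x y
  proof -
    have "(cmod (x + y))\<^sup>2 \<le> (cmod x + cmod y)\<^sup>2" by (intro power_mono norm_triangle_ineq) auto
    also have "\<dots> \<le> \<dots> + (cmod x - cmod y)\<^sup>2" by simp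
    finally show ?thesis by (simp add: power2_sum power2_diff)
  qed
  have "(\<integral>p. (cmod (rep (form_add f g) p))\<^sup>2 \<partial>base) \<le> (\<integral>p. 2 * (cmod (rep f p))\<^sup>2 + 2 * (cmod (rep g p))\<^sup>2 \<partial>base)"
    using L2_add[OF f g] f g by (intro integral_mono) (auto simp: L2_form_def rep_add ineq)
  also have "\<dots> = 2 * (\<integral>p. (cmod (rep f p))\<^sup>2 \<partial>base) + 2 * (\<integral>p. (cmod (rep g p))\<^sup>2 \<partial>base)"
    using f g by (subst Bochner_Integration.integral_add) (auto simp: L2_form_def)
  finally have "2 ^ CARD('n) * (\<integral>p. (cmod (rep (form_add f g) p))\<^sup>2 \<partial>base)
      \<le> 2 ^ CARD('n) * (2 * (\<integral>p. (cmod (rep f p))\<^sup>2 \<partial>base) + 2 * (\<integral>p. (cmod (rep g p))\<^sup>2 \<partial>base))"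
    by (rule mult_left_mono) simp
  then show ?thesis by (simp add: sqnorm_def algebra_simps)
qed

lemma L2_diff: "L2_form f ==> L2_form g ==> L2_form (form_diff f g)"
  using L2_add[OF _ L2_scale[of g "-1"], of f] by simp

lemma evaluation_bound_exists: "\<exists>C. \<forall>f. L2_form f \<longrightarrow> (cmod (f c z))\<^sup>2 \<le> C * sqnorm f"
proof (cases "c \<in> A \<and> z \<in> chart_image c")
  case True
  then have cz: "c \<in> A" "z \<in> chart_image c" by auto
  obtain r C where "r > 0" "\<And>f w. L2_form f ==> w \<in> ball z r ==> (cmod (f c w))\<^sup>2 \<le> C * sqnorm f"
    using local_evaluation_bound[OF cz] by metis
  then show ?thesis by (intro exI[of _ C]) auto
next
  case False
  then have "f c z = 0" if "L2_form f" for f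
    using that formD(3)[of f c z] by (auto simp: L2_form_def simp del: split_paired_All)
  then show ?thesis by (intro exI[of _ 0]) auto
qed

text \<open>
  Completeness: a Cauchy sequence is Cauchy locally uniformly in all charts, so it converges to a
  holomorphic form, and Fatou's lemma shows that the convergence holds in norm.
\<close>

lemma L2_complete:
  assumes s: "\<And>m :: nat. L2_form (s m)"
    and cauchy: "\<And>e. e > 0 ==> \<exists>K. \<forall>m\<ge>K. \<forall>k\<ge>K. sqnorm (form_diff (s m) (s k)) < e"
  shows "\<exists>f. L2_form f \<and> (\<forall>e>0. \<exists>K. \<forall>m\<ge>K. sqnorm (form_diff (s m) f) < e)"
proof -
  have sh: "s m \<in> holomorphic_forms A" for m using s by (simp add: L2_form_def)
  obtain B where B: "\<And>m. sqnorm (s m) \<le> B"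
  proof -
    obtain K where K: "\<And>m. m \<ge> K ==> sqnorm (form_diff (s m) (s K)) < 1" using cauchy[of 1] by auto
    have "sqnorm (s m) \<le> Max (insert (2 + 2 * sqnorm (s K)) ((\<lambda>m. sqnorm (s m)) ` {..<K}))" for m
    proof (cases "m < K")
      case True
      then show ?thesis by (intro Max_ge) auto
    next
      case False
      have "form_add (form_diff (s m) (s K)) (s K) = s m" by simp
      then have "sqnorm (s m) \<le> 2 * sqnorm (form_diff (s m) (s K)) + 2 * sqnorm (s K)"
        using sqnorm_add_le[OF L2_diff[OF s[of m] s[of K]] s[of K]] by simp
      also have "\<dots> \<le> 2 + 2 * sqnorm (s K)" using K[of m] False by simp
      finally show ?thesis by (meson Max_ge finite_imageI finite_insert finite_lessThan insertI1 order_trans)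
    qed
    then show ?thesis using that by blast
  qed
  have pt: "Cauchy (\<lambda>m. s m c z)" for c z
  proof (rule metric_CauchyI)
    fix e :: real assume e: "e > 0"
    obtain C where C: "\<And>f. L2_form f ==> (cmod (f c z))\<^sup>2 \<le> C * sqnorm f" using evaluation_bound_exists[of c z] by blast
    have "e\<^sup>2 / (\<bar>C\<bar> + 1) > 0" using e by (simp add: add_nonneg_pos)
    from cauchy[OF this] obtain K where K: "\<And>m k. m \<ge> K ==> k \<ge> K ==> sqnorm (form_diff (s m) (s k)) < e\<^sup>2 / (\<bar>C\<bar> + 1)" by blast
    show "\<exists>K. \<forall>m\<ge>K. \<forall>k\<ge>K. dist (s m c z) (s k c z) < e"
    proof (intro exI[of _ K] allI impI)
      fix m k assume mk: "K \<le> m" "K \<le> k"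
      have "(cmod (s m c z - s k c z))\<^sup>2 \<le> C * sqnorm (form_diff (s m) (s k))" using C[OF L2_diff[OF s[of m] s[of k]]] .
      also have "\<dots> \<le> (\<bar>C\<bar> + 1) * sqnorm (form_diff (s m) (s k))" by (intro mult_right_mono sqnorm_nonneg) auto
      also have "\<dots> < (\<bar>C\<bar> + 1) * (e\<^sup>2 / (\<bar>C\<bar> + 1))" using K[OF mk] by (intro mult_strict_left_mono) auto
      also have "\<dots> = e\<^sup>2" by (simp add: add_nonneg_eq_0_iff)
      finally show "dist (s m c z) (s k c z) < e" using e by (simp add: dist_norm power2_less_imp_less)
    qed
  qed
  define f where "f = (\<lambda>c z. lim (\<lambda>m. s m c z))"
  have lim: "(\<lambda>m. s m c z) \<longlonglongrightarrow> f c z" for c z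
    unfolding f_def using pt[of c z] by (simp add: Cauchy_convergent_iff convergent_LIMSEQ_iff)
  have fh: "f \<in> holomorphic_forms A"
  proof (rule formI)
    fix c assume c: "c \<in> A"
    show "holomorphic_Cn_on (f c) (chart_image c)"
    proof (rule bounded_pointwise_limit(1)[where F = "\<lambda>m. s m c"])
      fix z assume z: "z \<in> chart_image c"
      obtain r C where r: "r > 0" "ball z r \<subseteq> chart_image c"
        and C: "\<And>f w. L2_form f ==> w \<in> ball z r ==> (cmod (f c w))\<^sup>2 \<le> C * sqnorm f"
        using local_evaluation_bound[OF c z] by metis
      have "cmod (s m c w) \<le> sqrt (\<bar>C\<bar> * B)" if "w \<in> ball z r" for m w
      proof (rule real_le_rsqrt)
        have "(cmod (s m c w))\<^sup>2 \<le> C * sqnorm (s m)" by (rule C[OF s that])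
        also have "\<dots> \<le> \<bar>C\<bar> * B" using B[of m] sqnorm_nonneg[of "s m"] by (intro mult_mono) auto
        finally show "(cmod (s m c w))\<^sup>2 \<le> \<bar>C\<bar> * B" .
      qed
      then show "\<exists>r>0. \<exists>M. ball z r \<subseteq> chart_image c \<and> (\<forall>k. \<forall>y\<in>ball z r. cmod (s k c y) \<le> M)"
        using r by blast
    qed (use lim formD(1)[OF sh c] chart_domain(2)[OF c] in auto)
  next
    fix c d x assume cd: "c \<in> A" "d \<in> A" "x \<in> fst c" "x \<in> fst d"
    have "(\<lambda>m. s m c (snd c x)) \<longlonglongrightarrow> det (complex_jacobian (transition c d) (snd c x)) * f d (snd d x)"
      unfolding formD(2)[OF sh cd] by (intro tendsto_mult_left lim)
    then show "f c (snd c x) = det (complex_jacobian (transition c d) (snd c x)) * f d (snd d x)"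
      by (rule LIMSEQ_unique[OF lim])
  next
    fix c z assume "c \<notin> A \<or> z \<notin> chart_image c"
    then have "s m c z = 0" for m using formD(3)[OF sh] by blast
    then show "f c z = 0" using LIMSEQ_unique[OF lim[of c z], of 0] by simp
  qed
  have fatou: "mass (form_diff (s k) f) \<le> ennreal e"
    if "\<And>m. m \<ge> K ==> sqnorm (form_diff (s k) (s m)) \<le> e" for k K e
  proof -
    have "mass (form_diff (s k) f) = (\<integral>\<^sup>+p. liminf (\<lambda>m. ennreal ((cmod (rep (form_diff (s k) (s m)) p))\<^sup>2)) \<partial>base)"
      unfolding mass_def
    proof (intro nn_integral_cong)
      fix p
      have "(\<lambda>m. rep (s m) p) \<longlonglongrightarrow> rep f p" unfolding rep_def by (intro tendsto_mult_left lim)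
      then have "(\<lambda>m. ennreal ((cmod (rep (form_diff (s k) (s m)) p))\<^sup>2)) \<longlonglongrightarrow> ennreal ((cmod (rep (form_diff (s k) f) p))\<^sup>2)"
        unfolding rep_diff by (intro tendsto_ennrealI tendsto_intros)
      then show "ennreal ((cmod (rep (form_diff (s k) f) p))\<^sup>2) = liminf (\<lambda>m. ennreal ((cmod (rep (form_diff (s k) (s m)) p))\<^sup>2))"
        by (rule lim_imp_Liminf[OF trivial_limit_sequentially, symmetric])
    qed
    also have "\<dots> \<le> liminf (\<lambda>m. mass (form_diff (s k) (s m)))"
      unfolding mass_def
      using measurable_compose[OF rep_square_measurable measurable_ennreal] L2_diff[OF s s]
      by (intro nn_integral_liminf) (auto simp: L2_form_def)
    also have "\<dots> \<le> ennreal e"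
    proof (rule Liminf_le)
      show "\<forall>\<^sub>F m in sequentially. mass (form_diff (s k) (s m)) \<le> ennreal e"
        using eventually_ge_at_top[of K]
      proof eventually_elim
        case (elim m)
        have "1 * mass (form_diff (s k) (s m)) \<le> 2 ^ CARD('n) * mass (form_diff (s k) (s m))"
          by (intro mult_right_mono) (simp_all add: one_le_power)
        also have "\<dots> = ennreal (sqnorm (form_diff (s k) (s m)))" using sqnorm_mass[OF L2_diff[OF s[of k] s[of m]]] by simp
        also have "\<dots> \<le> ennreal e" by (intro ennreal_leI that elim)
        finally show ?case by simp
      qed
    qed simp
    finally show ?thesis .
  qed
  have dh: "form_diff (s k) f \<in> holomorphic_forms A" for k
    using form_add_mem[OF sh form_scale_mem[OF fh, of "-1"]] by simp
  have dl: "L2_form (form_diff (s k) f)" if "\<And>m. m \<ge> K ==> sqnorm (form_diff (s k) (s m)) \<le> e" for k K e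
    using fatou[of K k e] that dh unfolding L2_form_iff_mass by (auto intro: le_less_trans)
  have fL: "L2_form f"
  proof -
    obtain K where K: "\<And>m k. m \<ge> K ==> k \<ge> K ==> sqnorm (form_diff (s m) (s k)) < 1" using cauchy[of 1] by auto
    have "L2_form (form_diff (s K) f)" by (rule dl[of K K 1]) (use K[of K] in force)
    then have "L2_form (form_diff (s K) (form_diff (s K) f))" by (rule L2_diff[OF s])
    then show ?thesis by simp
  qed
  have "\<exists>K. \<forall>m\<ge>K. sqnorm (form_diff (s m) f) < e" if e: "e > 0" for e
  proof -
    define d where "d = e / (2 * 2 ^ CARD('n))"
    have d: "d > 0" using e by (simp add: d_def)
    obtain K where K: "\<And>m k. m \<ge> K ==> k \<ge> K ==> sqnorm (form_diff (s m) (s k)) < d" using cauchy[OF d] by blast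
    have "sqnorm (form_diff (s k) f) < e" if "k \<ge> K" for k
    proof -
      have "ennreal (sqnorm (form_diff (s k) f)) \<le> 2 ^ CARD('n) * ennreal d"
        unfolding sqnorm_mass[OF L2_diff[OF s fL]]
        by (intro mult_left_mono fatou[of K]) (use K that in \<open>auto intro: less_imp_le\<close>)
      also have "\<dots> = ennreal (2 ^ CARD('n) * d)" using d by (simp add: ennreal_mult ennreal_two_power)
      also have "2 ^ CARD('n) * d = e / 2" by (simp add: d_def)
      finally show ?thesis using e by simp
    qed
    then show ?thesis by blast
  qed
  then show ?thesis using fL by blast
qed

lemma nonempty_chart: obtains c where "c \<in> A" "chart_image c \<noteq> {}"
proof -
  have "topspace M \<noteq> {}" using manifold unfolding complex_manifold_def by blast
  then obtain x c where "c \<in> A" "x \<in> fst c" using charts_cover by blast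
  then show ?thesis using that[of c] by (auto simp: chart_image_def)
qed

lemma L2_separable: "\<exists>D. countable D \<and> (\<forall>f. L2_form f \<longrightarrow> (\<forall>(c, z)\<in>D. f c z = 0) \<longrightarrow> f = zero_form)"
proof -
  obtain c where c: "c \<in> A" "chart_image c \<noteq> {}" by (rule nonempty_chart)
  obtain Q :: "(complex ^ 'n) set" where Q: "countable Q" "\<And>X. open X ==> X \<noteq> {} ==> \<exists>d\<in>Q. d \<in> X"
    using countable_dense_exists by blast
  have "f = zero_form" if f: "L2_form f" and z: "\<forall>(c, z)\<in>{c} \<times> Q. f c z = 0" for f
  proof (rule form_identity[OF _ c(1) chart_domain(2)[OF c(1)] c(2) subset_refl])
    show fh: "f \<in> holomorphic_forms A" using f by (simp add: L2_form_def)
    fix w assume w: "w \<in> chart_image c"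
    show "f c w = 0"
    proof (rule ccontr)
      assume nz: "f c w \<noteq> 0"
      have "open (f c -` (- {0}) \<inter> chart_image c)"
        using continuous_open_preimage[OF holomorphic_Cn_continuous[OF formD(1)[OF fh c(1)]] chart_domain(2)[OF c(1)], of "- {0}"]
        by (simp add: Int_commute open_Compl)
      moreover have "f c -` (- {0}) \<inter> chart_image c \<noteq> {}" using nz w by auto
      ultimately obtain d where "d \<in> Q" "d \<in> f c -` (- {0}) \<inter> chart_image c" using Q(2) by blast
      then show False using z by auto
    qed
  qed
  then show ?thesis using Q(1) by (intro exI[of _ "{c} \<times> Q"]) auto
qed

end

sublocale holomorphic_atlas \<subseteq> function_inner_space "bergman_space M A" "bergman_inner M A"
proof (unfold_locales, unfold bergman_space_iff)
  fix f g h :: "('a, 'n) form" and a :: complex and c z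
  show "L2_form zero_form" by (rule L2_zero)
  show "L2_form (form_scale a f)" if "L2_form f" using that by (rule L2_scale)
  show "L2_form (form_add f g)" if "L2_form f" "L2_form g" using that by (rule L2_add)
  show "bergman_inner M A (form_add f g) h = bergman_inner M A f h + bergman_inner M A g h"
    if "L2_form f" "L2_form g" "L2_form h"
    using rep_mult_integrable[OF that(1,3)] rep_mult_integrable[OF that(2,3)]
    by (simp add: bergman_inner_eq rep_add distrib_right distrib_left)
  show "bergman_inner M A (form_scale a f) h = a * bergman_inner M A f h" if "L2_form f" "L2_form h"
    by (simp add: bergman_inner_eq rep_scale mult.assoc)
  show "bergman_inner M A g f = cnj (bergman_inner M A f g)" if "L2_form f" "L2_form g"
    unfolding bergman_inner_eq complex_cnj_mult Bochner_Integration.integral_cnj[symmetric]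
    by (simp add: mult.commute)
  show "0 \<le> Re (bergman_inner M A f f)" if "L2_form f"
    by (simp add: inner_self sqnorm_nonneg)
  show "\<exists>C. \<forall>f\<in>bergman_space M A. (cmod (f c z))\<^sup>2 \<le> C * Re (bergman_inner M A f f)"
  proof -
    obtain C where C: "\<And>f. L2_form f ==> (cmod (f c z))\<^sup>2 \<le> C * sqnorm f" using evaluation_bound_exists[of c z] by blast
    show ?thesis by (intro exI[of _ C] ballI) (simp add: inner_self bergman_space_iff C)
  qed
  show "\<exists>D. countable D \<and> (\<forall>f\<in>bergman_space M A. (\<forall>(c, z)\<in>D. f c z = 0) \<longrightarrow> f = zero_form)"
    using L2_separable by (auto simp: bergman_space_iff)
next
  fix s :: "nat \<Rightarrow> ('a, 'n) form"
  assume "\<And>m. L2_form (s m)"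
    and "\<And>e. e > 0 ==> \<exists>K. \<forall>m\<ge>K. \<forall>k\<ge>K. Re (bergman_inner M A (form_diff (s m) (s k)) (form_diff (s m) (s k))) < e"
  then have "\<exists>f. L2_form f \<and> (\<forall>e>0. \<exists>K. \<forall>m\<ge>K. sqnorm (form_diff (s m) f) < e)"
    by (intro L2_complete) (auto simp: inner_self)
  then obtain f where "L2_form f" "\<forall>e>0. \<exists>K. \<forall>m\<ge>K. sqnorm (form_diff (s m) f) < e" by blast
  then show "\<exists>f\<in>bergman_space M A. \<forall>e>0. \<exists>K. \<forall>m\<ge>K. Re (bergman_inner M A (form_diff (s m) f) (form_diff (s m) f)) < e"
    by (intro bexI[of _ f]) (simp_all add: inner_self bergman_space_iff)
qed

section \<open>The Bergman kernel\<close>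

context holomorphic_atlas
begin

abbreviation "A2 \<equiv> bergman_space M A"
abbreviation "bip \<equiv> bergman_inner M A"

lemma sqn_eq: "sqn f = sqnorm f"
  by (simp add: sqn_def inner_self)

lemma A2_holomorphic: "f \<in> A2 ==> f \<in> holomorphic_forms A"
  by (simp add: bergman_space_def)

definition basis_length :: enat where
  "basis_length = fst (SOME (N, f). bergman_orthonormal_basis M A N f)"

definition basis :: "nat \<Rightarrow> ('a, 'n) form" where
  "basis j = (if enat j < basis_length then snd (SOME (N, f). bergman_orthonormal_basis M A N f) j else zero_form)"

lemma bergman_orthonormal_basisD:
  assumes "bergman_orthonormal_basis M A N f"
  shows "enat j < N ==> f j \<in> A2"
    and "enat i < N ==> enat j < N ==> bip (f i) (f j) = (if i = j then 1 else 0)"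
    and "g \<in> A2 ==> \<forall>j. enat j < N \<longrightarrow> bip g (f j) = 0 ==> g = zero_form"
  using assms unfolding bergman_orthonormal_basis_def by blast+

lemma basis_orthonormal_basis: "orthonormal_basis {j. enat j < basis_length} basis"
proof -
  let ?Nf = "SOME (N, f). bergman_orthonormal_basis M A N f"
  have "\<exists>Nf. case Nf of (N, f) \<Rightarrow> bergman_orthonormal_basis M A N f"
    by (rule orthonormal_sequence_exists) (unfold bergman_orthonormal_basis_def, blast)
  from someI_ex[OF this] have b: "bergman_orthonormal_basis M A (fst ?Nf) (snd ?Nf)"
    by (cases ?Nf) simp
  have bl: "fst ?Nf = basis_length" by (simp only: basis_length_def)
  define F where "F = snd ?Nf"
  have bj: "basis j = F j" if "enat j < basis_length" for j using that by (simp only: basis_def if_True F_def)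
  have b': "bergman_orthonormal_basis M A basis_length F" using b by (simp only: bl F_def)
  note b1 = bergman_orthonormal_basisD(1)[OF b'] and b2 = bergman_orthonormal_basisD(2)[OF b']
    and b3 = bergman_orthonormal_basisD(3)[OF b']
  have b0: "basis j = zero_form" if "\<not> enat j < basis_length" for j using that by (simp only: basis_def if_False)
  have z: "bip zero_form f = 0 \<and> bip f zero_form = 0" if "f \<in> A2" for f
    using ip_zero[OF that] ip_cnj[OF zero_mem that] by simp
  have mem: "basis j \<in> A2" for j
  proof (cases "enat j < basis_length")
    case True
    show ?thesis unfolding bj[OF True] by (rule b1[OF True])
  next
    case False
    show ?thesis unfolding b0[OF False] by (rule zero_mem)
  qed
  have "bip (basis i) (basis j) = (if i = j \<and> i \<in> {j. enat j < basis_length} then 1 else 0)" for i j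
  proof (cases "enat i < basis_length \<and> enat j < basis_length")
    case True
    then have ij: "enat i < basis_length" "enat j < basis_length" by blast+
    show ?thesis unfolding bj[OF ij(1)] bj[OF ij(2)] b2[OF ij] using ij by simp
  next
    case False
    then have "basis i = zero_form \<or> basis j = zero_form" using b0 by blast
    then have "bip (basis i) (basis j) = 0"
    proof
      assume "basis i = zero_form" show ?thesis unfolding \<open>basis i = zero_form\<close> using z[OF mem[of j]] by blast
    next
      assume "basis j = zero_form" show ?thesis unfolding \<open>basis j = zero_form\<close> using z[OF mem[of i]] by blast
    qed
    then show ?thesis using False by auto
  qed
  moreover have "g = zero_form" if g: "g \<in> A2" "\<And>j. bip g (basis j) = 0" for g
  proof (rule b3[OF g(1)], intro allI impI)
    fix j assume "enat j < basis_length"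
    from g(2)[of j, unfolded bj[OF this]] show "bip g (F j) = 0" .
  qed
  ultimately show ?thesis
    using mem b0 by (simp add: orthonormal_basis_def orthonormal_family_def)
qed

lemma basis_mem: "basis j \<in> A2"
  using basis_orthonormal_basis by (simp add: orthonormal_basis_def orthonormal_family_def)

definition kern :: "('a, 'n) chart \<Rightarrow> complex ^ 'n \<Rightarrow> ('a, 'n) form" where
  "kern c w = (SOME e. e \<in> A2 \<and> (\<forall>f\<in>A2. bip f e = f c w))"

lemma kern: "kern c w \<in> A2" "f \<in> A2 ==> bip f (kern c w) = f c w"
proof -
  obtain C where C: "\<And>f. f \<in> A2 ==> (cmod (f c w))\<^sup>2 \<le> C * sqn f" using eval_bound[of c w] unfolding sqn_def by blast
  obtain e where "e \<in> A2" "\<And>f. f \<in> A2 ==> bip f e = f c w"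
    by (rule riesz[OF basis_orthonormal_basis, of "\<lambda>f. f c w" C]) (use C in auto)
  then have "\<exists>e. e \<in> A2 \<and> (\<forall>f\<in>A2. bip f e = f c w)" by blast
  from someI_ex[OF this] show "kern c w \<in> A2" "f \<in> A2 ==> bip f (kern c w) = f c w"
    unfolding kern_def by blast+
qed

lemma kern_sums: "(\<lambda>j. basis j c z * cnj (basis j c w)) sums kern c w c z"
proof -
  have "bip (kern c w) (basis j) = cnj (basis j c w)" for j
    using kern(2)[OF basis_mem[of j], of c w] ip_cnj[OF basis_mem[of j] kern(1)[of c w]] by simp
  then show ?thesis
    using basis_expansion(1)[OF basis_orthonormal_basis kern(1)[of c w], of c z] by (simp add: mult.commute)
qed

lemma kern_sym: "kern c w c z = cnj (kern c z c w)"
  using kern(2)[OF kern(1)[of c w], of c z] kern(2)[OF kern(1)[of c z], of c w] ip_cnj[OF kern(1)[of c z] kern(1)[of c w]]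
  by simp

lemma kern_diag: "kern c z c z = of_real (sqn (kern c z))"
  using kern(2)[OF kern(1)[of c z], of c z] ip_self[OF kern(1)[of c z]] by simp

lemma bergman_kernel_eq: "bergman_kernel M A c z = kern c z c z"
proof -
  let ?Nf = "SOME (N, f). bergman_orthonormal_basis M A N f"
  have eq: "wedge_cnj (snd ?Nf j) (snd ?Nf j) c z = basis j c z * cnj (basis j c z)" if "enat j < fst ?Nf" for j
    using that by (simp add: wedge_cnj_def basis_def basis_length_def)
  have "(\<lambda>j. complex_of_real ((cmod (basis j c z))\<^sup>2)) sums complex_of_real (sqn (kern c z))"
    using kern_sums[of c z z] by (simp add: kern_diag of_real_cmod_square)
  then have "(\<lambda>j. (cmod (basis j c z))\<^sup>2) sums sqn (kern c z)" by (simp only: sums_of_real_iff)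
  then have "((\<lambda>j. (cmod (basis j c z))\<^sup>2) has_sum sqn (kern c z)) UNIV"
    by (intro sums_nonneg_imp_has_sum) auto
  then have "((\<lambda>j. complex_of_real ((cmod (basis j c z))\<^sup>2)) has_sum complex_of_real (sqn (kern c z))) UNIV"
    by (rule has_sum_of_real)
  then have "((\<lambda>j. wedge_cnj (snd ?Nf j) (snd ?Nf j) c z) has_sum kern c z c z) {j. enat j < fst ?Nf}"
    unfolding kern_diag
    by (subst has_sum_cong_neutral[where T = UNIV and g = "\<lambda>j. complex_of_real ((cmod (basis j c z))\<^sup>2)"])
       (auto simp: eq of_real_cmod_square basis_def[of _ ] basis_length_def)
  then have "(\<Sum>\<^sub>\<infinity>j\<in>{j. enat j < fst ?Nf}. wedge_cnj (snd ?Nf j) (snd ?Nf j) c z) = kern c z c z"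
    by (rule infsumI)
  then show ?thesis by (simp add: bergman_kernel_def case_prod_beta)
qed

lemma kern_bounded:
  assumes c: "c \<in> A" and z: "z \<in> chart_image c"
  obtains r C where "r > 0" "ball z r \<subseteq> chart_image c" "C \<ge> 0"
    "\<And>w. w \<in> ball z r ==> sqn (kern c w) \<le> C" "\<And>f w. f \<in> A2 ==> w \<in> ball z r ==> (cmod (f c w))\<^sup>2 \<le> C * sqn f"
proof -
  obtain r C where r: "r > 0" "ball z r \<subseteq> chart_image c"
    "\<And>f w. L2_form f ==> w \<in> ball z r ==> (cmod (f c w))\<^sup>2 \<le> C * sqnorm f"
    using local_evaluation_bound[OF c z] by metis
  show thesis
  proof (rule that[of r "\<bar>C\<bar>"])
    show ev: "(cmod (f c w))\<^sup>2 \<le> \<bar>C\<bar> * sqn f" if "f \<in> A2" "w \<in> ball z r" for f w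
    proof -
      have "(cmod (f c w))\<^sup>2 \<le> C * sqnorm f" using r(3)[OF _ that(2)] that(1) by (simp add: bergman_space_iff)
      also have "\<dots> \<le> \<bar>C\<bar> * sqnorm f" by (intro mult_right_mono sqnorm_nonneg) simp
      finally show ?thesis by (simp add: sqn_eq)
    qed
    show "sqn (kern c w) \<le> \<bar>C\<bar>" if "w \<in> ball z r" for w
    proof -
      have "(cmod (kern c w c w))\<^sup>2 \<le> \<bar>C\<bar> * sqn (kern c w)" by (rule ev[OF kern(1) that])
      then have "sqn (kern c w) * sqn (kern c w) \<le> \<bar>C\<bar> * sqn (kern c w)"
        using sqn_nonneg[OF kern(1)] by (simp add: kern_diag power2_eq_square)
      then show ?thesis using sqn_nonneg[OF kern(1), of c w] by (cases "sqn (kern c w) = 0") auto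
    qed
  qed (use r in auto)
qed

end

section \<open>Flat Kaehler potentials\<close>

lemma wirtinger_conjugate:
  fixes f :: "complex ^ 'n \<Rightarrow> complex"
  assumes f: "holomorphic_Cn_on f S" and S: "open S"
  shows "holomorphic_Cn_on (\<lambda>w. cnj (f (vec_cnj w))) {w. vec_cnj w \<in> S}"
    and "vec_cnj w \<in> S ==> wirtinger i (\<lambda>w. cnj (f (vec_cnj w))) w = cnj (wirtinger i f (vec_cnj w))"
proof -
  have bl: "bounded_linear (vec_cnj :: complex ^ 'n \<Rightarrow> _)"
    unfolding linear_conv_bounded_linear[symmetric] by (rule linearI) (simp_all add: vec_eq_iff)
  have *: "((\<lambda>w. cnj (f (vec_cnj w))) has_derivative (\<lambda>v. cnj (Cn_derivative f (vec_cnj w) (vec_cnj v)))) (at w)"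
    if "vec_cnj w \<in> S" for w
  proof -
    have "(vec_cnj has_derivative vec_cnj) (at w)" by (rule bounded_linear_imp_has_derivative[OF bl])
    from diff_chain_at[OF this holomorphic_Cn_derivative[OF f S that]]
    have "((\<lambda>w. f (vec_cnj w)) has_derivative (\<lambda>v. Cn_derivative f (vec_cnj w) (vec_cnj v))) (at w)"
      by (simp add: o_def)
    from bounded_linear.has_derivative[OF bounded_linear_cnj this] show ?thesis .
  qed
  have sc: "cnj (Cn_derivative f x (vec_cnj (a *s v))) = a * cnj (Cn_derivative f x (vec_cnj v))" for x a v
  proof -
    have "vec_cnj (a *s v) = cnj a *s vec_cnj v" by (simp add: vec_eq_iff)
    then show ?thesis by (simp add: Cn_derivative_scale)
  qed
  show "holomorphic_Cn_on (\<lambda>w. cnj (f (vec_cnj w))) {w. vec_cnj w \<in> S}"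
    by (rule holomorphic_CnI[OF *]) (simp_all add: sc)
  show "wirtinger i (\<lambda>w. cnj (f (vec_cnj w))) w = cnj (wirtinger i f (vec_cnj w))" if "vec_cnj w \<in> S"
  proof -
    have "vec_cnj (axis i 1) = (axis i 1 :: complex ^ 'n)" by (simp add: vec_eq_iff axis_def)
    then show ?thesis using wirtinger_eqI[OF *[OF that] sc, of i] by (simp add: Cn_derivative_axis)
  qed
qed

lemma bidisc_left_constant:
  assumes f: "holomorphic_Cn_on f (bidisc p r)"
    and z: "\<And>x k. x \<in> bidisc p r ==> wirtinger (Inl k) f x = 0"
    and m: "z \<in> ball p r" "z' \<in> ball p r" "w \<in> ball (vec_cnj p) r"
  shows "f (vec_join z w) = f (vec_join z' w)"
proof (rule has_derivative_zero_unique[OF convex_ball _ m(1,2)])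
  fix y assume "y \<in> ball p r"
  then have j: "vec_join y w \<in> bidisc p r" using m(3) by simp
  have "(\<lambda>v. Cn_derivative f (vec_join y w) (vec_join v 0)) = (\<lambda>v. 0)"
    using z[OF j] by (simp add: Cn_derivative_vec_join)
  then show "((\<lambda>z. f (vec_join z w)) has_derivative (\<lambda>h. 0)) (at y within ball p r)"
    using wirtinger_join_left(1)[OF f open_bidisc j] by (simp add: has_derivative_at_withinI)
qed

lemma bidisc_right_constant:
  assumes f: "holomorphic_Cn_on f (bidisc p r)"
    and z: "\<And>x k. x \<in> bidisc p r ==> wirtinger (Inr k) f x = 0"
    and m: "z \<in> ball p r" "w \<in> ball (vec_cnj p) r" "w' \<in> ball (vec_cnj p) r"
  shows "f (vec_join z w) = f (vec_join z w')"
proof (rule has_derivative_zero_unique[OF convex_ball _ m(2,3)])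
  fix y assume "y \<in> ball (vec_cnj p) r"
  then have j: "vec_join z y \<in> bidisc p r" using m(1) by simp
  have "(\<lambda>v. Cn_derivative f (vec_join z y) (vec_join 0 v)) = (\<lambda>v. 0)"
    using z[OF j] by (simp add: Cn_derivative_vec_join)
  then show "((\<lambda>w. f (vec_join z w)) has_derivative (\<lambda>h. 0)) (at y within ball (vec_cnj p) r)"
    using wirtinger_join_right(1)[OF f open_bidisc j] by (simp add: has_derivative_at_withinI)
qed

lemma holomorphic_Cn_sum':
  assumes "\<And>j. j \<in> I ==> holomorphic_Cn_on (f j) S" "open S"
  shows "holomorphic_Cn_on (\<lambda>z. \<Sum>j\<in>I. f j z) S"
    and "z \<in> S ==> wirtinger i (\<lambda>z. \<Sum>j\<in>I. f j z) z = (\<Sum>j\<in>I. wirtinger i (f j) z)"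
  using holomorphic_Cn_sum[of I f S] assms by (cases "finite I"; simp)+

definition holo_matrix_on :: "(complex ^ 'm \<Rightarrow> complex ^ 'k ^ 'k) \<Rightarrow> (complex ^ 'm) set \<Rightarrow> bool" where
  "holo_matrix_on G S \<longleftrightarrow> (\<forall>i j. holomorphic_Cn_on (\<lambda>x. G x $ i $ j) S)"

definition dmat :: "'m \<Rightarrow> (complex ^ 'm \<Rightarrow> complex ^ 'k ^ 'k) \<Rightarrow> complex ^ 'm \<Rightarrow> complex ^ 'k ^ 'k" where
  "dmat i G x = (\<chi> a b. wirtinger i (\<lambda>x. G x $ a $ b) x)"

lemma holo_matrix_mult:
  fixes G :: "complex ^ 'm::finite \<Rightarrow> complex ^ 'k::finite ^ 'k"
  assumes "holo_matrix_on G S" "holo_matrix_on H S" "open S"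
  shows "holo_matrix_on (\<lambda>x. G x ** H x) S"
    and "x \<in> S ==> dmat i (\<lambda>x. G x ** H x) x = dmat i G x ** H x + G x ** dmat i H x"
proof -
  have t: "holomorphic_Cn_on (\<lambda>x. G x $ a $ k * H x $ k $ b) S"
    "\<And>x. x \<in> S ==> wirtinger i (\<lambda>x. G x $ a $ k * H x $ k $ b) x =
        G x $ a $ k * wirtinger i (\<lambda>x. H x $ k $ b) x + wirtinger i (\<lambda>x. G x $ a $ k) x * H x $ k $ b" for a b k i
    using holomorphic_Cn_mult[of "\<lambda>x. G x $ a $ k" S "\<lambda>x. H x $ k $ b"] assms by (simp_all add: holo_matrix_on_def)
  show "holo_matrix_on (\<lambda>x. G x ** H x) S"
    unfolding holo_matrix_on_def matrix_matrix_mult_def vec_lambda_beta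
    by (intro allI holomorphic_Cn_sum'(1) t(1) assms(3))
  assume x: "x \<in> S"
  have "wirtinger i (\<lambda>x. \<Sum>k\<in>UNIV. G x $ a $ k * H x $ k $ b) x =
      (\<Sum>k\<in>UNIV. wirtinger i (\<lambda>x. G x $ a $ k * H x $ k $ b) x)" for a b
    by (rule holomorphic_Cn_sum'(2)[OF t(1) assms(3) x])
  then show "dmat i (\<lambda>x. G x ** H x) x = dmat i G x ** H x + G x ** dmat i H x"
    using t(2)[OF x] by (simp add: dmat_def vec_eq_iff matrix_matrix_mult_def sum.distrib add.commute)
qed

lemma holo_matrix_const: "holo_matrix_on (\<lambda>x. C) S" "dmat i (\<lambda>x. C) x = 0"
  by (simp_all add: holo_matrix_on_def dmat_def vec_eq_iff)

lemma dmat_cong: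
  assumes "open S" "x \<in> S" "\<And>y. y \<in> S ==> G y = H y"
  shows "dmat i G x = dmat i H x"
proof -
  have "wirtinger i (\<lambda>x. G x $ a $ b) x = wirtinger i (\<lambda>x. H x $ a $ b) x" for a b
    by (rule wirtinger_cong(1)[OF assms(1,2)]) (simp add: assms(3))
  then show ?thesis by (simp add: dmat_def)
qed

lemma matrix_inv_det_nonzero:
  fixes A :: "complex ^ 'k ^ 'k"
  assumes "det A \<noteq> 0"
  shows "A ** matrix_inv A = mat 1" "matrix_inv A ** A = mat 1"
proof -
  obtain B where B: "A ** B = mat 1 \<and> B ** A = mat 1"
    using assms invertible_det_nz[of A] unfolding invertible_def by blast
  have "A ** matrix_inv A = mat 1 \<and> matrix_inv A ** A = mat 1"
    unfolding matrix_inv_def by (rule someI[of _ B]) (rule B)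
  then show "A ** matrix_inv A = mat 1" "matrix_inv A ** A = mat 1" by auto
qed

lemma holo_matrix_det:
  fixes H :: "complex ^ 'm::finite \<Rightarrow> complex ^ 'k::finite ^ 'k"
  assumes "holo_matrix_on H S" and S: "open S"
  shows "holomorphic_Cn_on (\<lambda>x. det (H x)) S"
proof -
  have "holomorphic_Cn_on (\<lambda>x. of_int (sign q) * (\<Prod>i\<in>UNIV. H x $ i $ q i)) S" for q
    using assms(1) by (intro holomorphic_Cn_cmult(1) holomorphic_Cn_prod S) (simp add: holo_matrix_on_def)
  then show ?thesis
    unfolding det_def by (intro holomorphic_Cn_sum'(1) S)
qed

lemma holo_matrix_inv:
  fixes G :: "complex ^ 'm::finite \<Rightarrow> complex ^ 'k::finite ^ 'k"
  assumes G: "holo_matrix_on G S" and S: "open S" and nz: "\<And>x. x \<in> S ==> det (G x) \<noteq> 0"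
  shows "holo_matrix_on (\<lambda>x. matrix_inv (G x)) S"
    and "x \<in> S ==> dmat i (\<lambda>x. matrix_inv (G x)) x = - (matrix_inv (G x) ** dmat i G x ** matrix_inv (G x))"
proof -
  have entry: "matrix_inv (G x) $ k $ l = det (\<chi> i j. if j = k then axis l 1 $ i else G x $ i $ j) / det (G x)"
    if "x \<in> S" for x k l
  proof -
    have "G x *v (matrix_inv (G x) *v axis l 1) = axis l 1"
      using matrix_inv_det_nonzero(1)[OF nz[OF that]] by (simp add: matrix_vector_mul_assoc)
    then have "matrix_inv (G x) *v axis l 1 = (\<chi> k. det (\<chi> i j. if j = k then axis l 1 $ i else G x $ i $ j) / det (G x))"
      using cramer[OF nz[OF that]] by simp
    moreover have "(matrix_inv (G x) *v axis l 1) $ k = matrix_inv (G x) $ k $ l"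
      by (simp add: matrix_vector_mult_def axis_def if_distrib cong: if_cong)
    ultimately show ?thesis by simp
  qed
  have "holomorphic_Cn_on (\<lambda>x. matrix_inv (G x) $ k $ l) S" for k l
  proof (rule holomorphic_Cn_cong)
    have "holo_matrix_on (\<lambda>x. \<chi> i j. if j = k then axis l 1 $ i else G x $ i $ j) S"
      unfolding holo_matrix_on_def
    proof (intro allI)
      fix i j show "holomorphic_Cn_on (\<lambda>x. (\<chi> i j. if j = k then axis l 1 $ i else G x $ i $ j) $ i $ j) S"
        using G by (cases "j = k") (simp_all add: holo_matrix_on_def)
    qed
    then show "holomorphic_Cn_on (\<lambda>x. det (\<chi> i j. if j = k then axis l 1 $ i else G x $ i $ j) / det (G x)) S"
      by (intro holomorphic_Cn_divide holo_matrix_det G S nz)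
  qed (simp add: entry)
  then show hi: "holo_matrix_on (\<lambda>x. matrix_inv (G x)) S" by (simp add: holo_matrix_on_def)
  assume x: "x \<in> S"
  let ?I = "\<lambda>x. matrix_inv (G x)"
  have "dmat i (\<lambda>x. ?I x ** G x) x = dmat i (\<lambda>x. mat 1) x"
    by (rule dmat_cong[OF S x]) (simp add: matrix_inv_det_nonzero(2)[OF nz])
  then have "dmat i ?I x ** G x + ?I x ** dmat i G x = 0"
    by (simp add: holo_matrix_mult(2)[OF hi G S x] holo_matrix_const)
  then have "dmat i ?I x ** G x = - (?I x ** dmat i G x)" by (rule eq_neg_iff_add_eq_0[THEN iffD2])
  then have "dmat i ?I x ** G x ** ?I x = - (?I x ** dmat i G x) ** ?I x" by simp
  then show "dmat i ?I x = - (?I x ** dmat i G x ** ?I x)"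
  proof -
    assume a: "dmat i ?I x ** G x ** ?I x = - (?I x ** dmat i G x) ** ?I x"
    have "dmat i ?I x ** G x ** ?I x = dmat i ?I x"
      by (simp add: matrix_mul_assoc[symmetric] matrix_inv_det_nonzero(1)[OF nz[OF x]])
    moreover have "- B ** ?I x = - (B ** ?I x)" for B :: "complex ^ 'k ^ 'k"
      by (simp add: vec_eq_iff matrix_matrix_mult_def sum_negf)
    ultimately show ?thesis using a by simp
  qed
qed

definition herm :: "complex ^ 'n ^ 'n \<Rightarrow> complex ^ 'n \<Rightarrow> complex ^ 'n \<Rightarrow> complex" where
  "herm g v w = (\<Sum>a\<in>UNIV. \<Sum>b\<in>UNIV. g $ a $ b * v $ a * cnj (w $ b))"

lemma herm_add_left: "herm g (u + v) w = herm g u w + herm g v w"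
  by (simp add: herm_def sum.distrib algebra_simps)

lemma herm_scale_left: "herm g (a *s v) w = a * herm g v w"
  by (simp add: herm_def sum_distrib_left algebra_simps)

lemma herm_sum_left: "herm g (\<Sum>i\<in>I. f i) w = (\<Sum>i\<in>I. herm g (f i) w)"
proof (induction I rule: infinite_finite_induct)
  case (insert i I)
  then show ?case by (simp add: herm_add_left)
qed (simp_all add: herm_def)

lemma herm_cnj:
  assumes "\<And>a b. g $ b $ a = cnj (g $ a $ b)"
  shows "herm g w v = cnj (herm g v w)"
proof -
  have "cnj (herm g v w) = (\<Sum>b\<in>UNIV. \<Sum>a\<in>UNIV. cnj (g $ a $ b) * cnj (v $ a) * w $ b)"
    unfolding herm_def by (subst sum.swap) simp
  also have "\<dots> = herm g w v"
    unfolding herm_def by (intro sum.cong refl) (simp only: assms[symmetric] mult_ac)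
  finally show ?thesis by simp
qed

text \<open>
  Gram-Schmidt: a vector with a nonzero new coordinate is made orthogonal to the vectors found so
  far and then normalized.
\<close>

lemma hermitian_factorization:
  fixes g :: "complex ^ 'n::finite ^ 'n"
  assumes sym: "\<And>a b. g $ b $ a = cnj (g $ a $ b)"
    and pos: "\<And>v. v \<noteq> 0 ==> Re (herm g v v) > 0"
  obtains W :: "complex ^ 'n ^ 'n" where "\<And>k l. herm g (W $ k) (W $ l) = (if k = l then 1 else 0)"
proof -
  note hc = herm_cnj[OF sym]
  have re: "herm g v v = of_real (Re (herm g v v))" for v
    using hc[of v v] by (simp add: complex_eq_iff)
  have "\<exists>v :: 'n \<Rightarrow> complex ^ 'n. (\<forall>i\<in>S. \<forall>j\<in>S. herm g (v i) (v j) = (if i = j then 1 else 0)) \<and>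
     (\<forall>i\<in>S. \<forall>j. j \<notin> S \<longrightarrow> v i $ j = 0)" if "finite S" for S :: "'n set"
    using that
  proof (induction S rule: finite_induct)
    case empty
    then show ?case by simp
  next
    case (insert k S)
    then obtain v where v: "\<And>i j. i \<in> S ==> j \<in> S ==> herm g (v i) (v j) = (if i = j then 1 else 0)"
      "\<And>i j. i \<in> S ==> j \<notin> S ==> v i $ j = 0" by blast
    define u where "u = axis k 1 + (\<Sum>i\<in>S. (- herm g (axis k 1) (v i)) *s v i)"
    have uk: "u $ k = 1" using v(2)[of _ k] insert.hyps(2) by (simp add: u_def axis_def)
    have u0: "u $ j = 0" if "j \<notin> insert k S" for j
      using v(2)[of _ j] that by (simp add: u_def axis_def)
    have orth: "herm g u (v j) = 0" if j: "j \<in> S" for j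
    proof -
      have "herm g u (v j) = herm g (axis k 1) (v j) + (\<Sum>i\<in>S. - herm g (axis k 1) (v i) * herm g (v i) (v j))"
        unfolding u_def herm_add_left herm_sum_left herm_scale_left ..
      also have "(\<Sum>i\<in>S. - herm g (axis k 1) (v i) * herm g (v i) (v j)) = (\<Sum>i\<in>S. if i = j then - herm g (axis k 1) (v j) else 0)"
        by (intro sum.cong refl) (simp add: v(1) j)
      finally show ?thesis using j insert.hyps(1) by simp
    qed
    have "u \<noteq> 0" using uk by (metis zero_index zero_neq_one)
    define t where "t = Re (herm g u u)"
    have t: "t > 0" unfolding t_def by (rule pos) fact
    define e where "e = of_real (1 / sqrt t) *s u"
    have e1: "herm g e e = 1"
    proof -
      have "herm g e u = of_real (1 / sqrt t) * herm g u u" unfolding e_def by (rule herm_scale_left)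
      also have "\<dots> = of_real (1 / sqrt t * t)" using re[of u] by (simp add: t_def)
      finally have "herm g u e = of_real (1 / sqrt t * t)" using hc[of u e] by simp
      moreover have "herm g e e = of_real (1 / sqrt t) * herm g u e"
        by (subst (1) e_def) (rule herm_scale_left)
      ultimately have "herm g e e = of_real (1 / sqrt t * (1 / sqrt t) * t)"
        by (simp only: of_real_mult mult.assoc)
      also have "1 / sqrt t * (1 / sqrt t) * t = 1" using t by (simp add: field_simps)
      finally show ?thesis by simp
    qed
    have e2: "herm g e (v j) = 0" "herm g (v j) e = 0" if "j \<in> S" for j
    proof -
      show *: "herm g e (v j) = 0" unfolding e_def herm_scale_left orth[OF that] by simp
      show "herm g (v j) e = 0" using hc[of "v j" e] * by simp
    qed
    have e3: "e $ j = 0" if "j \<notin> insert k S" for j using u0[OF that] by (simp add: e_def)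
    have ne: "i \<noteq> k" if "i \<in> S" for i using that insert.hyps(2) by blast
    show ?case
    proof (intro exI[of _ "v(k := e)"] conjI ballI allI impI)
      fix i j assume "i \<in> insert k S" "j \<in> insert k S"
      then show "herm g ((v(k := e)) i) ((v(k := e)) j) = (if i = j then 1 else 0)"
        using v(1)[of i j] e1 e2(1)[of j] e2(2)[of i] by (cases "i = k"; cases "j = k") auto
    next
      fix i j assume "i \<in> insert k S" "j \<notin> insert k S"
      then show "(v(k := e)) i $ j = 0" using e3 v(2) by (cases "i = k") simp_all
    qed
  qed
  from this[of UNIV] obtain v :: "'n \<Rightarrow> complex ^ 'n" where v: "\<And>i j. herm g (v i) (v j) = (if i = j then 1 else 0)"
    by auto
  show thesis by (rule that[of "\<chi> k. v k"]) (simp add: v)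
qed

text \<open>
  With \<open>W g W\<^sup>* = 1\<close> the inverse matrix is \<open>W\<^sup>* W\<close>.
\<close>

lemma inverse_of_factorization:
  fixes g W :: "complex ^ 'n::finite ^ 'n"
  assumes W: "\<And>k l. herm g (W $ k) (W $ l) = (if k = l then 1 else 0)"
  shows "matrix_inv g $ a $ b = (\<Sum>k\<in>UNIV. cnj (W $ k $ a) * W $ k $ b)" "det W \<noteq> 0" "det g \<noteq> 0"
proof -
  define V where "V = (\<chi> b l. cnj (W $ l $ b))"
  have "(W ** g ** V) $ k $ l = herm g (W $ k) (W $ l)" for k l
    unfolding herm_def V_def matrix_matrix_mult_def
    by (simp add: sum_distrib_right) (subst sum.swap, simp add: mult_ac)
  then have WgV: "W ** g ** V = mat 1" by (simp add: vec_eq_iff mat_def W)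
  have "det W * det g * det V = 1" using arg_cong[OF WgV, of det] by (simp add: det_mul)
  then show nz: "det W \<noteq> 0" "det g \<noteq> 0" by auto
  have "g ** V ** W = mat 1"
  proof -
    have "W ** (g ** V) = mat 1" using WgV by (simp add: matrix_mul_assoc)
    then show ?thesis by (simp add: matrix_left_right_inverse)
  qed
  then have gVW: "g ** (V ** W) = mat 1" by (simp add: matrix_mul_assoc)
  have "matrix_inv g = matrix_inv g ** (g ** (V ** W))" by (simp add: gVW)
  also have "\<dots> = V ** W" by (simp add: matrix_mul_assoc matrix_inv_det_nonzero(2)[OF nz(2)])
  finally have "matrix_inv g $ a $ b = (V ** W) $ a $ b" by simp
  then show "matrix_inv g $ a $ b = (\<Sum>k\<in>UNIV. cnj (W $ k $ a) * W $ k $ b)"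
    by (simp add: matrix_matrix_mult_def V_def)
qed

text \<open>A quartic form with the symmetries of a Kaehler curvature tensor is determined by its diagonal.\<close>

lemma symmetric_form_zero:
  fixes S :: "'n::finite \<Rightarrow> 'n \<Rightarrow> complex"
  assumes sym: "\<And>i k. S i k = S k i" and z: "\<And>X :: complex ^ 'n. (\<Sum>i\<in>UNIV. \<Sum>k\<in>UNIV. S i k * X $ i * X $ k) = 0"
  shows "S i k = 0"
proof -
  have dd: "(\<Sum>i\<in>UNIV. \<Sum>k\<in>UNIV. if i = a then if k = b then c else 0 else 0) = c" for a b :: 'n and c :: complex
  proof -
    have "(\<Sum>k\<in>UNIV. if i = a then if k = b then c else 0 else 0) = (if i = a then c else 0)" for i
      by (cases "i = a") simp_all
    then show ?thesis by simp
  qed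
  have ev: "(\<Sum>i\<in>UNIV. \<Sum>k\<in>UNIV. S i k * (axis a 1 + axis b 1 :: complex ^ 'n) $ i * (axis a 1 + axis b 1) $ k)
      = S a a + S a b + S b a + S b b" for a b
    by (simp add: axis_def algebra_simps sum.distrib if_distrib[of "\<lambda>x. _ * x"] dd cong: if_cong)
  have "4 * S a a = 0" for a using ev[of a a] z[of "axis a 1 + axis a 1"] by (simp add: algebra_simps)
  then have d: "S a a = 0" for a by simp
  have "S i k + S k i = 0" using ev[of i k] z[of "axis i 1 + axis k 1"] d by simp
  then show ?thesis using sym[of i k] by simp
qed

lemma curvature_polarization:
  fixes R :: "'n::finite \<Rightarrow> 'n \<Rightarrow> 'n \<Rightarrow> 'n \<Rightarrow> complex"
  assumes s1: "\<And>i j k l. R i j k l = R k j i l" and s2: "\<And>i j k l. R i j k l = R i l k j"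
    and z: "\<And>X :: complex ^ 'n. (\<Sum>i\<in>UNIV. \<Sum>j\<in>UNIV. \<Sum>k\<in>UNIV. \<Sum>l\<in>UNIV. R i j k l * X $ i * cnj (X $ j) * X $ k * cnj (X $ l)) = 0"
  shows "R i j k l = 0"
proof -
  define H where "H = (\<lambda>x :: complex ^ ('n + 'n). \<Sum>i\<in>UNIV. \<Sum>j\<in>UNIV. \<Sum>k\<in>UNIV. \<Sum>l\<in>UNIV.
      R i j k l * x $ Inl i * x $ Inr j * x $ Inl k * x $ Inr l)"
  have Hh: "holomorphic_Cn_on H (bidisc 0 r)" for r
    unfolding H_def
    by (intro holomorphic_Cn_sum'(1) holomorphic_Cn_mult(1) open_bidisc holomorphic_Cn_const holomorphic_Cn_component)
  have H0: "H (vec_join X (vec_cnj X)) = 0" for X using z[of X] by (simp add: H_def)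
  have HXY: "H (vec_join X Y) = 0" for X Y
  proof -
    define r where "r = 4 * (norm X + norm Y + 1)"
    have "norm X < r / 4" "norm Y < r / 4" by (simp_all add: r_def add_nonneg_pos)
    moreover have "vec_cnj (0 :: complex ^ 'n) = 0" by (simp add: vec_eq_iff)
    ultimately show ?thesis by (intro polarization[OF Hh H0, where r = r]) simp_all
  qed
  have "(\<Sum>j\<in>UNIV. \<Sum>l\<in>UNIV. R i j k l * Y $ j * Y $ l) = 0" for i k and Y :: "complex ^ 'n"
  proof (rule symmetric_form_zero[of "\<lambda>i k. \<Sum>j\<in>UNIV. \<Sum>l\<in>UNIV. R i j k l * Y $ j * Y $ l"])
    show "(\<Sum>j\<in>UNIV. \<Sum>l\<in>UNIV. R i j k l * Y $ j * Y $ l) = (\<Sum>j\<in>UNIV. \<Sum>l\<in>UNIV. R k j i l * Y $ j * Y $ l)" for i k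
      by (simp only: s1[of i _ k])
    fix X :: "complex ^ 'n"
    have "(\<Sum>i\<in>UNIV. \<Sum>k\<in>UNIV. (\<Sum>j\<in>UNIV. \<Sum>l\<in>UNIV. R i j k l * Y $ j * Y $ l) * X $ i * X $ k) = H (vec_join X Y)"
      unfolding H_def
    proof (simp only: sum_distrib_right vec_join_nth, rule sum.cong[OF refl])
      fix i
      have "(\<Sum>k\<in>UNIV. \<Sum>j\<in>UNIV. \<Sum>l\<in>UNIV. R i j k l * Y $ j * Y $ l * X $ i * X $ k)
          = (\<Sum>j\<in>UNIV. \<Sum>k\<in>UNIV. \<Sum>l\<in>UNIV. R i j k l * Y $ j * Y $ l * X $ i * X $ k)" by (rule sum.swap)
      also have "\<dots> = (\<Sum>j\<in>UNIV. \<Sum>k\<in>UNIV. \<Sum>l\<in>UNIV. R i j k l * X $ i * Y $ j * X $ k * Y $ l)"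
        by (intro sum.cong refl) (simp add: mult_ac)
      finally show "(\<Sum>k\<in>UNIV. \<Sum>j\<in>UNIV. \<Sum>l\<in>UNIV. R i j k l * Y $ j * Y $ l * X $ i * X $ k)
          = (\<Sum>j\<in>UNIV. \<Sum>k\<in>UNIV. \<Sum>l\<in>UNIV. R i j k l * X $ i * Y $ j * X $ k * Y $ l)" .
    qed
    then show "(\<Sum>i\<in>UNIV. \<Sum>k\<in>UNIV. (\<Sum>j\<in>UNIV. \<Sum>l\<in>UNIV. R i j k l * Y $ j * Y $ l) * X $ i * X $ k) = 0"
      by (simp only: HXY)
  qed
  then show ?thesis
    by (intro symmetric_form_zero[of "\<lambda>j l. R i j k l"]) (rule s2)
qed

locale flat_potential =
  fixes p :: "complex ^ 'n::finite" and r :: real and \<Phi> :: "complex ^ ('n + 'n) \<Rightarrow> complex"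
  assumes r: "r > 0" and \<Phi>: "holomorphic_Cn_on \<Phi> (bidisc p r)"
    and herm: "\<And>z w. z \<in> ball p r ==> w \<in> ball (vec_cnj p) r ==> \<Phi> (vec_join z w) = cnj (\<Phi> (vec_join (vec_cnj w) (vec_cnj z)))"
begin

definition G :: "complex ^ ('n + 'n) \<Rightarrow> complex ^ 'n ^ 'n" where
  "G x = (\<chi> \<alpha> \<beta>. wirtinger (Inl \<alpha>) (wirtinger (Inr \<beta>) \<Phi>) x)"

definition curv :: "complex ^ ('n + 'n) \<Rightarrow> 'n \<Rightarrow> 'n \<Rightarrow> 'n \<Rightarrow> 'n \<Rightarrow> complex" where
  "curv x i j k l = - wirtinger (Inl k) (wirtinger (Inr l) (\<lambda>x. G x $ i $ j)) x +
     (\<Sum>\<alpha>\<in>UNIV. \<Sum>\<beta>\<in>UNIV. matrix_inv (G x) $ \<beta> $ \<alpha> *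
        wirtinger (Inl k) (\<lambda>x. G x $ i $ \<beta>) x * wirtinger (Inr l) (\<lambda>x. G x $ \<alpha> $ j) x)"

lemma G_holo: "holo_matrix_on G (bidisc p r)"
  by (simp add: holo_matrix_on_def G_def holomorphic_Cn_wirtinger[OF holomorphic_Cn_wirtinger[OF \<Phi> open_bidisc] open_bidisc])

lemma G_entry: "holomorphic_Cn_on (\<lambda>x. G x $ i $ j) (bidisc p r)"
  using G_holo by (simp add: holo_matrix_on_def)

lemma G_entry_eq: "(\<lambda>x. G x $ i $ j) = wirtinger (Inl i) (wirtinger (Inr j) \<Phi>)"
  by (simp add: G_def)

lemma pd_holo: "holomorphic_Cn_on (wirtinger s \<Phi>) (bidisc p r)"
  by (rule holomorphic_Cn_wirtinger[OF \<Phi> open_bidisc])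

lemma G_sym_left: "x \<in> bidisc p r ==> wirtinger (Inl k) (\<lambda>x. G x $ i $ j) x = wirtinger (Inl i) (\<lambda>x. G x $ k $ j) x"
  unfolding G_entry_eq by (rule wirtinger_commute[OF pd_holo open_bidisc])

lemma G_sym_right: "x \<in> bidisc p r ==> wirtinger (Inr l) (\<lambda>x. G x $ i $ j) x = wirtinger (Inr j) (\<lambda>x. G x $ i $ l) x"
proof -
  assume x: "x \<in> bidisc p r"
  have sw: "wirtinger (Inl i) (wirtinger (Inr j) \<Phi>) y = wirtinger (Inr j) (wirtinger (Inl i) \<Phi>) y" if "y \<in> bidisc p r" for y i j
    by (rule wirtinger_commute[OF \<Phi> open_bidisc that])
  have "wirtinger (Inr l) (wirtinger (Inl i) (wirtinger (Inr j) \<Phi>)) x = wirtinger (Inr l) (wirtinger (Inr j) (wirtinger (Inl i) \<Phi>)) x"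
    by (rule wirtinger_cong(1)[OF open_bidisc x sw])
  also have "\<dots> = wirtinger (Inr j) (wirtinger (Inr l) (wirtinger (Inl i) \<Phi>)) x"
    by (rule wirtinger_commute[OF pd_holo open_bidisc x])
  also have "\<dots> = wirtinger (Inr j) (wirtinger (Inl i) (wirtinger (Inr l) \<Phi>)) x"
    by (rule wirtinger_cong(1)[OF open_bidisc x sw[symmetric]])
  finally show ?thesis unfolding G_entry_eq .
qed

lemma curv_sym:
  assumes x: "x \<in> bidisc p r"
  shows "curv x i j k l = curv x k j i l" "curv x i j k l = curv x i l k j"
proof -
  have c: "wirtinger (Inl k) (wirtinger (Inr l) (\<lambda>x. G x $ i $ j)) x = wirtinger (Inr l) (wirtinger (Inl k) (\<lambda>x. G x $ i $ j)) x" for i j k l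
    by (rule wirtinger_commute[OF G_entry open_bidisc x])
  have "wirtinger (Inr l) (wirtinger (Inl k) (\<lambda>x. G x $ i $ j)) x = wirtinger (Inr l) (wirtinger (Inl i) (\<lambda>x. G x $ k $ j)) x"
    by (rule wirtinger_cong(1)[OF open_bidisc x G_sym_left])
  then have 1: "wirtinger (Inl k) (wirtinger (Inr l) (\<lambda>x. G x $ i $ j)) x = wirtinger (Inl i) (wirtinger (Inr l) (\<lambda>x. G x $ k $ j)) x"
    by (simp only: c)
  have 2: "wirtinger (Inl k) (wirtinger (Inr l) (\<lambda>x. G x $ i $ j)) x = wirtinger (Inl k) (wirtinger (Inr j) (\<lambda>x. G x $ i $ l)) x"
    by (rule wirtinger_cong(1)[OF open_bidisc x G_sym_right])
  show "curv x i j k l = curv x k j i l" unfolding curv_def 1 by (simp only: G_sym_left[OF x, of k i])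
  show "curv x i j k l = curv x i l k j" unfolding curv_def 2 by (simp only: G_sym_right[OF x, of l _ j])
qed

text \<open>
  If the curvature vanishes, the Christoffel symbols \<open>\<partial>\<^sub>k g g\<^sup>-\<^sup>1\<close> are holomorphic, that is,
  independent of the conjugate variables. The polarized metric therefore solves, in the holomorphic
  variables, a linear equation not involving the conjugate ones and factors.
\<close>

context
  assumes nz: "\<And>x. x \<in> bidisc p r ==> det (G x) \<noteq> 0"
    and flat: "\<And>x i j k l. x \<in> bidisc p r ==> curv x i j k l = 0"
begin

abbreviation "Gi \<equiv> \<lambda>x. matrix_inv (G x)"

lemma Gi_holo: "holo_matrix_on Gi (bidisc p r)"
  by (rule holo_matrix_inv(1)[OF G_holo open_bidisc nz])

lemma flat_matrix:
  assumes x: "x \<in> bidisc p r"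
  shows "dmat (Inr l) (dmat (Inl k) G) x = dmat (Inl k) G x ** Gi x ** dmat (Inr l) G x"
proof -
  have "dmat (Inr l) (dmat (Inl k) G) x $ i $ j = (dmat (Inl k) G x ** Gi x ** dmat (Inr l) G x) $ i $ j" for i j
  proof -
    have "dmat (Inr l) (dmat (Inl k) G) x $ i $ j = wirtinger (Inr l) (wirtinger (Inl k) (\<lambda>x. G x $ i $ j)) x"
      by (simp add: dmat_def)
    also have "\<dots> = wirtinger (Inl k) (wirtinger (Inr l) (\<lambda>x. G x $ i $ j)) x"
      by (rule wirtinger_commute[OF G_entry open_bidisc x])
    also have "\<dots> = (\<Sum>\<alpha>\<in>UNIV. \<Sum>\<beta>\<in>UNIV. Gi x $ \<beta> $ \<alpha> *
        wirtinger (Inl k) (\<lambda>x. G x $ i $ \<beta>) x * wirtinger (Inr l) (\<lambda>x. G x $ \<alpha> $ j) x)"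
      using flat[OF x, of i j k l] by (simp add: curv_def)
    also have "\<dots> = (dmat (Inl k) G x ** Gi x ** dmat (Inr l) G x) $ i $ j"
      by (simp add: matrix_matrix_mult_def dmat_def sum_distrib_right sum_distrib_left mult_ac)
    finally show ?thesis .
  qed
  then show ?thesis by (simp add: vec_eq_iff)
qed

lemma dG_holo: "holo_matrix_on (dmat s G) (bidisc p r)"
  using G_entry by (simp add: holo_matrix_on_def dmat_def holomorphic_Cn_wirtinger open_bidisc)

lemma christoffel_constant:
  assumes "z \<in> ball p r" "w \<in> ball (vec_cnj p) r" "w' \<in> ball (vec_cnj p) r"
  shows "dmat (Inl k) G (vec_join z w) ** Gi (vec_join z w) = dmat (Inl k) G (vec_join z w') ** Gi (vec_join z w')"
proof -
  let ?\<Gamma> = "\<lambda>x. dmat (Inl k) G x ** Gi x"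
  have h: "holo_matrix_on ?\<Gamma> (bidisc p r)" by (rule holo_matrix_mult(1)[OF dG_holo Gi_holo open_bidisc])
  have "dmat (Inr l) ?\<Gamma> x = 0" if x: "x \<in> bidisc p r" for l x
  proof -
    have dGi: "dmat (Inr l) Gi x = - (Gi x ** dmat (Inr l) G x ** Gi x)"
      by (rule holo_matrix_inv(2)[OF G_holo open_bidisc nz x])
    have "dmat (Inr l) ?\<Gamma> x = dmat (Inl k) G x ** Gi x ** dmat (Inr l) G x ** Gi x
        + dmat (Inl k) G x ** - (Gi x ** dmat (Inr l) G x ** Gi x)"
      unfolding holo_matrix_mult(2)[OF dG_holo Gi_holo open_bidisc x] flat_matrix[OF x] dGi ..
    also have "\<dots> = 0"
    proof -
      have "B ** - C = - (B ** C)" for B C :: "complex ^ 'n ^ 'n"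
        by (simp add: vec_eq_iff matrix_matrix_mult_def sum_negf)
      then show ?thesis by (simp add: matrix_mul_assoc)
    qed
    finally show ?thesis .
  qed
  then have "wirtinger (Inr l) (\<lambda>x. ?\<Gamma> x $ i $ j) x = 0" if "x \<in> bidisc p r" for l x i j
    using that by (simp add: dmat_def vec_eq_iff)
  then have "?\<Gamma> (vec_join z w) $ i $ j = ?\<Gamma> (vec_join z w') $ i $ j" for i j
    using bidisc_right_constant[of "\<lambda>x. ?\<Gamma> x $ i $ j", OF _ _ assms] h by (simp add: holo_matrix_on_def)
  then show ?thesis by (simp add: vec_eq_iff)
qed

abbreviation "left_part x \<equiv> (\<chi> i. x $ Inl i)"
abbreviation "right_part x \<equiv> (\<chi> i. x $ Inr i)"

lemma centre_mem: "p \<in> ball p r" "vec_cnj p \<in> ball (vec_cnj p) r"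
  using r by simp_all

lemma left_compose:
  assumes f: "holomorphic_Cn_on f (bidisc p r)"
  shows "holomorphic_Cn_on (\<lambda>x. f (vec_join (left_part x) (vec_cnj p))) (bidisc p r)"
    and "x \<in> bidisc p r ==> wirtinger (Inl k) (\<lambda>x. f (vec_join (left_part x) (vec_cnj p))) x = wirtinger (Inl k) f (vec_join (left_part x) (vec_cnj p))"
    and "x \<in> bidisc p r ==> wirtinger (Inr k) (\<lambda>x. f (vec_join (left_part x) (vec_cnj p))) x = 0"
proof -
  have comp: "holomorphic_Cn_on (\<lambda>x. (vec_join (left_part x) (vec_cnj p)) $ s) (bidisc p r)" for s
    by (cases s) simp_all
  have sub: "(\<lambda>x. vec_join (left_part x) (vec_cnj p)) ` bidisc p r \<subseteq> bidisc p r"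
    using centre_mem by (auto elim!: bidisc_cases)
  show "holomorphic_Cn_on (\<lambda>x. f (vec_join (left_part x) (vec_cnj p))) (bidisc p r)"
    by (rule holomorphic_Cn_compose(1)[OF comp open_bidisc f open_bidisc sub])
  have split: "(\<Sum>s\<in>UNIV. h s) = (\<Sum>i\<in>UNIV. h (Inl i)) + (\<Sum>i\<in>UNIV. h (Inr i))" for h :: "'n + 'n \<Rightarrow> complex"
    unfolding UNIV_Plus_UNIV[symmetric] by (subst sum.Plus) (auto simp: comp_def)
  assume x: "x \<in> bidisc p r"
  note d = holomorphic_Cn_compose(2)[OF comp open_bidisc f open_bidisc sub x]
  show "wirtinger (Inl k) (\<lambda>x. f (vec_join (left_part x) (vec_cnj p))) x = wirtinger (Inl k) f (vec_join (left_part x) (vec_cnj p))"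
    unfolding d split by (simp add: wirtinger_component if_distrib[of "\<lambda>a. _ * a"] cong: if_cong)
  show "wirtinger (Inr k) (\<lambda>x. f (vec_join (left_part x) (vec_cnj p))) x = 0"
    unfolding d split by (simp add: wirtinger_component)
qed

lemma right_compose:
  assumes f: "holomorphic_Cn_on f (bidisc p r)"
  shows "holomorphic_Cn_on (\<lambda>x. f (vec_join p (right_part x))) (bidisc p r)"
    and "x \<in> bidisc p r ==> wirtinger (Inr k) (\<lambda>x. f (vec_join p (right_part x))) x = wirtinger (Inr k) f (vec_join p (right_part x))"
    and "x \<in> bidisc p r ==> wirtinger (Inl k) (\<lambda>x. f (vec_join p (right_part x))) x = 0"
proof -
  have comp: "holomorphic_Cn_on (\<lambda>x. (vec_join p (right_part x)) $ s) (bidisc p r)" for s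
    by (cases s) simp_all
  have sub: "(\<lambda>x. vec_join p (right_part x)) ` bidisc p r \<subseteq> bidisc p r"
    using centre_mem by (auto elim!: bidisc_cases)
  show "holomorphic_Cn_on (\<lambda>x. f (vec_join p (right_part x))) (bidisc p r)"
    by (rule holomorphic_Cn_compose(1)[OF comp open_bidisc f open_bidisc sub])
  have split: "(\<Sum>s\<in>UNIV. h s) = (\<Sum>i\<in>UNIV. h (Inl i)) + (\<Sum>i\<in>UNIV. h (Inr i))" for h :: "'n + 'n \<Rightarrow> complex"
    unfolding UNIV_Plus_UNIV[symmetric] by (subst sum.Plus) (auto simp: comp_def)
  assume x: "x \<in> bidisc p r"
  note d = holomorphic_Cn_compose(2)[OF comp open_bidisc f open_bidisc sub x]
  show "wirtinger (Inr k) (\<lambda>x. f (vec_join p (right_part x))) x = wirtinger (Inr k) f (vec_join p (right_part x))"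
    unfolding d split by (simp add: wirtinger_component if_distrib[of "\<lambda>a. _ * a"] cong: if_cong)
  show "wirtinger (Inl k) (\<lambda>x. f (vec_join p (right_part x))) x = 0"
    unfolding d split by (simp add: wirtinger_component)
qed

lemma metric_factorization:
  assumes z: "z \<in> ball p r" and w: "w \<in> ball (vec_cnj p) r"
  shows "G (vec_join z w) = G (vec_join z (vec_cnj p)) ** Gi (vec_join p (vec_cnj p)) ** G (vec_join p w)"
proof -
  let ?l = "\<lambda>x. vec_join (left_part x) (vec_cnj p)"
  have lm: "?l x \<in> bidisc p r" if "x \<in> bidisc p r" for x
    using that centre_mem by (auto elim!: bidisc_cases)
  have Gl: "holo_matrix_on (\<lambda>x. G (?l x)) (bidisc p r)"
    unfolding holo_matrix_on_def using left_compose(1)[OF G_entry] by blast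
  have nzl: "det (G (?l x)) \<noteq> 0" if "x \<in> bidisc p r" for x using nz[OF lm[OF that]] .
  have dGl: "dmat (Inl k) (\<lambda>x. G (?l x)) x = dmat (Inl k) G (?l x)" if "x \<in> bidisc p r" for k x
    using left_compose(2)[OF G_entry that, of k] by (simp add: dmat_def vec_eq_iff)
  have Gil: "holo_matrix_on (\<lambda>x. Gi (?l x)) (bidisc p r)" by (rule holo_matrix_inv(1)[OF Gl open_bidisc nzl])
  let ?M = "\<lambda>x. Gi (?l x) ** G x"
  have Mh: "holo_matrix_on ?M (bidisc p r)" by (rule holo_matrix_mult(1)[OF Gil G_holo open_bidisc])
  have "dmat (Inl k) ?M x = 0" if x: "x \<in> bidisc p r" for k x
  proof -
    obtain a b where ab: "x = vec_join a b" "a \<in> ball p r" "b \<in> ball (vec_cnj p) r" by (rule bidisc_cases[OF x])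
    have \<Gamma>: "dmat (Inl k) G (?l x) ** Gi (?l x) = dmat (Inl k) G x ** Gi x"
      using christoffel_constant[OF ab(2) centre_mem(2) ab(3), of k] by (simp add: ab(1))
    have dGi: "dmat (Inl k) (\<lambda>x. Gi (?l x)) x = - (Gi (?l x) ** dmat (Inl k) (\<lambda>x. G (?l x)) x ** Gi (?l x))"
      by (rule holo_matrix_inv(2)[OF Gl open_bidisc nzl x])
    have "dmat (Inl k) ?M x = - (Gi (?l x) ** dmat (Inl k) G (?l x) ** Gi (?l x)) ** G x + Gi (?l x) ** dmat (Inl k) G x"
      unfolding holo_matrix_mult(2)[OF Gil G_holo open_bidisc x] dGi dGl[OF x] ..
    also have "Gi (?l x) ** dmat (Inl k) G (?l x) ** Gi (?l x) = Gi (?l x) ** (dmat (Inl k) G x ** Gi x)"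
      by (simp add: matrix_mul_assoc[symmetric] \<Gamma>)
    also have "- (Gi (?l x) ** (dmat (Inl k) G x ** Gi x)) ** G x = - (Gi (?l x) ** dmat (Inl k) G x)"
    proof -
      have "- B ** C = - (B ** C)" for B C :: "complex ^ 'n ^ 'n"
        by (simp add: vec_eq_iff matrix_matrix_mult_def sum_negf)
      then show ?thesis by (simp add: matrix_mul_assoc[symmetric] matrix_inv_det_nonzero(2)[OF nz[OF x]])
    qed
    finally show ?thesis by simp
  qed
  then have "wirtinger (Inl k) (\<lambda>x. ?M x $ i $ j) x = 0" if "x \<in> bidisc p r" for k x i j
    using that by (simp add: dmat_def vec_eq_iff)
  then have "?M (vec_join z w) $ i $ j = ?M (vec_join p w) $ i $ j" for i j
    using bidisc_left_constant[of "\<lambda>x. ?M x $ i $ j", OF _ _ z centre_mem(1) w] Mh by (simp add: holo_matrix_on_def)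
  then have "?M (vec_join z w) = ?M (vec_join p w)" by (simp add: vec_eq_iff)
  then have M: "Gi (vec_join z (vec_cnj p)) ** G (vec_join z w) = Gi (vec_join p (vec_cnj p)) ** G (vec_join p w)"
    by simp
  have "det (G (vec_join z (vec_cnj p))) \<noteq> 0" using z centre_mem by (intro nz) simp
  then have "G (vec_join z w) = G (vec_join z (vec_cnj p)) ** (Gi (vec_join z (vec_cnj p)) ** G (vec_join z w))"
    by (simp add: matrix_mul_assoc matrix_inv_det_nonzero(1))
  then show ?thesis by (simp add: M matrix_mul_assoc)
qed

definition T :: "complex ^ 'n \<Rightarrow> complex ^ 'n" where
  "T z = (\<chi> a. wirtinger (Inr a) \<Phi> (vec_join z (vec_cnj p)) - wirtinger (Inr a) \<Phi> (vec_join p (vec_cnj p)))"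

lemma T_holo: "holomorphic_Cn_on (\<lambda>z. T z $ a) (ball p r)"
    and T_deriv: "z \<in> ball p r ==> wirtinger i (\<lambda>z. T z $ a) z = G (vec_join z (vec_cnj p)) $ i $ a"
    and T_centre: "T p = 0"
proof -
  have j: "vec_join z (vec_cnj p) \<in> bidisc p r" if "z \<in> ball p r" for z using that centre_mem by simp
  have h: "holomorphic_Cn_on (\<lambda>z. wirtinger (Inr a) \<Phi> (vec_join z (vec_cnj p))) (ball p r)"
  proof (rule holomorphic_CnI)
    fix z assume "z \<in> ball p r"
    show "((\<lambda>z. wirtinger (Inr a) \<Phi> (vec_join z (vec_cnj p))) has_derivative (\<lambda>v. Cn_derivative (wirtinger (Inr a) \<Phi>) (vec_join z (vec_cnj p)) (vec_join v 0))) (at z)"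
      by (rule wirtinger_join_left(1)[OF pd_holo open_bidisc j]) fact
    have "vec_join (b *s v) (0 :: complex ^ 'n) = b *s vec_join v 0" for b v
      using vec_join_scale[of b v 0] by simp
    then show "Cn_derivative (wirtinger (Inr a) \<Phi>) (vec_join z (vec_cnj p)) (vec_join (b *s v) 0) =
        b * Cn_derivative (wirtinger (Inr a) \<Phi>) (vec_join z (vec_cnj p)) (vec_join v 0)" for b v
      by (simp add: Cn_derivative_scale)
  qed
  show "holomorphic_Cn_on (\<lambda>z. T z $ a) (ball p r)"
    unfolding T_def vec_lambda_beta by (rule holomorphic_Cn_diff(1)[OF h holomorphic_Cn_const open_ball])
  show "wirtinger i (\<lambda>z. T z $ a) z = G (vec_join z (vec_cnj p)) $ i $ a" if "z \<in> ball p r"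
    unfolding T_def vec_lambda_beta holomorphic_Cn_diff(2)[OF h holomorphic_Cn_const open_ball that]
    by (simp add: wirtinger_join_left(2)[OF pd_holo open_bidisc j[OF that]] G_def)
  show "T p = 0" by (simp add: T_def vec_eq_iff)
qed

lemma T_conjugate:
  assumes w: "w \<in> ball (vec_cnj p) r"
  shows "wirtinger (Inl b) \<Phi> (vec_join p w) - wirtinger (Inl b) \<Phi> (vec_join p (vec_cnj p)) = cnj (T (vec_cnj w) $ b)"
proof -
  have gen: "wirtinger (Inl b) \<Phi> (vec_join p w) = cnj (wirtinger (Inr b) \<Phi> (vec_join (vec_cnj w) (vec_cnj p)))"
    if w: "w \<in> ball (vec_cnj p) r" for w
  proof -
    have cw: "vec_cnj w \<in> ball p r" using w vec_cnj_in_ball[of w "vec_cnj p" r] by simp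
    define f where "f = (\<lambda>v. \<Phi> (vec_join (vec_cnj w) v))"
    have jv: "vec_join (vec_cnj w) v \<in> bidisc p r" if "v \<in> ball (vec_cnj p) r" for v using cw that by simp
    have fh: "holomorphic_Cn_on f (ball (vec_cnj p) r)"
    proof (rule holomorphic_CnI)
      fix v assume "v \<in> ball (vec_cnj p) r"
      show "(f has_derivative (\<lambda>u. Cn_derivative \<Phi> (vec_join (vec_cnj w) v) (vec_join 0 u))) (at v)"
        unfolding f_def by (rule wirtinger_join_right(1)[OF \<Phi> open_bidisc jv]) fact
      have "vec_join (0 :: complex ^ 'n) (b *s u) = b *s vec_join 0 u" for b u
        using vec_join_scale[of b 0 u] by simp
      then show "Cn_derivative \<Phi> (vec_join (vec_cnj w) v) (vec_join 0 (b *s u)) =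
          b * Cn_derivative \<Phi> (vec_join (vec_cnj w) v) (vec_join 0 u)" for b u
        by (simp add: Cn_derivative_scale)
    qed
    have jp: "vec_join p w \<in> bidisc p r" using w centre_mem by simp
    have "wirtinger (Inl b) \<Phi> (vec_join p w) = wirtinger b (\<lambda>z. \<Phi> (vec_join z w)) p"
      by (rule wirtinger_join_left(2)[OF \<Phi> open_bidisc jp, symmetric])
    also have "\<dots> = wirtinger b (\<lambda>z. cnj (f (vec_cnj z))) p"
      by (rule wirtinger_cong(1)[OF open_ball centre_mem(1)]) (simp only: f_def herm[OF _ w])
    also have "\<dots> = cnj (wirtinger b f (vec_cnj p))"
      by (rule wirtinger_conjugate(2)[OF fh open_ball centre_mem(2)])
    also have "wirtinger b f (vec_cnj p) = wirtinger (Inr b) \<Phi> (vec_join (vec_cnj w) (vec_cnj p))"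
      unfolding f_def by (rule wirtinger_join_right(2)[OF \<Phi> open_bidisc jv[OF centre_mem(2)]])
    finally show ?thesis .
  qed
  show ?thesis using gen[OF w] gen[OF centre_mem(2)] by (simp add: T_def)
qed

lemma potential_formula:
  assumes z: "z \<in> ball p r" and w: "w \<in> ball p r"
  shows "\<Phi> (vec_join z (vec_cnj w)) = \<Phi> (vec_join z (vec_cnj p)) + \<Phi> (vec_join p (vec_cnj w)) - \<Phi> (vec_join p (vec_cnj p))
    + (\<Sum>a\<in>UNIV. \<Sum>b\<in>UNIV. T z $ a * Gi (vec_join p (vec_cnj p)) $ a $ b * cnj (T w $ b))"
proof -
  let ?C = "Gi (vec_join p (vec_cnj p))" and ?c = "vec_cnj p"
  have cp: "vec_join p ?c \<in> bidisc p r" using centre_mem by simp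
  define t where "t a x = wirtinger (Inr a) \<Phi> (vec_join (left_part x) ?c) - wirtinger (Inr a) \<Phi> (vec_join p ?c)" for a and x :: "complex ^ ('n + 'n)"
  define u where "u b x = wirtinger (Inl b) \<Phi> (vec_join p (right_part x)) - wirtinger (Inl b) \<Phi> (vec_join p ?c)" for b and x :: "complex ^ ('n + 'n)"
  have th: "holomorphic_Cn_on (t a) (bidisc p r)" and tl: "x \<in> bidisc p r ==> wirtinger (Inl k) (t a) x = G (vec_join (left_part x) ?c) $ k $ a"
    and tr: "x \<in> bidisc p r ==> wirtinger (Inr k) (t a) x = 0" for a x k
    using holomorphic_Cn_diff[OF left_compose(1)[OF pd_holo[of "Inr a"]] holomorphic_Cn_const[of "wirtinger (Inr a) \<Phi> (vec_join p ?c)"] open_bidisc]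
      left_compose(2,3)[OF pd_holo[of "Inr a"]]
    by (simp_all add: t_def[abs_def] G_def)
  have uh: "holomorphic_Cn_on (u b) (bidisc p r)" and ul: "x \<in> bidisc p r ==> wirtinger (Inl k) (u b) x = 0"
    and ur: "x \<in> bidisc p r ==> wirtinger (Inr k) (u b) x = wirtinger (Inr k) (wirtinger (Inl b) \<Phi>) (vec_join p (right_part x))" for b x k
    using holomorphic_Cn_diff[OF right_compose(1)[OF pd_holo[of "Inl b"]] holomorphic_Cn_const[of "wirtinger (Inl b) \<Phi> (vec_join p ?c)"] open_bidisc]
      right_compose(2,3)[OF pd_holo[of "Inl b"]]
    by (simp_all add: u_def[abs_def])
  have ur': "wirtinger (Inr k) (u b) x = G (vec_join p (right_part x)) $ b $ k" if x: "x \<in> bidisc p r" for k b x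
  proof -
    have "vec_join p (right_part x) \<in> bidisc p r" using x centre_mem by (auto elim!: bidisc_cases)
    from wirtinger_commute[OF \<Phi> open_bidisc this, of "Inr k" "Inl b"] ur[OF x] show ?thesis by (simp add: G_def)
  qed
  define \<Psi> where "\<Psi> x = \<Phi> x - (\<Sum>a\<in>UNIV. \<Sum>b\<in>UNIV. t a x * (?C $ a $ b * u b x))" for x
  have prodh: "holomorphic_Cn_on (\<lambda>x. t a x * (?C $ a $ b * u b x)) (bidisc p r)" for a b
    by (intro holomorphic_Cn_mult(1) th holomorphic_Cn_const uh open_bidisc)
  have inner_s: "holomorphic_Cn_on (\<lambda>x. \<Sum>b\<in>UNIV. t a x * (?C $ a $ b * u b x)) (bidisc p r)" for a
    by (rule holomorphic_Cn_sum'(1)[OF prodh open_bidisc])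
  have sumh: "holomorphic_Cn_on (\<lambda>x. \<Sum>a\<in>UNIV. \<Sum>b\<in>UNIV. t a x * (?C $ a $ b * u b x)) (bidisc p r)"
    by (rule holomorphic_Cn_sum'(1)[OF inner_s open_bidisc])
  have \<Psi>h: "holomorphic_Cn_on \<Psi> (bidisc p r)"
    unfolding \<Psi>_def by (rule holomorphic_Cn_diff(1)[OF \<Phi> sumh open_bidisc])
  have dr: "wirtinger (Inr k) \<Psi> x = wirtinger (Inr k) \<Phi> x - (\<Sum>a\<in>UNIV. \<Sum>b\<in>UNIV. t a x * (?C $ a $ b * G (vec_join p (right_part x)) $ b $ k))"
    if x: "x \<in> bidisc p r" for x k
  proof -
    have "wirtinger (Inr k) (\<lambda>x. t a x * (?C $ a $ b * u b x)) x = t a x * (?C $ a $ b * G (vec_join p (right_part x)) $ b $ k)" for a b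
      using holomorphic_Cn_mult(2)[OF th holomorphic_Cn_cmult(1)[OF uh open_bidisc] open_bidisc x, of "Inr k" a "?C $ a $ b" b]
        holomorphic_Cn_cmult(2)[OF uh open_bidisc x, of "Inr k" "?C $ a $ b" b] tr[OF x] ur'[OF x] by simp
    then show ?thesis
      unfolding \<Psi>_def holomorphic_Cn_diff(2)[OF \<Phi> sumh open_bidisc x]
        holomorphic_Cn_sum'(2)[OF inner_s open_bidisc x] holomorphic_Cn_sum'(2)[OF prodh open_bidisc x] by simp
  qed
  have mixed: "wirtinger (Inl i) (wirtinger (Inr k) \<Psi>) x = 0" if x: "x \<in> bidisc p r" for x i k
  proof -
    obtain y v where yv: "x = vec_join y v" "y \<in> ball p r" "v \<in> ball ?c r" by (rule bidisc_cases[OF x])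
    let ?g = "\<lambda>a b x. t a x * (?C $ a $ b * G (vec_join p (right_part x)) $ b $ k)"
    have gh: "holomorphic_Cn_on (\<lambda>x. ?C $ a $ b * G (vec_join p (right_part x)) $ b $ k) (bidisc p r)" for a b
      by (rule holomorphic_Cn_cmult(1)[OF right_compose(1)[OF G_entry] open_bidisc])
    have g1: "holomorphic_Cn_on (?g a b) (bidisc p r)" for a b by (rule holomorphic_Cn_mult(1)[OF th gh open_bidisc])
    have g2: "wirtinger (Inl i) (?g a b) x = G (vec_join (left_part x) ?c) $ i $ a * (?C $ a $ b * G (vec_join p (right_part x)) $ b $ k)" for a b
      unfolding holomorphic_Cn_mult(2)[OF th gh open_bidisc x] holomorphic_Cn_cmult(2)[OF right_compose(1)[OF G_entry] open_bidisc x]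
        right_compose(3)[OF G_entry x] tl[OF x] by simp
    have g3: "holomorphic_Cn_on (\<lambda>x. \<Sum>b\<in>UNIV. ?g a b x) (bidisc p r)" for a
      by (rule holomorphic_Cn_sum'(1)[OF g1 open_bidisc])
    have g4: "holomorphic_Cn_on (\<lambda>x. \<Sum>a\<in>UNIV. \<Sum>b\<in>UNIV. ?g a b x) (bidisc p r)"
      by (rule holomorphic_Cn_sum'(1)[OF g3 open_bidisc])
    have "wirtinger (Inl i) (wirtinger (Inr k) \<Psi>) x = wirtinger (Inl i) (\<lambda>x. wirtinger (Inr k) \<Phi> x - (\<Sum>a\<in>UNIV. \<Sum>b\<in>UNIV. ?g a b x)) x"
      by (rule wirtinger_cong(1)[OF open_bidisc x dr])
    also have "\<dots> = wirtinger (Inl i) (wirtinger (Inr k) \<Phi>) x - wirtinger (Inl i) (\<lambda>x. \<Sum>a\<in>UNIV. \<Sum>b\<in>UNIV. ?g a b x) x"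
      by (rule holomorphic_Cn_diff(2)[OF pd_holo g4 open_bidisc x])
    also have "wirtinger (Inl i) (\<lambda>x. \<Sum>a\<in>UNIV. \<Sum>b\<in>UNIV. ?g a b x) x = (\<Sum>a\<in>UNIV. \<Sum>b\<in>UNIV. wirtinger (Inl i) (?g a b) x)"
      unfolding holomorphic_Cn_sum'(2)[OF g3 open_bidisc x] holomorphic_Cn_sum'(2)[OF g1 open_bidisc x] ..
    also have "\<dots> = G x $ i $ k"
      unfolding g2 using metric_factorization[OF yv(2,3)]
      by (simp add: yv(1) matrix_matrix_mult_def sum_distrib_right mult.assoc) (rule sum.swap)
    finally show ?thesis by (simp add: G_def)
  qed
  have wc: "vec_cnj w \<in> ball ?c r" using w by (simp only: vec_cnj_in_ball)
  have rind: "wirtinger (Inr k) \<Psi> (vec_join a v) = wirtinger (Inr k) \<Psi> (vec_join p v)" if "a \<in> ball p r" "v \<in> ball ?c r" for k a v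
    by (rule bidisc_left_constant[OF holomorphic_Cn_wirtinger[OF \<Psi>h open_bidisc] mixed that(1) centre_mem(1) that(2)])
  let ?D = "\<lambda>x. \<Psi> x - \<Psi> (vec_join p (right_part x))"
  have Dh: "holomorphic_Cn_on ?D (bidisc p r)"
    by (rule holomorphic_Cn_diff(1)[OF \<Psi>h right_compose(1)[OF \<Psi>h] open_bidisc])
  have Dd: "wirtinger (Inr k) ?D x = 0" if x: "x \<in> bidisc p r" for x k
  proof -
    obtain y v where yv: "x = vec_join y v" "y \<in> ball p r" "v \<in> ball ?c r" by (rule bidisc_cases[OF x])
    show ?thesis
      unfolding holomorphic_Cn_diff(2)[OF \<Psi>h right_compose(1)[OF \<Psi>h] open_bidisc x] right_compose(2)[OF \<Psi>h x]
      using rind[OF yv(2,3), of k] by (simp add: yv(1))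
  qed
  have "?D (vec_join z (vec_cnj w)) = ?D (vec_join z ?c)"
    by (rule bidisc_right_constant[OF Dh Dd z wc centre_mem(2)])
  moreover have rp: "right_part (vec_join a b) = b" for a b :: "complex ^ 'n" by (simp add: vec_eq_iff)
  ultimately have "\<Psi> (vec_join z (vec_cnj w)) - \<Psi> (vec_join p (vec_cnj w)) = \<Psi> (vec_join z ?c) - \<Psi> (vec_join p ?c)"
    by (simp only:)
  then have main: "\<Psi> (vec_join z (vec_cnj w)) = \<Psi> (vec_join z ?c) + \<Psi> (vec_join p (vec_cnj w)) - \<Psi> (vec_join p ?c)"
    by (simp add: algebra_simps)
  have t_eq: "t a (vec_join y v) = T y $ a" for a y v by (simp add: t_def T_def)
  have u_eq: "u b (vec_join y (vec_cnj v)) = cnj (T v $ b)" if "v \<in> ball p r" for b y v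
    unfolding u_def rp using T_conjugate[of "vec_cnj v" b] that by (simp only: vec_cnj_in_ball vec_cnj_cnj)
  have e1: "\<Psi> (vec_join y (vec_cnj v)) = \<Phi> (vec_join y (vec_cnj v)) - (\<Sum>a\<in>UNIV. \<Sum>b\<in>UNIV. T y $ a * (?C $ a $ b * cnj (T v $ b)))"
    if "v \<in> ball p r" for y v
    unfolding \<Psi>_def t_eq u_eq[OF that] ..
  show ?thesis
    using main unfolding e1[OF w] e1[OF centre_mem(1)] T_centre by (simp add: algebra_simps)
qed

end

end

lemma norm_vec_join_le: "norm (vec_join a b) \<le> norm a + norm b"
proof -
  have "vec_join a b = vec_join a 0 + vec_join 0 b" by (simp add: vec_join_add[symmetric])
  moreover have "norm (vec_join a (0 :: complex ^ 'a)) = norm a"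
    unfolding norm_vec_def L2_set_def UNIV_Plus_UNIV[symmetric] by (subst sum.Plus) (auto simp: comp_def)
  moreover have "norm (vec_join (0 :: complex ^ 'a) b) = norm b"
    unfolding norm_vec_def L2_set_def UNIV_Plus_UNIV[symmetric] by (subst sum.Plus) (auto simp: comp_def)
  ultimately show ?thesis using norm_triangle_ineq[of "vec_join a 0" "vec_join 0 b"] by simp
qed

lemma bidisc_neighbourhood:
  fixes p :: "complex ^ 'n::finite"
  assumes S: "open S" "vec_join p (vec_cnj p) \<in> S" and R: "R > 0"
  obtains \<rho> where "\<rho> > 0" "\<rho> \<le> R" "bidisc p \<rho> \<subseteq> S"
proof -
  obtain e where e: "e > 0" "ball (vec_join p (vec_cnj p)) e \<subseteq> S" by (rule openE[OF S])
  show thesis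
  proof (rule that[of "min R (e / 2)"])
    show "bidisc p (min R (e / 2)) \<subseteq> S"
    proof
      fix x assume "x \<in> bidisc p (min R (e / 2))"
      then obtain z w where x: "x = vec_join z w" "z \<in> ball p (min R (e / 2))" "w \<in> ball (vec_cnj p) (min R (e / 2))"
        by (rule bidisc_cases)
      have "vec_join p (vec_cnj p) - x = vec_join (p - z) (vec_cnj p - w)"
        by (subst vec_join_eq_iff[THEN iffD2]) (simp_all add: x(1))
      then have "dist (vec_join p (vec_cnj p)) x \<le> norm (p - z) + norm (vec_cnj p - w)"
        by (simp only: dist_norm norm_vec_join_le)
      also have "\<dots> < e" using x(2,3) by (simp add: dist_norm)
      finally show "x \<in> S" using e(2) by (auto simp del: dist_norm)
    qed
  qed (use R e in auto)
qed

lemma wirtinger_divide: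
  assumes f: "holomorphic_Cn_on f S" and g: "holomorphic_Cn_on g S" and S: "open S" "x \<in> S" and nz: "\<And>y. y \<in> S ==> g y \<noteq> 0"
  shows "wirtinger i (\<lambda>x. f x / g x) x = (wirtinger i f x * g x - f x * wirtinger i g x) / (g x)\<^sup>2"
proof -
  have q: "holomorphic_Cn_on (\<lambda>x. f x / g x) S" by (rule holomorphic_Cn_divide[OF f g S(1) nz])
  have "wirtinger i f x = wirtinger i (\<lambda>x. f x / g x * g x) x"
    by (rule wirtinger_cong(1)[OF S]) (simp add: nz)
  also have "\<dots> = f x / g x * wirtinger i g x + wirtinger i (\<lambda>x. f x / g x) x * g x"
    by (rule holomorphic_Cn_mult(2)[OF q g S])
  finally show ?thesis using nz[OF S(2)] by (simp add: field_simps power2_eq_square)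
qed

lemma hermitian_if_real:
  fixes g :: "complex ^ 'n::finite ^ 'n"
  assumes re: "\<And>v. Im (herm g v v) = 0"
  shows "g $ b $ a = cnj (g $ a $ b)"
proof -
  have ax: "herm g (axis i c) (axis j d) = g $ i $ j * c * cnj d" for i j c d
  proof -
    have "herm g (axis i c) (axis j d) = (\<Sum>a\<in>UNIV. \<Sum>b\<in>UNIV. if a = i then if b = j then g $ i $ j * c * cnj d else 0 else 0)"
      unfolding herm_def by (intro sum.cong refl) (simp add: axis_def)
    also have "\<dots> = (\<Sum>a\<in>UNIV. if a = i then g $ i $ j * c * cnj d else 0)"
      by (intro sum.cong refl) simp
    finally show ?thesis by simp
  qed
  have right: "herm g u (v + w) = herm g u v + herm g u w" for u v w
    by (simp add: herm_def sum.distrib algebra_simps)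
  have "herm g (axis a 1 + axis b c) (axis a 1 + axis b c) = g $ a $ a + g $ a $ b * cnj c + g $ b $ a * c + g $ b $ b * (c * cnj c)" for c
    unfolding herm_add_left right ax by (simp add: algebra_simps)
  then have ex: "Im (g $ a $ a + g $ a $ b * cnj c + g $ b $ a * c + g $ b $ b * (c * cnj c)) = 0" for c
    by (metis re)
  have d: "Im (g $ i $ i) = 0" for i using re[of "axis i 1"] by (simp add: ax)
  have "Im (g $ a $ b) + Im (g $ b $ a) = 0" using ex[of 1] d by simp
  moreover have "Re (g $ b $ a) - Re (g $ a $ b) = 0" using ex[of \<i>] d by simp
  ultimately show ?thesis by (simp add: complex_eq_iff)
qed

context holomorphic_atlas
begin

section \<open>The polarized kernel\<close>

lemma derivative_functional:
  assumes c: "c \<in> A" and z: "z \<in> chart_image c"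
  obtains e where "e \<in> A2" "\<And>f. f \<in> A2 ==> bip f e = Cn_derivative (f c) z X"
proof -
  obtain r C where r: "r > 0" "ball z r \<subseteq> chart_image c" "C \<ge> 0"
    and C: "\<And>f w. f \<in> A2 ==> w \<in> ball z r ==> (cmod (f c w))\<^sup>2 \<le> C * sqn f"
    using kern_bounded[OF c z] by metis
  have hol: "holomorphic_Cn_on (f c) (ball z r)" if "f \<in> A2" for f
    using holomorphic_Cn_subset[OF formD(1)[OF A2_holomorphic[OF that] c] r(2)] .
  have zb: "z \<in> ball z r" using r by simp
  show thesis
  proof (rule riesz[OF basis_orthonormal_basis, of "\<lambda>f. Cn_derivative (f c) z X" "(2 / r * norm X)\<^sup>2 * C"])
    show "Cn_derivative (\<lambda>z. f c z + g c z) z X = Cn_derivative (f c) z X + Cn_derivative (g c) z X"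
      if "f \<in> A2" "g \<in> A2" for f g
      using holomorphic_Cn_add(2)[OF hol[OF that(1)] hol[OF that(2)] open_ball zb]
      by (simp add: Cn_derivative_def sum.distrib distrib_left)
    show "Cn_derivative (\<lambda>z. a * f c z) z X = a * Cn_derivative (f c) z X" if "f \<in> A2" for f a
      using holomorphic_Cn_cmult(2)[OF hol[OF that] open_ball zb]
      by (simp add: Cn_derivative_def sum_distrib_left mult.left_commute)
    show "(cmod (Cn_derivative (f c) z X))\<^sup>2 \<le> (2 / r * norm X)\<^sup>2 * C * sqn f" if f: "f \<in> A2" for f
    proof -
      have "cmod (f c w) \<le> sqrt (C * sqn f)" if "w \<in> ball z r" for w
        by (rule real_le_rsqrt[OF C[OF f that]])
      from holomorphic_Cn_first_order(2)[OF hol[OF f] r(1) this]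
      have "cmod (Cn_derivative (f c) z X) \<le> 2 * sqrt (C * sqn f) / r * norm X" .
      then have "(cmod (Cn_derivative (f c) z X))\<^sup>2 \<le> (2 * sqrt (C * sqn f) / r * norm X)\<^sup>2"
        by (rule power_mono) simp
      also have "\<dots> = (2 / r * norm X)\<^sup>2 * (sqrt (C * sqn f))\<^sup>2"
        by (simp add: power_mult_distrib power_divide)
      also have "(sqrt (C * sqn f))\<^sup>2 = C * sqn f" using r(3) sqn_nonneg[OF f] by simp
      finally show ?thesis by (simp only: mult.assoc)
    qed
  qed (rule that)
qed

definition Kh :: "('a, 'n) chart \<Rightarrow> complex ^ ('n + 'n) \<Rightarrow> complex" where
  "Kh c x = kern c (vec_cnj (\<chi> i. x $ Inr i)) c (\<chi> i. x $ Inl i)"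

lemma Kh_join: "Kh c (vec_join z w) = kern c (vec_cnj w) c z"
  by (simp add: Kh_def)

lemma Kh_holo:
  assumes c: "c \<in> A" and p: "p \<in> chart_image c"
  obtains r where "r > 0" "ball p r \<subseteq> chart_image c" "holomorphic_Cn_on (Kh c) (bidisc p r)"
proof -
  obtain r C where r: "r > 0" "ball p r \<subseteq> chart_image c"
    and C: "\<And>w. w \<in> ball p r ==> sqn (kern c w) \<le> C"
    using kern_bounded[OF c p] by metis
  let ?l = "\<lambda>x :: complex ^ ('n + 'n). (\<chi> i. x $ Inl i) :: complex ^ 'n" and ?r = "\<lambda>x :: complex ^ ('n + 'n). (\<chi> i. x $ Inr i) :: complex ^ 'n"
  have bh: "holomorphic_Cn_on (basis j c) (ball p r)" for j
    using holomorphic_Cn_subset[OF formD(1)[OF A2_holomorphic[OF basis_mem] c] r(2)] .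
  have lh: "holomorphic_Cn_on (\<lambda>x. basis j c (?l x)) (bidisc p r)" for j
    by (rule holomorphic_Cn_compose(1)[OF _ open_bidisc bh open_ball]) (auto simp: bidisc_def)
  have ch: "holomorphic_Cn_on (\<lambda>w. cnj (basis j c (vec_cnj w))) (ball (vec_cnj p) r)" for j
  proof (rule holomorphic_Cn_subset[OF wirtinger_conjugate(1)[OF bh open_ball]])
    show "ball (vec_cnj p) r \<subseteq> {w. vec_cnj w \<in> ball p r}"
    proof
      fix w assume "w \<in> ball (vec_cnj p) r"
      then show "w \<in> {w. vec_cnj w \<in> ball p r}" using vec_cnj_in_ball[of w "vec_cnj p" r] by simp
    qed
  qed
  have rh: "holomorphic_Cn_on (\<lambda>x. cnj (basis j c (vec_cnj (?r x)))) (bidisc p r)" for j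
    by (rule holomorphic_Cn_compose(1)[OF _ open_bidisc ch open_ball]) (auto simp: bidisc_def)
  define F where "F m x = (\<Sum>j<m. basis j c (?l x) * cnj (basis j c (vec_cnj (?r x))))" for m :: nat and x
  have Fh: "holomorphic_Cn_on (F m) (bidisc p r)" for m
    unfolding F_def by (intro holomorphic_Cn_sum'(1) holomorphic_Cn_mult(1) lh rh open_bidisc)
  have diag: "(\<Sum>j<m. (cmod (basis j c z))\<^sup>2) \<le> C" if "z \<in> ball p r" for z m
  proof -
    have "(\<lambda>j. complex_of_real ((cmod (basis j c z))\<^sup>2)) sums complex_of_real (sqn (kern c z))"
      using kern_sums[of c z z] by (simp add: kern_diag of_real_cmod_square)
    then have s: "(\<lambda>j. (cmod (basis j c z))\<^sup>2) sums sqn (kern c z)" by (simp only: sums_of_real_iff)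
    have "(\<Sum>j<m. (cmod (basis j c z))\<^sup>2) \<le> (\<Sum>j. (cmod (basis j c z))\<^sup>2)"
      by (rule sum_le_suminf) (use s in \<open>auto simp: sums_iff\<close>)
    then show ?thesis using s C[OF that] by (simp add: sums_iff)
  qed
  have Fb: "cmod (F m x) \<le> C" if x: "x \<in> bidisc p r" for m x
  proof -
    obtain z w where zw: "x = vec_join z w" "z \<in> ball p r" "w \<in> ball (vec_cnj p) r" by (rule bidisc_cases[OF x])
    have w': "vec_cnj w \<in> ball p r" using zw(3) vec_cnj_in_ball[of w "vec_cnj p" r] by simp
    have ab: "a * b \<le> (a\<^sup>2 + b\<^sup>2) / 2" for a b :: real
      using zero_le_power2[of "a - b"] by (simp add: power2_diff)
    have "cmod (F m x) \<le> (\<Sum>j<m. cmod (basis j c z) * cmod (basis j c (vec_cnj w)))"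
      unfolding F_def zw(1) by (rule order_trans[OF norm_sum]) (simp add: norm_mult)
    also have "\<dots> \<le> (\<Sum>j<m. ((cmod (basis j c z))\<^sup>2 + (cmod (basis j c (vec_cnj w)))\<^sup>2) / 2)"
      by (intro sum_mono ab)
    also have "\<dots> = ((\<Sum>j<m. (cmod (basis j c z))\<^sup>2) + (\<Sum>j<m. (cmod (basis j c (vec_cnj w)))\<^sup>2)) / 2"
      by (simp add: sum.distrib sum_divide_distrib add_divide_distrib)
    also have "\<dots> \<le> (C + C) / 2" by (intro divide_right_mono add_mono diag zw w') simp
    finally show ?thesis by simp
  qed
  have lim: "(\<lambda>m. F m x) \<longlonglongrightarrow> Kh c x" for x
    unfolding F_def Kh_def using kern_sums[of c "?l x" "vec_cnj (?r x)"] by (simp add: sums_def)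
  have "holomorphic_Cn_on (Kh c) (bidisc p r)"
  proof (rule bounded_pointwise_limit(1)[where F = F])
    fix x assume "x \<in> bidisc p r"
    then obtain s where "s > 0" "ball x s \<subseteq> bidisc p r" by (rule openE[OF open_bidisc])
    then show "\<exists>s>0. \<exists>M. ball x s \<subseteq> bidisc p r \<and> (\<forall>k. \<forall>y\<in>ball x s. cmod (F k y) \<le> M)"
      using Fb by (intro exI[of _ s] conjI exI[of _ C]) auto
  qed (use Fh lim open_bidisc in auto)
  then show thesis by (rule that[OF r])
qed

text \<open>
  The Hermitian form of the metric at a vector \<open>X\<close> measures how far the representer of the
  derivative along \<open>X\<close> is from being a multiple of the kernel element.
\<close>

lemma kernel_second_derivative:
  assumes c: "c \<in> A" and r: "ball p r \<subseteq> chart_image c" and K: "holomorphic_Cn_on (Kh c) (bidisc p r)"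
    and z: "z \<in> ball p r" and e: "e \<in> A2" "\<And>f. f \<in> A2 ==> bip f e = Cn_derivative (f c) z X"
  shows "(\<Sum>\<alpha>\<in>UNIV. X $ \<alpha> * wirtinger (Inl \<alpha>) (Kh c) (vec_join z (vec_cnj z))) = bip (kern c z) e"
    and "(\<Sum>\<beta>\<in>UNIV. cnj (X $ \<beta>) * wirtinger (Inr \<beta>) (Kh c) (vec_join z (vec_cnj z))) = cnj (bip (kern c z) e)"
    and "(\<Sum>\<alpha>\<in>UNIV. \<Sum>\<beta>\<in>UNIV. X $ \<alpha> * cnj (X $ \<beta>) * wirtinger (Inl \<alpha>) (wirtinger (Inr \<beta>) (Kh c)) (vec_join z (vec_cnj z))) = of_real (sqn e)"
proof -
  have j: "vec_join z w \<in> bidisc p r" if "w \<in> ball (vec_cnj p) r" for w using z that by simp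
  have zc: "vec_cnj z \<in> ball (vec_cnj p) r" using z by (simp only: vec_cnj_in_ball)
  have fh: "holomorphic_Cn_on (f c) (ball p r)" if "f \<in> A2" for f
    using holomorphic_Cn_subset[OF formD(1)[OF A2_holomorphic[OF that] c] r] .
  have left: "(\<Sum>\<alpha>\<in>UNIV. X $ \<alpha> * wirtinger (Inl \<alpha>) (Kh c) (vec_join z w)) = cnj (e c (vec_cnj w))" if w: "w \<in> ball (vec_cnj p) r" for w
  proof -
    have "wirtinger (Inl \<alpha>) (Kh c) (vec_join z w) = wirtinger \<alpha> (kern c (vec_cnj w) c) z" for \<alpha>
      using wirtinger_join_left(2)[OF K open_bidisc j[OF w], of \<alpha>] by (simp add: Kh_join)
    then have "(\<Sum>\<alpha>\<in>UNIV. X $ \<alpha> * wirtinger (Inl \<alpha>) (Kh c) (vec_join z w)) = Cn_derivative (kern c (vec_cnj w) c) z X"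
      by (simp add: Cn_derivative_def)
    also have "\<dots> = bip (kern c (vec_cnj w)) e" by (rule e(2)[OF kern(1), symmetric])
    also have "\<dots> = cnj (e c (vec_cnj w))"
      using kern(2)[OF e(1), of c "vec_cnj w"] ip_cnj[OF e(1) kern(1)[of c "vec_cnj w"]] by simp
    finally show ?thesis .
  qed
  show "(\<Sum>\<alpha>\<in>UNIV. X $ \<alpha> * wirtinger (Inl \<alpha>) (Kh c) (vec_join z (vec_cnj z))) = bip (kern c z) e"
    using left[OF zc] kern(2)[OF e(1), of c z] ip_cnj[OF e(1) kern(1)[of c z]] by simp
  have sym: "Kh c (vec_join z w) = cnj (kern c z c (vec_cnj w))" for w
    unfolding Kh_join by (rule kern_sym)
  have "wirtinger (Inr \<beta>) (Kh c) (vec_join z (vec_cnj z)) = cnj (wirtinger \<beta> (kern c z c) z)" for \<beta>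
    using wirtinger_join_right(2)[OF K open_bidisc j[OF zc], of \<beta>]
      wirtinger_conjugate(2)[OF fh[OF kern(1)] open_ball, of "vec_cnj z" \<beta> c z] z by (simp add: sym)
  then have "(\<Sum>\<beta>\<in>UNIV. cnj (X $ \<beta>) * wirtinger (Inr \<beta>) (Kh c) (vec_join z (vec_cnj z))) = cnj (Cn_derivative (kern c z c) z X)"
    by (simp add: Cn_derivative_def)
  then show "(\<Sum>\<beta>\<in>UNIV. cnj (X $ \<beta>) * wirtinger (Inr \<beta>) (Kh c) (vec_join z (vec_cnj z))) = cnj (bip (kern c z) e)"
    by (simp only: e(2)[OF kern(1)])
  have Kl: "holomorphic_Cn_on (wirtinger (Inl \<alpha>) (Kh c)) (bidisc p r)" for \<alpha>
    by (rule holomorphic_Cn_wirtinger[OF K open_bidisc])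
  have hw: "holomorphic_Cn_on (\<lambda>w. wirtinger (Inl \<alpha>) (Kh c) (vec_join z w)) (ball (vec_cnj p) r)" for \<alpha>
  proof (rule holomorphic_CnI)
    fix v assume "v \<in> ball (vec_cnj p) r"
    show "((\<lambda>w. wirtinger (Inl \<alpha>) (Kh c) (vec_join z w)) has_derivative (\<lambda>u. Cn_derivative (wirtinger (Inl \<alpha>) (Kh c)) (vec_join z v) (vec_join 0 u))) (at v)"
      by (rule wirtinger_join_right(1)[OF Kl open_bidisc j]) fact
    have "vec_join (0 :: complex ^ 'n) (b *s u) = b *s vec_join 0 u" for b u
      using vec_join_scale[of b 0 u] by simp
    then show "Cn_derivative (wirtinger (Inl \<alpha>) (Kh c)) (vec_join z v) (vec_join 0 (b *s u)) =
        b * Cn_derivative (wirtinger (Inl \<alpha>) (Kh c)) (vec_join z v) (vec_join 0 u)" for b u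
      by (simp add: Cn_derivative_scale)
  qed
  have row: "(\<Sum>\<alpha>\<in>UNIV. X $ \<alpha> * wirtinger (Inl \<alpha>) (wirtinger (Inr \<beta>) (Kh c)) (vec_join z (vec_cnj z))) = cnj (wirtinger \<beta> (e c) z)" for \<beta>
  proof -
    have "wirtinger (Inl \<alpha>) (wirtinger (Inr \<beta>) (Kh c)) (vec_join z (vec_cnj z)) = wirtinger \<beta> (\<lambda>w. wirtinger (Inl \<alpha>) (Kh c) (vec_join z w)) (vec_cnj z)" for \<alpha>
      unfolding wirtinger_join_right(2)[OF Kl open_bidisc j[OF zc]]
      by (rule wirtinger_commute[OF K open_bidisc j[OF zc]])
    then have "(\<Sum>\<alpha>\<in>UNIV. X $ \<alpha> * wirtinger (Inl \<alpha>) (wirtinger (Inr \<beta>) (Kh c)) (vec_join z (vec_cnj z)))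
        = (\<Sum>\<alpha>\<in>UNIV. wirtinger \<beta> (\<lambda>w. X $ \<alpha> * wirtinger (Inl \<alpha>) (Kh c) (vec_join z w)) (vec_cnj z))"
      using holomorphic_Cn_cmult(2)[OF hw open_ball zc] by simp
    also have "\<dots> = wirtinger \<beta> (\<lambda>w. \<Sum>\<alpha>\<in>UNIV. X $ \<alpha> * wirtinger (Inl \<alpha>) (Kh c) (vec_join z w)) (vec_cnj z)"
      by (rule holomorphic_Cn_sum'(2)[OF holomorphic_Cn_cmult(1)[OF hw open_ball] open_ball zc, symmetric])
    also have "\<dots> = wirtinger \<beta> (\<lambda>w. cnj (e c (vec_cnj w))) (vec_cnj z)"
      by (rule wirtinger_cong(1)[OF open_ball zc left])
    also have "\<dots> = cnj (wirtinger \<beta> (e c) z)"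
      using wirtinger_conjugate(2)[OF fh[OF e(1)] open_ball, of "vec_cnj z" \<beta>] z by simp
    finally show ?thesis .
  qed
  have "(\<Sum>\<alpha>\<in>UNIV. \<Sum>\<beta>\<in>UNIV. X $ \<alpha> * cnj (X $ \<beta>) * wirtinger (Inl \<alpha>) (wirtinger (Inr \<beta>) (Kh c)) (vec_join z (vec_cnj z)))
      = (\<Sum>\<beta>\<in>UNIV. cnj (X $ \<beta>) * (\<Sum>\<alpha>\<in>UNIV. X $ \<alpha> * wirtinger (Inl \<alpha>) (wirtinger (Inr \<beta>) (Kh c)) (vec_join z (vec_cnj z))))"
    by (subst sum.swap) (simp add: sum_distrib_left mult_ac)
  also have "\<dots> = cnj (Cn_derivative (e c) z X)" unfolding row by (simp add: Cn_derivative_def)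
  also have "\<dots> = of_real (sqn e)" unfolding e(2)[OF e(1), symmetric] ip_self[OF e(1)] by simp
  finally show "(\<Sum>\<alpha>\<in>UNIV. \<Sum>\<beta>\<in>UNIV. X $ \<alpha> * cnj (X $ \<beta>) * wirtinger (Inl \<alpha>) (wirtinger (Inr \<beta>) (Kh c)) (vec_join z (vec_cnj z))) = of_real (sqn e)" .
qed

lemma kern_positive:
  assumes "base_point_free M A" "c \<in> A" "z \<in> chart_image c"
  shows "sqn (kern c z) > 0"
proof (rule ccontr)
  assume "\<not> sqn (kern c z) > 0"
  then have "kern c z = zero_form"
    using eq_zero_if_sqn_zero[OF kern(1)] sqn_nonneg[OF kern(1), of c z] by simp
  moreover have "bip f zero_form = 0" if "f \<in> A2" for f
    using ip_cnj[OF zero_mem that] ip_zero[OF that] by simp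
  ultimately have "f c z = 0" if "f \<in> A2" for f using kern(2)[OF that, of c z] that by simp
  then show False using assms unfolding base_point_free_def by blast
qed

lemma derivative_not_proportional:
  assumes sep: "separates_holomorphic_directions M A" and pos: "sqn (kern c z) > 0"
    and c: "c \<in> A" "z \<in> chart_image c" and X: "X \<noteq> 0"
    and e: "e \<in> A2" "\<And>f. f \<in> A2 ==> bip f e = Cn_derivative (f c) z X"
  shows "(cmod (bip (kern c z) e))\<^sup>2 < sqn (kern c z) * sqn e"
proof (rule ccontr)
  assume "\<not> (cmod (bip (kern c z) e))\<^sup>2 < sqn (kern c z) * sqn e"
  then have eq: "(cmod (bip (kern c z) e))\<^sup>2 = sqn (kern c z) * sqn e"
    using cauchy_schwarz[OF kern(1)[of c z] e(1)] by simp
  let ?k = "kern c z"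
  define l where "l = bip e ?k / of_real (sqn ?k)"
  have ek: "cmod (bip e ?k) = cmod (bip ?k e)" using ip_cnj[OF kern(1)[of c z] e(1)] by simp
  define h where "h = form_diff e (form_scale l ?k)"
  have lk: "form_scale l ?k \<in> A2" by (rule scale_mem[OF kern(1)])
  have h: "h \<in> A2" unfolding h_def by (rule diff_mem[OF e(1) lk])
  have hk: "bip h ?k = 0"
    unfolding h_def using ip_diff[OF e(1) lk kern(1)[of c z]] ip_scale[OF kern(1)[of c z] kern(1)[of c z], of l]
      ip_self[OF kern(1)[of c z]] pos by (simp add: l_def)
  have "bip h h = bip h e"
  proof -
    have "bip h h = bip h e - bip h (form_scale l ?k)"
      unfolding h_def[of] using ip_diff_right[OF e(1) lk h[unfolded h_def]] by simp
    also have "bip h (form_scale l ?k) = cnj l * bip h ?k" by (rule ip_scale_right[OF kern(1) h])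
    finally show ?thesis by (simp add: hk)
  qed
  also have "bip h e = bip e e - l * bip ?k e"
    unfolding h_def using ip_diff[OF e(1) lk e(1)] ip_scale[OF kern(1)[of c z] e(1), of l] by simp
  also have "l * bip ?k e = of_real ((cmod (bip ?k e))\<^sup>2 / sqn ?k)"
    using ip_cnj[OF kern(1)[of c z] e(1)] by (simp add: l_def of_real_cmod_square mult.commute)
  also have "(cmod (bip ?k e))\<^sup>2 / sqn ?k = sqn e" using eq pos by simp
  finally have "sqn h = 0" using ip_self[OF e(1)] ip_self[OF h] by simp
  obtain f where f: "f \<in> A2" "f c z = 0" "(\<Sum>i\<in>UNIV. X $ i * wirtinger i (f c) z) \<noteq> 0"
    using sep c X unfolding separates_holomorphic_directions_def by blast
  have "bip f h = bip f e - cnj l * bip f ?k"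
    unfolding h_def using ip_diff_right[OF e(1) lk f(1)] ip_scale_right[OF kern(1)[of c z] f(1), of l] by simp
  also have "bip f ?k = 0" using kern(2)[OF f(1), of c z] f(2) by simp
  finally have "bip f h = bip f e" by simp
  moreover have "(cmod (bip f h))\<^sup>2 \<le> 0" using cauchy_schwarz[OF f(1) h] \<open>sqn h = 0\<close> by simp
  ultimately have "Cn_derivative (f c) z X = 0" using e(2)[OF f(1)] by simp
  then show False using f(3) by (simp add: Cn_derivative_def)
qed

text \<open>
  The logarithm of the polarized kernel is a Hermitian potential whose mixed derivatives are the
  metric. Its curvature vanishes on the diagonal by assumption, hence nearby by polarization, so
  \<open>potential_formula\<close> applies; a unitary frame at \<open>p\<close> turns the constant metric in that formula
  into the identity matrix.
\<close>

theorem local_flat_structure: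
  assumes bpf: "base_point_free M A" and sep: "separates_holomorphic_directions M A"
    and flat: "bergman_metric_has_constant_hsc M A 0" and c: "c \<in> A" and p: "p \<in> chart_image c"
  obtains r s F where "r > 0" "ball p r \<subseteq> chart_image c" "holomorphic_Cn_on s (ball p r)"
    "\<And>z. z \<in> ball p r ==> s z \<noteq> 0" "\<And>k. holomorphic_Cn_on (\<lambda>z. F z $ k) (ball p r)" "F p = 0"
    "det (complex_jacobian F p) \<noteq> 0"
    "\<And>z w. z \<in> ball p r ==> w \<in> ball p r ==> kern c w c z = s z * cnj (s w) * exp (\<Sum>k\<in>UNIV. F z $ k * cnj (F w $ k))"
proof -
  obtain r0 where r0: "r0 > 0" "ball p r0 \<subseteq> chart_image c" "holomorphic_Cn_on (Kh c) (bidisc p r0)"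
    by (rule Kh_holo[OF c p])
  let ?x0 = "vec_join p (vec_cnj p)"
  have x0: "Kh c ?x0 = of_real (sqn (kern c p))" by (simp add: Kh_join kern_diag)
  obtain r1 where r1: "r1 > 0" "r1 \<le> r0" "bidisc p r1 \<subseteq> {x \<in> bidisc p r0. Re (Kh c x) > 0}"
  proof (rule bidisc_neighbourhood[OF _ _ r0(1)])
    have "open (bidisc p r0 \<inter> Kh c -` {w. Re w > 0})"
      by (intro continuous_open_preimage[OF holomorphic_Cn_continuous[OF r0(3)] open_bidisc] open_halfspace_Re_gt)
    moreover have "bidisc p r0 \<inter> Kh c -` {w. Re w > 0} = {x \<in> bidisc p r0. Re (Kh c x) > 0}" by auto
    ultimately show "open {x \<in> bidisc p r0. Re (Kh c x) > 0}" by simp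
    show "?x0 \<in> {x \<in> bidisc p r0. Re (Kh c x) > 0}"
      using r0(1) kern_positive[OF bpf c p] by (simp add: x0)
  qed (rule that)
  have K1: "holomorphic_Cn_on (Kh c) (bidisc p r1)" using holomorphic_Cn_subset[OF r0(3)] r1(3) by blast
  have Re1: "Re (Kh c x) > 0" if "x \<in> bidisc p r1" for x using r1(3) that by blast
  have nn: "Kh c x \<notin> \<real>\<^sub>\<le>\<^sub>0" "Kh c x \<noteq> 0" if "x \<in> bidisc p r1" for x
    using Re1[OF that] by (auto simp: complex_nonpos_Reals_iff)
  have b1: "ball p r1 \<subseteq> chart_image c" using r0(2) r1(2) subset_ball[of r1 r0 p] by blast
  define \<Phi> where "\<Phi> = (\<lambda>x. Ln (Kh c x))"
  have Lnh: "Ln holomorphic_on (- \<real>\<^sub>\<le>\<^sub>0)" by (rule holomorphic_on_Ln) auto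
  have opn: "open (- \<real>\<^sub>\<le>\<^sub>0 :: complex set)" using closed_nonpos_Reals_complex by (rule open_Compl)
  have \<Phi>h: "holomorphic_Cn_on \<Phi> (bidisc p r1)"
    and \<Phi>d: "wirtinger s \<Phi> x = wirtinger s (Kh c) x / Kh c x" if "x \<in> bidisc p r1" for s x
  proof -
    have sub: "Kh c ` bidisc p r1 \<subseteq> - \<real>\<^sub>\<le>\<^sub>0" using nn by auto
    show "holomorphic_Cn_on \<Phi> (bidisc p r1)"
      unfolding \<Phi>_def by (rule holomorphic_Cn_compose_field(1)[OF K1 open_bidisc Lnh opn sub])
    have "deriv Ln (Kh c x) = inverse (Kh c x)"
      by (rule DERIV_imp_deriv) (use nn(1)[OF that] in \<open>simp add: has_field_derivative_Ln\<close>)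
    then show "wirtinger s \<Phi> x = wirtinger s (Kh c) x / Kh c x"
      unfolding \<Phi>_def holomorphic_Cn_compose_field(2)[OF K1 open_bidisc Lnh opn sub that] by (simp add: field_simps)
  qed
  have \<Phi>h: "holomorphic_Cn_on \<Phi> (bidisc p r1)" using \<Phi>h[of ?x0] r1(1) by simp
  have herm\<Phi>: "\<Phi> (vec_join z w) = cnj (\<Phi> (vec_join (vec_cnj w) (vec_cnj z)))" if "z \<in> ball p r1" "w \<in> ball (vec_cnj p) r1" for z w
  proof -
    have "vec_join z w \<in> bidisc p r1" using that by simp
    moreover have "Kh c (vec_join (vec_cnj w) (vec_cnj z)) = cnj (Kh c (vec_join z w))"
      unfolding Kh_join vec_cnj_cnj by (rule kern_sym)
    ultimately show ?thesis unfolding \<Phi>_def using cnj_Ln[OF nn(1), of "vec_join z w"] by (metis complex_cnj_cnj)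
  qed
  interpret fp1: flat_potential p r1 \<Phi>
    by unfold_locales (use r1(1) \<Phi>h herm\<Phi> in auto)
  have dj: "vec_join z (vec_cnj z) \<in> bidisc p r1" if "z \<in> ball p r1" for z
    using that by (simp only: vec_join_in_bidisc vec_cnj_in_ball)
  have logk: "log_bergman_kernel M A c z = \<Phi> (vec_join z (vec_cnj z))" if "z \<in> ball p r1" for z
  proof -
    have "sqn (kern c z) > 0" using kern_positive[OF bpf c] b1 that by blast
    then show ?thesis
      by (simp add: log_bergman_kernel_def bergman_kernel_eq kern_diag \<Phi>_def Kh_join Ln_of_real)
  qed
  have metric: "bergman_metric M A c z = fp1.G (vec_join z (vec_cnj z))" if z: "z \<in> ball p r1" for z
  proof -
    have "wirtinger_bar \<beta> (log_bergman_kernel M A c) w = wirtinger (Inr \<beta>) \<Phi> (vec_join w (vec_cnj w))" if w: "w \<in> ball p r1" for \<beta> w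
      using wirtinger_cong(2)[OF open_ball w logk] wirtinger_join_cnj(2)[OF \<Phi>h open_bidisc dj[OF w]] by simp
    then have "wirtinger \<alpha> (wirtinger_bar \<beta> (log_bergman_kernel M A c)) z = wirtinger (Inl \<alpha>) (wirtinger (Inr \<beta>) \<Phi>) (vec_join z (vec_cnj z))" for \<alpha> \<beta>
      using wirtinger_cong(1)[OF open_ball z, of "wirtinger_bar \<beta> (log_bergman_kernel M A c)" "\<lambda>w. wirtinger (Inr \<beta>) \<Phi> (vec_join w (vec_cnj w))" \<alpha>]
        wirtinger_join_cnj(1)[OF fp1.pd_holo open_bidisc dj[OF z]] by simp
    then show ?thesis by (simp add: bergman_metric_def fp1.G_def)
  qed
  have curvature: "curvature_component (bergman_metric M A c) z i j k l = fp1.curv (vec_join z (vec_cnj z)) i j k l"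
    if z: "z \<in> ball p r1" for z i j k l
  proof -
    have m: "bergman_metric M A c w $ i $ j = fp1.G (vec_join w (vec_cnj w)) $ i $ j" if "w \<in> ball p r1" for w i j
      using metric[OF that] by simp
    have wb: "wirtinger_bar l (\<lambda>w. bergman_metric M A c w $ i $ j) w = wirtinger (Inr l) (\<lambda>x. fp1.G x $ i $ j) (vec_join w (vec_cnj w))"
      if "w \<in> ball p r1" for w i j l
      using wirtinger_cong(2)[OF open_ball that m] wirtinger_join_cnj(2)[OF fp1.G_entry open_bidisc dj[OF that]] by simp
    have wl: "wirtinger k (\<lambda>w. bergman_metric M A c w $ i $ j) w = wirtinger (Inl k) (\<lambda>x. fp1.G x $ i $ j) (vec_join w (vec_cnj w))"
      if "w \<in> ball p r1" for w i j k
      using wirtinger_cong(1)[OF open_ball that m] wirtinger_join_cnj(1)[OF fp1.G_entry open_bidisc dj[OF that]] by simp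
    have "wirtinger k (wirtinger_bar l (\<lambda>w. bergman_metric M A c w $ i $ j)) z
        = wirtinger (Inl k) (wirtinger (Inr l) (\<lambda>x. fp1.G x $ i $ j)) (vec_join z (vec_cnj z))"
      using wirtinger_cong(1)[OF open_ball z wb] wirtinger_join_cnj(1)[OF holomorphic_Cn_wirtinger[OF fp1.G_entry open_bidisc] open_bidisc dj[OF z]] by simp
    then show ?thesis by (simp add: curvature_component_def fp1.curv_def wb[OF z] wl[OF z] metric[OF z])
  qed
  have form: "\<exists>t>0. herm (fp1.G (vec_join z (vec_cnj z))) X X = of_real t" if z: "z \<in> ball p r1" and X: "X \<noteq> 0" for z X
  proof -
    let ?x = "vec_join z (vec_cnj z)" and ?k = "kern c z"
    have zi: "z \<in> chart_image c" using z b1 by blast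
    obtain e where e: "e \<in> A2" "\<And>f. f \<in> A2 ==> bip f e = Cn_derivative (f c) z X"
      using derivative_functional[OF c zi] by metis
    have k0: "sqn ?k > 0" by (rule kern_positive[OF bpf c zi])
    have Kx: "Kh c ?x = of_real (sqn ?k)" by (simp add: Kh_join kern_diag)
    have Gx: "fp1.G ?x $ \<alpha> $ \<beta> = (wirtinger (Inl \<alpha>) (wirtinger (Inr \<beta>) (Kh c)) ?x * Kh c ?x
        - wirtinger (Inr \<beta>) (Kh c) ?x * wirtinger (Inl \<alpha>) (Kh c) ?x) / (Kh c ?x)\<^sup>2" for \<alpha> \<beta>
    proof -
      have "wirtinger (Inl \<alpha>) (wirtinger (Inr \<beta>) \<Phi>) ?x = wirtinger (Inl \<alpha>) (\<lambda>x. wirtinger (Inr \<beta>) (Kh c) x / Kh c x) ?x"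
        by (rule wirtinger_cong(1)[OF open_bidisc dj[OF z] \<Phi>d])
      also have "\<dots> = (wirtinger (Inl \<alpha>) (wirtinger (Inr \<beta>) (Kh c)) ?x * Kh c ?x
        - wirtinger (Inr \<beta>) (Kh c) ?x * wirtinger (Inl \<alpha>) (Kh c) ?x) / (Kh c ?x)\<^sup>2"
        by (rule wirtinger_divide[OF holomorphic_Cn_wirtinger[OF K1 open_bidisc] K1 open_bidisc dj[OF z] nn(2)])
      finally show ?thesis by (simp add: fp1.G_def)
    qed
    note sd = kernel_second_derivative[OF c b1 K1 z e]
    have "herm (fp1.G ?x) X X * (Kh c ?x)\<^sup>2 =
        (\<Sum>\<alpha>\<in>UNIV. \<Sum>\<beta>\<in>UNIV. Kh c ?x * (X $ \<alpha> * cnj (X $ \<beta>) * wirtinger (Inl \<alpha>) (wirtinger (Inr \<beta>) (Kh c)) ?x)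
          - (X $ \<alpha> * wirtinger (Inl \<alpha>) (Kh c) ?x) * (cnj (X $ \<beta>) * wirtinger (Inr \<beta>) (Kh c) ?x))"
      unfolding herm_def sum_distrib_right Gx
      by (intro sum.cong refl) (use nn(2)[OF dj[OF z]] in \<open>simp add: field_simps power2_eq_square\<close>)
    also have "\<dots> = Kh c ?x * (\<Sum>\<alpha>\<in>UNIV. \<Sum>\<beta>\<in>UNIV. X $ \<alpha> * cnj (X $ \<beta>) * wirtinger (Inl \<alpha>) (wirtinger (Inr \<beta>) (Kh c)) ?x)
        - (\<Sum>\<alpha>\<in>UNIV. X $ \<alpha> * wirtinger (Inl \<alpha>) (Kh c) ?x) * (\<Sum>\<beta>\<in>UNIV. cnj (X $ \<beta>) * wirtinger (Inr \<beta>) (Kh c) ?x)"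
      by (simp only: sum_subtractf sum_product) (simp only: sum_distrib_left)
    also have "\<dots> = of_real (sqn ?k * sqn e - (cmod (bip ?k e))\<^sup>2)"
      by (simp only: sd Kx) (simp add: of_real_cmod_square)
    finally have eq: "herm (fp1.G ?x) X X * of_real ((sqn ?k)\<^sup>2) = of_real (sqn ?k * sqn e - (cmod (bip ?k e))\<^sup>2)"
      by (simp add: Kx)
    define t where "t = (sqn ?k * sqn e - (cmod (bip ?k e))\<^sup>2) / (sqn ?k)\<^sup>2"
    have "herm (fp1.G ?x) X X = of_real t"
      using eq k0 by (simp add: t_def divide_simps)
    moreover have "t > 0"
      using derivative_not_proportional[OF sep k0 c zi X e] k0 by (simp add: t_def)
    ultimately show ?thesis by blast
  qed
  have factor: "\<exists>W :: complex ^ 'n ^ 'n. \<forall>k l. herm (fp1.G (vec_join z (vec_cnj z))) (W $ k) (W $ l) = (if k = l then 1 else 0)" if z: "z \<in> ball p r1" for z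
  proof -
    let ?g = "fp1.G (vec_join z (vec_cnj z))"
    have "Im (herm ?g v v) = 0" for v
    proof (cases "v = 0")
      case True
      then show ?thesis by (simp add: herm_def)
    next
      case False
      then show ?thesis using form[OF z False] by auto
    qed
    from hermitian_if_real[OF this] have sym: "?g $ b $ a = cnj (?g $ a $ b)" for a b .
    have pos: "Re (herm ?g v v) > 0" if "v \<noteq> 0" for v using form[OF z that] by auto
    show ?thesis
    proof (rule hermitian_factorization[OF sym])
      fix W :: "complex ^ 'n ^ 'n" assume "\<And>k l. herm ?g (W $ k) (W $ l) = (if k = l then 1 else 0)"
      then show ?thesis by (intro exI[of _ W] allI)
    qed (rule pos)
  qed
  have det0: "det (fp1.G (vec_join z (vec_cnj z))) \<noteq> 0" if "z \<in> ball p r1" for z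
    using factor[OF that] inverse_of_factorization(3) by blast
  obtain r2 where r2: "r2 > 0" "r2 \<le> r1" "bidisc p r2 \<subseteq> {x \<in> bidisc p r1. det (fp1.G x) \<noteq> 0}"
  proof (rule bidisc_neighbourhood[OF _ _ r1(1)])
    have "open (bidisc p r1 \<inter> (\<lambda>x. det (fp1.G x)) -` (- {0}))"
      by (intro continuous_open_preimage[OF holomorphic_Cn_continuous[OF holo_matrix_det[OF fp1.G_holo open_bidisc]] open_bidisc]) (simp add: open_Compl)
    moreover have "bidisc p r1 \<inter> (\<lambda>x. det (fp1.G x)) -` (- {0}) = {x \<in> bidisc p r1. det (fp1.G x) \<noteq> 0}" by auto
    ultimately show "open {x \<in> bidisc p r1. det (fp1.G x) \<noteq> 0}" by simp
    have "p \<in> ball p r1" using r1(1) by simp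
    then show "?x0 \<in> {x \<in> bidisc p r1. det (fp1.G x) \<noteq> 0}"
      using det0 dj by blast
  qed (rule that)
  have sub2: "bidisc p r2 \<subseteq> bidisc p r1" using r2(3) by blast
  have nz2: "det (fp1.G x) \<noteq> 0" if "x \<in> bidisc p r2" for x using r2(3) that by blast
  have ball21: "ball p r2 \<subseteq> ball p r1" using r2(2) by (rule subset_ball)
  have zero_diag: "fp1.curv (vec_join z (vec_cnj z)) i j k l = 0" if z: "z \<in> ball p r2" for z i j k l
  proof (rule curvature_polarization[of "fp1.curv (vec_join z (vec_cnj z))"])
    have z1: "z \<in> ball p r1" using z ball21 by blast
    show "fp1.curv (vec_join z (vec_cnj z)) i j k l = fp1.curv (vec_join z (vec_cnj z)) k j i l" for i j k l
      by (rule fp1.curv_sym(1)[OF dj[OF z1]])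
    show "fp1.curv (vec_join z (vec_cnj z)) i j k l = fp1.curv (vec_join z (vec_cnj z)) i l k j" for i j k l
      by (rule fp1.curv_sym(2)[OF dj[OF z1]])
    fix X :: "complex ^ 'n"
    show "(\<Sum>i\<in>UNIV. \<Sum>j\<in>UNIV. \<Sum>k\<in>UNIV. \<Sum>l\<in>UNIV. fp1.curv (vec_join z (vec_cnj z)) i j k l * X $ i * cnj (X $ j) * X $ k * cnj (X $ l)) = 0"
    proof (cases "X = 0")
      case False
      have zi: "z \<in> chart_image c" using z1 b1 by blast
      have "holomorphic_sectional_curvature (bergman_metric M A c) z X = 0"
        using flat c zi False unfolding bergman_metric_has_constant_hsc_def by simp
      moreover have "(\<Sum>i\<in>UNIV. \<Sum>j\<in>UNIV. bergman_metric M A c z $ i $ j * X $ i * cnj (X $ j)) \<noteq> 0"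
        using form[OF z1 False] unfolding metric[OF z1] herm_def by auto
      ultimately show ?thesis
        unfolding holomorphic_sectional_curvature_def curvature[OF z1] by simp
    qed simp
  qed
  have G2: "holo_matrix_on fp1.G (bidisc p r2)"
    unfolding holo_matrix_on_def using holomorphic_Cn_subset[OF fp1.G_entry sub2] by blast
  have Ge2: "holomorphic_Cn_on (\<lambda>x. fp1.G x $ i $ j) (bidisc p r2)" for i j
    using holomorphic_Cn_subset[OF fp1.G_entry sub2] .
  have Gi2: "holomorphic_Cn_on (\<lambda>x. matrix_inv (fp1.G x) $ i $ j) (bidisc p r2)" for i j
    using holo_matrix_inv(1)[OF G2 open_bidisc nz2] unfolding holo_matrix_on_def by blast
  have curv_holo: "holomorphic_Cn_on (\<lambda>x. fp1.curv x i j k l) (bidisc p r2)" for i j k l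
    unfolding fp1.curv_def
    by (intro holomorphic_Cn_add(1) holomorphic_Cn_uminus(1) holomorphic_Cn_sum'(1) holomorphic_Cn_mult(1)
        holomorphic_Cn_wirtinger Ge2 Gi2 open_bidisc)
  define r3 where "r3 = r2 / 4"
  have r3: "r3 > 0" "r3 \<le> r2" "r3 \<le> r1" using r2 by (simp_all add: r3_def)
  have sub3: "bidisc p r3 \<subseteq> bidisc p r2" "bidisc p r3 \<subseteq> bidisc p r1" by (intro bidisc_mono r3)+
  have curv0: "fp1.curv x i j k l = 0" if x: "x \<in> bidisc p r3" for x i j k l
  proof -
    obtain z w where zw: "x = vec_join z w" "z \<in> ball p r3" "w \<in> ball (vec_cnj p) r3" by (rule bidisc_cases[OF x])
    show ?thesis unfolding zw(1)
      by (rule polarization[OF curv_holo zero_diag]) (use zw r3_def in auto)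
  qed
  have nz3: "det (fp1.G x) \<noteq> 0" if "x \<in> bidisc p r3" for x using nz2 sub3(1) that by blast
  have ball31: "ball p r3 \<subseteq> ball p r1" using r3(3) by (rule subset_ball)
  interpret fp3: flat_potential p r3 \<Phi>
  proof unfold_locales
    show "holomorphic_Cn_on \<Phi> (bidisc p r3)" using holomorphic_Cn_subset[OF \<Phi>h sub3(2)] .
    show "\<Phi> (vec_join z w) = cnj (\<Phi> (vec_join (vec_cnj w) (vec_cnj z)))" if "z \<in> ball p r3" "w \<in> ball (vec_cnj p) r3" for z w
      by (rule herm\<Phi>) (use that r3(3) in auto)
  qed (rule r3(1))
  have formula: "\<Phi> (vec_join z (vec_cnj w)) = \<Phi> (vec_join z (vec_cnj p)) + \<Phi> (vec_join p (vec_cnj w)) - \<Phi> ?x0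
    + (\<Sum>a\<in>UNIV. \<Sum>b\<in>UNIV. fp3.T z $ a * matrix_inv (fp1.G ?x0) $ a $ b * cnj (fp3.T w $ b))"
    if "z \<in> ball p r3" "w \<in> ball p r3" for z w
    by (rule fp3.potential_formula[OF nz3 curv0 that])
  have T_holo: "holomorphic_Cn_on (\<lambda>z. fp3.T z $ a) (ball p r3)" for a
    by (rule fp3.T_holo[OF nz3 curv0])
  have T_deriv: "wirtinger i (\<lambda>z. fp3.T z $ a) z = fp1.G (vec_join z (vec_cnj p)) $ i $ a" if "z \<in> ball p r3" for z i a
    by (rule fp3.T_deriv[OF nz3 curv0 that])
  have T_centre: "fp3.T p = 0" by (rule fp3.T_centre[OF nz3 curv0])
  have pb: "p \<in> ball p r1" "p \<in> ball p r3" using r1 r3 by auto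
  obtain W :: "complex ^ 'n ^ 'n" where W: "\<And>k l. herm (fp1.G ?x0) (W $ k) (W $ l) = (if k = l then 1 else 0)" using factor[OF pb(1)] by metis
  define F where "F z = (\<chi> k. \<Sum>a\<in>UNIV. cnj (W $ k $ a) * fp3.T z $ a)" for z
  have Tc: "holomorphic_Cn_on (\<lambda>z. cnj (W $ k $ a) * fp3.T z $ a) (ball p r3)" for k a
    by (rule holomorphic_Cn_cmult(1)[OF T_holo open_ball])
  have Fh: "holomorphic_Cn_on (\<lambda>z. F z $ k) (ball p r3)" for k
    unfolding F_def vec_lambda_beta by (intro holomorphic_Cn_sum'(1) Tc open_ball)
  have F0: "F p = 0" by (simp add: F_def T_centre vec_eq_iff)
  have jac: "complex_jacobian F p = (\<chi> k a. cnj (W $ k $ a)) ** transpose (fp1.G ?x0)"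
  proof -
    have "wirtinger j (\<lambda>z. F z $ k) p = (\<Sum>a\<in>UNIV. cnj (W $ k $ a) * fp1.G ?x0 $ j $ a)" for j k
      unfolding F_def vec_lambda_beta holomorphic_Cn_sum'(2)[OF Tc open_ball pb(2)]
        holomorphic_Cn_cmult(2)[OF T_holo open_ball pb(2)] T_deriv[OF pb(2)] ..
    then show ?thesis by (simp add: complex_jacobian_def vec_eq_iff matrix_matrix_mult_def transpose_def)
  qed
  have detW: "det (\<chi> k a. cnj (W $ k $ a)) \<noteq> 0"
  proof -
    have "det (\<chi> k a. cnj (W $ k $ a)) = cnj (det W)" by (simp add: det_def)
    then show ?thesis using inverse_of_factorization(2)[OF W] by simp
  qed
  have detF: "det (complex_jacobian F p) \<noteq> 0"
    unfolding jac det_mul det_transpose using detW det0[OF pb(1)] by simp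
  have quad: "(\<Sum>a\<in>UNIV. \<Sum>b\<in>UNIV. fp3.T z $ a * matrix_inv (fp1.G ?x0) $ a $ b * cnj (fp3.T w $ b))
      = (\<Sum>k\<in>UNIV. F z $ k * cnj (F w $ k))" for z w
  proof -
    have "(\<Sum>k\<in>UNIV. F z $ k * cnj (F w $ k)) =
        (\<Sum>k\<in>UNIV. \<Sum>a\<in>UNIV. \<Sum>b\<in>UNIV. (cnj (W $ k $ a) * fp3.T z $ a) * (W $ k $ b * cnj (fp3.T w $ b)))"
      by (simp add: F_def sum_product)
    also have "\<dots> = (\<Sum>a\<in>UNIV. \<Sum>k\<in>UNIV. \<Sum>b\<in>UNIV. (cnj (W $ k $ a) * fp3.T z $ a) * (W $ k $ b * cnj (fp3.T w $ b)))"
      by (rule sum.swap)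
    also have "\<dots> = (\<Sum>a\<in>UNIV. \<Sum>b\<in>UNIV. \<Sum>k\<in>UNIV. (cnj (W $ k $ a) * fp3.T z $ a) * (W $ k $ b * cnj (fp3.T w $ b)))"
      by (intro sum.cong refl sum.swap)
    also have "\<dots> = (\<Sum>a\<in>UNIV. \<Sum>b\<in>UNIV. fp3.T z $ a * matrix_inv (fp1.G ?x0) $ a $ b * cnj (fp3.T w $ b))"
      unfolding inverse_of_factorization(1)[OF W] sum_distrib_left sum_distrib_right
      by (intro sum.cong refl) (simp only: mult_ac)
    finally show ?thesis by simp
  qed
  define s where "s z = Kh c (vec_join z (vec_cnj p)) / of_real (sqrt (sqn (kern c p)))" for z
  have kp: "sqn (kern c p) > 0" by (rule kern_positive[OF bpf c p])
  have jp: "vec_join z (vec_cnj p) \<in> bidisc p r1" if "z \<in> ball p r1" for z using that r1(1) by simp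
  have snz: "s z \<noteq> 0" if "z \<in> ball p r3" for z
    using nn(2)[OF jp[of z]] that ball31 kp by (auto simp: s_def simp del: mem_ball)
  have sh: "holomorphic_Cn_on s (ball p r3)"
  proof -
    have "s z = 1 / of_real (sqrt (sqn (kern c p))) * kern c p c z" for z by (simp add: s_def Kh_join)
    then have "s = (\<lambda>z. 1 / of_real (sqrt (sqn (kern c p))) * kern c p c z)" by (rule ext)
    moreover have "holomorphic_Cn_on (kern c p c) (ball p r3)"
      using holomorphic_Cn_subset[OF formD(1)[OF A2_holomorphic[OF kern(1)] c]] b1 ball31 by blast
    ultimately show ?thesis using holomorphic_Cn_cmult(1)[OF _ open_ball] by metis
  qed
  have kernel: "kern c w c z = s z * cnj (s w) * exp (\<Sum>k\<in>UNIV. F z $ k * cnj (F w $ k))" if z: "z \<in> ball p r3" and w: "w \<in> ball p r3" for z w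
  proof -
    have zw1: "z \<in> ball p r1" "w \<in> ball p r1" using z w ball31 by auto
    have in1: "vec_join z (vec_cnj w) \<in> bidisc p r1" "vec_join z (vec_cnj p) \<in> bidisc p r1" "vec_join p (vec_cnj w) \<in> bidisc p r1" "?x0 \<in> bidisc p r1"
      using zw1 pb(1) by (simp_all only: vec_join_in_bidisc vec_cnj_in_ball)
    have ex: "exp (\<Phi> x) = Kh c x" if "x \<in> bidisc p r1" for x unfolding \<Phi>_def by (rule exp_Ln[OF nn(2)[OF that]])
    have "Kh c (vec_join z (vec_cnj w)) = exp (\<Phi> (vec_join z (vec_cnj w)))" using ex[OF in1(1)] by simp
    also have "\<dots> = exp (\<Phi> (vec_join z (vec_cnj p)) + \<Phi> (vec_join p (vec_cnj w)) - \<Phi> ?x0 + (\<Sum>k\<in>UNIV. F z $ k * cnj (F w $ k)))"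
      using formula[OF z w] by (simp add: quad)
    also have "\<dots> = Kh c (vec_join z (vec_cnj p)) * Kh c (vec_join p (vec_cnj w)) / Kh c ?x0 * exp (\<Sum>k\<in>UNIV. F z $ k * cnj (F w $ k))"
      unfolding exp_add exp_diff ex[OF in1(2)] ex[OF in1(3)] ex[OF in1(4)] by simp
    also have "Kh c (vec_join p (vec_cnj w)) = cnj (Kh c (vec_join w (vec_cnj p)))"
      unfolding Kh_join vec_cnj_cnj by (rule kern_sym)
    also have "Kh c (vec_join z (vec_cnj p)) * cnj (Kh c (vec_join w (vec_cnj p))) / Kh c ?x0 = s z * cnj (s w)"
    proof -
      have "complex_of_real (sqrt (sqn (kern c p))) * complex_of_real (sqrt (sqn (kern c p))) = of_real (sqn (kern c p))"
        using kp by (simp flip: of_real_mult)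
      then show ?thesis by (simp add: s_def x0)
    qed
    finally show ?thesis by (simp add: Kh_join)
  qed
  show thesis
  proof (rule that[OF r3(1) _ sh snz Fh F0 detF kernel])
    show "ball p r3 \<subseteq> chart_image c" using b1 ball31 by blast
  qed
qed

end

section \<open>Coherent states\<close>

text \<open>
  The Hermitian product of \<open>\<complex>\<^sup>n\<close>, linear in the first argument.
\<close>

definition hp :: "complex ^ 'n::finite \<Rightarrow> complex ^ 'n \<Rightarrow> complex" where
  "hp x y = (\<Sum>i\<in>UNIV. x $ i * cnj (y $ i))"

lemma hp_scale_left: "hp (a *s x) y = a * hp x y"
  by (simp add: hp_def sum_distrib_left mult.assoc)

lemma hp_scale_right: "hp x (a *s y) = cnj a * hp x y"
  by (simp add: hp_def sum_distrib_left mult_ac)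

lemma hp_zero [simp]: "hp 0 y = 0" "hp x 0 = 0"
  by (simp_all add: hp_def)

lemma cnj_hp: "cnj (hp x y) = hp y x"
  by (simp add: hp_def mult.commute)

lemma hp_self: "hp x x = of_real ((norm x)\<^sup>2)"
proof -
  have "(norm x)\<^sup>2 = (\<Sum>i\<in>UNIV. (cmod (x $ i))\<^sup>2)"
    by (simp add: norm_vec_def L2_set_def sum_nonneg)
  then show ?thesis by (simp add: hp_def of_real_cmod_square)
qed

lemma hp_axis: "hp x (axis i 1) = x $ i"
  by (simp add: hp_def axis_def if_distrib[of cnj] if_distrib[of "\<lambda>t. _ * t"] cong: if_cong)

text \<open>
  If \<open>a \<noteq> 0\<close>, the relations say \<open>b k = a h\<^sup>k / k!\<close> with \<open>h = b 1 / a\<close>. All powers of the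
  meromorphic function \<open>h\<close> have a pole of order at most that of \<open>1 / a\<close>, so \<open>h\<close> has no pole, and
  \<open>b k\<close> vanishes where \<open>a\<close> does.
\<close>

lemma exponential_family_zero:
  fixes a :: "complex \<Rightarrow> complex" and b :: "nat \<Rightarrow> complex \<Rightarrow> complex"
  assumes a: "a holomorphic_on D" and b: "\<And>k. b k holomorphic_on D"
    and D: "open D" "connected D" "0 \<in> D" "w \<in> D" and a0: "a 0 = 0" and aw: "a w \<noteq> 0"
    and rel: "\<And>\<zeta> k. \<zeta> \<in> D ==> b k \<zeta> * a \<zeta> ^ k * fact k = a \<zeta> * b 1 \<zeta> ^ k"
  shows "b k 0 = 0"
proof -
  have "\<not> a constant_on D" using D(3,4) a0 aw unfolding constant_on_def by metis
  from holomorphic_factor_zero_nonconstant[OF a D(1,2,3) a0 this]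
  obtain g r m where g: "0 < m" "0 < r" "ball 0 r \<subseteq> D" "g holomorphic_on ball 0 r"
    "\<And>w. w \<in> ball 0 r ==> a w = (w - 0) ^ m * g w" "\<And>w. w \<in> ball 0 r ==> g w \<noteq> 0" by metis
  define h where "h \<zeta> = b 1 \<zeta> / a \<zeta>" for \<zeta>
  have anz: "a \<zeta> \<noteq> 0" if "\<zeta> \<in> ball 0 r - {0}" for \<zeta> using g(5,6)[of \<zeta>] that by auto
  have bh: "b k \<zeta> = a \<zeta> * h \<zeta> ^ k / fact k" if \<zeta>: "\<zeta> \<in> ball 0 r - {0}" for k \<zeta>
    using rel[of \<zeta> k] anz[OF \<zeta>] \<zeta> g(3) by (auto simp: h_def power_divide field_simps)
  have hh: "h holomorphic_on ball 0 r - {0}"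
    unfolding h_def[abs_def] by (rule holomorphic_on_divide[OF holomorphic_on_subset[OF b] holomorphic_on_subset[OF a] anz]) (use g(3) in blast)+
  let ?q = "\<lambda>\<zeta>. \<zeta> * b (Suc m) \<zeta> * fact (Suc m) / g \<zeta>"
  have lim: "f \<midarrow>0\<rightarrow> f 0" if "f holomorphic_on ball 0 r" for f
    using holomorphic_on_imp_continuous_on[OF that] continuous_on_eq_continuous_at[OF open_ball, of 0 r f] g(2)
    by (simp add: isCont_def)
  have "?q holomorphic_on ball 0 r"
    by (intro holomorphic_on_divide holomorphic_on_mult holomorphic_on_ident holomorphic_on_const holomorphic_on_subset[OF b g(3)] g(4,6))
  from lim[OF this] have q0: "?q \<midarrow>0\<rightarrow> 0" by simp
  have ev: "\<forall>\<^sub>F \<zeta> in at 0. ?q \<zeta> = (\<zeta> * h \<zeta>) ^ Suc m"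
  proof (rule eventually_at_ball'[OF g(2), THEN eventually_mono])
    fix \<zeta> :: complex assume "\<zeta> \<in> ball 0 r \<and> \<zeta> \<noteq> 0 \<and> \<zeta> \<in> UNIV"
    then have \<zeta>: "\<zeta> \<in> ball 0 r - {0}" by simp
    then have "\<zeta> ^ m * g \<zeta> \<noteq> 0" "a \<zeta> = \<zeta> ^ m * g \<zeta>" using g(5,6)[of \<zeta>] by auto
    then show "?q \<zeta> = (\<zeta> * h \<zeta>) ^ Suc m"
      unfolding bh[OF \<zeta>, of "Suc m"] by (simp add: power_mult_distrib del: fact_Suc)
  qed
  have "(\<lambda>\<zeta>. (\<zeta> * h \<zeta>) ^ Suc m) \<midarrow>0\<rightarrow> 0" using q0 tendsto_cong[OF ev] by simp
  then have "(\<lambda>\<zeta>. norm (\<zeta> * h \<zeta>) ^ Suc m) \<midarrow>0\<rightarrow> 0" by (simp only: tendsto_norm_zero_iff flip: norm_power)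
  then have "(\<lambda>\<zeta>. (\<zeta> - 0) * h \<zeta>) \<midarrow>0\<rightarrow> 0" by (simp only: power_tendsto_0_iff[OF zero_less_Suc] tendsto_norm_zero_iff diff_zero)
  moreover have "0 \<in> interior (ball 0 r :: complex set)" using g(2) by simp
  ultimately obtain H where H: "H holomorphic_on ball 0 r" "\<forall>\<zeta>\<in>ball 0 r - {0}. H \<zeta> = h \<zeta>"
    using holomorphic_on_extend_lim[OF hh] by blast
  have c1: "b k \<midarrow>0\<rightarrow> b k 0" by (rule lim[OF holomorphic_on_subset[OF b g(3)]])
  have c2: "(\<lambda>\<zeta>. a \<zeta> * H \<zeta> ^ k / fact k) \<midarrow>0\<rightarrow> a 0 * H 0 ^ k / fact k"
    by (intro lim holomorphic_on_divide holomorphic_on_mult holomorphic_on_power holomorphic_on_const holomorphic_on_subset[OF a g(3)] H(1)) simp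
  have "\<forall>\<^sub>F \<zeta> in at 0. b k \<zeta> = a \<zeta> * H \<zeta> ^ k / fact k"
    by (rule eventually_at_ball'[OF g(2), THEN eventually_mono]) (use bh H(2) in auto)
  from tendsto_cong[OF this] c1 have "(\<lambda>\<zeta>. a \<zeta> * H \<zeta> ^ k / fact k) \<midarrow>0\<rightarrow> b k 0" by blast
  from LIM_unique[OF this c2] have "b k 0 = a 0 * H 0 ^ k / fact k" .
  then show ?thesis using a0 by simp
qed

text \<open>
  The situation near a point of a flat Bergman manifold: in the coordinates \<open>y\<close> given by
  \<open>\<gamma>\<close>, and after division by \<open>\<sigma>\<close>, the kernel is the Fock kernel \<open>exp (hp x y)\<close>.
\<close>

locale fock_chart = holomorphic_atlas M A
  for M :: "'a topology" and A :: "('a, 'n::finite) chart set" +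
  fixes c0 :: "('a, 'n) chart" and \<gamma> :: "complex ^ 'n \<Rightarrow> complex ^ 'n" and \<sigma> :: "complex ^ 'n \<Rightarrow> complex" and \<epsilon> :: real
  assumes bpf: "base_point_free M A" and sep: "separates_holomorphic_directions M A"
    and c0: "c0 \<in> A" and eps: "\<epsilon> > 0"
    and \<gamma>_holo: "\<And>k. holomorphic_Cn_on (\<lambda>y. \<gamma> y $ k) (ball 0 \<epsilon>)"
    and \<sigma>_holo: "holomorphic_Cn_on \<sigma> (ball 0 \<epsilon>)" and \<sigma>_nonzero: "\<And>y. y \<in> ball 0 \<epsilon> ==> \<sigma> y \<noteq> 0"
    and \<gamma>_open: "open (\<gamma> ` ball 0 \<epsilon>)" and \<gamma>_chart: "\<gamma> ` ball 0 \<epsilon> \<subseteq> chart_image c0"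
    and fock_kernel: "\<And>x y. x \<in> ball 0 \<epsilon> ==> y \<in> ball 0 \<epsilon> ==> kern c0 (\<gamma> y) c0 (\<gamma> x) = \<sigma> x * cnj (\<sigma> y) * exp (hp x y)"
begin

definition tr :: "('a, 'n) form \<Rightarrow> complex ^ 'n \<Rightarrow> complex" where
  "tr f y = f c0 (\<gamma> y) / \<sigma> y"

lemma tr_holo:
  assumes "f \<in> A2" shows "holomorphic_Cn_on (tr f) (ball 0 \<epsilon>)"
  unfolding tr_def[abs_def]
  by (rule holomorphic_Cn_divide[OF holomorphic_Cn_compose(1)[OF \<gamma>_holo open_ball
        formD(1)[OF A2_holomorphic[OF assms] c0] chart_domain(2)[OF c0] \<gamma>_chart] \<sigma>_holo open_ball \<sigma>_nonzero])

lemma tr_kern: "x \<in> ball 0 \<epsilon> ==> y \<in> ball 0 \<epsilon> ==> tr (kern c0 (\<gamma> x)) y = cnj (\<sigma> x) * exp (hp y x)"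
  using fock_kernel[of y x] \<sigma>_nonzero[of y] by (simp add: tr_def del: mem_ball mem_ball_0)

lemma tr_bound:
  assumes f: "f \<in> A2" and y: "y \<in> ball 0 \<epsilon>"
  shows "(cmod (tr f y))\<^sup>2 \<le> exp ((norm y)\<^sup>2) * sqn f"
proof -
  have nz: "cmod (\<sigma> y) > 0" using \<sigma>_nonzero[OF y] by simp
  have "complex_of_real (sqn (kern c0 (\<gamma> y))) = of_real ((cmod (\<sigma> y))\<^sup>2 * exp ((norm y)\<^sup>2))"
    using kern_diag[of c0 "\<gamma> y"] fock_kernel[OF y y] by (simp add: hp_self of_real_cmod_square flip: exp_of_real)
  then have sq: "sqn (kern c0 (\<gamma> y)) = (cmod (\<sigma> y))\<^sup>2 * exp ((norm y)\<^sup>2)" by (simp only: of_real_eq_iff)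
  have "(cmod (f c0 (\<gamma> y)))\<^sup>2 \<le> sqn f * ((cmod (\<sigma> y))\<^sup>2 * exp ((norm y)\<^sup>2))"
    using cauchy_schwarz[OF f kern(1)[of c0 "\<gamma> y"]] kern(2)[OF f, of c0 "\<gamma> y"] sq by simp
  then show ?thesis using nz by (simp add: tr_def norm_divide power_divide divide_simps mult_ac)
qed

text \<open>
  The image of \<open>\<gamma>\<close> is open, so an element of the Bergman space is determined by its values there.
\<close>

lemma A2_eqI:
  assumes f: "f \<in> A2" "g \<in> A2" and eq: "\<And>y. y \<in> ball 0 \<epsilon> ==> tr f y = tr g y"
  shows "f = g"
proof -
  have "form_diff f g = zero_form"
  proof (rule form_identity[OF A2_holomorphic[OF diff_mem[OF f]] c0 \<gamma>_open _ \<gamma>_chart])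
    show "\<gamma> ` ball 0 \<epsilon> \<noteq> {}" using eps by simp
    show "f c0 z - g c0 z = 0" if "z \<in> \<gamma> ` ball 0 \<epsilon>" for z
    proof -
      from that obtain y where y: "y \<in> ball 0 \<epsilon>" "z = \<gamma> y" by (rule imageE) 
      then show ?thesis using eq[OF y(1)] \<sigma>_nonzero[OF y(1)] by (simp add: tr_def)
    qed
  qed
  then have "f c z - g c z = 0" for c z by (rule fun_cong[OF fun_cong])
  then show ?thesis by (intro ext) simp
qed

definition radius :: "complex ^ 'n \<Rightarrow> real" where
  "radius v = \<epsilon> / (1 + norm v)"

lemma radius_pos: "radius v > 0"
  using eps by (simp add: radius_def add_pos_nonneg)

lemma radius_mem: "\<zeta> \<in> ball 0 (radius v) ==> \<zeta> *s v \<in> ball 0 \<epsilon>"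
proof -
  assume "\<zeta> \<in> ball 0 (radius v)"
  then have "cmod \<zeta> * (1 + norm v) < \<epsilon>" by (simp add: radius_def pos_less_divide_eq add_pos_nonneg)
  moreover have "cmod \<zeta> * norm v \<le> cmod \<zeta> * (1 + norm v)" by (intro mult_left_mono) auto
  ultimately show ?thesis by (simp add: norm_vector_scale_complex)
qed

lemma tr_line_holo:
  assumes "f \<in> A2" shows "(\<lambda>\<zeta>. tr f (\<zeta> *s v)) holomorphic_on {\<zeta>. \<zeta> *s v \<in> ball 0 \<epsilon>}"
  using holomorphic_on_line[OF tr_holo[OF assms] open_ball, of 0 v] by simp

lemma tr_line_radius:
  assumes "f \<in> A2" shows "(\<lambda>\<zeta>. tr f (\<zeta> *s v)) holomorphic_on ball 0 (radius v)"
  by (rule holomorphic_on_subset[OF tr_line_holo[OF assms]]) (use radius_mem in blast)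

text \<open>
  The \<open>k\<close>-th Taylor coefficient along the direction \<open>v\<close> is a bounded functional; it is
  represented by an element \<open>coh v k\<close>, which near the base point is \<open>\<sigma> (hp y v)\<^sup>k / k!\<close>.
\<close>

lemma taylor_functional:
  "\<exists>e. e \<in> A2 \<and> (\<forall>f\<in>A2. bip f e = (deriv ^^ k) (\<lambda>\<zeta>. tr f (\<zeta> *s v)) 0 / fact k)"
proof -
  let ?l = "\<lambda>f. (deriv ^^ k) (\<lambda>\<zeta>. tr f (\<zeta> *s v)) 0 / fact k"
  define r where "r = radius v / 2"
  have r: "r > 0" "cball 0 r \<subseteq> ball 0 (radius v)" using radius_pos[of v] by (auto simp: r_def)
  have z: "0 \<in> ball (0 :: complex) (radius v)" using radius_pos[of v] by simp
  have "(cmod (?l f))\<^sup>2 \<le> exp (\<epsilon>\<^sup>2) / (r ^ k)\<^sup>2 * sqn f" if f: "f \<in> A2" for f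
  proof -
    have B: "cmod (tr f (\<zeta> *s v)) \<le> sqrt (exp (\<epsilon>\<^sup>2) * sqn f)" if "norm (0 - \<zeta>) = r" for \<zeta>
    proof (rule real_le_rsqrt)
      have m: "\<zeta> *s v \<in> ball 0 \<epsilon>" using that radius_pos[of v] by (intro radius_mem) (simp add: r_def)
      have "exp ((norm (\<zeta> *s v))\<^sup>2) \<le> exp (\<epsilon>\<^sup>2)" using m by (simp add: power_mono)
      then show "(cmod (tr f (\<zeta> *s v)))\<^sup>2 \<le> exp (\<epsilon>\<^sup>2) * sqn f"
        using tr_bound[OF f m] mult_right_mono[OF _ sqn_nonneg[OF f]] by (rule_tac order_trans) auto
    qed
    have "norm ((deriv ^^ k) (\<lambda>\<zeta>. tr f (\<zeta> *s v)) 0) \<le> fact k * sqrt (exp (\<epsilon>\<^sup>2) * sqn f) / r ^ k"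
      by (rule Cauchy_inequality[OF holomorphic_on_subset[OF tr_line_radius[OF f]]
            continuous_on_subset[OF holomorphic_on_imp_continuous_on[OF tr_line_radius[OF f]] r(2)] r(1) B])
        (use r(2) ball_subset_cball in blast)
    then have "norm ((deriv ^^ k) (\<lambda>\<zeta>. tr f (\<zeta> *s v)) 0) / fact k \<le> fact k * sqrt (exp (\<epsilon>\<^sup>2) * sqn f) / r ^ k / fact k"
      by (rule divide_right_mono) simp
    then have "cmod (?l f) \<le> sqrt (exp (\<epsilon>\<^sup>2) * sqn f) / r ^ k"
      by (simp add: norm_divide)
    then have "(cmod (?l f))\<^sup>2 \<le> (sqrt (exp (\<epsilon>\<^sup>2) * sqn f) / r ^ k)\<^sup>2" by (rule power_mono) simp
    then show ?thesis using sqn_nonneg[OF f] by (simp add: power_divide)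
  qed
  note bound = this
  obtain e where "e \<in> A2" "\<And>f. f \<in> A2 ==> bip f e = ?l f"
  proof (rule riesz[OF basis_orthonormal_basis, of ?l "exp (\<epsilon>\<^sup>2) / (r ^ k)\<^sup>2"])
    fix f g assume fg: "f \<in> A2" "g \<in> A2"
    have "(\<lambda>\<zeta>. tr (form_add f g) (\<zeta> *s v)) = (\<lambda>\<zeta>. tr f (\<zeta> *s v) + tr g (\<zeta> *s v))"
      by (simp add: tr_def add_divide_distrib)
    then show "?l (form_add f g) = ?l f + ?l g"
      using higher_deriv_add[OF tr_line_radius[OF fg(1)] tr_line_radius[OF fg(2)] open_ball z]
      by (simp add: add_divide_distrib)
  next
    fix f a assume f: "f \<in> A2"
    have "(\<lambda>\<zeta>. tr (form_scale a f) (\<zeta> *s v)) = (\<lambda>\<zeta>. a * tr f (\<zeta> *s v))" by (simp add: tr_def)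
    then show "?l (form_scale a f) = a * ?l f"
      using higher_deriv_cmult[OF tr_line_radius[OF f] z open_ball] by simp
  qed (use bound in auto)
  then show ?thesis by blast
qed

definition coh :: "complex ^ 'n \<Rightarrow> nat \<Rightarrow> ('a, 'n) form" where
  "coh v k = (SOME e. e \<in> A2 \<and> (\<forall>f\<in>A2. bip f e = (deriv ^^ k) (\<lambda>\<zeta>. tr f (\<zeta> *s v)) 0 / fact k))"

lemma coh_mem: "coh v k \<in> A2"
  and bip_coh: "f \<in> A2 ==> bip f (coh v k) = (deriv ^^ k) (\<lambda>\<zeta>. tr f (\<zeta> *s v)) 0 / fact k"
  using someI_ex[OF taylor_functional[of k v]] unfolding coh_def by blast+

lemma bip_coh_fps:
  assumes f: "f \<in> A2" and eq: "\<And>y. y \<in> ball 0 \<epsilon> ==> tr f y = u y" and P: "(\<lambda>\<zeta>. u (\<zeta> *s v)) has_fps_expansion P"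
  shows "bip f (coh v k) = fps_nth P k"
proof -
  have "eventually (\<lambda>\<zeta>. tr f (\<zeta> *s v) = u (\<zeta> *s v)) (nhds 0)"
    using eventually_nhds_in_open[of "ball 0 (radius v)" 0] radius_pos[of v]
    by (auto elim!: eventually_mono intro!: eq radius_mem simp del: mem_ball mem_ball_0)
  from iffD2[OF has_fps_expansion_cong[OF this refl] P] have "(\<lambda>\<zeta>. tr f (\<zeta> *s v)) has_fps_expansion P" .
  from fps_nth_fps_expansion[OF this] show ?thesis using bip_coh[OF f] by simp
qed

lemma bip_coh_exp:
  assumes f: "f \<in> A2" and eq: "\<And>y. y \<in> ball 0 \<epsilon> ==> tr f y = C * exp (hp y x)"
  shows "bip f (coh v k) = C * hp v x ^ k / fact k"
proof -
  have "(\<lambda>\<zeta>. C * exp (hp v x * \<zeta>)) has_fps_expansion fps_const C * fps_exp (hp v x)"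
    by (intro fps_expansion_intros)
  then have "(\<lambda>\<zeta>. C * exp (hp (\<zeta> *s v) x)) has_fps_expansion fps_const C * fps_exp (hp v x)"
    by (simp add: hp_scale_left mult.commute)
  from bip_coh_fps[OF f eq this] show ?thesis by simp
qed

lemma tr_coh:
  assumes y: "y \<in> ball 0 \<epsilon>" shows "tr (coh v k) y = hp y v ^ k / fact k"
proof -
  have "coh v k c0 (\<gamma> y) = cnj (bip (kern c0 (\<gamma> y)) (coh v k))"
    using kern(2)[OF coh_mem, of v k c0 "\<gamma> y"] ip_cnj[OF kern(1)[of c0 "\<gamma> y"] coh_mem[of v k]] by simp
  also have "\<dots> = \<sigma> y * hp y v ^ k / fact k"
    using bip_coh_exp[OF kern(1) tr_kern[OF y]] by (simp add: cnj_hp)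
  finally show ?thesis using \<sigma>_nonzero[OF y] by (simp add: tr_def)
qed

lemma sqn_coh: "sqn (coh v k) = (norm v)\<^sup>2 ^ k / fact k"
proof -
  have "(\<lambda>\<zeta>. hp v v ^ k / fact k * \<zeta> ^ k) has_fps_expansion fps_const (hp v v ^ k / fact k) * fps_X ^ k"
    by (intro fps_expansion_intros)
  then have "(\<lambda>\<zeta>. hp (\<zeta> *s v) v ^ k / fact k) has_fps_expansion fps_const (hp v v ^ k / fact k) * fps_X ^ k"
    by (simp add: hp_scale_left power_mult_distrib mult.commute)
  note P = this
  have "bip (coh v k) (coh v k) = fps_nth (fps_const (hp v v ^ k / fact k) * fps_X ^ k) k"
    by (rule bip_coh_fps[OF coh_mem tr_coh P])
  then have "bip (coh v k) (coh v k) = of_real ((norm v)\<^sup>2 ^ k / fact k)" by (simp add: hp_self)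
  then show ?thesis unfolding ip_self[OF coh_mem] of_real_eq_iff .
qed

lemma coh_scale: "coh (a *s v) k = form_scale (cnj a ^ k) (coh v k)"
proof (rule A2_eqI[OF coh_mem scale_mem[OF coh_mem]])
  fix y :: "complex ^ 'n" assume y: "y \<in> ball 0 \<epsilon>"
  have "tr (form_scale b f) y = b * tr f y" for b f by (simp add: tr_def)
  then show "tr (coh (a *s v) k) y = tr (form_scale (cnj a ^ k) (coh v k)) y"
    by (simp only: tr_coh[OF y]) (simp add: hp_scale_right power_mult_distrib)
qed

definition coherent :: "complex ^ 'n \<Rightarrow> ('a, 'n) form" where
  "coherent v = (SOME e. e \<in> A2 \<and> (\<forall>f\<in>A2. (\<lambda>k. bip f (coh v k)) sums bip f e))"

lemma coherent_mem: "coherent v \<in> A2"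
  and coherent_sums: "f \<in> A2 ==> (\<lambda>k. bip f (coh v k)) sums bip f (coherent v)"
proof -
  let ?s = "\<lambda>k. sqrt (sqn (coh v k))"
  have "summable ?s"
  proof (rule summable_comparison_test[where g = "\<lambda>k. ((2 * norm v)\<^sup>2) ^ k / fact k + (1 / 4) ^ k"])
    have "?s k \<le> ((2 * norm v)\<^sup>2) ^ k / fact k + (1 / 4) ^ k" for k
    proof -
      have "sqn (coh v k) = ((2 * norm v)\<^sup>2 ^ k / fact k) * (1 / 4) ^ k"
        by (simp add: sqn_coh power_mult_distrib power_divide)
      also have "\<dots> \<le> (((2 * norm v)\<^sup>2) ^ k / fact k + (1 / 4) ^ k)\<^sup>2"
      proof -
        have ab: "a * b \<le> (a + b)\<^sup>2" if "a \<ge> 0" "b \<ge> 0" for a b :: real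
          using that by (simp add: power2_sum)
        show ?thesis by (rule ab) simp_all
      qed
      finally show ?thesis by (rule real_le_lsqrt[rotated]) (simp add: add_nonneg_nonneg)
    qed
    then show "\<exists>N. \<forall>n\<ge>N. norm (?s n) \<le> ((2 * norm v)\<^sup>2) ^ n / fact n + (1 / 4) ^ n"
      using sqn_nonneg[OF coh_mem] by auto
    have "summable (\<lambda>k. ((2 * norm v)\<^sup>2) ^ k / fact k)"
      using summable_exp[of "(2 * norm v)\<^sup>2"] by (simp add: divide_inverse mult.commute)
    then show "summable (\<lambda>k. ((2 * norm v)\<^sup>2) ^ k / fact k + (1 / 4) ^ k)"
      by (intro summable_add summable_geometric) auto
  qed
  have bd: "cmod (bip f (coh v k)) \<le> sqrt (sqn f) * ?s k" if "f \<in> A2" for f k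
    using real_le_rsqrt[OF cauchy_schwarz[OF that coh_mem]] by (simp add: real_sqrt_mult)
  have sn: "summable (\<lambda>k. cmod (bip f (coh v k)))" if "f \<in> A2" for f
    by (rule summable_comparison_test[OF _ summable_mult[OF \<open>summable ?s\<close>, of "sqrt (sqn f)"]])
      (use bd[OF that] in auto)
  have sm: "summable (\<lambda>k. bip f (coh v k))" if "f \<in> A2" for f
    using summable_norm_cancel[OF sn[OF that]] .
  obtain e where e: "e \<in> A2" "\<And>f. f \<in> A2 ==> bip f e = (\<Sum>k. bip f (coh v k))"
  proof (rule riesz[OF basis_orthonormal_basis, of "\<lambda>f. \<Sum>k. bip f (coh v k)" "(suminf ?s)\<^sup>2"])
    show "(\<Sum>k. bip (form_add f g) (coh v k)) = (\<Sum>k. bip f (coh v k)) + (\<Sum>k. bip g (coh v k))"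
      if "f \<in> A2" "g \<in> A2" for f g
      using suminf_add[OF sm[OF that(1)] sm[OF that(2)]] ip_add[OF that coh_mem] by simp
    show "(\<Sum>k. bip (form_scale a f) (coh v k)) = a * (\<Sum>k. bip f (coh v k))" if "f \<in> A2" for f a
      using suminf_mult[OF sm[OF that], of a] ip_scale[OF that coh_mem] by simp
    show "(cmod (\<Sum>k. bip f (coh v k)))\<^sup>2 \<le> (suminf ?s)\<^sup>2 * sqn f" if f: "f \<in> A2" for f
    proof -
      have "cmod (\<Sum>k. bip f (coh v k)) \<le> (\<Sum>k. cmod (bip f (coh v k)))" by (rule summable_norm[OF sn[OF f]])
      also have "\<dots> \<le> (\<Sum>k. sqrt (sqn f) * ?s k)"
        by (rule suminf_le[OF bd[OF f] sn[OF f] summable_mult[OF \<open>summable ?s\<close>]])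
      also have "\<dots> = sqrt (sqn f) * suminf ?s" by (rule suminf_mult[OF \<open>summable ?s\<close>])
      finally have "(cmod (\<Sum>k. bip f (coh v k)))\<^sup>2 \<le> (sqrt (sqn f) * suminf ?s)\<^sup>2" by (rule power_mono) simp
      then show ?thesis using sqn_nonneg[OF f] by (simp add: power_mult_distrib mult.commute)
    qed
  qed (use that in blast)
  then have "\<exists>e. e \<in> A2 \<and> (\<forall>f\<in>A2. (\<lambda>k. bip f (coh v k)) sums bip f e)"
    using summable_sums[OF sm] by (intro exI[of _ e]) auto
  from someI_ex[OF this] show "coherent v \<in> A2" "f \<in> A2 ==> (\<lambda>k. bip f (coh v k)) sums bip f (coherent v)"
    unfolding coherent_def by blast+
qed

lemma coherent_pointwise: "(\<lambda>k. coh v k c z) sums coherent v c z"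
proof -
  have val: "cnj (bip (kern c z) f) = f c z" if "f \<in> A2" for f
    using kern(2)[OF that, of c z] ip_cnj[OF kern(1)[of c z] that] by simp
  have "(\<lambda>k. cnj (bip (kern c z) (coh v k))) sums cnj (bip (kern c z) (coherent v))"
    using coherent_sums[OF kern(1)[of c z], of v] by (simp only: sums_cnj)
  then show ?thesis by (simp only: val coh_mem coherent_mem)
qed

lemma tr_coherent:
  assumes y: "y \<in> ball 0 \<epsilon>" shows "tr (coherent v) y = exp (hp y v)"
proof -
  have "(\<lambda>k. tr (coh v k) y) sums tr (coherent v) y"
    unfolding tr_def by (rule sums_divide[OF coherent_pointwise])
  moreover have "(\<lambda>k. tr (coh v k) y) sums exp (hp y v)"
    using exp_converges[of "hp y v"] by (simp only: tr_coh[OF y]) (simp add: scaleR_conv_of_real divide_inverse mult.commute)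
  ultimately show ?thesis by (rule sums_unique2)
qed

lemma bip_coherent: "bip (coherent y) (coherent x) = exp (hp x y)"
proof -
  have "(\<lambda>k. bip (coherent y) (coh x k)) sums exp (hp x y)"
    using exp_converges[of "hp x y"] bip_coh_exp[OF coherent_mem, of y 1 y x]
    by (simp add: tr_coherent scaleR_conv_of_real divide_inverse mult.commute del: mem_ball mem_ball_0)
  then show ?thesis using coherent_sums[OF coherent_mem] sums_unique2 by blast
qed

lemma bip_coherent_near:
  assumes f: "f \<in> A2" and y: "y \<in> ball 0 \<epsilon>" shows "bip f (coherent y) = tr f y"
proof -
  define R where "R = (if y = 0 then 2 else \<epsilon> / norm y)"
  have R: "1 < R" using y by (simp add: R_def)
  have sub: "ball 0 R \<subseteq> {\<zeta>. \<zeta> *s y \<in> ball 0 \<epsilon>}"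
    using eps by (auto simp: R_def norm_vector_scale_complex pos_less_divide_eq split: if_splits)
  have "(\<lambda>k. (deriv ^^ k) (\<lambda>\<zeta>. tr f (\<zeta> *s y)) 0 / fact k * (1 - 0) ^ k) sums tr f (1 *s y)"
    by (rule holomorphic_power_series[OF holomorphic_on_subset[OF tr_line_holo[OF f] sub]]) (use R in simp)
  then have "(\<lambda>k. bip f (coh y k)) sums tr f y" by (simp add: bip_coh[OF f])
  then show ?thesis using coherent_sums[OF f] sums_unique2 by blast
qed

lemma bip_coherent_entire:
  assumes f: "f \<in> A2" shows "(\<lambda>\<eta>. bip f (coherent (\<eta> *s v))) holomorphic_on UNIV"
proof -
  have "(\<lambda>k. bip f (coh v k) * (\<eta> - 0) ^ k) sums bip f (coherent (\<eta> *s v))" for \<eta>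
    using coherent_sums[OF f, of "\<eta> *s v"] by (simp add: coh_scale ip_scale_right[OF coh_mem f] mult.commute)
  then have h: "(\<lambda>\<eta>. bip f (coherent (\<eta> *s v))) holomorphic_on ball 0 R" for R
    by (rule power_series_holomorphic)
  have "(\<lambda>\<eta>. bip f (coherent (\<eta> *s v))) field_differentiable (at \<eta>)" for \<eta>
    by (rule holomorphic_on_imp_differentiable_at[OF h[of "cmod \<eta> + 1"] open_ball]) simp
  then show ?thesis by (simp add: holomorphic_on_def)
qed

lemma coherent_total:
  assumes f: "f \<in> A2" and z: "\<And>y. bip f (coherent y) = 0" shows "f = zero_form"
proof (rule A2_eqI[OF f zero_mem])
  show "tr f y = tr zero_form y" if "y \<in> ball 0 \<epsilon>" for y
    using bip_coherent_near[OF f that] z[of y] by (simp add: tr_def)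
qed

definition vac :: "('a, 'n) form" where
  "vac = coherent 0"

lemma vac_mem: "vac \<in> A2" by (simp add: vac_def coherent_mem)

lemma tr_vac: "y \<in> ball 0 \<epsilon> ==> tr vac y = 1"
  by (simp add: vac_def tr_coherent del: mem_ball mem_ball_0)

lemma coh_relation:
  assumes c: "c \<in> A" "z \<in> chart_image c"
  shows "coh v k c z * vac c z ^ k * fact k = vac c z * coh v 1 c z ^ k"
proof -
  let ?h = "\<lambda>c z. coh v k c z * vac c z ^ k * fact k - vac c z * coh v 1 c z ^ k"
  have fh: "holomorphic_Cn_on (f d) (chart_image d)" if "d \<in> A" "f \<in> A2" for d f
    using formD(1)[OF A2_holomorphic[OF that(2)] that(1)] .
  have "?h c z = 0"
  proof (rule section_identity[OF _ _ c0 \<gamma>_open _ \<gamma>_chart _ c, where f = ?h])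
    show "holomorphic_Cn_on (?h d) (chart_image d)" if "d \<in> A" for d
      by (intro holomorphic_Cn_diff(1) holomorphic_Cn_mult(1) holomorphic_Cn_power holomorphic_Cn_const
          fh[OF that] coh_mem vac_mem chart_domain(2)[OF that])
    show "?h d (snd d x) = 0" if d: "d \<in> A" "x \<in> fst d" "e \<in> A" "x \<in> fst e" and h: "?h e (snd e x) = 0" for d e x
    proof -
      have tf: "f d (snd d x) = det (complex_jacobian (transition d e) (snd d x)) * f e (snd e x)" if "f \<in> A2" for f
        by (rule formD(2)[OF A2_holomorphic[OF that] d(1,3,2,4)])
      have "?h d (snd d x) = det (complex_jacobian (transition d e) (snd d x)) ^ Suc k * ?h e (snd e x)"
        unfolding tf[OF coh_mem] tf[OF vac_mem] by (simp add: power_mult_distrib algebra_simps)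
      then show ?thesis unfolding h by simp
    qed
    show "\<gamma> ` ball 0 \<epsilon> \<noteq> {}" using eps by simp
    show "?h c0 w = 0" if w: "w \<in> \<gamma> ` ball 0 \<epsilon>" for w
    proof -
      from w obtain y where y: "y \<in> ball 0 \<epsilon>" "w = \<gamma> y" by (rule imageE)
      have ev: "f c0 w = \<sigma> y * tr f y" for f using \<sigma>_nonzero[OF y(1)] by (simp add: tr_def y(2))
      show ?thesis unfolding ev tr_coh[OF y(1)] tr_vac[OF y(1)] by (simp add: power_mult_distrib)
    qed
  qed
  then show ?thesis by simp
qed

text \<open>
  At a zero of the vacuum form all \<open>coh v k\<close> would vanish, hence all coherent states, which span;
  this contradicts the absence of base points.
\<close>

lemma vac_nonzero:
  assumes c: "c \<in> A" and z: "z \<in> chart_image c"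
  shows "vac c z \<noteq> 0"
proof
  assume v0: "vac c z = 0"
  obtain r where r: "r > 0" "ball z r \<subseteq> chart_image c" by (rule openE[OF chart_domain(2)[OF c] z])
  have fh: "holomorphic_Cn_on (f c) (ball z r)" if "f \<in> A2" for f
    using holomorphic_Cn_subset[OF formD(1)[OF A2_holomorphic[OF that] c] r(2)] .
  have "\<exists>w\<in>ball z r. vac c w \<noteq> 0"
  proof (rule ccontr)
    assume "\<not> (\<exists>w\<in>ball z r. vac c w \<noteq> 0)"
    then have "vac = zero_form" by (intro form_identity[OF A2_holomorphic[OF vac_mem] c open_ball _ r(2)]) (use r(1) in auto)
    moreover have "tr vac 0 = 1" using eps by (simp add: tr_vac)
    ultimately show False by (simp add: tr_def)
  qed
  then obtain w where w: "w \<in> ball z r" "vac c w \<noteq> 0" by blast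
  let ?D = "{\<zeta>. z + \<zeta> *s (w - z) \<in> ball z r}"
  have lh: "(\<lambda>\<zeta>. f c (z + \<zeta> *s (w - z))) holomorphic_on ?D" if "f \<in> A2" for f
    by (rule holomorphic_on_line[OF fh[OF that] open_ball])
  have "coh v k c z = 0" for v k
  proof -
    have "(\<lambda>k \<zeta>. coh v k c (z + \<zeta> *s (w - z))) k 0 = 0"
    proof (rule exponential_family_zero[OF lh[OF vac_mem] lh[OF coh_mem] open_line_vimage[OF open_ball]
          convex_connected[OF convex_line_vimage[OF convex_ball]]])
      show "1 \<in> ?D" using w by simp
      show "coh v k c (z + \<zeta> *s (w - z)) * vac c (z + \<zeta> *s (w - z)) ^ k * fact k =
          vac c (z + \<zeta> *s (w - z)) * coh v 1 c (z + \<zeta> *s (w - z)) ^ k" if "\<zeta> \<in> ?D" for \<zeta> k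
        by (rule coh_relation[OF c]) (use that r(2) in blast)
    qed (use r w v0 in simp_all)
    then show ?thesis by simp
  qed
  then have "coherent y c z = 0" for y
    using coherent_pointwise[of y c z] by (simp add: sums_iff)
  then have "bip (coherent y) (kern c z) = 0" for y using kern(2)[OF coherent_mem] by simp
  then have "bip (kern c z) (coherent y) = 0" for y
    using ip_cnj[OF coherent_mem kern(1)[of c z], of y] by simp
  then have "kern c z = zero_form" by (rule coherent_total[OF kern(1)])
  then have "f c z = 0" if "f \<in> A2" for f
    using kern(2)[OF that, of c z] ip_cnj[OF kern(1)[of c z] that] ip_zero[OF that] by simp
  then show False using bpf c z unfolding base_point_free_def by blast
qed

text \<open>The coordinates of the Fock space as global functions on the manifold.\<close>

definition dev :: "('a, 'n) chart \<Rightarrow> complex ^ 'n \<Rightarrow> complex ^ 'n" where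
  "dev c z = (\<chi> i. coh (axis i 1) 1 c z / vac c z)"

lemma dev_holo: "c \<in> A ==> holomorphic_Cn_on (\<lambda>z. dev c z $ i) (chart_image c)"
  unfolding dev_def vec_lambda_beta
  by (intro holomorphic_Cn_divide formD(1) A2_holomorphic coh_mem vac_mem chart_domain(2) vac_nonzero)

lemma dev_invariant:
  assumes "c \<in> A" "d \<in> A" "x \<in> fst c" "x \<in> fst d"
  shows "dev c (snd c x) = dev d (snd d x)"
proof -
  have "det (complex_jacobian (transition c d) (snd c x)) \<noteq> 0"
    using assms by (intro transition_det_nonzero) (auto simp: overlap_def)
  then show ?thesis
    using formD(2)[OF A2_holomorphic[OF coh_mem] assms] formD(2)[OF A2_holomorphic[OF vac_mem] assms]
    by (simp add: dev_def vec_eq_iff)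
qed

lemma dev_near:
  assumes y: "y \<in> ball 0 \<epsilon>" shows "dev c0 (\<gamma> y) = y"
proof -
  have ev: "f c0 (\<gamma> y) = \<sigma> y * tr f y" for f using \<sigma>_nonzero[OF y] by (simp add: tr_def)
  have "coh (axis i 1) 1 c0 (\<gamma> y) = \<sigma> y * y $ i" "vac c0 (\<gamma> y) = \<sigma> y" for i
    by (simp_all only: ev tr_coh[OF y] tr_vac[OF y] hp_axis power_one_right fact_1 div_by_1 mult_1_right)
  then show ?thesis
    using \<sigma>_nonzero[OF y] by (simp add: dev_def vec_eq_iff)
qed

lemma coherent_formula:
  assumes c: "c \<in> A" "z \<in> chart_image c"
  shows "coherent v c z = vac c z * exp (hp (dev c z) v)"
proof -
  have "coh v 1 = form_comb UNIV (\<lambda>i. cnj (v $ i)) (\<lambda>i. coh (axis i 1) 1)"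
  proof (rule A2_eqI[OF coh_mem comb_mem[OF coh_mem]])
    fix y :: "complex ^ 'n" assume y: "y \<in> ball 0 \<epsilon>"
    have "tr (form_comb UNIV (\<lambda>i. cnj (v $ i)) (\<lambda>i. coh (axis i 1) 1)) y = (\<Sum>i\<in>UNIV. cnj (v $ i) * tr (coh (axis i 1) 1) y)"
      by (simp add: tr_def sum_divide_distrib)
    also have "\<dots> = tr (coh v 1) y"
      unfolding tr_coh[OF y] by (simp add: hp_axis) (simp add: hp_def mult.commute)
    finally show "tr (coh v 1) y = tr (form_comb UNIV (\<lambda>i. cnj (v $ i)) (\<lambda>i. coh (axis i 1) 1)) y" ..
  qed
  then have "coh v 1 c z = (\<Sum>i\<in>UNIV. cnj (v $ i) * coh (axis i 1) 1 c z)" by (rule fun_cong[OF fun_cong])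
  then have h: "coh v 1 c z = vac c z * hp (dev c z) v"
    using vac_nonzero[OF c] by (simp add: hp_def dev_def sum_distrib_left mult.commute)
  have "coh v k c z = vac c z * (hp (dev c z) v ^ k / fact k)" for k
    using coh_relation[OF c, of v k] vac_nonzero[OF c] unfolding h by (simp add: power_mult_distrib field_simps)
  then have "(\<lambda>k. coh v k c z) sums (vac c z * exp (hp (dev c z) v))"
    using sums_mult[OF exp_converges[of "hp (dev c z) v"], of "vac c z"]
    by (simp add: scaleR_conv_of_real divide_inverse mult_ac)
  then show ?thesis using coherent_pointwise sums_unique2 by blast
qed

definition jac :: "('a, 'n) chart \<Rightarrow> complex ^ 'n \<Rightarrow> complex" where
  "jac c z = det (complex_jacobian (dev c) z)"

text \<open>
  A vector annihilated by the derivative of \<open>dev\<close> is not separated: along it every coherent state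
  has the same logarithmic derivative as \<open>vac\<close>, and coherent states span.
\<close>

lemma jac_nonzero:
  assumes c: "c \<in> A" and z: "z \<in> chart_image c"
  shows "jac c z \<noteq> 0"
proof
  assume "jac c z = 0"
  then obtain X where X: "X \<noteq> 0" "complex_jacobian (dev c) z *v X = 0"
    unfolding jac_def using invertible_det_nz[of "complex_jacobian (dev c) z"]
      matrix_left_invertible_ker[of "complex_jacobian (dev c) z"] invertible_left_inverse by blast
  have o: "open (chart_image c)" by (rule chart_domain(2)[OF c])
  have vh: "holomorphic_Cn_on (vac c) (chart_image c)" by (rule formD(1)[OF A2_holomorphic[OF vac_mem] c])
  define \<mu> where "\<mu> = Cn_derivative (vac c) z X / vac c z"
  obtain e where e: "e \<in> A2" "\<And>f. f \<in> A2 ==> bip f e = Cn_derivative (f c) z X"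
    using derivative_functional[OF c z, where X = X] by metis
  define q where "q = form_diff e (form_scale (cnj \<mu>) (kern c z))"
  have q: "q \<in> A2" unfolding q_def by (rule diff_mem[OF e(1) scale_mem[OF kern(1)]])
  have bq: "bip f q = Cn_derivative (f c) z X - \<mu> * f c z" if f: "f \<in> A2" for f
    unfolding q_def ip_diff_right[OF e(1) scale_mem[OF kern(1)] f] ip_scale_right[OF kern(1) f] kern(2)[OF f] e(2)[OF f] by simp
  have "bip (coherent v) q = 0" for v
  proof -
    let ?g = "\<lambda>z. hp (dev c z) v"
    have t: "holomorphic_Cn_on (\<lambda>z. cnj (v $ i) * dev c z $ i) (chart_image c)" for i
      by (rule holomorphic_Cn_cmult(1)[OF dev_holo[OF c] o])
    have g_eq: "?g = (\<lambda>z. \<Sum>i\<in>UNIV. cnj (v $ i) * dev c z $ i)" by (simp add: hp_def mult.commute)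
    have gh: "holomorphic_Cn_on ?g (chart_image c)" unfolding g_eq by (rule holomorphic_Cn_sum'(1)[OF t o])
    have gd: "Cn_derivative ?g z X = 0"
    proof -
      have "Cn_derivative ?g z X = (\<Sum>j\<in>UNIV. X $ j * (\<Sum>i\<in>UNIV. cnj (v $ i) * wirtinger j (\<lambda>z. dev c z $ i) z))"
        unfolding Cn_derivative_def g_eq holomorphic_Cn_sum'(2)[OF t o z] holomorphic_Cn_cmult(2)[OF dev_holo[OF c] o z] ..
      also have "\<dots> = (\<Sum>i\<in>UNIV. cnj (v $ i) * (complex_jacobian (dev c) z *v X) $ i)"
        by (simp add: matrix_vector_mult_def complex_jacobian_def sum_distrib_left) (subst sum.swap, simp add: mult_ac)
      finally show ?thesis by (simp add: X(2))
    qed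
    have "Cn_derivative (coherent v c) z X = (\<Sum>i\<in>UNIV. X $ i * wirtinger i (\<lambda>z. vac c z * exp (?g z)) z)"
      unfolding Cn_derivative_def
      by (intro sum.cong refl arg_cong2[where f = "(*)"] wirtinger_cong(1)[OF o z coherent_formula[OF c]])
    also have "\<dots> = vac c z * exp (?g z) * Cn_derivative ?g z X + exp (?g z) * Cn_derivative (vac c) z X"
      unfolding holomorphic_Cn_mult(2)[OF vh holomorphic_Cn_exp(1)[OF gh o] o z] holomorphic_Cn_exp(2)[OF gh o z]
      by (simp add: Cn_derivative_def sum_distrib_left sum.distrib algebra_simps)
    also have "\<dots> = \<mu> * coherent v c z"
      using vac_nonzero[OF c z] by (simp add: gd \<mu>_def coherent_formula[OF c z])
    finally show ?thesis by (simp add: bq[OF coherent_mem])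
  qed
  then have "bip q (coherent v) = 0" for v using ip_cnj[OF coherent_mem q, of v] by simp
  then have q0: "q = zero_form" by (rule coherent_total[OF q])
  obtain f where f: "f \<in> A2" "f c z = 0" "Cn_derivative (f c) z X \<noteq> 0"
    using sep c z X(1) unfolding separates_holomorphic_directions_def Cn_derivative_def by blast
  have "bip f q = 0" unfolding q0 using ip_cnj[OF zero_mem f(1)] ip_zero[OF f(1)] by simp
  then show False using bq[OF f(1)] f(2,3) by simp
qed

lemma jac_holo: "c \<in> A ==> holomorphic_Cn_on (jac c) (chart_image c)"
  unfolding jac_def[abs_def]
  by (rule holo_matrix_det)
    (auto simp: holo_matrix_on_def complex_jacobian_def intro!: holomorphic_Cn_wirtinger dev_holo chart_domain(2))

text \<open>
  The quotient of a coherent state by the Jacobian determinant of \<open>dev\<close> is a function.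
\<close>

definition quot :: "complex ^ 'n \<Rightarrow> ('a, 'n) chart \<Rightarrow> complex ^ 'n \<Rightarrow> complex" where
  "quot y c z = coherent y c z / jac c z"

lemma quot_holo: "c \<in> A ==> holomorphic_Cn_on (quot y c) (chart_image c)"
  unfolding quot_def[abs_def]
  by (intro holomorphic_Cn_divide formD(1) A2_holomorphic coherent_mem jac_holo chart_domain(2) jac_nonzero)

lemma quot_invariant:
  assumes x: "c \<in> A" "d \<in> A" "x \<in> fst c" "x \<in> fst d"
  shows "quot y c (snd c x) = quot y d (snd d x)"
proof -
  have m: "snd c x \<in> overlap c d" using x by (auto simp: overlap_def)
  have "complex_jacobian (dev c) (snd c x) = complex_jacobian (\<lambda>z. dev d (transition c d z)) (snd c x)"
  proof (rule complex_jacobian_cong[OF overlap_open[OF x(1,2)] m])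
    fix w assume "w \<in> overlap c d"
    then obtain y where "y \<in> fst c" "y \<in> fst d" "w = snd c y" unfolding overlap_def by blast
    then show "dev c w = dev d (transition c d w)" using dev_invariant[OF x(1,2)] transition_snd[OF x(1)] by simp
  qed
  also have "\<dots> = complex_jacobian (dev d) (transition c d (snd c x)) ** complex_jacobian (transition c d) (snd c x)"
    by (rule complex_jacobian_compose[OF transition_holomorphic[OF x(1,2)] overlap_open[OF x(1,2)] dev_holo[OF x(2)]
          chart_domain(2)[OF x(2)] _ m]) (use transition_image[OF x(1), of d] overlap_subset in blast)
  finally have "jac c (snd c x) = det (complex_jacobian (transition c d) (snd c x)) * jac d (snd d x)"
    using x by (simp add: jac_def det_mul)
  then show ?thesis
    using formD(2)[OF A2_holomorphic[OF coherent_mem] x] transition_det_nonzero[OF x(1,2) m] by (simp add: quot_def)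
qed

end

section \<open>A lattice of characters and comparison of measures on cubes\<close>

lemma half_power_sum:
  assumes "finite S" "inj_on h S"
  shows "(\<Sum>m\<in>S. (1 / 2 :: real) ^ h m) \<le> 2"
proof -
  have "(\<Sum>m\<in>S. (1 / 2 :: real) ^ h m) = (\<Sum>t\<in>h ` S. (1 / 2) ^ t)"
    using sum.reindex[OF assms(2), of "\<lambda>t. (1 / 2 :: real) ^ t"] by simp
  also have "\<dots> \<le> (\<Sum>t. (1 / 2) ^ t)"
    by (rule sum_le_suminf) (use assms(1) in \<open>auto intro: summable_geometric\<close>)
  also have "\<dots> = 2" by (subst suminf_geometric) auto
  finally show ?thesis .
qed

lemma gauss_sum: "(\<Sum>m<N. exp (- (real j - real m)\<^sup>2)) \<le> 4"
proof -
  have e: "exp (- (real t)\<^sup>2) \<le> (1 / 2) ^ t" for t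
  proof -
    have "real t \<le> (real t)\<^sup>2" by (cases "t = 0") (auto simp: power2_eq_square)
    then have "exp (- (real t)\<^sup>2) \<le> exp (real t * (- 1))" by simp
    also have "\<dots> = exp (- 1) ^ t" by (rule exp_of_nat_mult)
    also have "\<dots> \<le> (1 / 2) ^ t"
      using exp_ge_add_one_self[of 1] by (intro power_mono) (auto simp: exp_minus field_simps)
    finally show ?thesis .
  qed
  have "(\<Sum>m<N. exp (- (real j - real m)\<^sup>2)) \<le> (\<Sum>m<N. if m < j then (1 / 2) ^ (j - m) else (1 / 2) ^ (m - j))"
  proof (rule sum_mono)
    fix m
    show "exp (- (real j - real m)\<^sup>2) \<le> (if m < j then (1 / 2) ^ (j - m) else (1 / 2) ^ (m - j))"
      using e[of "j - m"] e[of "m - j"] by (auto simp: of_nat_diff power2_commute)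
  qed
  also have "\<dots> = (\<Sum>m\<in>{..<N} \<inter> {m. m < j}. (1 / 2) ^ (j - m)) + (\<Sum>m\<in>{..<N} \<inter> - {m. m < j}. (1 / 2) ^ (m - j))"
    by (rule sum.If_cases) simp
  also have "\<dots> \<le> 2 + 2"
    by (intro add_mono half_power_sum) (auto simp: inj_on_def)
  finally show ?thesis by simp
qed

definition grid :: "nat \<Rightarrow> complex set" where
  "grid N = (\<lambda>(m, k). Complex (real m) (real k)) ` ({..<N} \<times> {..<N})"

definition lattice :: "nat \<Rightarrow> (complex ^ 'n::finite) set" where
  "lattice N = {a. \<forall>i. a $ i \<in> grid N}"

lemma sum_grid: "sum f (grid N) = (\<Sum>m<N. \<Sum>k<N. f (Complex (real m) (real k)))"
proof -
  have "inj_on (\<lambda>(m, k). Complex (real m) (real k)) ({..<N} \<times> {..<N})" by (auto simp: inj_on_def)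
  from sum.reindex[OF this, of f] show ?thesis
    unfolding grid_def by (simp add: sum.cartesian_product case_prod_unfold comp_def)
qed

lemma finite_grid: "finite (grid N)"
  by (simp add: grid_def)

lemma card_grid: "card (grid N) = N * N"
  using sum_grid[of "\<lambda>_. 1 :: nat" N] by simp

lemma sum_lattice:
  fixes f :: "'n::finite \<Rightarrow> complex \<Rightarrow> 'b::comm_semiring_1"
  shows "(\<Sum>a\<in>lattice N. \<Prod>i\<in>UNIV. f i (a $ i)) = (\<Prod>i\<in>UNIV. \<Sum>g\<in>grid N. f i g)"
  unfolding lattice_def prod_sum_PiE[OF finite finite_grid]
  by (rule sum.reindex_bij_witness[of _ vec_lambda vec_nth]) (auto simp: PiE_def extensional_def Pi_def)

lemma card_lattice: "card (lattice N :: (complex ^ 'n::finite) set) = (N * N) ^ CARD('n)"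
  using sum_lattice[of "\<lambda>(_ :: 'n) _. 1 :: nat" N] by (simp add: card_grid)

lemma norm_vec_square: "(norm (x :: complex ^ 'n::finite))\<^sup>2 = (\<Sum>i\<in>UNIV. (cmod (x $ i))\<^sup>2)"
  by (simp add: norm_vec_def L2_set_def sum_nonneg)

text \<open>
  The sum factors over the real coordinates; the bound does not depend on the size of the lattice.
\<close>

lemma lattice_gauss_sum:
  fixes a :: "complex ^ 'n::finite"
  assumes a: "a \<in> lattice N"
  shows "(\<Sum>b\<in>lattice N. exp (- (norm (a - b))\<^sup>2)) \<le> 16 ^ CARD('n)"
proof -
  have row: "(\<Sum>g\<in>grid N. exp (- (cmod (\<alpha> - g))\<^sup>2)) \<le> 16" if \<alpha>: "\<alpha> \<in> grid N" for \<alpha>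
  proof -
    obtain r s where rs: "\<alpha> = Complex (real r) (real s)" using \<alpha> by (auto simp: grid_def)
    have "(\<Sum>g\<in>grid N. exp (- (cmod (\<alpha> - g))\<^sup>2)) = (\<Sum>m<N. \<Sum>k<N. exp (- (real r - real m)\<^sup>2) * exp (- (real s - real k)\<^sup>2))"
      unfolding sum_grid rs by (simp add: cmod_power2 flip: exp_add)
    also have "\<dots> = (\<Sum>m<N. exp (- (real r - real m)\<^sup>2)) * (\<Sum>k<N. exp (- (real s - real k)\<^sup>2))"
      by (simp only: sum_product)
    also have "\<dots> \<le> 4 * 4" by (intro mult_mono gauss_sum sum_nonneg) auto
    finally show ?thesis by simp
  qed
  have "(\<Sum>b\<in>lattice N. exp (- (norm (a - b))\<^sup>2)) = (\<Sum>b\<in>lattice N. \<Prod>i\<in>UNIV. exp (- (cmod (a $ i - b $ i))\<^sup>2))"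
    by (simp add: norm_vec_square exp_sum flip: sum_negf)
  also have "\<dots> = (\<Prod>i\<in>UNIV. \<Sum>g\<in>grid N. exp (- (cmod (a $ i - g))\<^sup>2))" by (rule sum_lattice)
  also have "\<dots> \<le> (\<Prod>i\<in>(UNIV :: 'n set). 16)"
    by (intro prod_mono conjI sum_nonneg row) (use a in \<open>auto simp: lattice_def\<close>)
  finally show ?thesis by simp
qed

lemma cos_ge_half: "\<bar>\<theta>\<bar> \<le> 1 ==> 1 / 2 \<le> cos (\<theta> :: real)"
proof -
  assume "\<bar>\<theta>\<bar> \<le> 1"
  then have "\<bar>sin (\<theta> / 2)\<bar> \<le> 1 / 2" using abs_sin_x_le_abs_x[of "\<theta> / 2"] by linarith
  then have "(sin (\<theta> / 2))\<^sup>2 \<le> (1 / 2)\<^sup>2" by (metis power2_abs power_mono abs_ge_zero)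
  then show ?thesis using cos_double_sin[of "\<theta> / 2"] by (simp add: power2_eq_square)
qed

text \<open>
  An open set containing \<open>S\<close> has a countable family of nonoverlapping small cubes covering
  \<open>S\<close>, and the volumes of these add up to at most the volume of the open set.
\<close>

lemma measure_le_of_cubes:
  fixes \<nu> :: "'a::euclidean_space measure"
  assumes sets: "sets \<nu> = sets borel" and C: "C \<ge> 0" and \<rho>: "\<rho> > 0"
    and cube: "\<And>u v \<sigma>. 0 < \<sigma> ==> \<sigma> \<le> \<rho> ==> (\<forall>i\<in>Basis. v \<bullet> i - u \<bullet> i = \<sigma>) ==> emeasure \<nu> (cbox u v) \<le> ennreal (C * \<sigma> ^ DIM('a))"
    and V: "open V" "S \<subseteq> V" and S: "bounded S"
  shows "\<exists>U\<in>sets borel. S \<subseteq> U \<and> emeasure \<nu> U \<le> ennreal C * emeasure lborel V"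
proof -
  obtain R where R: "R > 0" "\<And>x. x \<in> S ==> norm x \<le> R" using S by (auto simp: bounded_pos)
  define b :: 'a where "b = R *\<^sub>R One"
  have bi: "b \<bullet> i = R" if "i \<in> Basis" for i using that by (simp add: b_def)
  have sub: "S \<subseteq> cbox (- b) b"
  proof
    fix x assume x: "x \<in> S"
    have "- b \<bullet> i \<le> x \<bullet> i \<and> x \<bullet> i \<le> b \<bullet> i" if "i \<in> Basis" for i
    proof -
      have "\<bar>x \<bullet> i\<bar> \<le> R" using Basis_le_norm[OF that, of x] R(2)[OF x] by linarith
      then show ?thesis by (auto simp: bi[OF that] abs_le_iff)
    qed
    then show "x \<in> cbox (- b) b" unfolding mem_box by (rule ballI)
  qed
  have ne: "box (- b) b \<noteq> {}" using R(1) by (auto simp: box_ne_empty bi)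
  define g where "g x = (if x \<in> V then V \<inter> ball x (\<rho> / 2) else ball x 1)" for x
  have gg: "gauge g" using V(1) \<rho> by (auto simp: gauge_def g_def)
  obtain D where D1: "countable D" and "\<Union>D \<subseteq> cbox (- b) b"
    and D2: "\<And>K. K \<in> D ==> interior K \<noteq> {} \<and> (\<exists>c d. K = cbox c d)"
    and D3: "pairwise (\<lambda>A B. interior A \<inter> interior B = {}) D"
    and D4: "\<And>K. K \<in> D ==> \<exists>x \<in> S \<inter> K. K \<subseteq> g x"
    and D5: "\<And>u v. cbox u v \<in> D ==> \<exists>n. \<forall>i \<in> Basis. v \<bullet> i - u \<bullet> i = (b \<bullet> i - (- b) \<bullet> i) / 2^n"
    and D6: "S \<subseteq> \<Union>D"
  proof (rule covering_lemma[OF sub ne gg])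
    fix E assume "countable E" "\<Union>E \<subseteq> cbox (- b) b"
      "\<And>K. K \<in> E ==> interior K \<noteq> {} \<and> (\<exists>c d. K = cbox c d)"
      "pairwise (\<lambda>A B. interior A \<inter> interior B = {}) E"
      "\<And>K. K \<in> E ==> \<exists>x \<in> S \<inter> K. K \<subseteq> g x"
      "\<And>u v. cbox u v \<in> E ==> \<exists>n. \<forall>i \<in> Basis. v \<bullet> i - u \<bullet> i = (b \<bullet> i - (- b) \<bullet> i) / 2^n"
      "S \<subseteq> \<Union>E"
    then show thesis by (rule that)
  qed
  have small: "K \<subseteq> V \<and> (\<exists>x. K \<subseteq> ball x (\<rho> / 2))" if KD: "K \<in> D" for K
  proof -
    obtain x where x: "x \<in> S" "K \<subseteq> g x" using D4[OF KD] by blast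
    have "x \<in> V" using V(2) x(1) by (rule subsetD)
    then have "K \<subseteq> V \<inter> ball x (\<rho> / 2)" using x(2) by (simp add: g_def)
    then show ?thesis by (intro conjI exI[of _ x]) auto
  qed
  note KV = small[THEN conjunct1] and Kb = small[THEN conjunct2]
  have borelK: "K \<in> sets borel" if "K \<in> D" for K using D2[OF that] by auto
  have ind: "indicator K \<in> borel_measurable \<nu>" if "K \<in> D" for K
    using borelK[OF that] sets by simp
  have cubeK: "emeasure \<nu> K \<le> ennreal C * emeasure lborel (interior K)" if K: "K \<in> D" for K
  proof -
    obtain u v where uv: "K = cbox u v" using D2[OF K] by blast
    obtain n where n: "\<And>i. i \<in> Basis ==> v \<bullet> i - u \<bullet> i = 2 * R / 2 ^ n" using D5[of u v] K by (auto simp: uv bi)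
    let ?\<sigma> = "2 * R / 2 ^ n"
    have \<sigma>: "0 < ?\<sigma>" using R(1) by simp
    obtain x where x: "K \<subseteq> ball x (\<rho> / 2)" using Kb[OF K] by blast
    have le: "u \<bullet> i \<le> v \<bullet> i" if "i \<in> Basis" for i using n[OF that] \<sigma> by linarith
    have "u \<in> K" "v \<in> K" by (simp_all add: uv mem_box le)
    then have "dist x u < \<rho> / 2" "dist x v < \<rho> / 2" using x by auto
    then have "dist v u < \<rho>" using dist_triangle3[of v u x] by linarith
    then have duv: "norm (v - u) < \<rho>" by (simp only: dist_norm)
    obtain i0 :: 'a where i0: "i0 \<in> Basis" using nonempty_Basis by blast
    have "(v - u) \<bullet> i0 = ?\<sigma>" using n[OF i0] by (simp add: inner_diff_left)
    moreover have "\<bar>(v - u) \<bullet> i0\<bar> \<le> norm (v - u)" by (rule Basis_le_norm[OF i0])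
    ultimately have "?\<sigma> \<le> norm (v - u)" by linarith
    then have "emeasure \<nu> K \<le> ennreal (C * ?\<sigma> ^ DIM('a))"
      unfolding uv using \<sigma> duv n by (intro cube) auto
    also have "\<dots> = ennreal C * ennreal (?\<sigma> ^ DIM('a))" using C \<sigma> by (intro ennreal_mult) auto
    also have "ennreal (?\<sigma> ^ DIM('a)) = emeasure lborel (interior K)"
    proof -
      have "\<forall>i\<in>Basis. u \<bullet> i \<le> v \<bullet> i" using le by blast
      then show ?thesis using n by (simp add: uv interior_cbox emeasure_lborel_box_eq inner_diff_left)
    qed
    finally show ?thesis .
  qed
  have intb: "interior K \<in> sets lborel" if "K \<in> D" for K by simp
  have disj: "disjoint_family_on interior D" using D3 by (auto simp: disjoint_family_on_def pairwise_def)
  let ?U = "\<Union>D"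
  have Ub: "?U \<in> sets borel" using borelK D1 by (intro sets.countable_Union) auto
  have "emeasure \<nu> ?U = (\<integral>\<^sup>+x. indicator ?U x \<partial>\<nu>)" using Ub sets by simp
  also have "\<dots> \<le> (\<integral>\<^sup>+x. (\<integral>\<^sup>+K. indicator K x \<partial>count_space D) \<partial>\<nu>)"
  proof (rule nn_integral_mono)
    fix x
    show "indicator ?U x \<le> (\<integral>\<^sup>+K. indicator K x \<partial>count_space D)"
    proof (cases "x \<in> ?U")
      case True
      then obtain K where "K \<in> D" "x \<in> K" by blast
      then show ?thesis using nn_integral_ge_point[of K D "\<lambda>K. indicator K x"] True by simp
    qed simp
  qed
  also have "\<dots> = (\<integral>\<^sup>+K. (\<integral>\<^sup>+x. indicator K x \<partial>\<nu>) \<partial>count_space D)"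
    by (rule nn_integral_count_space_nn_integral[OF D1 ind])
  also have "\<dots> \<le> (\<integral>\<^sup>+K. ennreal C * emeasure lborel (interior K) \<partial>count_space D)"
    using cubeK borelK sets by (intro nn_integral_mono) simp
  also have "\<dots> = ennreal C * (\<integral>\<^sup>+K. emeasure lborel (interior K) \<partial>count_space D)"
    by (rule nn_integral_cmult) simp
  also have "(\<integral>\<^sup>+K. emeasure lborel (interior K) \<partial>count_space D) = emeasure lborel (\<Union>(interior ` D))"
    by (rule emeasure_UN_countable[OF intb D1 disj, symmetric])
  also have "\<dots> \<le> emeasure lborel V"
    using KV interior_subset V(1) by (intro emeasure_mono) auto
  finally have "emeasure \<nu> ?U \<le> ennreal C * emeasure lborel V" by (simp add: mult_left_mono)
  then show ?thesis using Ub D6 by blast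
qed

section \<open>Bounded multipliers\<close>

context fock_chart
begin

lemma hp_add_right: "hp x (y + d) = hp x y + hp x d"
  and hp_diff_right: "hp x (y - d) = hp x y - hp x d"
  and hp_diff_left: "hp (x - w) d = hp x d - hp w d"
  by (simp_all add: hp_def algebra_simps sum.distrib sum_subtractf)

definition devp :: "nat \<times> (complex ^ 'n) \<Rightarrow> complex ^ 'n" where
  "devp p = dev (cov (fst p)) (snd p)"

lemma devp_measurable: "devp \<in> borel_measurable base"
proof (rule base_measurable)
  fix k
  have comp: "(\<lambda>z. dev (cov k) z $ i) \<in> borel_measurable borel" for i
    unfolding dev_def vec_lambda_beta
    by (intro borel_measurable_divide form_borel A2_holomorphic coh_mem vac_mem)
  have "(\<lambda>z. dev (cov k) z \<bullet> b) \<in> borel_measurable borel" if b: "b \<in> Basis" for b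
  proof -
    obtain i u where "b = axis i u" using b by (auto simp: Basis_vec_def)
    then have "(\<lambda>z. dev (cov k) z \<bullet> b) = (\<lambda>z. dev (cov k) z $ i \<bullet> u)" by (simp add: inner_axis)
    then show ?thesis using comp[of i] by simp
  qed
  then show "(\<lambda>z. devp (k, z)) \<in> borel_measurable borel"
    by (simp add: devp_def borel_measurable_euclidean_space[of "\<lambda>z. dev (cov k) z"])
qed

definition chi :: "complex ^ 'n \<Rightarrow> complex ^ 'n \<Rightarrow> complex" where
  "chi a q = exp (hp q a - cnj (hp q a))"

lemma chi_cis: "chi a q = cis (2 * Im (hp q a))"
proof -
  have "hp q a - cnj (hp q a) = \<i> * of_real (2 * Im (hp q a))" by (simp add: complex_eq_iff)
  then show ?thesis by (simp add: chi_def cis_conv_exp)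
qed

lemma chi_mult: "chi a q * cnj (chi b q) = chi (a - b) q"
  by (simp add: chi_def exp_cnj hp_diff_right algebra_simps flip: exp_add)

lemma chi_diff: "chi a (q - w) = chi a q * cnj (chi a w)"
  by (simp add: chi_def exp_cnj hp_diff_left algebra_simps flip: exp_add)

lemma character_integral:
  shows "integrable base (\<lambda>p. of_real ((cmod (rep (coherent y) p))\<^sup>2) * chi d (devp p))"
    and "cmod (\<integral>p. of_real ((cmod (rep (coherent y) p))\<^sup>2) * chi d (devp p) \<partial>base) \<le> exp ((norm y)\<^sup>2) * exp (- (norm d)\<^sup>2)"
proof -
  have eq: "rep (coherent (y + d)) p * cnj (rep (coherent (y - d)) p) = of_real ((cmod (rep (coherent y) p))\<^sup>2) * chi d (devp p)" for p
  proof (cases "snd p \<in> piece (fst p)")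
    case True
    have f: "coherent x (cov (fst p)) (snd p) = vac (cov (fst p)) (snd p) * exp (hp (devp p) x)" for x
      unfolding devp_def by (rule coherent_formula[OF cover_charts]) (use True piece_subset in blast)
    have r: "rep (coherent x) p = vac (cov (fst p)) (snd p) * exp (hp (devp p) x)" for x
      using True by (simp add: rep_def f)
    define \<alpha> \<beta> where "\<alpha> = hp (devp p) y" and "\<beta> = hp (devp p) d"
    have e: "exp (\<alpha> + \<beta>) * exp (cnj \<alpha> - cnj \<beta>) = exp \<alpha> * exp (cnj \<alpha>) * exp (\<beta> - cnj \<beta>)"
      by (simp add: algebra_simps flip: exp_add)
    let ?v = "vac (cov (fst p)) (snd p)"
    have "rep (coherent (y + d)) p * cnj (rep (coherent (y - d)) p) = ?v * cnj ?v * (exp (\<alpha> + \<beta>) * exp (cnj \<alpha> - cnj \<beta>))"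
      unfolding r hp_add_right hp_diff_right \<alpha>_def[symmetric] \<beta>_def[symmetric] complex_cnj_mult exp_cnj complex_cnj_diff by (simp only: mult_ac)
    also have "\<dots> = of_real ((cmod (rep (coherent y) p))\<^sup>2) * chi d (devp p)"
      unfolding e r of_real_power of_real_cmod_square chi_def \<alpha>_def[symmetric] \<beta>_def[symmetric] complex_cnj_mult exp_cnj by (simp only: mult_ac)
    finally show ?thesis .
  qed (simp add: rep_def)
  have L2: "L2_form (coherent x)" for x using coherent_mem bergman_space_iff by blast
  show "integrable base (\<lambda>p. of_real ((cmod (rep (coherent y) p))\<^sup>2) * chi d (devp p))"
    using rep_mult_integrable[OF L2[of "y + d"] L2[of "y - d"]] by (simp only: eq)
  have "2 ^ CARD('n) * (\<integral>p. of_real ((cmod (rep (coherent y) p))\<^sup>2) * chi d (devp p) \<partial>base) = exp (hp (y - d) (y + d))"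
    using bergman_inner_eq[of "coherent (y + d)" "coherent (y - d)"] by (simp only: eq bip_coherent)
  from arg_cong[OF this, of cmod]
  have "2 ^ CARD('n) * cmod (\<integral>p. of_real ((cmod (rep (coherent y) p))\<^sup>2) * chi d (devp p) \<partial>base) = cmod (exp (hp (y - d) (y + d)))"
    by (simp only: norm_mult norm_power norm_numeral)
  also have "\<dots> = exp ((norm y)\<^sup>2 - (norm d)\<^sup>2)"
  proof -
    have "hp (y - d) (y + d) = hp y y - hp d d + (hp y d - cnj (hp y d))"
      by (simp add: hp_add_right hp_diff_left cnj_hp)
    then show ?thesis by (simp add: hp_self)
  qed
  finally have *: "2 ^ CARD('n) * cmod (\<integral>p. of_real ((cmod (rep (coherent y) p))\<^sup>2) * chi d (devp p) \<partial>base) = exp ((norm y)\<^sup>2 - (norm d)\<^sup>2)" .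
  have "1 * cmod (\<integral>p. of_real ((cmod (rep (coherent y) p))\<^sup>2) * chi d (devp p) \<partial>base)
      \<le> 2 ^ CARD('n) * cmod (\<integral>p. of_real ((cmod (rep (coherent y) p))\<^sup>2) * chi d (devp p) \<partial>base)"
    by (intro mult_right_mono) auto
  then show "cmod (\<integral>p. of_real ((cmod (rep (coherent y) p))\<^sup>2) * chi d (devp p) \<partial>base) \<le> exp ((norm y)\<^sup>2) * exp (- (norm d)\<^sup>2)"
    unfolding * by (simp add: exp_diff exp_minus divide_inverse)
qed

definition tsum :: "nat \<Rightarrow> complex ^ 'n \<Rightarrow> complex ^ 'n \<Rightarrow> complex" where
  "tsum N w q = (\<Sum>a\<in>lattice N. chi a (q - w))"

lemma trigonometric_mass:
  shows "integrable base (\<lambda>p. (cmod (rep (coherent y) p))\<^sup>2 * (cmod (tsum N w (devp p)))\<^sup>2)"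
    and "(\<integral>p. (cmod (rep (coherent y) p))\<^sup>2 * (cmod (tsum N w (devp p)))\<^sup>2 \<partial>base)
      \<le> exp ((norm y)\<^sup>2) * 16 ^ CARD('n) * (real N * real N) ^ CARD('n)"
proof -
  let ?m = "\<lambda>p. (cmod (rep (coherent y) p))\<^sup>2"
  let ?L = "lattice N :: (complex ^ 'n) set"
  have ex: "of_real (?m p * (cmod (tsum N w q))\<^sup>2) = (\<Sum>a\<in>?L. \<Sum>b\<in>?L. cnj (chi (a - b) w) * (of_real (?m p) * chi (a - b) q))" for p q
  proof -
    have "complex_of_real ((cmod (tsum N w q))\<^sup>2) = (\<Sum>a\<in>?L. \<Sum>b\<in>?L. chi (a - b) (q - w))"
      unfolding of_real_power of_real_cmod_square tsum_def by (simp add: sum_product chi_mult)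
    then show ?thesis by (simp add: chi_diff sum_distrib_left sum_distrib_right mult_ac del: of_real_power)
  qed
  have i1: "integrable base (\<lambda>p. cnj (chi (a - b) w) * (of_real (?m p) * chi (a - b) (devp p)))" for a b
    by (intro integrable_mult_right character_integral(1))
  have i2: "integrable base (\<lambda>p. \<Sum>b\<in>?L. cnj (chi (a - b) w) * (of_real (?m p) * chi (a - b) (devp p)))" for a
    by (intro Bochner_Integration.integrable_sum i1)
  have int: "integrable base (\<lambda>p. \<Sum>a\<in>?L. \<Sum>b\<in>?L. cnj (chi (a - b) w) * (of_real (?m p) * chi (a - b) (devp p)))"
    by (intro Bochner_Integration.integrable_sum i2)
  then have ci: "integrable base (\<lambda>p. complex_of_real (?m p * (cmod (tsum N w (devp p)))\<^sup>2))" by (simp only: ex)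
  then show "integrable base (\<lambda>p. ?m p * (cmod (tsum N w (devp p)))\<^sup>2)"
    using integrable_Re[OF ci] by simp
  have "complex_of_real (\<integral>p. ?m p * (cmod (tsum N w (devp p)))\<^sup>2 \<partial>base)
      = (\<integral>p. complex_of_real (?m p * (cmod (tsum N w (devp p)))\<^sup>2) \<partial>base)"
    by (rule integral_complex_of_real[symmetric])
  also have "\<dots> = (\<Sum>a\<in>?L. \<Sum>b\<in>?L. cnj (chi (a - b) w) * (\<integral>p. of_real (?m p) * chi (a - b) (devp p) \<partial>base))"
    by (simp only: ex Bochner_Integration.integral_sum i1 i2 integral_mult_right_zero)
  finally have eq: "complex_of_real (\<integral>p. ?m p * (cmod (tsum N w (devp p)))\<^sup>2 \<partial>base)
      = (\<Sum>a\<in>?L. \<Sum>b\<in>?L. cnj (chi (a - b) w) * (\<integral>p. of_real (?m p) * chi (a - b) (devp p) \<partial>base))" .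
  have "(\<integral>p. ?m p * (cmod (tsum N w (devp p)))\<^sup>2 \<partial>base)
      \<le> cmod (complex_of_real (\<integral>p. ?m p * (cmod (tsum N w (devp p)))\<^sup>2 \<partial>base))"
    by (simp only: norm_of_real abs_ge_self)
  also have "\<dots> = cmod (\<Sum>a\<in>?L. \<Sum>b\<in>?L. cnj (chi (a - b) w) * (\<integral>p. of_real (?m p) * chi (a - b) (devp p) \<partial>base))"
    by (simp only: eq)
  also have "\<dots> \<le> (\<Sum>a\<in>?L. \<Sum>b\<in>?L. exp ((norm y)\<^sup>2) * exp (- (norm (a - b))\<^sup>2))"
    by (intro order_trans[OF norm_sum] sum_mono) (use character_integral(2) in \<open>simp add: norm_mult chi_cis\<close>)
  also have "\<dots> \<le> (\<Sum>a\<in>?L. exp ((norm y)\<^sup>2) * 16 ^ CARD('n))"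
    unfolding sum_distrib_left[symmetric] by (intro sum_mono mult_left_mono lattice_gauss_sum) auto
  finally show "(\<integral>p. ?m p * (cmod (tsum N w (devp p)))\<^sup>2 \<partial>base) \<le> exp ((norm y)\<^sup>2) * 16 ^ CARD('n) * (real N * real N) ^ CARD('n)"
    by (simp add: card_lattice mult_ac)
qed

lemma tsum_lower_bound:
  fixes u v q :: "complex ^ 'n"
  assumes side: "\<forall>i\<in>Basis. v \<bullet> i - u \<bullet> i = \<delta>" and q: "q \<in> cbox u v" and N: "8 * real CARD('n) * \<delta> * real N \<le> 1"
  shows "((real N * real N) ^ CARD('n) / 2)\<^sup>2 \<le> (cmod (tsum N u q))\<^sup>2"
proof -
  have coord: "0 \<le> (q - u) \<bullet> b \<and> (q - u) \<bullet> b \<le> \<delta>" if "b \<in> Basis" for b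
  proof -
    have "u \<bullet> b \<le> q \<bullet> b" "q \<bullet> b \<le> v \<bullet> b" using q that by (auto simp: mem_box)
    moreover have "v \<bullet> b - u \<bullet> b = \<delta>" using side that by blast
    ultimately show ?thesis by (simp add: inner_diff_left)
  qed
  have qi: "cmod ((q - u) $ i) \<le> 2 * \<delta>" for i
  proof -
    have "axis i 1 \<in> (Basis :: (complex ^ 'n) set)" "axis i \<i> \<in> (Basis :: (complex ^ 'n) set)"
      by (auto simp: axis_in_Basis_iff Basis_complex_def)
    from coord[OF this(1)] coord[OF this(2)]
    have "\<bar>Re ((q - u) $ i)\<bar> \<le> \<delta>" "\<bar>Im ((q - u) $ i)\<bar> \<le> \<delta>" by (auto simp: inner_axis inner_complex_def)
    then show ?thesis using cmod_le[of "(q - u) $ i"] by linarith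
  qed
  have \<delta>: "\<delta> \<ge> 0" using qi[of undefined] norm_ge_zero[of "(q - u) $ undefined"] by linarith
  have re: "1 / 2 \<le> Re (chi a (q - u))" if a: "a \<in> lattice N" for a
  proof -
    have ai: "cmod (a $ i) \<le> 2 * real N" for i
    proof -
      have "a $ i \<in> grid N" using a by (simp add: lattice_def)
      then obtain m k where "a $ i = Complex (real m) (real k)" "m < N" "k < N" unfolding grid_def by auto
      then show ?thesis using cmod_le[of "a $ i"] by simp
    qed
    have "\<bar>Im (hp (q - u) a)\<bar> \<le> cmod (hp (q - u) a)" by (rule abs_Im_le_cmod)
    also have "\<dots> \<le> (\<Sum>i\<in>(UNIV :: 'n set). (2 * \<delta>) * (2 * real N))"
      unfolding hp_def by (intro order_trans[OF norm_sum] sum_mono) (unfold norm_mult complex_mod_cnj, intro mult_mono qi ai, use \<delta> in auto)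
    finally have "\<bar>2 * Im (hp (q - u) a)\<bar> \<le> 8 * real CARD('n) * \<delta> * real N" by (simp add: mult_ac)
    then have "\<bar>2 * Im (hp (q - u) a)\<bar> \<le> 1" using N by linarith
    from cos_ge_half[OF this] show ?thesis by (simp add: chi_cis)
  qed
  have "(real N * real N) ^ CARD('n) / 2 = (\<Sum>a\<in>(lattice N :: (complex ^ 'n) set). 1 / 2 :: real)" by (simp add: card_lattice)
  also have "\<dots> \<le> (\<Sum>a\<in>lattice N. Re (chi a (q - u)))" by (intro sum_mono re)
  also have "\<dots> = Re (tsum N u q)" by (simp add: tsum_def)
  also have "\<dots> \<le> cmod (tsum N u q)" by (rule complex_Re_le_cmod)
  finally show ?thesis by (rule power_mono) simp
qed

definition push :: "complex ^ 'n \<Rightarrow> (complex ^ 'n) measure" where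
  "push y = distr (density base (\<lambda>p. ennreal ((cmod (rep (coherent y) p))\<^sup>2))) borel devp"

lemma coherent_square_measurable: "(\<lambda>p. ennreal ((cmod (rep (coherent y) p))\<^sup>2)) \<in> borel_measurable base"
  using rep_square_measurable[OF A2_holomorphic[OF coherent_mem]] by simp

lemma emeasure_push:
  assumes "U \<in> sets borel"
  shows "emeasure (push y) U = (\<integral>\<^sup>+p. ennreal ((cmod (rep (coherent y) p))\<^sup>2) * indicator U (devp p) \<partial>base)"
proof -
  have v: "devp -` U \<inter> space base \<in> sets base" by (rule measurable_sets[OF devp_measurable assms])
  have "emeasure (push y) U = emeasure (density base (\<lambda>p. ennreal ((cmod (rep (coherent y) p))\<^sup>2))) (devp -` U \<inter> space base)"
    unfolding push_def using devp_measurable assms by (subst emeasure_distr) auto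
  also have "\<dots> = (\<integral>\<^sup>+p. ennreal ((cmod (rep (coherent y) p))\<^sup>2) * indicator (devp -` U \<inter> space base) p \<partial>base)"
    by (rule emeasure_density[OF coherent_square_measurable v])
  also have "\<dots> = (\<integral>\<^sup>+p. ennreal ((cmod (rep (coherent y) p))\<^sup>2) * indicator U (devp p) \<partial>base)"
    by (intro nn_integral_cong) (simp add: indicator_def)
  finally show ?thesis .
qed

definition mbound :: "complex ^ 'n \<Rightarrow> real" where
  "mbound y = 4 * exp ((norm y)\<^sup>2) * 16 ^ CARD('n) * (16 * real CARD('n)) ^ (2 * CARD('n))"

lemma mbound_pos: "mbound y > 0"
  by (simp add: mbound_def)

text \<open>
  Integrating the square of a sum of \<open>N\<^sup>2\<^sup>n\<close> characters that almost agree on a cube of side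
  \<open>\<delta> \<approx> 1 / N\<close>: the Gaussian decay of the cross terms leaves only the diagonal.
\<close>

lemma push_cube:
  assumes \<delta>: "0 < \<delta>" "\<delta> \<le> 1 / (16 * real CARD('n))" and side: "\<forall>i\<in>Basis. v \<bullet> i - u \<bullet> i = \<delta>"
  shows "emeasure (push y) (cbox u v) \<le> ennreal (mbound y * \<delta> ^ DIM(complex ^ 'n))"
proof -
  let ?n = "real CARD('n)" and ?m = "\<lambda>p. (cmod (rep (coherent y) p))\<^sup>2"
  have n: "?n > 0" by simp
  define N where "N = nat \<lfloor>1 / (8 * ?n * \<delta>)\<rfloor>"
  have big: "2 \<le> 1 / (8 * ?n * \<delta>)" using \<delta> n by (simp add: field_simps)
  have N1: "real N \<le> 1 / (8 * ?n * \<delta>)" unfolding N_def by (rule of_nat_floor) (use big in linarith)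
  have "1 / (8 * ?n * \<delta>) < real N + 1" unfolding N_def using big by linarith
  then have N2: "1 / (16 * ?n * \<delta>) \<le> real N" using big by (simp add: field_simps)
  have Npos: "real N > 0" using N2 \<delta>(1) n by (smt (verit) divide_pos_pos mult_pos_pos)
  have N8: "8 * ?n * \<delta> * real N \<le> 1" using N1 \<delta>(1) n by (simp add: field_simps)
  define l where "l = (real N * real N) ^ CARD('n)"
  have l: "l > 0" using Npos by (simp add: l_def)
  let ?t = "\<lambda>p. (4 / l\<^sup>2) * (?m p * (cmod (tsum N u (devp p)))\<^sup>2)"
  have "emeasure (push y) (cbox u v) = (\<integral>\<^sup>+p. ennreal (?m p) * indicator (cbox u v) (devp p) \<partial>base)"
    by (rule emeasure_push) simp
  also have "\<dots> \<le> (\<integral>\<^sup>+p. ennreal (?t p) \<partial>base)"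
  proof (rule nn_integral_mono)
    fix p
    show "ennreal (?m p) * indicator (cbox u v) (devp p) \<le> ennreal (?t p)"
    proof (cases "devp p \<in> cbox u v")
      case True
      have "l\<^sup>2 / 4 \<le> (cmod (tsum N u (devp p)))\<^sup>2"
        using tsum_lower_bound[OF side True N8] by (simp add: l_def power_divide)
      then have "1 \<le> 4 / l\<^sup>2 * (cmod (tsum N u (devp p)))\<^sup>2" using l by (simp add: field_simps)
      then have "?m p * 1 \<le> ?m p * (4 / l\<^sup>2 * (cmod (tsum N u (devp p)))\<^sup>2)" by (rule mult_left_mono) simp
      then show ?thesis using True by (simp add: mult_ac)
    qed simp
  qed
  also have "\<dots> = ennreal (\<integral>p. ?t p \<partial>base)"
    by (rule nn_integral_eq_integral) (auto intro!: integrable_mult_right trigonometric_mass(1))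
  also have "\<dots> \<le> ennreal (4 / l\<^sup>2 * (exp ((norm y)\<^sup>2) * 16 ^ CARD('n) * l))"
    using trigonometric_mass(2)[of y N u] unfolding l_def[symmetric] integral_mult_right_zero
    by (intro ennreal_leI mult_left_mono) auto
  also have "\<dots> \<le> ennreal (mbound y * \<delta> ^ DIM(complex ^ 'n))"
  proof (rule ennreal_leI)
    have "1 / real N \<le> 16 * ?n * \<delta>" using N2 Npos \<delta>(1) n by (simp add: field_simps)
    then have "(1 / real N) ^ (2 * CARD('n)) \<le> (16 * ?n * \<delta>) ^ (2 * CARD('n))" using Npos by (intro power_mono) auto
    moreover have "(1 / real N) ^ (2 * CARD('n)) = 1 / l"
      by (simp add: l_def power_mult power_divide power2_eq_square)
    ultimately have "1 / l \<le> (16 * ?n) ^ (2 * CARD('n)) * \<delta> ^ (2 * CARD('n))" by (simp add: power_mult_distrib)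
    then have "4 * exp ((norm y)\<^sup>2) * 16 ^ CARD('n) * (1 / l) \<le> 4 * exp ((norm y)\<^sup>2) * 16 ^ CARD('n) * ((16 * ?n) ^ (2 * CARD('n)) * \<delta> ^ (2 * CARD('n)))"
      by (rule mult_left_mono) simp
    moreover have "DIM(complex ^ 'n) = 2 * CARD('n)" by simp
    ultimately show "4 / l\<^sup>2 * (exp ((norm y)\<^sup>2) * 16 ^ CARD('n) * l) \<le> mbound y * \<delta> ^ DIM(complex ^ 'n)"
      using l by (simp add: mbound_def power2_eq_square field_simps)
  qed
  finally show ?thesis .
qed

text \<open>
  Only one chart of the cover is kept from the sum that defines the mass of the image measure.
\<close>

lemma push_ge:
  assumes S: "S \<in> sets borel" "S \<subseteq> piece k" and U: "U \<in> sets borel" "dev (cov k) ` S \<subseteq> U"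
  shows "(\<integral>\<^sup>+z\<in>S. ennreal ((cmod (coherent y (cov k) z))\<^sup>2) \<partial>lborel) \<le> emeasure (push y) U"
proof -
  let ?h = "\<lambda>p. ennreal ((cmod (rep (coherent y) p))\<^sup>2) * indicator U (devp p)"
  have hm: "?h \<in> borel_measurable base"
    using coherent_square_measurable[of y] devp_measurable U(1) by measurable
  have "(\<integral>\<^sup>+z\<in>S. ennreal ((cmod (coherent y (cov k) z))\<^sup>2) \<partial>lborel) \<le> (\<integral>\<^sup>+z. ?h (k, z) \<partial>lborel)"
  proof (rule nn_integral_mono)
    fix z
    show "ennreal ((cmod (coherent y (cov k) z))\<^sup>2) * indicator S z \<le> ?h (k, z)"
    proof (cases "z \<in> S")
      case True
      then have "z \<in> piece k" "dev (cov k) z \<in> U" using S(2) U(2) by blast+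
      then show ?thesis by (simp add: rep_def devp_def indicator_def)
    qed simp
  qed
  also have "\<dots> \<le> (\<Sum>k. \<integral>\<^sup>+z. ?h (k, z) \<partial>lborel)"
    using sum_le_suminf[of "\<lambda>k. \<integral>\<^sup>+z. ?h (k, z) \<partial>lborel" "{k}"] by simp
  finally show ?thesis unfolding emeasure_push[OF U(1)] nn_integral_base[OF hm] .
qed

text \<open>
  On a set where the quotient were too large, the image volume \<open>\<integral> |jac|\<^sup>2\<close> would be too small to
  carry the mass of the coherent state.
\<close>

lemma quot_bounded_piece:
  "AE z in lborel. z \<in> piece k \<longrightarrow> (cmod (coherent y (cov k) z))\<^sup>2 \<le> 2 * mbound y * (cmod (jac (cov k) z))\<^sup>2"
proof -
  let ?c = "cov k" and ?C = "mbound y"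
  let ?E = "coherent y ?c"
  have U: "open (chart_image ?c)" by (rule chart_domain(2)[OF cover_charts])
  define D where "D z = indicator (chart_image ?c) z *\<^sub>R jac ?c z" for z
  have Dm: "D \<in> borel_measurable borel" unfolding D_def
    by (rule borel_measurable_continuous_on_indicator[OF _ holomorphic_Cn_continuous[OF jac_holo[OF cover_charts]]]) (use U in auto)
  have Em: "?E \<in> borel_measurable borel" by (rule form_borel[OF A2_holomorphic[OF coherent_mem]])
  have dm: "(\<lambda>z. devp (k, z)) \<in> borel_measurable borel"
    using measurable_compose[OF measurable_Pair1'[of k "count_space UNIV" "lborel :: (complex ^ 'n) measure"] devp_measurable] by simp
  define S where "S R = piece k \<inter> {z. 2 * ?C * (cmod (D z))\<^sup>2 < (cmod (?E z))\<^sup>2} \<inter> cball 0 (real R) \<inter> {z. cmod (D z) \<le> real R} \<inter> {z. norm (devp (k, z)) \<le> real R}" for R :: nat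
  have Sb: "S R \<in> sets borel" for R
  proof -
    have "{z \<in> space borel. 2 * ?C * (cmod (D z))\<^sup>2 < (cmod (?E z))\<^sup>2} \<in> sets borel"
      by (intro borel_measurable_less borel_measurable_times borel_measurable_const borel_measurable_power
          measurable_compose[OF Dm borel_measurable_norm] measurable_compose[OF Em borel_measurable_norm])
    moreover have "{z \<in> space borel. cmod (D z) \<le> real R} \<in> sets borel"
      by (intro borel_measurable_le borel_measurable_const measurable_compose[OF Dm borel_measurable_norm])
    moreover have "{z \<in> space borel. norm (devp (k, z)) \<le> real R} \<in> sets borel"
      by (intro borel_measurable_le borel_measurable_const measurable_compose[OF dm borel_measurable_norm])
    ultimately show ?thesis unfolding S_def using piece_borel[of k] by (intro sets.Int) auto
  qed
  have SU: "S R \<subseteq> chart_image ?c" for R using piece_subset[of k] by (auto simp: S_def)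
  have DS: "D z = jac ?c z" if "z \<in> S R" for z R using that SU[of R] by (auto simp: D_def)
  have null: "AE z in lborel. z \<notin> S R" for R
  proof -
    let ?j = "\<lambda>z. ennreal ((cmod (D z))\<^sup>2) * indicator (S R) z"
    have jm: "?j \<in> borel_measurable lborel"
      using Sb[of R] Dm by measurable
    have fin: "emeasure lborel (S R) < \<infinity>"
    proof -
      have "emeasure lborel (S R) \<le> emeasure lborel (cball (0 :: complex ^ 'n) (real R))"
        by (rule emeasure_mono) (auto simp: S_def)
      then show ?thesis using emeasure_lborel_cball_finite[of "0 :: complex ^ 'n" "real R"] by (simp add: order_le_less_trans)
    qed
    have "(\<integral>\<^sup>+z. ?j z \<partial>lborel) \<le> (\<integral>\<^sup>+z. ennreal ((real R)\<^sup>2) * indicator (S R) z \<partial>lborel)"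
      by (rule nn_integral_mono) (auto simp: S_def indicator_def intro!: ennreal_leI power_mono)
    also have "\<dots> = ennreal ((real R)\<^sup>2) * emeasure lborel (S R)" using Sb by (intro nn_integral_cmult_indicator) simp
    also have "\<dots> < \<infinity>" using fin by (simp add: ennreal_mult_less_top)
    finally have "(\<integral>\<^sup>+z. ?j z \<partial>lborel) < \<infinity>" .
    then obtain I where I: "I \<ge> 0" "(\<integral>\<^sup>+z. ?j z \<partial>lborel) = ennreal I"
      by (cases "\<integral>\<^sup>+z. ?j z \<partial>lborel") auto
    have "I \<le> e" if e: "e > 0" for e
    proof -
      have J: "(\<integral>\<^sup>+z\<in>S R. ennreal ((cmod (det (complex_jacobian (dev ?c) z)))\<^sup>2) \<partial>lborel) \<le> ennreal I"
        unfolding I(2)[symmetric] by (rule nn_integral_mono) (auto simp: indicator_def DS jac_def)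
      obtain V where V: "open V" "dev ?c ` S R \<subseteq> V" "emeasure lborel V \<le> ennreal (I + e)"
        using holomorphic_image_cover[OF dev_holo[OF cover_charts] U SU Sb e fin J I(1)] by blast
      have "bounded (dev ?c ` S R)"
        by (rule boundedI[of _ "real R"]) (auto simp: S_def devp_def)
      then obtain W where W: "W \<in> sets borel" "dev ?c ` S R \<subseteq> W" "emeasure (push y) W \<le> ennreal ?C * emeasure lborel V"
        using measure_le_of_cubes[of "push y" ?C "1 / (16 * real CARD('n))" V "dev ?c ` S R"] push_cube[of _ _ _ y] V(1,2) mbound_pos[of y]
        by (auto simp: push_def less_imp_le)
      have "ennreal (2 * ?C * I) = ennreal (2 * ?C) * (\<integral>\<^sup>+z. ?j z \<partial>lborel)"
        unfolding I(2) using mbound_pos[of y] I(1) by (simp add: ennreal_mult)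
      also have "\<dots> = (\<integral>\<^sup>+z. ennreal (2 * ?C) * ?j z \<partial>lborel)" by (rule nn_integral_cmult[symmetric, OF jm])
      also have "\<dots> \<le> (\<integral>\<^sup>+z\<in>S R. ennreal ((cmod (?E z))\<^sup>2) \<partial>lborel)"
      proof (rule nn_integral_mono)
        fix z
        show "ennreal (2 * ?C) * ?j z \<le> ennreal ((cmod (?E z))\<^sup>2) * indicator (S R) z"
        proof (cases "z \<in> S R")
          case True
          then have "2 * ?C * (cmod (D z))\<^sup>2 \<le> (cmod (?E z))\<^sup>2" by (simp add: S_def)
          then show ?thesis using True mbound_pos[of y] by (simp add: ennreal_leI flip: ennreal_mult)
        qed simp
      qed
      also have "\<dots> \<le> emeasure (push y) W" by (rule push_ge[OF Sb _ W(1,2)]) (auto simp: S_def)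
      also have "\<dots> \<le> ennreal ?C * ennreal (I + e)" by (rule order_trans[OF W(3) mult_left_mono[OF V(3)]]) simp
      also have "\<dots> = ennreal (?C * (I + e))" using mbound_pos[of y] I(1) e by (intro ennreal_mult[symmetric]) auto
      finally have "2 * ?C * I \<le> ?C * (I + e)" using mbound_pos[of y] I(1) e by (subst (asm) ennreal_le_iff) auto
      then have "?C * (2 * I) \<le> ?C * (I + e)" by (simp add: mult_ac)
      then have "2 * I \<le> I + e" using mbound_pos[of y] by (simp only: mult_le_cancel_left_pos)
      then show ?thesis by simp
    qed
    then have "I = 0" using I(1) by (meson dense_ge order_antisym)
    then have "AE z in lborel. ?j z = 0" using nn_integral_0_iff_AE[OF jm] I(2) by simp
    then show ?thesis
    proof (rule AE_mp, intro AE_I2 impI notI)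
      fix z assume z: "?j z = 0" "z \<in> S R"
      then have "jac ?c z = 0" using DS[OF z(2)] by simp
      then show False using jac_nonzero[OF cover_charts] SU z(2) by blast
    qed
  qed
  have "AE z in lborel. \<forall>R. z \<notin> S R" using null by (simp add: AE_all_countable)
  then show ?thesis
  proof (rule AE_mp, intro AE_I2 impI)
    fix z assume z: "\<forall>R. z \<notin> S R" "z \<in> piece k"
    obtain R :: nat where "norm z + cmod (D z) + norm (devp (k, z)) \<le> real R" using real_arch_simple by blast
    then have "norm z \<le> real R" "cmod (D z) \<le> real R" "norm (devp (k, z)) \<le> real R"
      using norm_ge_zero[of z] norm_ge_zero[of "D z"] norm_ge_zero[of "devp (k, z)"] by linarith+
    then have "\<not> 2 * ?C * (cmod (D z))\<^sup>2 < (cmod (?E z))\<^sup>2" using z by (auto simp: S_def)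
    moreover have "D z = jac ?c z" using z(2) piece_subset[of k] by (auto simp: D_def)
    ultimately show "(cmod (?E z))\<^sup>2 \<le> 2 * ?C * (cmod (jac ?c z))\<^sup>2" by simp
  qed
qed

lemma multiplier:
  assumes g: "g \<in> A2"
  shows "(\<lambda>c z. quot y c z * g c z) \<in> A2" and "sqn (\<lambda>c z. quot y c z * g c z) \<le> 2 * mbound y * sqn g"
proof -
  let ?f = "\<lambda>c z. quot y c z * g c z" and ?C = "2 * mbound y"
  have C: "?C \<ge> 0" using mbound_pos[of y] by simp
  have fh: "?f \<in> holomorphic_forms A"
    by (rule form_mult_mem[OF A2_holomorphic[OF g] quot_holo quot_invariant])
  have gL: "L2_form g" using g bergman_space_iff by blast
  have m: "(\<lambda>p. ennreal ((cmod (rep h p))\<^sup>2)) \<in> borel_measurable base" if "h \<in> holomorphic_forms A" for h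
    using rep_square_measurable[OF that] by simp
  have "(\<integral>\<^sup>+z. ennreal ((cmod (rep ?f (k, z)))\<^sup>2) \<partial>lborel) \<le> (\<integral>\<^sup>+z. ennreal ?C * ennreal ((cmod (rep g (k, z)))\<^sup>2) \<partial>lborel)" for k
  proof (rule nn_integral_mono_AE, rule AE_mp[OF quot_bounded_piece[of k y]], intro AE_I2 impI)
    fix z assume b: "z \<in> piece k \<longrightarrow> (cmod (coherent y (cov k) z))\<^sup>2 \<le> ?C * (cmod (jac (cov k) z))\<^sup>2"
    show "ennreal ((cmod (rep ?f (k, z)))\<^sup>2) \<le> ennreal ?C * ennreal ((cmod (rep g (k, z)))\<^sup>2)"
    proof (cases "z \<in> piece k")
      case True
      have "jac (cov k) z \<noteq> 0" using jac_nonzero[OF cover_charts] piece_subset[of k] True by blast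
      then have "(cmod (quot y (cov k) z))\<^sup>2 \<le> ?C"
        using b True by (simp add: quot_def norm_divide power_divide pos_divide_le_eq)
      then have "(cmod (quot y (cov k) z))\<^sup>2 * (cmod (g (cov k) z))\<^sup>2 \<le> ?C * (cmod (g (cov k) z))\<^sup>2"
        by (rule mult_right_mono) simp
      then show ?thesis using True C by (simp add: rep_def norm_mult power_mult_distrib ennreal_leI flip: ennreal_mult)
    qed (simp add: rep_def)
  qed
  then have "mass ?f \<le> (\<Sum>k. \<integral>\<^sup>+z. ennreal ?C * ennreal ((cmod (rep g (k, z)))\<^sup>2) \<partial>lborel)"
    unfolding mass_def nn_integral_base[OF m[OF fh]] by (intro suminf_le) auto
  also have "\<dots> = (\<integral>\<^sup>+p. ennreal ?C * ennreal ((cmod (rep g p))\<^sup>2) \<partial>base)"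
    by (rule nn_integral_base[symmetric]) (use m[OF A2_holomorphic[OF g]] in measurable)
  also have "\<dots> = ennreal ?C * mass g"
    unfolding mass_def by (rule nn_integral_cmult[OF m[OF A2_holomorphic[OF g]]])
  finally have le: "mass ?f \<le> ennreal ?C * mass g" .
  moreover have "mass g < \<infinity>" using gL L2_form_iff_mass by blast
  ultimately have "mass ?f < \<infinity>" by (simp add: ennreal_mult_less_top order_le_less_trans)
  then have fL: "L2_form ?f" using fh L2_form_iff_mass by blast
  then show "?f \<in> A2" using bergman_space_iff by blast
  have "ennreal (sqnorm ?f) \<le> 2 ^ CARD('n) * (ennreal ?C * mass g)"
    unfolding sqnorm_mass[OF fL] by (intro mult_left_mono le) simp
  also have "\<dots> = ennreal ?C * ennreal (sqnorm g)" unfolding sqnorm_mass[OF gL] by (simp only: mult_ac)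
  also have "\<dots> = ennreal (?C * sqnorm g)" using C sqnorm_nonneg by (intro ennreal_mult[symmetric])
  finally show "sqn ?f \<le> ?C * sqn g" unfolding sqn_eq using C sqnorm_nonneg[of g] by (subst (asm) ennreal_le_iff) auto
qed

text \<open>
  Multiplication by a bounded function has the coherent states as eigenvectors of its adjoint; the
  eigenvalue is an entire function, bounded by the norm of the multiplier.
\<close>

lemma quot_constant:
  assumes v: "v \<in> ball 0 \<epsilon>"
  shows "quot y c0 (\<gamma> v) = quot y c0 (\<gamma> 0)"
proof -
  let ?u = "\<lambda>g c z. quot y c z * g c z" and ?K = "2 * mbound y"
  define G where "G \<eta> = bip (?u vac) (coherent (\<eta> *s v))" for \<eta>
  have G_holo: "G holomorphic_on UNIV"
    unfolding G_def[abs_def] by (rule bip_coherent_entire[OF multiplier(1)[OF vac_mem]])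
  have tru: "tr (?u g) w = quot y c0 (\<gamma> w) * tr g w" for g w by (simp add: tr_def)
  have eigen: "bip (?u (coherent x)) (coherent (\<eta> *s v)) = G \<eta> * exp (hp (\<eta> *s v) x)" for x \<eta>
  proof (rule analytic_continuation_open[where s = "ball 0 (radius v)" and s' = UNIV
        and f = "\<lambda>\<eta>. bip (?u (coherent x)) (coherent (\<eta> *s v))" and g = "\<lambda>\<eta>. G \<eta> * exp (hp (\<eta> *s v) x)"])
    show "(\<lambda>\<eta>. bip (?u (coherent x)) (coherent (\<eta> *s v))) holomorphic_on UNIV"
      by (rule bip_coherent_entire[OF multiplier(1)[OF coherent_mem]])
    show "(\<lambda>\<eta>. G \<eta> * exp (hp (\<eta> *s v) x)) holomorphic_on UNIV"
      unfolding hp_scale_left by (intro holomorphic_intros G_holo)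
    show "ball 0 (radius v) \<noteq> {}" using radius_pos[of v] by simp
    fix \<eta> :: complex assume "\<eta> \<in> ball 0 (radius v)"
    from radius_mem[OF this] show "bip (?u (coherent x)) (coherent (\<eta> *s v)) = G \<eta> * exp (hp (\<eta> *s v) x)"
      unfolding G_def
      by (simp only: bip_coherent_near[OF multiplier(1)[OF coherent_mem]] bip_coherent_near[OF multiplier(1)[OF vac_mem]]
          tru tr_coherent tr_vac mult_1_right)
  qed auto
  have bound: "cmod (G \<eta>) \<le> sqrt ?K" for \<eta>
  proof -
    let ?x = "\<eta> *s v"
    have K: "?K \<ge> 0" using mbound_pos[of y] by simp
    have "complex_of_real (sqn (coherent ?x)) = of_real (exp ((norm ?x)\<^sup>2))"
      using bip_coherent[of ?x ?x] ip_self[OF coherent_mem[of ?x]] by (simp add: hp_self flip: exp_of_real)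
    then have sq: "sqn (coherent ?x) = exp ((norm ?x)\<^sup>2)" by (simp only: of_real_eq_iff)
    have "(cmod (G \<eta>) * exp ((norm ?x)\<^sup>2))\<^sup>2 = (cmod (bip (?u (coherent ?x)) (coherent ?x)))\<^sup>2"
      unfolding eigen by (simp add: norm_mult hp_self)
    also have "\<dots> \<le> sqn (?u (coherent ?x)) * sqn (coherent ?x)"
      by (rule cauchy_schwarz[OF multiplier(1)[OF coherent_mem] coherent_mem])
    also have "\<dots> \<le> ?K * sqn (coherent ?x) * sqn (coherent ?x)"
      by (rule mult_right_mono[OF multiplier(2)[OF coherent_mem] sqn_nonneg[OF coherent_mem]])
    also have "\<dots> = (sqrt ?K * exp ((norm ?x)\<^sup>2))\<^sup>2"
      unfolding power_mult_distrib real_sqrt_pow2[OF K] sq by (simp add: power2_eq_square)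
    finally have "cmod (G \<eta>) * exp ((norm ?x)\<^sup>2) \<le> sqrt ?K * exp ((norm ?x)\<^sup>2)"
      by (rule power2_le_imp_le) (use K in simp)
    then show ?thesis by (simp only: mult_le_cancel_right_pos exp_gt_zero)
  qed
  have "G constant_on UNIV"
    by (rule Liouville_theorem[OF G_holo]) (auto simp: bounded_iff intro!: exI[of _ "sqrt ?K"] bound)
  then have "G 1 = G 0" unfolding constant_on_def by (metis UNIV_I)
  moreover have "G 1 = quot y c0 (\<gamma> v)" "G 0 = quot y c0 (\<gamma> 0)"
    unfolding G_def using v eps
    by (simp_all only: bip_coherent_near[OF multiplier(1)[OF vac_mem]] tru tr_vac mult_1_right vector_smult_lid vector_smult_lzero centre_in_ball)
  ultimately show ?thesis by simp
qed

lemma contradiction: False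
proof -
  obtain i :: 'n where True by blast
  define t where "t = \<epsilon> / 2"
  let ?w = "complex_of_real t *s axis i 1 :: complex ^ 'n"
  have t: "t > 0" "t < \<epsilon>" using eps by (simp_all add: t_def)
  have "norm (axis i 1 :: complex ^ 'n) = 1" by (rule norm_Basis) (auto simp: axis_in_Basis_iff Basis_complex_def)
  then have w: "?w \<in> ball 0 \<epsilon>" using t by (simp add: norm_vector_scale_complex)
  have z: "0 \<in> ball (0 :: complex ^ 'n) \<epsilon>" using eps by simp
  have chart: "\<gamma> x \<in> chart_image c0" if "x \<in> ball 0 \<epsilon>" for x using \<gamma>_chart that by blast
  have q: "quot (axis i 1) c0 (\<gamma> x) = exp (x $ i) * quot 0 c0 (\<gamma> x)" if x: "x \<in> ball 0 \<epsilon>" for x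
    by (simp add: quot_def coherent_formula[OF c0 chart[OF x]] dev_near[OF x] hp_axis)
  have "quot 0 c0 (\<gamma> x) \<noteq> 0" if x: "x \<in> ball 0 \<epsilon>" for x
    using vac_nonzero[OF c0 chart[OF x]] jac_nonzero[OF c0 chart[OF x]] by (simp add: quot_def coherent_formula[OF c0 chart[OF x]])
  then have "exp (?w $ i) = exp ((0 :: complex ^ 'n) $ i)"
    using quot_constant[OF w, of "axis i 1"] quot_constant[OF w, of 0] q[OF w] q[OF z] z by simp
  then have "exp (complex_of_real t) = 1" by (simp add: axis_def)
  then have "exp t = 1" by (metis exp_of_real of_real_eq_1_iff)
  then show False using t by simp
qed

end

section \<open>Flat coordinates and the theorem\<close>

lemma bounded_linear_matrix_vector: "bounded_linear ((*v) (J :: complex ^ 'n::finite ^ 'n))"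
  unfolding linear_conv_bounded_linear[symmetric]
proof (rule linearI)
  show "J *v (x + y) = J *v x + J *v y" for x y by (rule matrix_vector_right_distrib)
  show "J *v (r *\<^sub>R x) = r *\<^sub>R (J *v x)" for r x
    by (simp add: matrix_vector_mult_def vec_eq_iff scaleR_sum_right)
qed

text \<open>
  The real inverse function theorem provides the inverse; the inverse of a complex linear
  isomorphism is complex linear.
\<close>

lemma holomorphic_local_inverse:
  fixes F :: "complex ^ 'n::finite \<Rightarrow> complex ^ 'n"
  assumes F: "\<And>k. holomorphic_Cn_on (\<lambda>z. F z $ k) W" and W: "open W" "p \<in> W" and Fp: "F p = 0"
    and det: "det (complex_jacobian F p) \<noteq> 0"
  obtains \<gamma> \<epsilon> where "\<epsilon> > 0" "\<And>k. holomorphic_Cn_on (\<lambda>y. \<gamma> y $ k) (ball 0 \<epsilon>)" "\<gamma> ` ball 0 \<epsilon> \<subseteq> W"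
    "open (\<gamma> ` ball 0 \<epsilon>)" "\<And>y. y \<in> ball 0 \<epsilon> ==> F (\<gamma> y) = y"
proof -
  let ?J = "complex_jacobian F"
  define F' where "F' x = Blinfun ((*v) (?J x))" for x
  have F'_apply: "blinfun_apply (F' x) = (*v) (?J x)" for x
    unfolding F'_def by (rule bounded_linear_Blinfun_apply[OF bounded_linear_matrix_vector])
  obtain J' where J': "J' ** ?J p = mat 1"
    using det invertible_det_nz[of "?J p"] by (auto simp: invertible_def)
  have derf: "(F has_derivative blinfun_apply (F' x)) (at x)" if x: "x \<in> W" for x
  proof -
    have "Cn_map_derivative F x = (*v) (?J x)" by (rule ext) (rule Cn_map_derivative_jacobian)
    then show ?thesis unfolding F'_apply using holomorphic_Cn_map_derivative[OF F W(1) x] by simp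
  qed
  have contf: "continuous_on W F'"
  proof (rule continuous_on_blinfun_componentwise)
    fix b :: "complex ^ 'n"
    have "continuous_on W (\<lambda>x. \<chi> k. \<Sum>j\<in>UNIV. wirtinger j (\<lambda>z. F z $ k) x * b $ j)"
      by (intro continuous_on_vec_lambda continuous_on_sum continuous_on_mult continuous_on_const
          holomorphic_Cn_continuous[OF holomorphic_Cn_wirtinger[OF F W(1)]])
    then show "continuous_on W (\<lambda>x. blinfun_apply (F' x) b)"
      unfolding F'_apply by (simp add: matrix_vector_mult_def complex_jacobian_def)
  qed
  have inv: "Blinfun ((*v) J') o\<^sub>L F' p = id_blinfun"
    by (rule blinfun_eqI)
      (simp add: F'_apply bounded_linear_Blinfun_apply[OF bounded_linear_matrix_vector] matrix_vector_mul_assoc J')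
  obtain U V g g' where g: "open U" "U \<subseteq> W" "p \<in> U" "open V" "F p \<in> V" "homeomorphism U V F g"
    "\<And>y. y \<in> V ==> (g has_derivative (g' y)) (at y)"
    "\<And>y. y \<in> V ==> g' y = inv (blinfun_apply (F' (g y)))" "\<And>y. y \<in> V ==> bij (blinfun_apply (F' (g y)))"
  proof (rule inverse_function_theorem[OF W(1) derf contf W(2) inv])
    fix U V g g' assume "open U" "U \<subseteq> W" "p \<in> U" "open V" "F p \<in> V" "homeomorphism U V F g"
      "\<And>y. y \<in> V ==> (g has_derivative (g' y)) (at y)"
      "\<And>y. y \<in> V ==> g' y = inv (blinfun_apply (F' (g y)))" "\<And>y. y \<in> V ==> bij (blinfun_apply (F' (g y)))"
    then show thesis by (rule that)
  qed
  obtain \<epsilon> where \<epsilon>: "\<epsilon> > 0" "ball 0 \<epsilon> \<subseteq> V" using openE[OF g(4,5)] unfolding Fp by blast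
  have lin: "g' y (a *s v) = a *s g' y v" if y: "y \<in> V" for y a v
  proof -
    have b: "bij ((*v) (?J (g y)))" using g(9)[OF y] by (simp only: F'_apply)
    have "?J (g y) *v (a *s g' y v) = a *s (?J (g y) *v g' y v)"
      by (simp add: matrix_vector_mult_def vec_eq_iff sum_distrib_left mult_ac)
    also have "?J (g y) *v g' y v = v"
      unfolding g(8)[OF y] F'_apply by (rule surj_f_inv_f[OF bij_is_surj[OF b]])
    finally have "inv ((*v) (?J (g y))) (a *s v) = a *s g' y v"
      using inv_f_f[OF bij_is_inj[OF b]] by metis
    then show ?thesis unfolding g(8)[OF y] F'_apply .
  qed
  have h: "F (g y) = y" "g y \<in> U" if "y \<in> V" for y using g(6) that by (auto simp: homeomorphism_def)
  have hU: "g (F x) = x" if "x \<in> U" for x using g(6) that by (auto simp: homeomorphism_def)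
  show thesis
  proof (rule that[OF \<epsilon>(1), of g])
    show "holomorphic_Cn_on (\<lambda>y. g y $ k) (ball 0 \<epsilon>)" for k
    proof (rule holomorphic_CnI[where L = "\<lambda>y v. g' y v $ k"])
      fix y :: "complex ^ 'n" assume "y \<in> ball 0 \<epsilon>"
      then have y: "y \<in> V" using \<epsilon>(2) by blast
      show "((\<lambda>y. g y $ k) has_derivative (\<lambda>v. g' y v $ k)) (at y)"
        using g(7)[OF y] has_derivative_vec_iff[of g "g' y"] by blast
      show "g' y (a *s v) $ k = a * g' y v $ k" for a v by (simp add: lin[OF y])
    qed
    show "g ` ball 0 \<epsilon> \<subseteq> W" using h(2) \<epsilon>(2) g(2) by blast
    have "g ` ball 0 \<epsilon> = U \<inter> F -` ball 0 \<epsilon>"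
    proof
      show "g ` ball 0 \<epsilon> \<subseteq> U \<inter> F -` ball 0 \<epsilon>" using h \<epsilon>(2) by fastforce
      show "U \<inter> F -` ball 0 \<epsilon> \<subseteq> g ` ball 0 \<epsilon>"
      proof
        fix x assume "x \<in> U \<inter> F -` ball 0 \<epsilon>"
        then show "x \<in> g ` ball 0 \<epsilon>" using hU[of x] by (intro image_eqI[of x g "F x"]) auto
      qed
    qed
    moreover have "continuous_on U F" using g(6) by (auto simp: homeomorphism_def)
    ultimately show "open (g ` ball 0 \<epsilon>)" using continuous_open_preimage[OF _ g(1) open_ball, of F 0 \<epsilon>] by simp
    show "F (g y) = y" if "y \<in> ball 0 \<epsilon>" for y using h(1) \<epsilon>(2) that by blast
  qed
qed

theorem corollary1p7:
  fixes M :: "'a topology" and A :: "('a, 'n::finite) chart set"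
  assumes "complex_manifold M A"
    and "base_point_free M A"
    and "separates_holomorphic_directions M A"
  shows "\<not> bergman_metric_has_constant_hsc M A 0"
proof
  assume flat: "bergman_metric_has_constant_hsc M A 0"
  interpret holomorphic_atlas M A by (unfold_locales) (rule assms(1))
  obtain c p where c: "c \<in> A" "p \<in> chart_image c" using nonempty_chart by blast
  obtain r s F where r: "r > 0" "ball p r \<subseteq> chart_image c" "holomorphic_Cn_on s (ball p r)"
    "\<And>z. z \<in> ball p r ==> s z \<noteq> 0" "\<And>k. holomorphic_Cn_on (\<lambda>z. F z $ k) (ball p r)" "F p = 0"
    "det (complex_jacobian F p) \<noteq> 0"
    "\<And>z w. z \<in> ball p r ==> w \<in> ball p r ==> kern c w c z = s z * cnj (s w) * exp (\<Sum>k\<in>UNIV. F z $ k * cnj (F w $ k))"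
  proof (rule local_flat_structure[OF assms(2,3) flat c])
    fix r s F assume "r > 0" "ball p r \<subseteq> chart_image c" "holomorphic_Cn_on s (ball p r)"
      "\<And>z. z \<in> ball p r ==> s z \<noteq> 0" "\<And>k. holomorphic_Cn_on (\<lambda>z. F z $ k) (ball p r)" "F p = 0"
      "det (complex_jacobian F p) \<noteq> 0"
      "\<And>z w. z \<in> ball p r ==> w \<in> ball p r ==> kern c w c z = s z * cnj (s w) * exp (\<Sum>k\<in>UNIV. F z $ k * cnj (F w $ k))"
    then show thesis by (rule that)
  qed
  have pr: "p \<in> ball p r" using r(1) by simp
  obtain \<gamma> \<epsilon> where \<gamma>: "\<epsilon> > 0" "\<And>k. holomorphic_Cn_on (\<lambda>y. \<gamma> y $ k) (ball 0 \<epsilon>)" "\<gamma> ` ball 0 \<epsilon> \<subseteq> ball p r"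
    "open (\<gamma> ` ball 0 \<epsilon>)" "\<And>y. y \<in> ball 0 \<epsilon> ==> F (\<gamma> y) = y"
  proof (rule holomorphic_local_inverse[OF r(5) open_ball pr r(6,7)])
    fix \<epsilon> \<gamma> assume "\<epsilon> > 0" "\<And>k. holomorphic_Cn_on (\<lambda>y. \<gamma> y $ k) (ball 0 \<epsilon>)" "\<gamma> ` ball 0 \<epsilon> \<subseteq> ball p r"
      "open (\<gamma> ` ball 0 \<epsilon>)" "\<And>y. y \<in> ball 0 \<epsilon> ==> F (\<gamma> y) = y"
    then show thesis by (rule that)
  qed
  have mem: "\<gamma> y \<in> ball p r" if "y \<in> ball 0 \<epsilon>" for y using \<gamma>(3) that by blast
  interpret fock_chart M A c \<gamma> "\<lambda>y. s (\<gamma> y)" \<epsilon>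
  proof unfold_locales
    show "holomorphic_Cn_on (\<lambda>y. s (\<gamma> y)) (ball 0 \<epsilon>)"
      by (rule holomorphic_Cn_compose(1)[OF \<gamma>(2) open_ball r(3) open_ball \<gamma>(3)])
    show "kern c (\<gamma> y) c (\<gamma> x) = s (\<gamma> x) * cnj (s (\<gamma> y)) * exp (hp x y)" if "x \<in> ball 0 \<epsilon>" "y \<in> ball 0 \<epsilon>" for x y
      unfolding r(8)[OF mem[OF that(1)] mem[OF that(2)]] \<gamma>(5)[OF that(1)] \<gamma>(5)[OF that(2)] hp_def ..
    show "s (\<gamma> y) \<noteq> 0" if "y \<in> ball 0 \<epsilon>" for y by (rule r(4)[OF mem[OF that]])
    show "\<gamma> ` ball 0 \<epsilon> \<subseteq> chart_image c" using \<gamma>(3) r(2) by (rule order_trans)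
  qed (use assms c \<gamma> in simp_all)
  show False by (rule contradiction)
qed

end
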